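(* (Hermitian Cauchy-Pompeiu formula in superspace.) Let $m>n\ge 0$ be integers and let $\Omega\subset\mathbb R^{2m}$ be open. Let $\boldsymbol G_2^1=\begin{pmatrix} G_1 & G_2 \\ G_2 & G_1 \end{pmatrix}$ with $G_1,G_2\in C^\infty(\Omega)\otimes\mathfrak G_{2n}\otimes\mathcal C_{2m,2n}$, and let $g=g_0+\mathbf g\in C^\infty(\mathbb R^{2m})\otimes\mathfrak G_{2n}^{(ev)}$ be a phase function such that $\{g_0\le0\}\subset\Omega$ is compact and the gradient of $g_0$ does not vanish on $g_0^{-1}(0)$. Then $$\int_{\mathbb R^{2m|2n}}\boldsymbol\Psi^{m|n}_{2\times2}(\mathbf Z-\mathbf U)\,\delta(g(\mathbf x))\,\boldsymbol{\mathcal D}_{(\mathbf Z,\mathbf Z^\dagger)}[g(\mathbf x)]\,\boldsymbol G_2^1(\mathbf x)-\int_{\mathbb R^{2m|2n}}H(-g(\mathbf x))\,\boldsymbol\Psi^{m|n}_{2\times2}(\mathbf Z-\mathbf U)\left(\boldsymbol{\mathcal D}_{(\mathbf Z,\mathbf Z^\dagger)}\boldsymbol G_2^1(\mathbf x)\right)=\begin{cases}\boldsymbol G_2^1(\mathbf y),&g_0(\underline y)<0,\\ 0,&g_0(\underline y)>0.\end{cases}$$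
   Context: Superspace. Commuting variables $x_1,\dots,x_{2m}$ (coordinates of $\underline x\in\mathbb R^{2m}$), anticommuting variables $\grave x_1,\dots,\grave x_{2n}$ commuting with the $x_j$; $\mathfrak G_{2n}$ is the Grassmann algebra generated by the $\grave x_j$, $\mathfrak G_{2n}^{(ev)}$ its even part. Superfunctions are $F=\sum_A F_A(\underline x)\grave{\underline x}_A$ with $F_A$ complex-valued smooth and $\grave{\underline x}_A$ ordered monomials; body $F_0=F_\emptyset$, nilpotent part $F-F_0$; real if all $F_A$ are real. A phase function is an even real superfunction $g=g_0+\mathbf g$ (body plus nilpotent part). For an even real superfunction $a=a_0+\mathbf a$ with $a_0>0$, $a^p=\sum_{j=0}^n\frac{\mathbf a^j}{j!}p(p-1)\cdots(p-j+1)a_0^{p-j}$. $\partial_{\grave x_j}F$ is the left derivative ($\partial_{\grave x_j}[1]=0$, $\partial_{\grave x_j}\grave x_k+\grave x_k\partial_{\grave x_j}=\delta_{jk}$, commuting with the $x_k$). Clifford generators. $\mathcal C_{2m,2n}$ is generated by $e_1,\dots,e_{2m},\grave e_1,\dots,\grave e_{2n}$ with $e_je_k+e_ke_j=-2\delta_{jk}$, $e_j\grave e_k+\grave e_ke_j=0$, $\grave e_j\grave e_k-\grave e_k\grave e_j=g_{jk}$, where $g_{2j,2k}=g_{2j-1,2k-1}=0$, $g_{2j-1,2k}=-g_{2k,2j-1}=\delta_{jk}$; it commutes with all variables and partial derivatives. Complex scalars are allowed. Put $\mathfrak f_j=\frac12(e_j-ie_{m+j})$, $\mathfrak f_j^\dagger=-\frac12(e_j+ie_{m+j})$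 ($1\le j\le m$), $\grave{\mathfrak f}_j=\frac12(\grave e_{2j-1}-i\grave e_{2j})$, $\grave{\mathfrak f}_j^\dagger=-\frac12(\grave e_{2j-1}+i\grave e_{2j})$ ($1\le j\le n$). Complex variables: $z_j=x_j+ix_{m+j}$, $z_j^c=x_j-ix_{m+j}$, $\grave z_j=\grave x_{2j-1}+i\grave x_{2j}$, $\grave z_j^c=\grave x_{2j-1}-i\grave x_{2j}$; $\partial_{z_j}=\frac12(\partial_{x_j}-i\partial_{x_{m+j}})$, $\partial_{z_j^c}=\frac12(\partial_{x_j}+i\partial_{x_{m+j}})$, $\partial_{\grave z_j}=\frac12(\partial_{\grave x_{2j-1}}-i\partial_{\grave x_{2j}})$, $\partial_{\grave z_j^c}=\frac12(\partial_{\grave x_{2j-1}}+i\partial_{\grave x_{2j}})$. Hermitian Dirac operators: $\partial_{\mathbf Z}F=\sum_{j=1}^m\mathfrak f_j^\dagger\partial_{z_j}F+2i\sum_{j=1}^n\grave{\mathfrak f}_j^\dagger\partial_{\grave z_j}F$, $\partial_{\mathbf Z^\dagger}F=\sum_{j=1}^m\mathfrak f_j\partial_{z_j^c}F-2i\sum_{j=1}^n\grave{\mathfrak f}_j\partial_{\grave z_j^c}F$. Matrix Dirac operator (acting by matrix multiplication): $\boldsymbol{\mathcal D}_{(\mathbf Z,\mathbf Z^\dagger)}=\begin{pmatrix}\partial_{\mathbf Z}&\partial_{\mathbf Z^\dagger}\\ \partial_{\mathbf Z^\dagger}&\partial_{\mathbf Z}\end{pmatrix}$; also $\boldsymbol{\mathcal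 D}_{(\mathbf Z,\mathbf Z^\dagger)}[g]=\begin{pmatrix}\partial_{\mathbf Z}[g]&\partial_{\mathbf Z^\dagger}[g]\\ \partial_{\mathbf Z^\dagger}[g]&\partial_{\mathbf Z}[g]\end{pmatrix}$. Kernel. $\mathbf Z=\sum_j z_j\mathfrak f_j+\sum_j\grave z_j\grave{\mathfrak f}_j$, $\mathbf Z^\dagger=\sum_j z_j^c\mathfrak f_j^\dagger+\sum_j\grave z_j^c\grave{\mathfrak f}_j^\dagger$, $|\mathbf Z|^2=\mathbf Z\mathbf Z^\dagger+\mathbf Z^\dagger\mathbf Z=\sum_j z_jz_j^c-\frac i2\sum_j\grave z_j\grave z_j^c$. $\mathbf y=\underline y+\grave{\underline y}$ consists of a point $\underline y\in\mathbb R^{2m}$ and further anticommuting parameters $\grave y_1,\dots,\grave y_{2n}$ (also anticommuting with the $\grave x_j$); $\mathbf U,\mathbf U^\dagger$ are built from $\mathbf y$ as $\mathbf Z,\mathbf Z^\dagger$ are from the $x_j,\grave x_j$. With $M=2m-2n$ and $|\mathbb S^{2m-1|2n}|=2\pi^{M/2}/\Gamma(M/2)$, $$\Psi_1^{m|n}(\mathbf Z)=\frac{2}{|\mathbb S^{2m-1|2n}|}\frac{\mathbf Z}{|\mathbf Z|^M},\quad {\Psi_1^{m|n}}^\dagger(\mathbf Z)=\frac{2}{|\mathbb S^{2m-1|2n}|}\frac{\mathbf Z^\dagger}{|\mathbf Z|^M},\quad \boldsymbol\Psi^{m|n}_{2\times2}=\begin{pmatrix}\Psi_1^{m|n}&{\Psi_1^{m|n}}^\dagger\\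 {\Psi_1^{m|n}}^\dagger&\Psi_1^{m|n}\end{pmatrix},$$ whose entries are locally integrable when expanded in the anticommuting variables and are regarded as superdistributions. Integration. $\int_B=\pi^{-n}\partial_{\grave x_{2n}}\cdots\partial_{\grave x_1}$. For a compactly supported superdistribution $\alpha=\sum_A\alpha_A\grave{\underline x}_A$ ($\alpha_A$ distributions on $\mathbb R^{2m}$) and $F=\sum_BF_B\grave{\underline x}_B$ smooth near the support, $\int_{\mathbb R^{2m|2n}}\alpha F=\sum_{A,B}\langle\alpha_A,F_B\rangle\int_B\grave{\underline x}_A\grave{\underline x}_B$, extended entrywise and linearly to Clifford-valued matrices, the $\grave y_j$ being constants. For a phase function $g$ with $\nabla g_0\neq0$ on $g_0^{-1}(0)$: $\delta(g)=\sum_{j=0}^n\frac{\mathbf g^j}{j!}\delta^{(j)}(g_0)$ and $H(-g)=H(-g_0)+\sum_{j=1}^n\frac{(-\mathbf g)^j}{j!}\delta^{(j-1)}(-g_0)$, with $\delta^{(j)}(g_0)$ the pullback of $\delta^{(j)}$ by $g_0$, and $H$ the Heaviside function. Products of (super)distributions with disjoint singular supports are defined componentwise by $\langle\alpha\beta,\phi\rangle=\langle\alpha,\beta\chi\phi\rangle+\langle\beta,\alpha(1-\chi)\phi\rangle$, with $\chi$ smooth, $\chi=0$ near $\operatorname{sing\,supp}\beta$ and $\chi=1$ near $\operatorname{sing\,supp}\alpha$; this applies here when $g_0(\underline y)\neq0$, since the kernel has singular support $\{\underline y\}$. *)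

theory Defs
  imports "HOL-Analysis.Analysis" "HOL-Library.Poly_Mapping"
begin

section \<open>The Clifford-Weyl algebra\<close>

text \<open>
  The free complex algebra on a set of generators is the monoid algebra of the monoid of words. There
  are orthogonal generators indexed by \<open>'i\<close> and symplectic generators indexed by all natural numbers;
  the algebra with \<open>2n\<close> symplectic generators is the subalgebra \<open>cliff_alg n\<close> below, which only
  involves those with indices \<open>1, \<dots>, 2n\<close>.
\<close>

datatype 'i cgen = Orth 'i | Symp nat

datatype 'g word = Word (letters: "'g list")

instantiation word :: (type) monoid_add
begin
definition "0 = Word []"
definition "v + w = Word (letters v @ letters w)"
instance by standard (auto simp: zero_word_def plus_word_def)
end

type_synonym 'i cfree = "'i cgen word \<Rightarrow>\<^sub>0 complex"

definition free_gen :: "'i cgen \<Rightarrow> 'i cfree" where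
  "free_gen a = Poly_Mapping.single (Word [a]) 1"

text \<open>The indices are paired as \<open>(1,2), (3,4), \<dots>\<close>; the index 0, which is never used, is unpaired.\<close>

definition symp_form :: "nat \<Rightarrow> nat \<Rightarrow> complex" where
  "symp_form j k = (if odd j \<and> k = j + 1 then 1 else if odd k \<and> j = k + 1 then - 1 else 0)"

text \<open>Congruence modulo the two-sided ideal generated by the defining relations.\<close>

inductive cliff_rel :: "'i cfree \<Rightarrow> 'i cfree \<Rightarrow> bool" where
  refl: "cliff_rel a a"
| sym: "cliff_rel a b \<Longrightarrow> cliff_rel b a"
| trans: "cliff_rel a b \<Longrightarrow> cliff_rel b c \<Longrightarrow> cliff_rel a c"
| add: "cliff_rel a b \<Longrightarrow> cliff_rel c d \<Longrightarrow> cliff_rel (a + c) (b + d)"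
| mult: "cliff_rel a b \<Longrightarrow> cliff_rel c d \<Longrightarrow> cliff_rel (a * c) (b * d)"
| orth: "cliff_rel (free_gen (Orth i) * free_gen (Orth j) + free_gen (Orth j) * free_gen (Orth i))
           (Poly_Mapping.single 0 (if i = j then - 2 else 0))"
| mixed: "cliff_rel (free_gen (Orth i) * free_gen (Symp j) + free_gen (Symp j) * free_gen (Orth i)) 0"
| symp: "cliff_rel (free_gen (Symp j) * free_gen (Symp k) - free_gen (Symp k) * free_gen (Symp j))
           (Poly_Mapping.single 0 (symp_form j k))"

quotient_type 'i cliff = "'i cfree" / cliff_rel
  by (rule equivpI) (auto intro!: reflpI sympI transpI intro: cliff_rel.intros)

text \<open>
  The quotient is not the zero ring: it acts on complex functions of a subset of \<open>'i\<close> and an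
  exponent vector, the orthogonal generators by spin matrices and the symplectic ones by
  derivatives and multiplications by variables.
\<close>

type_synonym 'i fock = "'i set \<times> (nat \<Rightarrow> nat) \<Rightarrow> complex"

definition below :: "'i::finite \<Rightarrow> 'i set \<Rightarrow> nat" where
  "below i S = card {k \<in> S. to_nat k < to_nat i}"

definition toggle :: "'i \<Rightarrow> 'i set \<Rightarrow> 'i set" where
  "toggle i S = (if i \<in> S then S - {i} else insert i S)"

primrec fock_gen :: "'i::finite cgen \<Rightarrow> 'i fock \<Rightarrow> 'i fock" where
  "fock_gen (Orth i) \<phi> = (\<lambda>(S, \<alpha>). \<i> * (-1) ^ below i S * \<phi> (toggle i S, \<alpha>))"
| "fock_gen (Symp j) \<phi> = (\<lambda>(S, \<alpha>). (-1) ^ card S *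
     (if odd j then of_nat (\<alpha> j + 1) * \<phi> (S, \<alpha>(j := \<alpha> j + 1))
      else if \<alpha> (j - 1) = 0 then 0 else \<phi> (S, \<alpha>(j - 1 := \<alpha> (j - 1) - 1))))"

definition fock_word :: "'i::finite cgen word \<Rightarrow> 'i fock \<Rightarrow> 'i fock" where
  "fock_word w = foldr fock_gen (letters w)"

definition fock_act :: "'i::finite cfree \<Rightarrow> 'i fock \<Rightarrow> 'i fock" where
  "fock_act a \<phi> = (\<lambda>s. \<Sum>w\<in>Poly_Mapping.keys a. Poly_Mapping.lookup a w * fock_word w \<phi> s)"

lemma fock_gen_lin:
  "fock_gen g (\<lambda>s. \<phi> s + \<psi> s) = (\<lambda>s. fock_gen g \<phi> s + fock_gen g \<psi> s)"
  "fock_gen g (\<lambda>s. c * \<phi> s) = (\<lambda>s. c * fock_gen g \<phi> s)"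
  by (cases g; auto simp: fun_eq_iff algebra_simps)+

lemma fock_word_lin:
  "fock_word w (\<lambda>s. \<phi> s + \<psi> s) = (\<lambda>s. fock_word w \<phi> s + fock_word w \<psi> s)"
  "fock_word w (\<lambda>s. c * \<phi> s) = (\<lambda>s. c * fock_word w \<phi> s)"
proof -
  have "foldr fock_gen l (\<lambda>s. \<phi> s + \<psi> s) = (\<lambda>s. foldr fock_gen l \<phi> s + foldr fock_gen l \<psi> s)"
    and "foldr fock_gen l (\<lambda>s. c * \<phi> s) = (\<lambda>s. c * foldr fock_gen l \<phi> s)" for l
    by (induction l) (simp_all add: fock_gen_lin)
  then show "fock_word w (\<lambda>s. \<phi> s + \<psi> s) = (\<lambda>s. fock_word w \<phi> s + fock_word w \<psi> s)"
    "fock_word w (\<lambda>s. c * \<phi> s) = (\<lambda>s. c * fock_word w \<phi> s)"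
    by (simp_all add: fock_word_def)
qed

lemma fock_word_sum:
  "finite K \<Longrightarrow> fock_word w (\<lambda>s. \<Sum>k\<in>K. c k * \<phi> k s) s = (\<Sum>k\<in>K. c k * fock_word w (\<phi> k) s)"
proof (induction K arbitrary: s rule: finite_induct)
  case empty
  show ?case using fun_cong[OF fock_word_lin(2)[of w 0 "\<lambda>_. 0"], of s] by simp
next
  case (insert x F)
  then show ?case by (simp add: fock_word_lin)
qed

lemma fock_act_superset:
  assumes "finite K" "Poly_Mapping.keys a \<subseteq> K"
  shows "fock_act a \<phi> s = (\<Sum>w\<in>K. Poly_Mapping.lookup a w * fock_word w \<phi> s)"
  unfolding fock_act_def using assms
  by (intro sum.mono_neutral_left) (auto simp: in_keys_iff)

lemma fock_act_add: "fock_act (a + b) \<phi> s = fock_act a \<phi> s + fock_act b \<phi> s"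
proof -
  let ?K = "Poly_Mapping.keys a \<union> Poly_Mapping.keys b"
  have "Poly_Mapping.keys (a + b) \<subseteq> ?K" by (rule Poly_Mapping.keys_add)
  then show ?thesis
    by (simp add: fock_act_superset[of ?K] lookup_add algebra_simps sum.distrib)
qed

lemma fock_act_single: "fock_act (Poly_Mapping.single w c) \<phi> s = c * fock_word w \<phi> s"
  by (subst fock_act_superset[of "{w}"]) auto

lemma fock_act_lin: "fock_act a (\<lambda>s. c * \<phi> s + \<psi> s) s = c * fock_act a \<phi> s + fock_act a \<psi> s"
  by (simp add: fock_act_def fock_word_lin algebra_simps sum.distrib sum_distrib_left)

lemma fock_act_diff: "fock_act (a - b) \<phi> s = fock_act a \<phi> s - fock_act b \<phi> s"
  using fock_act_add[of "a - b" b \<phi> s] by simp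

lemma fock_word_plus: "fock_word (v + w) \<phi> = fock_word v (fock_word w \<phi>)"
  by (simp add: fock_word_def plus_word_def)

lemma cfree_induct [case_names single add]:
  fixes a :: "'i cfree"
  assumes 1: "\<And>w c. P (Poly_Mapping.single w c)" and 2: "\<And>a b. P a \<Longrightarrow> P b \<Longrightarrow> P (a + b)"
  shows "P a"
proof (induction a rule: update_induct)
  case const
  then show ?case using 1[of 0 0] by simp
next
  case (update f w c)
  have "Poly_Mapping.update w c f = f + Poly_Mapping.single w c"
    using update(1) by (intro poly_mapping_eqI) (auto simp: lookup_update lookup_add lookup_single in_keys_iff when_def)
  then show ?case using 1 2 update by simp
qed

lemma fock_act_mult_single: "fock_act (Poly_Mapping.single v c * b) \<phi> s = c * fock_word v (fock_act b \<phi>) s"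
proof (induction b arbitrary: s rule: cfree_induct)
  case (single w d)
  have "fock_act (Poly_Mapping.single w d) \<phi> = (\<lambda>s. d * fock_word w \<phi> s)"
    by (simp add: fock_act_single fun_eq_iff)
  then show ?case by (simp add: mult_single fock_act_single fock_word_plus fock_word_lin)
next
  case (add a b)
  have "fock_act (a + b) \<phi> = (\<lambda>s. fock_act a \<phi> s + fock_act b \<phi> s)"
    by (simp add: fock_act_add fun_eq_iff)
  then show ?case by (simp add: distrib_left fock_act_add fock_word_lin add algebra_simps)
qed

lemma fock_act_mult: "fock_act (a * b) \<phi> s = fock_act a (fock_act b \<phi>) s"
  by (induction a rule: cfree_induct)
     (simp_all add: fock_act_mult_single fock_act_single fock_act_add distrib_right)

lemma fock_act_gen: "fock_act (free_gen g) \<phi> = fock_gen g \<phi>"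
  by (simp add: free_gen_def fock_act_single fock_word_def fun_eq_iff)

lemma fock_act_scalar: "fock_act (Poly_Mapping.single 0 c) \<phi> s = c * \<phi> s"
  by (simp add: fock_act_single fock_word_def zero_word_def)

lemma sign_pred: "0 < k \<Longrightarrow> (-1) ^ (k - Suc 0) = - ((-1::complex) ^ k)"
  by (cases k) auto

lemma sign_below: "(-1) ^ below i (toggle j S) = (if to_nat j < to_nat i then - 1 else 1) * (-1::complex) ^ below i S"
proof -
  have "{k \<in> S - {j}. to_nat k < to_nat i} = {k \<in> S. to_nat k < to_nat i} - {j}"
    "{k \<in> insert j S. to_nat k < to_nat i} =
      (if to_nat j < to_nat i then insert j {k \<in> S. to_nat k < to_nat i} else {k \<in> S. to_nat k < to_nat i})"
    by auto
  moreover have "j \<in> S \<Longrightarrow> to_nat j < to_nat i \<Longrightarrow> 0 < card {k \<in> S. to_nat k < to_nat i}"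
    by (auto simp: card_gt_0_iff)
  ultimately show ?thesis
    by (auto simp: below_def toggle_def sign_pred)
qed

lemma sign_card: "(-1) ^ card (toggle i S) = - ((-1::complex) ^ card S)" for S :: "'i::finite set"
  using sign_pred[of "card S"] by (auto simp: toggle_def card_gt_0_iff)

lemma toggle_twice: "toggle i (toggle i S) = S"
  and toggle_commute: "toggle i (toggle j S) = toggle j (toggle i S)"
  by (auto simp: toggle_def)

lemma sign_sq: "(-1) ^ k * ((-1) ^ k * z) = z" for z :: complex
  by (simp flip: power_mult_distrib mult.assoc)

lemma fock_orth: "fock_gen (Orth i) (fock_gen (Orth j) \<phi>) s + fock_gen (Orth j) (fock_gen (Orth i) \<phi>) s
    = (if i = j then - 2 else 0) * \<phi> s"
proof (cases s)
  case (Pair S \<alpha>)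
  show ?thesis
  proof (cases "i = j")
    case True
    have "\<i> * (-1) ^ k * (\<i> * (-1) ^ k * z) = - z" for k z
      using sign_sq[of k z] by (simp add: mult.left_commute flip: mult.assoc)
    from this[of "below i S"] show ?thesis using True Pair by (simp add: sign_below toggle_twice)
  next
    case False
    then have "to_nat i < to_nat j \<or> to_nat j < to_nat i"
      by (simp add: linorder_neq_iff[symmetric])
    then show ?thesis using False Pair
      by (auto simp: sign_below toggle_commute[of i j])
  qed
qed

lemma fock_mixed: "fock_gen (Orth i) (fock_gen (Symp j) \<phi>) s + fock_gen (Symp j) (fock_gen (Orth i) \<phi>) s = 0"
  by (cases s) (simp add: sign_card)

lemma fock_symp: "fock_gen (Symp j) (fock_gen (Symp k) \<phi>) s - fock_gen (Symp k) (fock_gen (Symp j) \<phi>) s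
    = symp_form j k * \<phi> s"
proof (cases s)
  case (Pair S \<alpha>)
  have sq: "(-1) ^ card S * (a * ((-1) ^ card S * z)) = a * z" for a z :: complex
    using sign_sq[of "card S" "a * z"] by (simp add: mult.left_commute)
  have tw: "a \<noteq> b \<Longrightarrow> \<alpha>(a := x, b := y) = \<alpha>(b := y, a := x)" for a b x y
    by (rule fun_upd_twist)
  consider "odd j" "odd k" | "odd j" "even k" | "even j" "odd k" | "even j" "even k" by blast
  then show ?thesis
  proof cases
    case 1
    then have "j \<noteq> Suc k" "k \<noteq> Suc j" by auto
    then show ?thesis using Pair 1 tw[of j k]
      by (cases "j = k") (simp_all add: symp_form_def sign_sq sq)
  next
    case 2
    show ?thesis
    proof (cases "k = Suc j")
      case True
      then show ?thesis using Pair 2 by (simp add: symp_form_def sign_sq sq distrib_right distrib_left left_diff_distrib)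
    next
      case False
      then have "k - Suc 0 \<noteq> j" using 2 by presburger
      then show ?thesis using Pair 2 False tw[of j "k - Suc 0"] by (simp add: symp_form_def sign_sq sq)
    qed
  next
    case 3
    show ?thesis
    proof (cases "j = Suc k")
      case True
      then show ?thesis using Pair 3 by (simp add: symp_form_def sign_sq sq distrib_right distrib_left left_diff_distrib)
    next
      case False
      then have "j - Suc 0 \<noteq> k" using 3 by presburger
      then show ?thesis using Pair 3 False tw[of "j - Suc 0" k] by (simp add: symp_form_def sign_sq sq)
    qed
  next
    case 4
    then have "j \<noteq> k \<Longrightarrow> j - Suc 0 \<noteq> k - Suc 0" by presburger
    then show ?thesis using Pair 4 tw[of "j - Suc 0" "k - Suc 0"]
      by (cases "j = k") (simp_all add: symp_form_def sign_sq sq)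
  qed
qed

lemma fock_act_rel: "cliff_rel a b \<Longrightarrow> fock_act a \<phi> = fock_act b \<phi>"
proof (induction arbitrary: \<phi> rule: cliff_rel.induct)
  case (add a b c d)
  then show ?case by (simp add: fun_eq_iff fock_act_add)
next
  case (mult a b c d)
  have "fock_act (a * c) \<phi> = fock_act a (fock_act c \<phi>)" "fock_act (b * d) \<phi> = fock_act b (fock_act d \<phi>)"
    by (rule ext, rule fock_act_mult)+
  then show ?case using mult.IH by simp
next
  case (orth i j)
  show ?case
    by (rule ext) (simp only: fock_act_add fock_act_mult fock_act_gen fock_act_scalar fock_orth)
next
  case (mixed i j)
  have "fock_act 0 \<phi> s = 0" for s by (simp add: fock_act_def)
  then show ?case
    by (intro ext) (simp only: fock_act_add fock_act_mult fock_act_gen fock_mixed)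
next
  case (symp j k)
  show ?case
    by (rule ext) (simp only: fock_act_diff fock_act_mult fock_act_gen fock_act_scalar fock_symp)
qed auto

lemma not_cliff_rel_0_1: "\<not> cliff_rel (0 :: 'i::finite cfree) 1"
proof
  assume "cliff_rel (0 :: 'i cfree) 1"
  then have "fock_act (0 :: 'i cfree) (\<lambda>_. 1) s = fock_act 1 (\<lambda>_. 1) s" for s
    by (simp add: fock_act_rel)
  moreover have "fock_act (1 :: 'i cfree) (\<lambda>_. 1) s = 1" for s
    using fock_act_scalar[of 1 "\<lambda>_. 1"] by simp
  ultimately show False by (simp add: fock_act_def)
qed


instantiation cliff :: (finite) ring_1
begin

lift_definition zero_cliff :: "'a cliff" is 0 .
lift_definition one_cliff :: "'a cliff" is 1 .
lift_definition plus_cliff :: "'a cliff \<Rightarrow> 'a cliff \<Rightarrow> 'a cliff" is "(+)"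
  by (rule cliff_rel.add)
lift_definition times_cliff :: "'a cliff \<Rightarrow> 'a cliff \<Rightarrow> 'a cliff" is "(*)"
  by (rule cliff_rel.mult)
lift_definition uminus_cliff :: "'a cliff \<Rightarrow> 'a cliff" is uminus
proof -
  fix a b :: "'a cfree"
  assume "cliff_rel a b"
  then have "cliff_rel ((- 1) * a) ((- 1) * b)"
    by (intro cliff_rel.mult cliff_rel.refl)
  then show "cliff_rel (- a) (- b)" by simp
qed
lift_definition minus_cliff :: "'a cliff \<Rightarrow> 'a cliff \<Rightarrow> 'a cliff" is minus
proof -
  fix a b c d :: "'a cfree"
  assume "cliff_rel a b" "cliff_rel c d"
  then have "cliff_rel (a + (- 1) * c) (b + (- 1) * d)"
    by (intro cliff_rel.add cliff_rel.mult cliff_rel.refl)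
  then show "cliff_rel (a - c) (b - d)" by simp
qed

instance
proof
  show "(0::'a cliff) \<noteq> 1"
    by transfer (rule not_cliff_rel_0_1)
  fix a b c :: "'a cliff"
  show "a * b * c = a * (b * c)" by transfer (simp only: mult.assoc cliff_rel.refl)
  show "(a + b) * c = a * c + b * c" by transfer (simp only: distrib_right cliff_rel.refl)
  show "a * (b + c) = a * b + a * c" by transfer (simp only: distrib_left cliff_rel.refl)
  show "a + b + c = a + (b + c)" by transfer (simp only: add.assoc cliff_rel.refl)
  show "a + b = b + a" by transfer (simp only: add.commute cliff_rel.refl)
  show "0 + a = a" "- a + a = 0" "a - b = a + - b" "1 * a = a" "a * 1 = a"
    by (transfer, simp add: cliff_rel.refl)+
qed

end

lift_definition cst :: "complex \<Rightarrow> 'i::finite cliff" is "Poly_Mapping.single 0" .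
lift_definition orth_gen :: "'i \<Rightarrow> 'i::finite cliff" is "\<lambda>i. free_gen (Orth i)" .
lift_definition symp_gen :: "nat \<Rightarrow> 'i::finite cliff" is "\<lambda>j. free_gen (Symp j)" .

lemma cst_0: "cst 0 = 0" and cst_1: "cst 1 = 1"
  and cst_add: "cst (c + d) = cst c + cst d" and cst_mult: "cst (c * d) = cst c * cst d"
  by (transfer, simp add: single_add mult_single cliff_rel.refl)+

lemma cst_central: "cst c * a = a * cst c"
proof transfer
  fix c and a :: "'a cfree"
  have "Poly_Mapping.single 0 c * a = a * Poly_Mapping.single 0 c"
    by (induction a rule: cfree_induct) (simp_all add: mult_single distrib_left distrib_right mult.commute)
  then show "cliff_rel (Poly_Mapping.single 0 c * a) (a * Poly_Mapping.single 0 c)"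
    by (simp add: cliff_rel.refl)
qed

lemma orth_orth: "orth_gen i * orth_gen j + orth_gen j * orth_gen i = (if i = j then - 2 else 0)"
proof -
  have "cst (- 2) + (cst 1 + cst 1) = (cst 0 :: 'a cliff)"
    by (simp only: cst_add[symmetric]) simp
  then have "cst (- 2) = (- 2 :: 'a cliff)"
    by (simp add: cst_0 cst_1 eq_neg_iff_add_eq_0)
  moreover have "orth_gen i * orth_gen j + orth_gen j * orth_gen i = cst (if i = j then - 2 else 0)"
    by transfer (rule cliff_rel.orth)
  ultimately show ?thesis by (simp add: cst_0)
qed

lemma orth_symp: "orth_gen i * symp_gen j + symp_gen j * orth_gen i = 0"
  by transfer (rule cliff_rel.mixed)

lemma symp_symp: "symp_gen j * symp_gen k - symp_gen k * symp_gen j = cst (symp_form j k)"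
  by transfer (rule cliff_rel.symp)

global_interpretation cliff: vector_space "\<lambda>c (a :: 'i::finite cliff). cst c * a"
  by standard (simp_all add: distrib_left distrib_right cst_add cst_mult cst_1 mult.assoc)

inductive_set cliff_alg :: "nat \<Rightarrow> 'i::finite cliff set" for n where
  "cst c \<in> cliff_alg n"
| "orth_gen i \<in> cliff_alg n"
| "1 \<le> j \<Longrightarrow> j \<le> 2 * n \<Longrightarrow> symp_gen j \<in> cliff_alg n"
| "a \<in> cliff_alg n \<Longrightarrow> b \<in> cliff_alg n \<Longrightarrow> a + b \<in> cliff_alg n"
| "a \<in> cliff_alg n \<Longrightarrow> b \<in> cliff_alg n \<Longrightarrow> a * b \<in> cliff_alg n"

text \<open>
  A fixed basis of the algebra as a complex vector space. It is only used to split algebra-valued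
  functions and distributions into scalar components and to reassemble the results linearly,
  which does not depend on the choice.
\<close>

definition cliff_basis :: "'i::finite cliff set" where
  "cliff_basis = cliff.extend_basis {}"

lemma cliff_basis: "cliff.independent cliff_basis" "cliff.span cliff_basis = UNIV"
  unfolding cliff_basis_def
  by (simp_all add: cliff.independent_extend_basis cliff.independent_empty cliff.span_extend_basis)

section \<open>Grassmann algebras\<close>

text \<open>
  Elements are \<open>\<Sum>\<^sub>A a\<^sub>A \<theta>\<^sub>A\<close> with coefficients in a ring commuting with the anticommuting generators
  \<open>\<theta>\<^sub>j\<close>, where \<open>\<theta>\<^sub>A\<close> is the product of the \<open>\<theta>\<^sub>j\<close>, \<open>j \<in> A\<close>, in increasing order. Throughout,
  \<open>\<theta>\<^sub>1, \<dots>, \<theta>\<^sub>2\<^sub>n\<close> are the odd coordinates of \<open>x\<close> and \<open>\<theta>\<^sub>2\<^sub>n\<^sub>+\<^sub>1, \<dots>, \<theta>\<^sub>4\<^sub>n\<close> those of \<open>y\<close>.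
\<close>

typedef (overloaded) 'c grass = "{f :: nat set \<Rightarrow> 'c::zero. \<forall>A. infinite A \<longrightarrow> f A = 0}"
  morphisms gcoef Abs_grass
  by (rule exI[of _ "\<lambda>_. 0"]) simp

setup_lifting type_definition_grass

definition inversions :: "nat set \<Rightarrow> nat set \<Rightarrow> nat" where
  "inversions A B = card {(i, j). i \<in> A \<and> j \<in> B \<and> j < i}"

lemma inversions_empty [simp]: "inversions {} B = 0" "inversions A {} = 0"
  by (simp_all add: inversions_def)

lemma finite_inversions: "finite A \<Longrightarrow> finite B \<Longrightarrow> finite {(i, j). i \<in> A \<and> j \<in> B \<and> j < i}"
  by (rule finite_subset[of _ "A \<times> B"]) auto

lemma inversions_Un_left:
  assumes "finite A" "finite B" "finite C" "A \<inter> B = {}"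
  shows "inversions (A \<union> B) C = inversions A C + inversions B C"
  unfolding inversions_def using assms
  by (subst card_Un_disjoint[symmetric]) (auto intro!: finite_inversions arg_cong[of _ _ card])

lemma inversions_Un_right:
  assumes "finite A" "finite B" "finite C" "A \<inter> B = {}"
  shows "inversions C (A \<union> B) = inversions C A + inversions C B"
  unfolding inversions_def using assms
  by (subst card_Un_disjoint[symmetric]) (auto intro!: finite_inversions arg_cong[of _ _ card])

lemma inversions_assoc:
  assumes "finite A" "finite B" "finite C" "A \<inter> B = {}" "A \<inter> C = {}" "B \<inter> C = {}"
  shows "inversions A B + inversions (A \<union> B) C = inversions A (B \<union> C) + inversions B C"
  using assms by (simp add: inversions_Un_left inversions_Un_right)

instantiation grass :: (ring_1) ring_1
begin

lift_definition zero_grass :: "'a grass" is "\<lambda>_. 0" by simp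
lift_definition one_grass :: "'a grass" is "\<lambda>A. if A = {} then 1 else 0" by auto
lift_definition plus_grass :: "'a grass \<Rightarrow> 'a grass \<Rightarrow> 'a grass" is "\<lambda>a b A. a A + b A" by simp
lift_definition minus_grass :: "'a grass \<Rightarrow> 'a grass \<Rightarrow> 'a grass" is "\<lambda>a b A. a A - b A" by simp
lift_definition uminus_grass :: "'a grass \<Rightarrow> 'a grass" is "\<lambda>a A. - a A" by simp
lift_definition times_grass :: "'a grass \<Rightarrow> 'a grass \<Rightarrow> 'a grass" is
  "\<lambda>a b C. \<Sum>A\<in>Pow C. (-1) ^ inversions A (C - A) * a A * b (C - A)"
  by simp

instance
proof
  fix a b c :: "'a grass"
  show "a * b * c = a * (b * c)"
  proof transfer
    fix a b c :: "nat set \<Rightarrow> 'a"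
    let ?s = "\<lambda>A B. (-1 :: 'a) ^ inversions A B"
    have comm: "x * ((-1) ^ k * y) = (-1) ^ k * (x * y)" for x y :: 'a and k
      by (cases "even k") simp_all
    show "(\<lambda>C. \<Sum>A\<in>Pow C. ?s A (C - A) * (\<Sum>B\<in>Pow A. ?s B (A - B) * a B * b (A - B)) * c (C - A)) =
       (\<lambda>C. \<Sum>A\<in>Pow C. ?s A (C - A) * a A * (\<Sum>B\<in>Pow (C - A). ?s B (C - A - B) * b B * c (C - A - B)))"
    proof
      fix D :: "nat set"
      show "(\<Sum>C\<in>Pow D. ?s C (D - C) * (\<Sum>A\<in>Pow C. ?s A (C - A) * a A * b (C - A)) * c (D - C)) =
         (\<Sum>A\<in>Pow D. ?s A (D - A) * a A * (\<Sum>B\<in>Pow (D - A). ?s B (D - A - B) * b B * c (D - A - B)))"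
      proof (cases "finite D")
        case False
        then show ?thesis by simp
      next
        case True
        have fin: "finite A" if "A \<subseteq> D" for A using that True finite_subset by blast
        have "(\<Sum>C\<in>Pow D. ?s C (D - C) * (\<Sum>A\<in>Pow C. ?s A (C - A) * a A * b (C - A)) * c (D - C)) =
          (\<Sum>(C, A)\<in>(SIGMA C:Pow D. Pow C). ?s C (D - C) * (?s A (C - A) * a A * b (C - A)) * c (D - C))"
          using True by (subst sum.Sigma[symmetric]) (auto simp: sum_distrib_left sum_distrib_right intro: fin)
        also have "\<dots> = (\<Sum>(A, B)\<in>(SIGMA A:Pow D. Pow (D - A)).
            ?s A (D - A) * a A * (?s B (D - A - B) * b B * c (D - A - B)))"
        proof (rule sum.reindex_bij_witness[where i = "\<lambda>(A, B). (A \<union> B, A)" and j = "\<lambda>(C, A). (A, C - A)"], goal_cases)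
          case (5 p)
          then obtain C A where p: "p = (C, A)" "A \<subseteq> C" "C \<subseteq> D" by auto
          have D: "D - A - (C - A) = D - C" "D - A = (C - A) \<union> (D - C)" "A \<union> (C - A) = C" using p by auto
          have f: "finite A" "finite (C - A)" "finite (D - C)" using p fin by auto
          have "inversions A (C - A) + inversions (A \<union> (C - A)) (D - C) =
              inversions A ((C - A) \<union> (D - C)) + inversions (C - A) (D - C)"
            using p f by (intro inversions_assoc) auto
          then have "inversions C (D - C) + inversions A (C - A) = inversions A (D - A) + inversions (C - A) (D - C)"
            unfolding D(3) D(2)[symmetric] by simp
          then have "?s C (D - C) * ?s A (C - A) = ?s A (D - A) * ?s (C - A) (D - C)"
            by (simp only: power_add[symmetric])
          then have "?s C (D - C) * (?s A (C - A) * a A * b (C - A)) * c (D - C) =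
             ?s A (D - A) * ?s (C - A) (D - C) * (a A * b (C - A) * c (D - C))"
            by (simp only: mult.assoc[symmetric])
          also have "\<dots> = ?s A (D - A) * a A * (?s (C - A) (D - C) * b (C - A) * c (D - C))"
            by (simp only: mult.assoc comm[of "a A"])
          finally show ?case by (simp add: p D(1))
        qed (clarsimp; blast)+
        also have "\<dots> = (\<Sum>A\<in>Pow D. ?s A (D - A) * a A * (\<Sum>B\<in>Pow (D - A). ?s B (D - A - B) * b B * c (D - A - B)))"
          using True by (subst sum.Sigma[symmetric]) (auto simp: sum_distrib_left intro: fin)
        finally show ?thesis .
      qed
    qed
  qed
  show "1 * a = a"
  proof transfer
    fix a :: "nat set \<Rightarrow> 'a" assume a: "\<forall>A. infinite A \<longrightarrow> a A = 0"
    have "(\<Sum>A\<in>Pow C. (-1) ^ inversions A (C - A) * (if A = {} then 1 else 0) * a (C - A)) = a C" for C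
    proof (cases "finite C")
      case True
      then have "(\<Sum>A\<in>Pow C. (-1) ^ inversions A (C - A) * (if A = {} then 1 else 0) * a (C - A)) =
          (\<Sum>A\<in>{{}}. (-1) ^ inversions A (C - A) * (if A = {} then 1 else 0) * a (C - A))"
        by (intro sum.mono_neutral_right) auto
      then show ?thesis by simp
    qed (simp add: a)
    then show "(\<lambda>C. \<Sum>A\<in>Pow C. (-1) ^ inversions A (C - A) * (if A = {} then 1 else 0) * a (C - A)) = a"
      by blast
  qed
  show "a * 1 = a"
  proof transfer
    fix a :: "nat set \<Rightarrow> 'a" assume a: "\<forall>A. infinite A \<longrightarrow> a A = 0"
    have "(\<Sum>A\<in>Pow C. (-1) ^ inversions A (C - A) * a A * (if C - A = {} then 1 else 0)) = a C" for C
    proof (cases "finite C")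
      case True
      then have "(\<Sum>A\<in>Pow C. (-1) ^ inversions A (C - A) * a A * (if C - A = {} then 1 else 0)) =
          (\<Sum>A\<in>{C}. (-1) ^ inversions A (C - A) * a A * (if C - A = {} then 1 else 0))"
        by (intro sum.mono_neutral_right) auto
      then show ?thesis by simp
    qed (simp add: a)
    then show "(\<lambda>C. \<Sum>A\<in>Pow C. (-1) ^ inversions A (C - A) * a A * (if C - A = {} then 1 else 0)) = a"
      by blast
  qed
  show "(a + b) * c = a * c + b * c" "a * (b + c) = a * b + a * c"
    by (transfer, simp add: distrib_left distrib_right sum.distrib)+
  show "(0 :: 'a grass) \<noteq> 1"
  proof transfer
    have "(if {} = {} then 1 else 0 :: 'a) \<noteq> 0" by simp
    then show "(\<lambda>_. 0 :: 'a) \<noteq> (\<lambda>A :: nat set. if A = {} then 1 else 0)" by metis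
  qed
  show "a + b + c = a + (b + c)" "a + b = b + a" "0 + a = a" "- a + a = 0" "a - b = a + - b"
    by (transfer, simp add: add_ac)+
qed

end

lift_definition mkgrass :: "(nat set \<Rightarrow> 'c) \<Rightarrow> 'c::zero grass" is "\<lambda>f A. if finite A then f A else 0"
  by simp

definition gconst :: "'c \<Rightarrow> 'c::zero grass" where
  "gconst c = mkgrass (\<lambda>A. if A = {} then c else 0)"

definition gmono :: "nat set \<Rightarrow> 'c::ring_1 grass" where
  "gmono A = mkgrass (\<lambda>B. if B = A then 1 else 0)"

definition gmap :: "('c \<Rightarrow> 'd) \<Rightarrow> 'c::zero grass \<Rightarrow> 'd::zero grass" where
  "gmap h a = mkgrass (\<lambda>A. h (gcoef a A))"

definition body :: "'c::zero grass \<Rightarrow> 'c" where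
  "body a = gcoef a {}"

definition nilpart :: "'c::ring_1 grass \<Rightarrow> 'c grass" where
  "nilpart a = a - gconst (body a)"

definition gpartial :: "nat \<Rightarrow> 'c grass \<Rightarrow> 'c::ring_1 grass" where
  "gpartial j a = mkgrass (\<lambda>A. if j \<in> A then 0 else (-1) ^ card {k \<in> A. k < j} * gcoef a (insert j A))"


section \<open>Smooth functions\<close>

definition dirderiv :: "'a \<Rightarrow> ('a::euclidean_space \<Rightarrow> 'b::real_normed_vector) \<Rightarrow> 'a \<Rightarrow> 'b" where
  "dirderiv v f x = frechet_derivative f (at x) v"

text \<open>For open \<open>U\<close>: all iterated partial derivatives exist and are (totally) differentiable on \<open>U\<close>.\<close>

definition smooth_on :: "'a set \<Rightarrow> ('a::euclidean_space \<Rightarrow> 'b::real_normed_vector) \<Rightarrow> bool" where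
  "smooth_on U f \<longleftrightarrow> (\<forall>vs x. set vs \<subseteq> Basis \<longrightarrow> x \<in> U \<longrightarrow> foldr dirderiv vs f differentiable (at x))"

definition fsupp :: "('a::topological_space \<Rightarrow> 'b::zero) \<Rightarrow> 'a set" where
  "fsupp f = closure {x. f x \<noteq> 0}"

definition test_fun :: "('a::euclidean_space \<Rightarrow> complex) \<Rightarrow> bool" where
  "test_fun \<phi> \<longleftrightarrow> smooth_on UNIV \<phi> \<and> compact (fsupp \<phi>)"

section \<open>Distributions\<close>

text \<open>Functionals on complex functions, of which only the values on test functions matter.\<close>

type_synonym 'a dist = "('a \<Rightarrow> complex) \<Rightarrow> complex"

definition regular :: "('a::euclidean_space \<Rightarrow> complex) \<Rightarrow> 'a dist" where
  "regular f \<phi> = (\<integral>x. f x * \<phi> x \<partial>lborel)"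

definition dsupp :: "'a::euclidean_space dist \<Rightarrow> 'a set" where
  "dsupp u = - \<Union>{U. open U \<and> (\<forall>\<phi>. test_fun \<phi> \<and> fsupp \<phi> \<subseteq> U \<longrightarrow> u \<phi> = 0)}"

definition represents :: "'a set \<Rightarrow> ('a \<Rightarrow> complex) \<Rightarrow> 'a::euclidean_space dist \<Rightarrow> bool" where
  "represents U f u \<longleftrightarrow> smooth_on U f \<and> (\<forall>\<phi>. test_fun \<phi> \<and> fsupp \<phi> \<subseteq> U \<longrightarrow> u \<phi> = regular f \<phi>)"

definition sing_supp :: "'a::euclidean_space dist \<Rightarrow> 'a set" where
  "sing_supp u = - \<Union>{U. open U \<and> (\<exists>f. represents U f u)}"

text \<open>
  The product of two distributions with disjoint singular supports; \<open>a\<close> and \<open>b\<close> are the smooth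
  functions given by \<open>u\<close> and \<open>v\<close> outside their singular supports.
\<close>

definition dist_mult :: "'a::euclidean_space dist \<Rightarrow> 'a dist \<Rightarrow> 'a dist" where
  "dist_mult u v \<phi> = (THE l. \<exists>\<eta> a b. smooth_on UNIV \<eta> \<and>
      (\<exists>W. open W \<and> sing_supp v \<subseteq> W \<and> (\<forall>x\<in>W. \<eta> x = 0)) \<and>
      (\<exists>W. open W \<and> sing_supp u \<subseteq> W \<and> (\<forall>x\<in>W. \<eta> x = 1)) \<and>
      represents (- sing_supp u) a u \<and> represents (- sing_supp v) b v \<and>
      l = u (\<lambda>x. b x * \<eta> x * \<phi> x) + v (\<lambda>x. a x * (1 - \<eta> x) * \<phi> x))"

text \<open>The pairing of a compactly supported distribution with a function smooth near its support.\<close>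

definition dpair :: "'a::euclidean_space dist \<Rightarrow> ('a \<Rightarrow> complex) \<Rightarrow> complex" where
  "dpair u F = (THE l. \<exists>\<eta> U. open U \<and> smooth_on U F \<and> test_fun \<eta> \<and> fsupp \<eta> \<subseteq> U \<and>
      (\<exists>W. open W \<and> dsupp u \<subseteq> W \<and> (\<forall>x\<in>W. \<eta> x = 1)) \<and> l = u (\<lambda>x. \<eta> x * F x))"

definition delta :: "nat \<Rightarrow> real dist" where
  "delta j \<psi> = (-1) ^ j * (dirderiv 1 ^^ j) \<psi> 0"

text \<open>
  The pullback \<open>u(f)\<close>, the continuous extension of composition with \<open>f\<close>: the limit of the
  compositions \<open>(u * \<rho>\<^sub>\<epsilon>) \<circ> f\<close> for mollifiers \<open>\<rho>\<^sub>\<epsilon>(s) = \<epsilon>\<inverse> \<rho>(s / \<epsilon>)\<close>.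
\<close>

definition pullback :: "real dist \<Rightarrow> ('a \<Rightarrow> real) \<Rightarrow> 'a::euclidean_space dist" where
  "pullback u f \<phi> = (THE l. \<forall>\<rho>. test_fun \<rho> \<and> (\<integral>s. \<rho> s \<partial>lborel) = 1 \<longrightarrow>
      ((\<lambda>\<epsilon>. regular (\<lambda>x. u (\<lambda>s. \<rho> ((f x - s) / \<epsilon>) / complex_of_real \<epsilon>)) \<phi>) \<longlongrightarrow> l) (at_right 0))"

section \<open>Superfunctions\<close>

text \<open>Superspace has the even coordinates \<open>x\<^sub>j = x $ Inl j\<close> and \<open>x\<^sub>m\<^sub>+\<^sub>j = x $ Inr j\<close>, where \<open>m = CARD('m)\<close>.\<close>

type_synonym 'm pt = "real ^ ('m + 'm)"
type_synonym 'm cgrass = "('m + 'm) cliff grass"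

abbreviation scal :: "complex \<Rightarrow> 'm::finite cgrass" where
  "scal c \<equiv> gconst (cst c)"

abbreviation emb :: "complex grass \<Rightarrow> 'm::finite cgrass" where
  "emb \<equiv> gmap cst"

definition ccoef :: "'i::finite cliff grass \<Rightarrow> nat set \<Rightarrow> 'i cliff \<Rightarrow> complex" where
  "ccoef a A b = cliff.representation cliff_basis (gcoef a A) b"

text \<open>The linear extension of a functional on scalar functions to algebra-valued functions.\<close>

definition lift_op :: "(('a \<Rightarrow> complex) \<Rightarrow> complex) \<Rightarrow> ('a \<Rightarrow> 'i cliff grass) \<Rightarrow> 'i::finite cliff grass" where
  "lift_op T F = mkgrass (\<lambda>A. \<Sum>b | b \<in> cliff_basis \<and> T (\<lambda>x. ccoef (F x) A b) \<noteq> 0.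
      cst (T (\<lambda>x. ccoef (F x) A b)) * b)"

definition smooth_super :: "nat \<Rightarrow> 'm pt set \<Rightarrow> ('m::finite pt \<Rightarrow> 'm cgrass) \<Rightarrow> bool" where
  "smooth_super n \<Omega> F \<longleftrightarrow>
    (\<forall>x\<in>\<Omega>. \<forall>A. gcoef (F x) A \<noteq> 0 \<longrightarrow> A \<subseteq> {1..2 * n}) \<and>
    (\<forall>A. \<exists>N f c. (\<forall>k<N. smooth_on \<Omega> (f k) \<and> c k \<in> cliff_alg n) \<and>
       (\<forall>x\<in>\<Omega>. gcoef (F x) A = (\<Sum>k<(N::nat). cst (f k x) * c k)))"

definition phase_function :: "nat \<Rightarrow> ('m::finite pt \<Rightarrow> real grass) \<Rightarrow> bool" where
  "phase_function n g \<longleftrightarrow>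
    (\<forall>x A. gcoef (g x) A \<noteq> 0 \<longrightarrow> A \<subseteq> {1..2 * n} \<and> even (card A)) \<and>
    (\<forall>A. smooth_on UNIV (\<lambda>x. gcoef (g x) A))"

text \<open>Renames the odd coordinates of \<open>x\<close> to those of \<open>y\<close>.\<close>

definition at_y :: "nat \<Rightarrow> 'c grass \<Rightarrow> 'c::ring_1 grass" where
  "at_y n a = (\<Sum>A\<in>Pow {1..2 * n}. gconst (gcoef a A) * gmono ((+) (2 * n) ` A))"

text \<open>The power \<open>a\<^sup>p\<close>, for even \<open>a\<close> with positive real body.\<close>

definition spow :: "nat \<Rightarrow> complex grass \<Rightarrow> real \<Rightarrow> complex grass" where
  "spow n a p = (\<Sum>j\<le>n. gconst (complex_of_real
      ((\<Prod>i<j. p - real i) / fact j * Re (body a) powr (p - real j))) * nilpart a ^ j)"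

section \<open>Hermitian Dirac operators\<close>

definition ff :: "'m::finite \<Rightarrow> 'm cgrass" where
  "ff j = gconst (cst (1/2) * (orth_gen (Inl j) - cst \<i> * orth_gen (Inr j)))"

definition ff_dag :: "'m::finite \<Rightarrow> 'm cgrass" where
  "ff_dag j = gconst (cst (-1/2) * (orth_gen (Inl j) + cst \<i> * orth_gen (Inr j)))"

definition fs :: "nat \<Rightarrow> 'm::finite cgrass" where
  "fs j = gconst (cst (1/2) * (symp_gen (2 * j - 1) - cst \<i> * symp_gen (2 * j)))"

definition fs_dag :: "nat \<Rightarrow> 'm::finite cgrass" where
  "fs_dag j = gconst (cst (-1/2) * (symp_gen (2 * j - 1) + cst \<i> * symp_gen (2 * j)))"

definition pd :: "'m + 'm \<Rightarrow> ('m::finite pt \<Rightarrow> 'm cgrass) \<Rightarrow> 'm pt \<Rightarrow> 'm cgrass" where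
  "pd i F x = lift_op (\<lambda>f. dirderiv (axis i 1) f x) F"

definition pd_z :: "'m \<Rightarrow> ('m::finite pt \<Rightarrow> 'm cgrass) \<Rightarrow> 'm pt \<Rightarrow> 'm cgrass" where
  "pd_z j F x = scal (1/2) * (pd (Inl j) F x - scal \<i> * pd (Inr j) F x)"

definition pd_zc :: "'m \<Rightarrow> ('m::finite pt \<Rightarrow> 'm cgrass) \<Rightarrow> 'm pt \<Rightarrow> 'm cgrass" where
  "pd_zc j F x = scal (1/2) * (pd (Inl j) F x + scal \<i> * pd (Inr j) F x)"

definition pd_zs :: "nat \<Rightarrow> 'm::finite cgrass \<Rightarrow> 'm cgrass" where
  "pd_zs j a = scal (1/2) * (gpartial (2 * j - 1) a - scal \<i> * gpartial (2 * j) a)"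

definition pd_zsc :: "nat \<Rightarrow> 'm::finite cgrass \<Rightarrow> 'm cgrass" where
  "pd_zsc j a = scal (1/2) * (gpartial (2 * j - 1) a + scal \<i> * gpartial (2 * j) a)"

definition dirac :: "nat \<Rightarrow> ('m::finite pt \<Rightarrow> 'm cgrass) \<Rightarrow> 'm pt \<Rightarrow> 'm cgrass" where
  "dirac n F x = (\<Sum>j\<in>UNIV. ff_dag j * pd_z j F x) +
     scal (2 * \<i>) * (\<Sum>j=1..n. fs_dag j * pd_zs j (F x))"

definition dirac_dag :: "nat \<Rightarrow> ('m::finite pt \<Rightarrow> 'm cgrass) \<Rightarrow> 'm pt \<Rightarrow> 'm cgrass" where
  "dirac_dag n F x = (\<Sum>j\<in>UNIV. ff j * pd_zc j F x) -
     scal (2 * \<i>) * (\<Sum>j=1..n. fs j * pd_zsc j (F x))"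

definition circ :: "'a \<Rightarrow> 'a \<Rightarrow> 'a ^ 2 ^ 2" where
  "circ a b = (\<chi> i j. if i = j then a else b)"

definition dirac_mat :: "nat \<Rightarrow> ('m::finite pt \<Rightarrow> 'm cgrass ^ 2 ^ 2) \<Rightarrow> 'm pt \<Rightarrow> 'm cgrass ^ 2 ^ 2" where
  "dirac_mat n F x = (\<chi> i j. \<Sum>k\<in>UNIV. (circ (dirac n) (dirac_dag n) $ i $ k) (\<lambda>x. F x $ k $ j) x)"

definition dirac_mat_of :: "nat \<Rightarrow> ('m::finite pt \<Rightarrow> real grass) \<Rightarrow> 'm pt \<Rightarrow> 'm cgrass ^ 2 ^ 2" where
  "dirac_mat_of n g x = circ (dirac n (\<lambda>x. emb (gmap complex_of_real (g x))) x)
     (dirac_dag n (\<lambda>x. emb (gmap complex_of_real (g x))) x)"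

section \<open>The kernel\<close>

text \<open>
  In the following \<open>x\<close> is the vector of even and \<open>\<theta>\<close> the sequence of odd coordinates of the argument.
\<close>

definition zc :: "'m::finite pt \<Rightarrow> 'm \<Rightarrow> complex" where
  "zc x j = Complex (x $ Inl j) (x $ Inr j)"

definition zs :: "(nat \<Rightarrow> complex grass) \<Rightarrow> nat \<Rightarrow> complex grass" where
  "zs \<theta> j = \<theta> (2 * j - 1) + gconst \<i> * \<theta> (2 * j)"

definition zs_conj :: "(nat \<Rightarrow> complex grass) \<Rightarrow> nat \<Rightarrow> complex grass" where
  "zs_conj \<theta> j = \<theta> (2 * j - 1) - gconst \<i> * \<theta> (2 * j)"

definition ZZ :: "nat \<Rightarrow> 'm::finite pt \<Rightarrow> (nat \<Rightarrow> complex grass) \<Rightarrow> 'm cgrass" where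
  "ZZ n x \<theta> = (\<Sum>j\<in>UNIV. scal (zc x j) * ff j) + (\<Sum>j=1..n. emb (zs \<theta> j) * fs j)"

definition ZZ_dag :: "nat \<Rightarrow> 'm::finite pt \<Rightarrow> (nat \<Rightarrow> complex grass) \<Rightarrow> 'm cgrass" where
  "ZZ_dag n x \<theta> = (\<Sum>j\<in>UNIV. scal (cnj (zc x j)) * ff_dag j) + (\<Sum>j=1..n. emb (zs_conj \<theta> j) * fs_dag j)"

definition normsq :: "nat \<Rightarrow> 'm::finite pt \<Rightarrow> (nat \<Rightarrow> complex grass) \<Rightarrow> complex grass" where
  "normsq n x \<theta> = gconst (\<Sum>j\<in>UNIV. zc x j * cnj (zc x j)) -
     gconst (\<i> / 2) * (\<Sum>j=1..n. zs \<theta> j * zs_conj \<theta> j)"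

definition sphere_area :: "nat \<Rightarrow> nat \<Rightarrow> real" where
  "sphere_area m n = (let M = 2 * real m - 2 * real n in 2 * pi powr (M / 2) / Gamma (M / 2))"

text \<open>\<open>1/|Z|\<^sup>M\<close>, with \<open>|Z|\<^sup>M = (|Z|\<^sup>2)\<^bsup>M/2\<^esup>\<close>.\<close>

definition inv_norm_pow :: "nat \<Rightarrow> 'm::finite pt \<Rightarrow> (nat \<Rightarrow> complex grass) \<Rightarrow> complex grass" where
  "inv_norm_pow n x \<theta> = spow n (normsq n x \<theta>) (- (2 * real CARD('m) - 2 * real n) / 2)"

definition Psi :: "nat \<Rightarrow> 'm::finite pt \<Rightarrow> (nat \<Rightarrow> complex grass) \<Rightarrow> 'm cgrass" where
  "Psi n x \<theta> = scal (complex_of_real (2 / sphere_area CARD('m) n)) * ZZ n x \<theta> * emb (inv_norm_pow n x \<theta>)"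

definition Psi_dag :: "nat \<Rightarrow> 'm::finite pt \<Rightarrow> (nat \<Rightarrow> complex grass) \<Rightarrow> 'm cgrass" where
  "Psi_dag n x \<theta> = scal (complex_of_real (2 / sphere_area CARD('m) n)) * ZZ_dag n x \<theta> * emb (inv_norm_pow n x \<theta>)"

text \<open>The matrix kernel at \<open>Z - U\<close>, as a function of \<open>x\<close> (with an irrelevant value at \<open>x = y\<close>).\<close>

definition kernel :: "nat \<Rightarrow> 'm::finite pt \<Rightarrow> 'm pt \<Rightarrow> 'm cgrass ^ 2 ^ 2" where
  "kernel n y x = (let \<theta> = (\<lambda>j. gmono {j} - gmono {2 * n + j}) in
     circ (Psi n (x - y) \<theta>) (Psi_dag n (x - y) \<theta>))"

section \<open>Superdistributions and integration\<close>

text \<open>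
  A scalar superdistribution is the family of its components \<open>\<alpha>\<^sub>A\<close>; for an algebra-valued one, there
  is a component for each \<open>A\<close> and each basis vector of the algebra.
\<close>

type_synonym 'a sdist = "nat set \<Rightarrow> 'a dist"
type_synonym 'm csdist = "nat set \<Rightarrow> ('m + 'm) cliff \<Rightarrow> 'm pt dist"

definition sd_mult :: "'a::euclidean_space sdist \<Rightarrow> 'a sdist \<Rightarrow> 'a sdist" where
  "sd_mult \<alpha> \<beta> C \<phi> = (\<Sum>A\<in>Pow C. (-1) ^ inversions A (C - A) * dist_mult (\<alpha> A) (\<beta> (C - A)) \<phi>)"

definition super_delta :: "nat \<Rightarrow> ('a::euclidean_space \<Rightarrow> real grass) \<Rightarrow> 'a sdist" where
  "super_delta n g A \<phi> = (\<Sum>j\<le>n. pullback (delta j) (\<lambda>x. body (g x))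
      (\<lambda>x. complex_of_real (gcoef (nilpart (g x) ^ j) A / fact j) * \<phi> x))"

definition super_heaviside_neg :: "nat \<Rightarrow> ('a::euclidean_space \<Rightarrow> real grass) \<Rightarrow> 'a sdist" where
  "super_heaviside_neg n g A \<phi> =
     (if A = {} then regular (\<lambda>x. if body (g x) < 0 then 1 else 0) \<phi> else 0) +
     (\<Sum>j=1..n. pullback (delta (j - 1)) (\<lambda>x. - body (g x))
        (\<lambda>x. complex_of_real (gcoef ((- nilpart (g x)) ^ j) A / fact j) * \<phi> x))"

definition kernel_comp :: "nat \<Rightarrow> 'm::finite pt \<Rightarrow> 2 \<Rightarrow> 2 \<Rightarrow> ('m + 'm) cliff \<Rightarrow> 'm pt sdist" where
  "kernel_comp n y i k b A = regular (\<lambda>x. ccoef (kernel n y x $ i $ k) A b)"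

definition kernel_times :: "nat \<Rightarrow> 'm::finite pt \<Rightarrow> 'm pt sdist \<Rightarrow> 'm csdist ^ 2 ^ 2" where
  "kernel_times n y \<beta> = (\<chi> i k. (\<lambda>A b. sd_mult (kernel_comp n y i k b) \<beta> A))"

definition times_kernel :: "nat \<Rightarrow> 'm pt sdist \<Rightarrow> 'm::finite pt \<Rightarrow> 'm csdist ^ 2 ^ 2" where
  "times_kernel n \<beta> y = (\<chi> i k. (\<lambda>A b. sd_mult \<beta> (kernel_comp n y i k b) A))"

definition berezin :: "nat \<Rightarrow> 'm::finite cgrass \<Rightarrow> 'm cgrass" where
  "berezin n a = scal (1 / of_real pi ^ n) * fold gpartial [1..<2 * n + 1] a"

definition super_int :: "nat \<Rightarrow> 'm csdist \<Rightarrow> ('m::finite pt \<Rightarrow> 'm cgrass) \<Rightarrow> 'm cgrass" where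
  "super_int n \<alpha> F = (\<Sum>A\<in>Pow {1..4 * n}. \<Sum>B\<in>Pow {1..4 * n}.
     \<Sum>(b, c) | b \<in> cliff_basis \<and> c \<in> cliff_basis \<and> dpair (\<alpha> A b) (\<lambda>x. ccoef (F x) B c) \<noteq> 0.
       scal (dpair (\<alpha> A b) (\<lambda>x. ccoef (F x) B c)) *
       berezin n (gconst b * gmono A * gconst c * gmono B))"

definition super_int_mat :: "nat \<Rightarrow> 'm csdist ^ 2 ^ 2 \<Rightarrow> ('m::finite pt \<Rightarrow> 'm cgrass ^ 2 ^ 2) \<Rightarrow> 'm cgrass ^ 2 ^ 2" where
  "super_int_mat n \<alpha> F = (\<chi> i j. \<Sum>k\<in>UNIV. super_int n (\<alpha> $ i $ k) (\<lambda>x. F x $ k $ j))"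

end

theory Submission
  imports Defs
begin

text \<open>
  Let \<open>H\<^sub>\<epsilon>\<close> be a smooth function vanishing on the negative axis and equal to 1 beyond \<open>\<epsilon>\<close>, and let
  \<open>h\<^sub>\<epsilon> = H\<^sub>\<epsilon>(-g)\<close>, expanded in the nilpotent part of \<open>g\<close>. The superdistributions \<open>H(-g)\<close> and \<open>\<delta>(g)\<close> are the
  limits of \<open>h\<^sub>\<epsilon>\<close> and \<open>H\<^sub>\<epsilon>'(-g)\<close>, and \<open>D(h\<^sub>\<epsilon> G) = h\<^sub>\<epsilon> D G - H\<^sub>\<epsilon>'(-g) D[g] G\<close>, so the left-hand side of the formula is
  the limit of \<open>- \<integral> \<Psi> D(h\<^sub>\<epsilon> G)\<close>. Since \<open>h\<^sub>\<epsilon> G\<close> has compact support, this equals \<open>(h\<^sub>\<epsilon> G)(y)\<close>, that is, \<open>G(y)\<close> or 0 for small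
  \<open>\<epsilon>\<close>: replace \<open>|Z|\<^sup>2\<close> in the denominator of \<open>\<Psi>\<close> by \<open>|Z|\<^sup>2 + \<epsilon>\<close>, integrate by parts, and observe that the right
  Dirac derivative of the regularised kernel is an approximate identity whose mass sits in the top
  odd degree.
\<close>

section \<open>Smooth functions\<close>

text \<open>Let k = m - n. Right differentiation of Z - U and its conjugate yields the
  superdimension k, and for \<phi>(t) = \<open>(t + \<epsilon>)^(-k)\<close> one has k \<phi> + t
  \<phi>' = k \<epsilon> \<open>(t + \<epsilon>)^(-k-1)\<close>: this cancellation leaves a source
  with a factor \<epsilon>. Expanding the source at the body of |Z - U|^2, the terms of nilpotent
  degree below n vanish in the limit. In degree n the exponent is m + 1, for which \<epsilon>
  \<open>(|x - y|^2 + \<epsilon>)^(-m-1)\<close> keeps a constant mass in 2m real dimensions, and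
  the n-th power of the nilpotent norm is a multiple of the product of all differences of odd
  variables, the odd delta function.

  Two obstacles shape the rest. Pullbacks, products and pairings of distributions are definite
  descriptions, so each one requires independence of the mollifier or of the cutoff. The
  Clifford-Weyl algebra is infinite-dimensional, so algebra-valued functions are handled as finite
  sums of scalar functions times constants (\<open>dec\<close>), and every analytic fact is proved
  for scalar functions first.\<close>

lemma dirderiv_cong:
  assumes "open U" "x \<in> U" "\<And>z. z \<in> U \<Longrightarrow> f z = g z"
  shows "dirderiv v f x = dirderiv v g x"
proof -
  have "(f has_derivative f') (at x) \<longleftrightarrow> (g has_derivative f') (at x)" for f'
    using has_derivative_transform_within_open[OF _ assms(1,2)] assms(3) by metis
  then show ?thesis by (simp add: dirderiv_def frechet_derivative_def)
qed

lemma dirderiv_eq: "(f has_derivative f') (at x) \<Longrightarrow> dirderiv v f x = f' v"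
  unfolding dirderiv_def using frechet_derivative_at by metis

lemma has_derivative_dirderiv:
  "f differentiable (at x) \<Longrightarrow> (f has_derivative (\<lambda>v. dirderiv v f x)) (at x)"
  unfolding dirderiv_def using frechet_derivative_works by auto

lemma dirderiv_linear: "f differentiable (at x) \<Longrightarrow> linear (\<lambda>v. dirderiv v f x)"
  using has_derivative_dirderiv has_derivative_linear by blast

lemma differentiable_cong_open:
  "open U \<Longrightarrow> x \<in> U \<Longrightarrow> (\<And>z. z \<in> U \<Longrightarrow> f z = g z) \<Longrightarrow> f differentiable (at x) \<Longrightarrow> g differentiable (at x)"
  by (meson differentiable_def has_derivative_transform_within_open)

lemma differentiable_bilinear:
  "bounded_bilinear pr \<Longrightarrow> f differentiable (at x) \<Longrightarrow> g differentiable (at x) \<Longrightarrow>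
    (\<lambda>x. pr (f x) (g x)) differentiable (at x)"
  unfolding differentiable_def by (blast intro: bounded_bilinear.FDERIV)

lemma differentiable_bounded_linear:
  "bounded_linear h \<Longrightarrow> f differentiable (at x) \<Longrightarrow> (\<lambda>x. h (f x)) differentiable (at x)"
  unfolding differentiable_def by (blast intro: bounded_linear.has_derivative)

text \<open>A version of \<open>smooth_on\<close> graded by the order. The product and chain rules
  express a derivative through the given functions and their first derivatives, so closure
  properties are proved by induction on the order.\<close>

primrec ck :: "nat \<Rightarrow> 'a set \<Rightarrow> ('a::euclidean_space \<Rightarrow> 'b::real_normed_vector) \<Rightarrow> bool" where
  "ck 0 U f \<longleftrightarrow> (\<forall>x\<in>U. f differentiable (at x))"
| "ck (Suc k) U f \<longleftrightarrow> (\<forall>x\<in>U. f differentiable (at x)) \<and> (\<forall>b\<in>Basis. ck k U (dirderiv b f))"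

lemma ck_iff_foldr: "ck k U f \<longleftrightarrow> (\<forall>vs x. set vs \<subseteq> Basis \<longrightarrow> length vs \<le> k \<longrightarrow> x \<in> U \<longrightarrow> foldr dirderiv vs f differentiable (at x))"
proof (induction k arbitrary: f)
  case (Suc k)
  show ?case (is "_ \<longleftrightarrow> ?R")
  proof
    assume c: "ck (Suc k) U f"
    show ?R
    proof (intro allI impI)
      fix vs :: "'a list" and x assume "set vs \<subseteq> Basis" "length vs \<le> Suc k" "x \<in> U"
      \<comment> \<open>\<open>foldr\<close> applies the last direction of the list first, and
        \<open>ck\<close> peels off the derivative that is taken first; so the list is split at its
        end.\<close>
      then show "foldr dirderiv vs f differentiable (at x)"
        using c Suc by (cases vs rule: rev_cases) auto
    qed
  next
    assume R: ?R
    have "foldr dirderiv vs (dirderiv b f) differentiable (at x)"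
      if "b \<in> Basis" "set vs \<subseteq> Basis" "length vs \<le> k" "x \<in> U" for b :: 'a and vs x
      using R[rule_format, of "vs @ [b]" x] that by simp
    then show "ck (Suc k) U f" using R[rule_format, of "[]"] by (auto simp: Suc)
  qed
qed auto

lemma smooth_on_iff_ck: "smooth_on U f \<longleftrightarrow> (\<forall>k. ck k U f)"
  unfolding ck_iff_foldr smooth_on_def by (metis order_refl)

lemma ck_SucD: "ck (Suc k) U f \<Longrightarrow> ck k U f"
  by (induction k arbitrary: f) auto

lemma ck_differentiable: "ck k U f \<Longrightarrow> x \<in> U \<Longrightarrow> f differentiable (at x)"
  by (cases k) auto

lemma ck_cong:
  assumes "open U" shows "(\<And>x. x \<in> U \<Longrightarrow> f x = g x) \<Longrightarrow> ck k U f \<Longrightarrow> ck k U g"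
proof (induction k arbitrary: f g)
  case 0
  show ?case unfolding ck.simps
  proof
    fix x assume "x \<in> U"
    then show "g differentiable (at x)"
      by (rule differentiable_cong_open[OF assms _ 0(1)]) (use 0(2) \<open>x \<in> U\<close> in simp_all)
  qed
next
  case (Suc k)
  have "ck k U (dirderiv b g)" if b: "b \<in> Basis" for b
  proof (rule Suc.IH)
    show "ck k U (dirderiv b f)" using Suc.prems(2) b by simp
    show "dirderiv b f x = dirderiv b g x" if "x \<in> U" for x
      by (rule dirderiv_cong[OF assms that Suc.prems(1)])
  qed
  moreover have "g differentiable (at x)" if "x \<in> U" for x
    by (rule differentiable_cong_open[OF assms that Suc.prems(1)]) (use Suc.prems(2) that in simp_all)
  ultimately show ?case by simp
qed

lemma ck_const: "ck k U (\<lambda>_. c)"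
proof (induction k arbitrary: c)
  case (Suc k)
  have "dirderiv b (\<lambda>_. c) = (\<lambda>_. 0)" for b :: 'a by (rule ext) (subst dirderiv_eq, rule has_derivative_const, simp)
  then show ?case using Suc by simp
qed simp

lemma dirderiv_add: "f differentiable (at x) \<Longrightarrow> g differentiable (at x) \<Longrightarrow>
    dirderiv b (\<lambda>x. f x + g x) x = dirderiv b f x + dirderiv b g x"
  by (subst dirderiv_eq, rule has_derivative_add, (rule has_derivative_dirderiv, assumption)+) simp

lemma dirderiv_bilinear:
  assumes "bounded_bilinear pr" "f differentiable (at x)" "g differentiable (at x)"
  shows "dirderiv b (\<lambda>x. pr (f x) (g x)) x = pr (f x) (dirderiv b g x) + pr (dirderiv b f x) (g x)"
  by (subst dirderiv_eq, rule bounded_bilinear.FDERIV[OF assms(1)], (rule has_derivative_dirderiv, rule assms)+) simp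

lemma dirderiv_bounded_linear:
  assumes "bounded_linear h" "f differentiable (at x)"
  shows "dirderiv b (\<lambda>x. h (f x)) x = h (dirderiv b f x)"
  by (subst dirderiv_eq, rule bounded_linear.has_derivative[OF assms(1)], rule has_derivative_dirderiv, rule assms) simp

lemma dirderiv_compose:
  fixes f :: "'a::euclidean_space \<Rightarrow> real"
  assumes "f differentiable (at x)" "h differentiable (at (f x))"
  shows "dirderiv b (\<lambda>x. h (f x)) x = dirderiv b f x *\<^sub>R dirderiv 1 h (f x)"
proof -
  note h = has_derivative_dirderiv[OF assms(2)]
  have "dirderiv b (\<lambda>x. h (f x)) x = dirderiv (dirderiv b f x) h (f x)"
    by (rule dirderiv_eq) (rule has_derivative_compose[OF has_derivative_dirderiv[OF assms(1)] h])
  then show ?thesis using linear_scale[OF dirderiv_linear[OF assms(2)], of "dirderiv b f x" 1] by simp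
qed

lemma ck_add:
  assumes "open U" shows "ck k U f \<Longrightarrow> ck k U g \<Longrightarrow> ck k U (\<lambda>x. f x + g x)"
proof (induction k arbitrary: f g)
  case (Suc k)
  have "ck k U (dirderiv b (\<lambda>x. f x + g x))" if "b \<in> Basis" for b
    by (rule ck_cong[OF assms, of "\<lambda>x. dirderiv b f x + dirderiv b g x"])
       (use Suc.prems that in \<open>auto intro!: Suc.IH dirderiv_add[symmetric]\<close>)
  then show ?case using Suc by auto
qed auto

lemma ck_bilinear:
  assumes "open U" "bounded_bilinear pr" shows "ck k U f \<Longrightarrow> ck k U g \<Longrightarrow> ck k U (\<lambda>x. pr (f x) (g x))"
proof (induction k arbitrary: f g)
  case 0
  then show ?case by (auto intro: differentiable_bilinear[OF assms(2)])
next
  case (Suc k)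
  have d: "(\<lambda>x. pr (f x) (g x)) differentiable (at x)" if "x \<in> U" for x
    using Suc.prems that by (intro differentiable_bilinear[OF assms(2)]) auto
  have "ck k U (dirderiv b (\<lambda>x. pr (f x) (g x)))" if "b \<in> Basis" for b
    by (rule ck_cong[OF assms(1), of "\<lambda>x. pr (f x) (dirderiv b g x) + pr (dirderiv b f x) (g x)"])
       (use Suc.prems that ck_SucD[OF Suc.prems(1)] ck_SucD[OF Suc.prems(2)] in
         \<open>auto intro!: Suc.IH ck_add[OF assms(1)] dirderiv_bilinear[OF assms(2), symmetric]\<close>)
  then show ?case using d by auto
qed

lemma ck_bounded_linear:
  assumes "open U" "bounded_linear h" shows "ck k U f \<Longrightarrow> ck k U (\<lambda>x. h (f x))"
proof (induction k arbitrary: f)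
  case 0
  then show ?case by (auto intro: differentiable_bounded_linear[OF assms(2)])
next
  case (Suc k)
  have d: "(\<lambda>x. h (f x)) differentiable (at x)" if "x \<in> U" for x
    using Suc.prems that by (intro differentiable_bounded_linear[OF assms(2)]) auto
  have "ck k U (dirderiv b (\<lambda>x. h (f x)))" if "b \<in> Basis" for b
    by (rule ck_cong[OF assms(1), of "\<lambda>x. h (dirderiv b f x)"])
       (use Suc.prems that in \<open>auto intro!: Suc.IH dirderiv_bounded_linear[OF assms(2), symmetric]\<close>)
  then show ?case using d by auto
qed

lemma ck_compose:
  fixes f :: "'a::euclidean_space \<Rightarrow> real"
  assumes U: "open U" and S: "open S" "\<And>x. x \<in> U \<Longrightarrow> f x \<in> S"
  shows "ck k S h \<Longrightarrow> ck k U f \<Longrightarrow> ck k U (\<lambda>x. h (f x))"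
proof (induction k arbitrary: h)
  case 0
  then show ?case using S by (auto intro: differentiable_compose)
next
  case (Suc k)
  have "ck k U (dirderiv b (\<lambda>x. h (f x)))" if "b \<in> Basis" for b
  proof (rule ck_cong[OF U])
    show "ck k U (\<lambda>x. dirderiv b f x *\<^sub>R dirderiv 1 h (f x))"
      using Suc.prems ck_SucD[OF Suc.prems(2)] that by (intro ck_bilinear[OF U bounded_bilinear_scaleR] Suc.IH) auto
    show "dirderiv b f x *\<^sub>R dirderiv 1 h (f x) = dirderiv b (\<lambda>x. h (f x)) x" if "x \<in> U" for x
      using Suc.prems that S by (intro dirderiv_compose[symmetric]) auto
  qed
  moreover have "(\<lambda>x. h (f x)) differentiable (at x)" if "x \<in> U" for x
    using Suc.prems that S by (auto intro: differentiable_compose)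
  ultimately show ?case by simp
qed

section \<open>Closure properties of smooth functions\<close>

lemma smooth_on_differentiable: "smooth_on U f \<Longrightarrow> x \<in> U \<Longrightarrow> f differentiable (at x)"
  using ck_differentiable smooth_on_iff_ck by blast

lemma smooth_on_continuous: "smooth_on U f \<Longrightarrow> continuous_on U f"
  by (meson smooth_on_differentiable continuous_at_imp_continuous_on differentiable_imp_continuous_within)

lemma smooth_on_dirderiv: "smooth_on U f \<Longrightarrow> b \<in> Basis \<Longrightarrow> smooth_on U (dirderiv b f)"
  unfolding smooth_on_iff_ck by (meson ck.simps(2))

lemma smooth_on_Suc:
  "(\<And>x. x \<in> U \<Longrightarrow> f differentiable (at x)) \<Longrightarrow> (\<And>b. b \<in> Basis \<Longrightarrow> smooth_on U (dirderiv b f)) \<Longrightarrow> smooth_on U f"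
  unfolding smooth_on_iff_ck
proof
  fix k assume *: "\<And>x. x \<in> U \<Longrightarrow> f differentiable (at x)" "\<And>b. b \<in> Basis \<Longrightarrow> \<forall>k. ck k U (dirderiv b f)"
  then show "ck k U f" by (cases k) auto
qed

lemma smooth_on_subset: "smooth_on U f \<Longrightarrow> V \<subseteq> U \<Longrightarrow> smooth_on V f"
  unfolding smooth_on_def by blast

lemma smooth_on_Un: "smooth_on U f \<Longrightarrow> smooth_on V f \<Longrightarrow> smooth_on (U \<union> V) f"
  unfolding smooth_on_def by blast

lemma smooth_on_locally: "(\<And>x. x \<in> U \<Longrightarrow> \<exists>V. x \<in> V \<and> smooth_on V f) \<Longrightarrow> smooth_on U f"
  unfolding smooth_on_def by meson

lemma smooth_on_cong: "open U \<Longrightarrow> (\<And>x. x \<in> U \<Longrightarrow> f x = g x) \<Longrightarrow> smooth_on U f \<Longrightarrow> smooth_on U g"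
  unfolding smooth_on_iff_ck using ck_cong by metis

lemma smooth_on_const: "smooth_on U (\<lambda>_. c)"
  unfolding smooth_on_iff_ck using ck_const by blast

lemma smooth_on_bounded_linear: "open U \<Longrightarrow> bounded_linear h \<Longrightarrow> smooth_on U f \<Longrightarrow> smooth_on U (\<lambda>x. h (f x))"
  unfolding smooth_on_iff_ck using ck_bounded_linear by blast

lemma smooth_on_add: "open U \<Longrightarrow> smooth_on U f \<Longrightarrow> smooth_on U g \<Longrightarrow> smooth_on U (\<lambda>x. f x + g x)"
  unfolding smooth_on_iff_ck using ck_add by blast

lemma smooth_on_bilinear: "open U \<Longrightarrow> bounded_bilinear pr \<Longrightarrow> smooth_on U f \<Longrightarrow> smooth_on U g \<Longrightarrow> smooth_on U (\<lambda>x. pr (f x) (g x))"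
  unfolding smooth_on_iff_ck using ck_bilinear by blast

lemma smooth_on_compose:
  "open U \<Longrightarrow> open S \<Longrightarrow> (\<And>x. x \<in> U \<Longrightarrow> f x \<in> S) \<Longrightarrow> smooth_on S h \<Longrightarrow> smooth_on U f \<Longrightarrow> smooth_on U (\<lambda>x. h (f x))"
  for f :: "'a::euclidean_space \<Rightarrow> real"
  unfolding smooth_on_iff_ck using ck_compose[of U S f] by blast

lemma smooth_on_mult:
  fixes f g :: "'a::euclidean_space \<Rightarrow> 'b::real_normed_algebra"
  shows "open U \<Longrightarrow> smooth_on U f \<Longrightarrow> smooth_on U g \<Longrightarrow> smooth_on U (\<lambda>x. f x * g x)"
  by (rule smooth_on_bilinear[OF _ bounded_bilinear_mult])

lemma smooth_on_minus: "open U \<Longrightarrow> smooth_on U f \<Longrightarrow> smooth_on U (\<lambda>x. - f x)"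
  by (rule smooth_on_bounded_linear) (auto intro: bounded_linear_minus bounded_linear_ident)

lemma smooth_on_diff: "open U \<Longrightarrow> smooth_on U f \<Longrightarrow> smooth_on U g \<Longrightarrow> smooth_on U (\<lambda>x. f x - g x)"
  using smooth_on_add[of U f "\<lambda>x. - g x"] smooth_on_minus[of U g] by simp

lemma smooth_on_of_real: "open U \<Longrightarrow> smooth_on U f \<Longrightarrow> smooth_on U (\<lambda>x. complex_of_real (f x))"
  by (rule smooth_on_bounded_linear[OF _ bounded_linear_of_real])

lemma smooth_on_sum: "open U \<Longrightarrow> (\<And>i. i \<in> I \<Longrightarrow> smooth_on U (f i)) \<Longrightarrow> smooth_on U (\<lambda>x. \<Sum>i\<in>I. f i x)"
  by (induction I rule: infinite_finite_induct) (auto intro: smooth_on_const smooth_on_add)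

lemma smooth_on_prod:
  fixes f :: "'i \<Rightarrow> 'a::euclidean_space \<Rightarrow> 'b::{real_normed_algebra, comm_ring_1}"
  shows "open U \<Longrightarrow> (\<And>i. i \<in> I \<Longrightarrow> smooth_on U (f i)) \<Longrightarrow> smooth_on U (\<lambda>x. \<Prod>i\<in>I. f i x)"
  by (induction I rule: infinite_finite_induct) (auto intro: smooth_on_const smooth_on_mult)

lemma smooth_on_power:
  fixes f :: "'a::euclidean_space \<Rightarrow> 'b::real_normed_algebra_1"
  shows "open U \<Longrightarrow> smooth_on U f \<Longrightarrow> smooth_on U (\<lambda>x. f x ^ k)"
  by (induction k) (auto intro: smooth_on_const smooth_on_mult)

lemma smooth_on_linear: "bounded_linear h \<Longrightarrow> smooth_on U h"
proof (rule smooth_on_Suc)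
  assume h: "bounded_linear h"
  have "dirderiv b h = (\<lambda>_. h b)" for b by (rule ext, rule dirderiv_eq, rule bounded_linear_imp_has_derivative[OF h])
  then show "smooth_on U (dirderiv b h)" for b by (simp add: smooth_on_const)
  show "h differentiable (at x)" for x using bounded_linear_imp_differentiable[OF h] .
qed

lemma smooth_on_norm_sq: "smooth_on UNIV (\<lambda>x. (norm (x - a))\<^sup>2)"
proof -
  have "smooth_on UNIV (\<lambda>x. x - a)"
    by (intro smooth_on_diff smooth_on_const smooth_on_linear bounded_linear_ident) auto
  from smooth_on_bilinear[OF _ bounded_bilinear_inner this this] show ?thesis
    by (simp add: power2_norm_eq_inner)
qed

lemma DERIV_inverse_power:
  fixes t :: real
  assumes "0 < t"
  shows "((\<lambda>t. inverse (t ^ k)) has_field_derivative - real k * inverse (t ^ Suc k)) (at t)"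
proof (cases k)
  case (Suc j)
  have "- (inverse (t ^ k) * (real k * (1 * t ^ (k - Suc 0))) * inverse (t ^ k)) = - real k * inverse (t ^ Suc k)"
    using assms by (simp add: Suc field_simps)
  from DERIV_cong[OF DERIV_inverse'[OF DERIV_power[OF DERIV_ident]] this] show ?thesis using assms by simp
qed simp

text \<open>Differentiation only raises the exponent and multiplies by a constant, so the induction
  on the order runs over all exponents at once.\<close>

lemma smooth_on_inverse_power: "smooth_on {0<..} (\<lambda>t::real. inverse (t ^ k))"
proof -
  have "ck j {0<..} (\<lambda>t::real. inverse (t ^ k))" for j
  proof (induction j arbitrary: k)
    case 0
    show ?case by (auto intro!: derivative_intros)
  next
    case (Suc j)
    have "ck j {0<..} (dirderiv 1 (\<lambda>t::real. inverse (t ^ k)))"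
    proof (rule ck_cong)
      show "ck j {0<..} (\<lambda>t::real. - real k * inverse (t ^ Suc k))"
        by (intro ck_bilinear[OF _ bounded_bilinear_mult] ck_const Suc) auto
      fix t :: real assume t: "t \<in> {0<..}"
      have "((\<lambda>t. inverse (t ^ k)) has_field_derivative - real k * inverse (t ^ Suc k)) (at t)"
        using t by (intro DERIV_inverse_power) simp
      then show "- real k * inverse (t ^ Suc k) = dirderiv 1 (\<lambda>t. inverse (t ^ k)) t"
        unfolding has_field_derivative_def by (simp add: dirderiv_eq)
    qed auto
    then show ?case by (auto intro!: derivative_intros)
  qed
  then show ?thesis by (simp add: smooth_on_iff_ck)
qed

lemma smooth_on_inverse:
  "open U \<Longrightarrow> smooth_on U f \<Longrightarrow> (\<And>x. x \<in> U \<Longrightarrow> 0 < f x) \<Longrightarrow> smooth_on U (\<lambda>x. inverse (f x ^ k))"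
  for f :: "'a::euclidean_space \<Rightarrow> real"
  by (rule smooth_on_compose[of U "{0<..}"]) (auto intro: smooth_on_inverse_power)

text \<open>Extension by zero: the open sets U and \<open>- C\<close> cover the space, and f is
  smooth on each of them.\<close>

lemma smooth_on_extend:
  assumes "open U" "closed C" "C \<subseteq> U" "smooth_on U f" "\<And>x. x \<notin> C \<Longrightarrow> f x = 0"
  shows "smooth_on UNIV f"
proof -
  have "smooth_on (- C) f" by (rule smooth_on_cong[of _ "\<lambda>_. 0"]) (use assms in \<open>auto intro: smooth_on_const\<close>)
  with smooth_on_Un[OF assms(4)] have "smooth_on (U \<union> - C) f" .
  moreover have "U \<union> - C = UNIV" using assms by auto
  ultimately show ?thesis by simp
qed

section \<open>Bump functions\<close>

text \<open>The classical function exp(-1/t), flat at 0. The powers of t are included because the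
  family is then closed under differentiation up to linear combinations, so that smoothness of all
  members follows by one induction.\<close>

definition flat :: "nat \<Rightarrow> real \<Rightarrow> real" where
  "flat k t = (if t > 0 then inverse (t ^ k) * exp (- 1 / t) else 0)"

lemma flat_deriv: "(flat k has_field_derivative - real k * flat (k + 1) t + flat (k + 2) t) (at t)"
proof -
  consider "t < 0" | "t > 0" | "t = 0" by linarith
  then show ?thesis
  proof cases
    case 1
    have "(flat k has_field_derivative 0) (at t)"
      by (rule DERIV_cong_ev[THEN iffD2, OF HOL.refl _ HOL.refl, of _ "\<lambda>_. 0"])
         (use eventually_nhds_in_open[of "{..<0}" t] 1 in \<open>auto simp: flat_def elim!: eventually_mono\<close>)
    then show ?thesis using 1 by (simp add: flat_def)
  next
    case 2
    have "((\<lambda>t. inverse (t ^ k) * exp (- 1 / t)) has_field_derivative - real k * flat (k + 1) t + flat (k + 2) t) (at t)"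
    proof -
      have d: "((\<lambda>t. - 1 / t) has_field_derivative inverse (t\<^sup>2)) (at t)"
        using 2 by (auto intro!: derivative_eq_intros simp: field_simps power2_eq_square)
      show ?thesis
        by (rule DERIV_cong[OF DERIV_mult[OF DERIV_inverse_power[OF 2] DERIV_chain2[OF DERIV_exp d]]])
           (use 2 in \<open>auto simp: flat_def field_simps power2_eq_square\<close>)
    qed
    moreover have "\<forall>\<^sub>F x in nhds t. flat k x = inverse (x ^ k) * exp (- 1 / x)"
      using eventually_nhds_in_open[of "{0<..}" t] 2 by (auto simp: flat_def elim!: eventually_mono)
    ultimately show ?thesis by (rule DERIV_cong_ev[OF HOL.refl _ HOL.refl, THEN iffD2, rotated])
  next
    case 3
    \<comment> \<open>This is the difference quotient at 0. The substitution x = 1/h turns it into a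
      power of x divided by exp x.\<close>
    have "((\<lambda>h. inverse (h ^ Suc k) * exp (- 1 / h)) \<longlongrightarrow> 0) (at_right (0::real))"
    proof -
      have "((\<lambda>x::real. x ^ Suc k / exp x) \<longlongrightarrow> 0) at_top" by (rule tendsto_power_div_exp_0)
      then have "((\<lambda>x::real. inverse x ^ Suc k / exp (inverse x)) \<longlongrightarrow> 0) (at_right 0)"
        by (rule filterlim_compose[OF _ filterlim_inverse_at_top_right])
      then show ?thesis by (simp add: exp_minus field_simps power_inverse)
    qed
    then have "((\<lambda>h. flat k h / h) \<longlongrightarrow> 0) (at_right 0)"
      by (rule Lim_transform_eventually)
         (auto simp: flat_def eventually_at_right_field field_simps intro!: exI[of _ 1])
    moreover have "((\<lambda>h. flat k h / h) \<longlongrightarrow> 0) (at_left 0)"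
      by (rule Lim_transform_eventually[of "\<lambda>_. 0"])
         (auto simp: flat_def eventually_at_left_field intro!: exI[of _ "-1"])
    ultimately have "((\<lambda>h. flat k h / h) \<longlongrightarrow> 0) (at 0)" by (simp add: filterlim_split_at)
    then show ?thesis using 3 by (simp add: DERIV_def flat_def)
  qed
qed

lemma smooth_flat: "smooth_on U (flat k)"
proof -
  have "ck j UNIV (flat k)" for j
  proof (induction j arbitrary: k)
    case 0
    show ?case using flat_deriv by (auto simp: real_differentiable_def)
  next
    case (Suc j)
    have "dirderiv 1 (flat k) = (\<lambda>t. - real k * flat (k + 1) t + flat (k + 2) t)"
      by (rule ext) (simp add: dirderiv_eq[OF flat_deriv[unfolded has_field_derivative_def]])
    moreover have "ck j UNIV (\<lambda>t. - real k * flat (k + 1) t + flat (k + 2) t)"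
      by (intro ck_add ck_bilinear[OF _ bounded_bilinear_mult] ck_const Suc) auto
    moreover have "flat k differentiable (at t)" for t
      using flat_deriv real_differentiable_def by blast
    ultimately show ?case by simp
  qed
  then show ?thesis using smooth_on_subset[of UNIV] by (auto simp: smooth_on_iff_ck)
qed

text \<open>A smooth transition from 0 to 1 on the unit interval. The denominator is positive
  because t and 1 - t are never both nonpositive.\<close>

definition step :: "real \<Rightarrow> real" where
  "step t = flat 0 t / (flat 0 t + flat 0 (1 - t))"

lemma step_denom: "flat 0 t + flat 0 (1 - t) > 0"
proof (cases "t > 0")
  case True
  then have "flat 0 t > 0" by (simp add: flat_def)
  moreover have "flat 0 (1 - t) \<ge> 0" by (simp add: flat_def)
  ultimately show ?thesis by linarith
qed (simp add: flat_def)

lemma smooth_step: "smooth_on UNIV step"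
proof -
  have 1: "smooth_on UNIV (\<lambda>t::real. 1 - t)"
    by (intro smooth_on_diff smooth_on_const smooth_on_linear bounded_linear_ident) auto
  have "smooth_on UNIV (\<lambda>t. flat 0 (1 - t))"
    by (rule smooth_on_compose[OF open_UNIV open_UNIV _ smooth_flat 1]) simp
  then have "smooth_on UNIV (\<lambda>t. flat 0 t * inverse ((flat 0 t + flat 0 (1 - t)) ^ 1))"
    by (intro smooth_on_mult smooth_flat smooth_on_inverse smooth_on_add step_denom) auto
  then show ?thesis by (simp add: step_def[abs_def] divide_inverse)
qed

lemma step_0: "t \<le> 0 \<Longrightarrow> step t = 0"
  and step_1: "t \<ge> 1 \<Longrightarrow> step t = 1"
  using step_denom[of t] by (simp_all add: step_def flat_def)

lemma step_bounds: "0 \<le> step t" "step t \<le> 1"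
proof -
  have "flat 0 t \<ge> 0" "flat 0 (1 - t) \<ge> 0" by (simp_all add: flat_def)
  then show "0 \<le> step t" "step t \<le> 1" using step_denom[of t] by (simp_all add: step_def)
qed

lemma fsupp_subset: "closed C \<Longrightarrow> (\<And>x. x \<notin> C \<Longrightarrow> f x = 0) \<Longrightarrow> fsupp f \<subseteq> C"
  unfolding fsupp_def by (rule closure_minimal) auto

lemma fsupp_eq_0: "x \<notin> fsupp f \<Longrightarrow> f x = 0"
  using closure_subset[of "{x. f x \<noteq> 0}"] by (auto simp: fsupp_def)

lemma closed_fsupp: "closed (fsupp f)"
  by (simp add: fsupp_def)

lemma test_funI: "smooth_on UNIV f \<Longrightarrow> compact C \<Longrightarrow> (\<And>x. x \<notin> C \<Longrightarrow> f x = 0) \<Longrightarrow> test_fun f"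
proof -
  assume "smooth_on UNIV f" and C: "compact C" "\<And>x. x \<notin> C \<Longrightarrow> f x = 0"
  have "C \<inter> fsupp f = fsupp f" using fsupp_subset[OF compact_imp_closed[OF C(1)], of f] C(2) by auto
  then show "test_fun f"
    using \<open>smooth_on UNIV f\<close> compact_Int_closed[OF C(1) closed_fsupp[of f]] by (simp add: test_fun_def)
qed

text \<open>The squared norm keeps the function smooth at the centre. The argument of
  \<open>step\<close> is at least 1 within distance r of the centre, and negative from distance 2 r
  on.\<close>

definition bump :: "'a::euclidean_space \<Rightarrow> real \<Rightarrow> 'a \<Rightarrow> complex" where
  "bump a r x = complex_of_real (step (2 - (norm (x - a))\<^sup>2 / r\<^sup>2))"

lemma bump_1: "r > 0 \<Longrightarrow> x \<in> cball a r \<Longrightarrow> bump a r x = 1"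
  by (auto simp: bump_def dist_norm norm_minus_commute intro!: step_1 power_mono)

lemma bump_0: "r > 0 \<Longrightarrow> x \<notin> ball a (2 * r) \<Longrightarrow> bump a r x = 0"
proof -
  assume r: "r > 0" "x \<notin> ball a (2 * r)"
  then have "(2 * r)\<^sup>2 \<le> (norm (x - a))\<^sup>2"
    by (intro power_mono) (auto simp: dist_norm norm_minus_commute)
  moreover have "(2 * r)\<^sup>2 = 4 * r\<^sup>2" by (simp add: power_mult_distrib)
  ultimately have "2 * r\<^sup>2 \<le> (norm (x - a))\<^sup>2"
    using zero_le_power2[of r] by linarith
  then have "2 - (norm (x - a))\<^sup>2 / r\<^sup>2 \<le> 0" using r by (simp add: field_simps)
  then show ?thesis by (simp add: bump_def step_0)
qed

lemma smooth_bump: "smooth_on UNIV (bump a r)"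
proof -
  have "smooth_on UNIV (\<lambda>x. 2 - (norm (x - a))\<^sup>2 * (1 / r\<^sup>2))"
    by (intro smooth_on_diff smooth_on_const smooth_on_mult smooth_on_norm_sq) auto
  then have "smooth_on UNIV (\<lambda>x. step (2 - (norm (x - a))\<^sup>2 / r\<^sup>2))"
    by (intro smooth_on_compose[OF open_UNIV open_UNIV _ smooth_step]) (auto simp: divide_inverse)
  then show ?thesis unfolding bump_def[abs_def] by (rule smooth_on_of_real[OF open_UNIV])
qed

lemma test_bump: "r > 0 \<Longrightarrow> test_fun (bump a r)"
  by (rule test_funI[OF smooth_bump, of "cball a (2 * r)"]) (auto intro!: bump_0)

lemma fsupp_bump: "r > 0 \<Longrightarrow> fsupp (bump a r) \<subseteq> cball a (2 * r)"
  by (rule fsupp_subset) (auto intro!: bump_0)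


section \<open>Integrals of test functions\<close>

lemma test_fun_smooth: "test_fun f \<Longrightarrow> smooth_on UNIV f"
  by (simp add: test_fun_def)

text \<open>Smoothness of h near the support of f suffices, because the product is extended by zero.
  This is how functions that are singular away from the support enter.\<close>

lemma test_fun_mult_smooth:
  assumes "test_fun f" "open U" "fsupp f \<subseteq> U" "smooth_on U h"
  shows "test_fun (\<lambda>x. h x * f x)"
proof (rule test_funI[of _ "fsupp f"])
  show "smooth_on UNIV (\<lambda>x. h x * f x)"
    by (rule smooth_on_extend[of U "fsupp f"])
       (use assms in \<open>auto simp: closed_fsupp fsupp_eq_0 intro!: smooth_on_mult intro: smooth_on_subset[OF test_fun_smooth]\<close>)
qed (use assms in \<open>auto simp: test_fun_def fsupp_eq_0\<close>)

lemma test_fun_mult: "test_fun f \<Longrightarrow> smooth_on UNIV h \<Longrightarrow> test_fun (\<lambda>x. h x * f x)"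
  by (rule test_fun_mult_smooth[of f UNIV]) auto

lemma test_fun_mult_left: "test_fun f \<Longrightarrow> smooth_on UNIV h \<Longrightarrow> test_fun (\<lambda>x. f x * h x)"
  using test_fun_mult[of f h] by (simp add: mult.commute)

lemma test_fun_add: "test_fun f \<Longrightarrow> test_fun h \<Longrightarrow> test_fun (\<lambda>x. f x + h x)"
  by (rule test_funI[of _ "fsupp f \<union> fsupp h"])
     (auto simp: test_fun_def fsupp_eq_0 intro: smooth_on_add)

lemma test_fun_0: "test_fun (\<lambda>_. 0)"
  by (rule test_funI[of _ "{}"]) (auto intro: smooth_on_const)

lemma test_fun_sum: "(\<And>i. i \<in> I \<Longrightarrow> test_fun (f i)) \<Longrightarrow> test_fun (\<lambda>x. \<Sum>i\<in>I. f i x)"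
  by (induction I rule: infinite_finite_induct) (auto intro: test_fun_add test_fun_0)

lemma test_fun_cmult: "test_fun f \<Longrightarrow> test_fun (\<lambda>x. c * f x)"
  by (rule test_fun_mult[OF _ smooth_on_const])

lemma test_fun_diff: "test_fun f \<Longrightarrow> test_fun h \<Longrightarrow> test_fun (\<lambda>x. f x - h x)"
  using test_fun_add[of f "\<lambda>x. (-1) * h x"] test_fun_cmult[of h "-1"] by simp

lemma dirderiv_off_fsupp: "x \<notin> fsupp f \<Longrightarrow> dirderiv v f x = 0"
proof -
  assume "x \<notin> fsupp f"
  then have "dirderiv v f x = dirderiv v (\<lambda>_. 0) x"
    by (intro dirderiv_cong[of "- fsupp f"]) (auto simp: closed_fsupp fsupp_eq_0)
  then show ?thesis by (simp add: dirderiv_eq[OF has_derivative_const])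
qed

lemma test_fun_dirderiv: "test_fun f \<Longrightarrow> b \<in> Basis \<Longrightarrow> test_fun (dirderiv b f)"
  by (rule test_funI[of _ "fsupp f"]) (auto simp: test_fun_def dirderiv_off_fsupp intro: smooth_on_dirderiv)

lemma integrable_compact_supp:
  fixes f :: "'a::euclidean_space \<Rightarrow> complex"
  assumes "continuous_on UNIV f" "compact C" "\<And>x. x \<notin> C \<Longrightarrow> f x = 0"
  shows "integrable lborel f"
proof -
  have "integrable lborel (\<lambda>x. indicator C x *\<^sub>R f x)"
    by (rule borel_integrable_compact[OF assms(2)]) (rule continuous_on_subset[OF assms(1)], simp)
  also have "(\<lambda>x. indicator C x *\<^sub>R f x) = f" using assms(3) by (auto simp: indicator_def)
  finally show ?thesis .
qed

lemma test_fun_integrable: "test_fun f \<Longrightarrow> integrable lborel f"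
  using integrable_compact_supp[of f "fsupp f"] by (auto simp: test_fun_def fsupp_eq_0 smooth_on_continuous)

lemma test_fun_bounded: "test_fun f \<Longrightarrow> \<exists>B. \<forall>x. norm (f x) \<le> B"
proof -
  assume f: "test_fun f"
  then have "compact (f ` fsupp f)"
    by (intro compact_continuous_image continuous_on_subset[OF smooth_on_continuous[OF test_fun_smooth]])
       (auto simp: test_fun_def)
  then obtain B where B: "\<And>x. x \<in> fsupp f \<Longrightarrow> norm (f x) \<le> B"
    using compact_imp_bounded bounded_iff by (metis imageI)
  have "norm (f x) \<le> max B 0" for x
    using B[of x] fsupp_eq_0[of x f] by (cases "x \<in> fsupp f") (simp_all add: le_max_iff_disj)
  then show ?thesis by blast
qed

text \<open>By translation invariance, difference quotients have integral zero.\<close>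

lemma integral_dirderiv:
  assumes f: "test_fun f" and b: "b \<in> Basis"
  shows "(\<integral>x. dirderiv b f x \<partial>lborel) = 0"
proof -
  obtain B where B: "\<And>x. norm (dirderiv b f x) \<le> B"
    using test_fun_bounded[OF test_fun_dirderiv[OF f b]] by blast
  have B0: "0 \<le> B" using B[of 0] norm_ge_zero order_trans by blast
  obtain R where R: "fsupp f \<subseteq> cball 0 R"
    using f compact_imp_bounded[of "fsupp f"] bounded_iff[of "fsupp f"] by (auto simp: test_fun_def subset_eq)
  have df: "(f has_derivative (\<lambda>v. dirderiv v f x)) (at x)" for x
    using has_derivative_dirderiv smooth_on_differentiable[OF test_fun_smooth[OF f]] by blast
  have line: "((\<lambda>t. f (x + t *\<^sub>R b)) has_derivative (\<lambda>s. s *\<^sub>R dirderiv b f (x + t *\<^sub>R b))) (at t)" for x t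
  proof -
    have "((\<lambda>t. f (x + t *\<^sub>R b)) has_derivative (\<lambda>s. dirderiv (s *\<^sub>R b) f (x + t *\<^sub>R b))) (at t)"
      by (rule has_derivative_compose[OF _ df]) (auto intro!: derivative_eq_intros)
    moreover have "dirderiv (s *\<^sub>R b) f (x + t *\<^sub>R b) = s *\<^sub>R dirderiv b f (x + t *\<^sub>R b)" for s
      by (rule linear_scale[OF dirderiv_linear[OF smooth_on_differentiable[OF test_fun_smooth[OF f]]]]) simp
    ultimately show ?thesis by simp
  qed
  \<comment> \<open>The mean value inequality along b bounds all difference quotients by the
    supremum B of the derivative.\<close>
  have lip: "norm (f (x + t *\<^sub>R b) - f x) \<le> B * t" if "t \<ge> 0" for x t
  proof -
    have "norm (f (x + t *\<^sub>R b) - f (x + 0 *\<^sub>R b)) \<le> B * norm (t - 0)"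
    proof (rule differentiable_bound[of "{0..t}" "\<lambda>t. f (x + t *\<^sub>R b)" "\<lambda>t s. s *\<^sub>R dirderiv b f (x + t *\<^sub>R b)"])
      show "onorm (\<lambda>s. s *\<^sub>R dirderiv b f (x + r *\<^sub>R b)) \<le> B" for r
        using B B0 by (intro onorm_bound) (auto intro!: mult_left_mono simp: mult.commute[of B])
    qed (use that line in \<open>auto intro: has_derivative_at_withinI\<close>)
    then show ?thesis using that by simp
  qed
  define F where "F n x = of_nat (Suc n) * (f (x + (1 / Suc n) *\<^sub>R b) - f x)" for n x
  have intF: "(\<integral>x. F n x \<partial>lborel) = 0" for n
  proof -
    have i: "integrable lborel f" by (rule test_fun_integrable[OF f])
    define c where "c = (1 / Suc n) *\<^sub>R b"
    have m: "f \<in> borel_measurable borel" using borel_measurable_integrable[OF i] by simp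
    have "integrable lborel (\<lambda>x. f (c + x))"
      using integrable_distr_eq[of "(+) c" lborel borel f] i m by (simp add: lborel_distr_plus)
    moreover have "(\<integral>x. f (c + x) \<partial>lborel) = (\<integral>x. f x \<partial>lborel)"
      using integral_distr[of "(+) c" lborel borel f] m by (simp add: lborel_distr_plus)
    moreover have "F n = (\<lambda>x. of_nat (Suc n) * (f (c + x) - f x))"
      by (simp add: F_def c_def fun_eq_iff add.commute)
    ultimately show ?thesis using i by (simp del: of_nat_Suc)
  qed
  have "(\<lambda>n. \<integral>x. F n x \<partial>lborel) \<longlonglongrightarrow> (\<integral>x. dirderiv b f x \<partial>lborel)"
  \<comment> \<open>The shifts have length at most 1, so the ball of radius R + 1 contains the
    supports of all difference quotients.\<close>
  proof (rule integral_dominated_convergence[where w = "\<lambda>x. B * indicator (cball 0 (R + 1)) x"])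
    show "dirderiv b f \<in> borel_measurable lborel"
      using test_fun_integrable[OF test_fun_dirderiv[OF f b]] by auto
    have "continuous_on UNIV f" by (rule smooth_on_continuous[OF test_fun_smooth[OF f]])
    then have m: "f \<in> borel_measurable borel" by (rule borel_measurable_continuous_onI)
    show "F n \<in> borel_measurable lborel" for n unfolding F_def using m by simp measurable
    show "integrable lborel (\<lambda>x. B * indicator (cball (0::'a) (R + 1)) x)"
      by (intro integrable_mult_right integrable_real_indicator) (use emeasure_lborel_cball_finite[of "0::'a" "R + 1"] in \<open>auto simp: infinity_ennreal_def\<close>)
    show "AE x in lborel. (\<lambda>n. F n x) \<longlonglongrightarrow> dirderiv b f x"
    proof (rule AE_I2)
      fix x
      have "((\<lambda>h. norm (f (x + h *\<^sub>R b) - f x - h *\<^sub>R dirderiv b f x) / norm h) \<longlongrightarrow> 0) (at 0)"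
        using line[of x 0] by (simp add: has_derivative_iff_norm)
      then have "((\<lambda>h. norm ((f (x + h *\<^sub>R b) - f x) /\<^sub>R h - dirderiv b f x)) \<longlongrightarrow> 0) (at 0)"
      proof (rule Lim_transform_eventually)
        have "norm (z - h *\<^sub>R d) / norm h = norm (z /\<^sub>R h - d)" if "h \<noteq> 0" for h :: real and z d :: complex
        proof -
          have "z /\<^sub>R h - d = (z - h *\<^sub>R d) /\<^sub>R h" using that by (simp add: scaleR_right_diff_distrib)
          then show ?thesis by (simp add: divide_inverse mult.commute)
        qed
        then show "\<forall>\<^sub>F h in at 0. norm (f (x + h *\<^sub>R b) - f x - h *\<^sub>R dirderiv b f x) / norm h =
            norm ((f (x + h *\<^sub>R b) - f x) /\<^sub>R h - dirderiv b f x)"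
          by (auto simp: eventually_at_filter)
      qed
      then have "((\<lambda>h. (f (x + h *\<^sub>R b) - f x) /\<^sub>R h) \<longlongrightarrow> dirderiv b f x) (at 0)"
        using Lim_null tendsto_norm_zero_iff by fast
      moreover have "filterlim (\<lambda>n. 1 / real (Suc n)) (at 0) sequentially"
        using LIMSEQ_inverse_real_of_nat by (simp add: filterlim_at divide_inverse)
      ultimately have "(\<lambda>n. (f (x + (1 / real (Suc n)) *\<^sub>R b) - f x) /\<^sub>R (1 / real (Suc n))) \<longlonglongrightarrow> dirderiv b f x"
        by (rule filterlim_compose)
      then show "(\<lambda>n. F n x) \<longlonglongrightarrow> dirderiv b f x" by (simp add: F_def scaleR_conv_of_real del: of_nat_Suc)
    qed
    show "AE x in lborel. norm (F n x) \<le> B * indicator (cball 0 (R + 1)) x" for n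
    proof (rule AE_I2)
      fix x :: 'a
      show "norm (F n x) \<le> B * indicator (cball 0 (R + 1)) x"
      proof (cases "x \<in> cball 0 (R + 1)")
        case True
        have "norm (F n x) \<le> Suc n * (B * (1 / Suc n))"
          unfolding F_def norm_mult norm_of_nat by (intro mult_left_mono lip) auto
        also have "Suc n * (B * (1 / Suc n)) = B" by (simp del: of_nat_Suc)
        finally show ?thesis using True by simp
      next
        case False
        define c where "c = (1 / Suc n) *\<^sub>R b"
        have "norm c \<le> 1" using b by (simp add: c_def)
        then have "x \<notin> cball 0 R" "x + c \<notin> cball 0 R"
          using False norm_triangle_ineq4[of "x + c" c] by auto
        then have "f x = 0" "f (x + c) = 0" using R fsupp_eq_0 by blast+
        then show ?thesis using B0 by (simp add: F_def c_def)
      qed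
    qed
  qed
  then show ?thesis by (simp add: intF LIMSEQ_const_iff)
qed

text \<open>The product h f is a test function although h is smooth only near the support of f, so
  its derivative has integral zero. Off U both sides of the Leibniz rule vanish.\<close>

lemma integral_by_parts:
  assumes "test_fun f" "b \<in> Basis" "smooth_on U h" "open U" "fsupp f \<subseteq> U"
  shows "(\<integral>x. h x * dirderiv b f x \<partial>lborel) = - (\<integral>x. dirderiv b h x * f x \<partial>lborel)"
proof -
  have 1: "test_fun (\<lambda>x. h x * f x)" by (rule test_fun_mult_smooth[OF assms(1,4,5,3)])
  have fs: "fsupp (dirderiv b f) \<subseteq> U"
    using fsupp_subset[OF closed_fsupp, of f "dirderiv b f"] dirderiv_off_fsupp assms(5) by blast
  have 2: "test_fun (\<lambda>x. h x * dirderiv b f x)"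
    by (rule test_fun_mult_smooth[OF test_fun_dirderiv[OF assms(1,2)] assms(4) fs assms(3)])
  have 3: "test_fun (\<lambda>x. dirderiv b h x * f x)"
    by (rule test_fun_mult_smooth[OF assms(1,4,5) smooth_on_dirderiv[OF assms(3,2)]])
  have "dirderiv b (\<lambda>x. h x * f x) x = h x * dirderiv b f x + dirderiv b h x * f x" for x
  proof (cases "x \<in> U")
    case True
    then show ?thesis using assms
      by (intro dirderiv_bilinear[OF bounded_bilinear_mult] smooth_on_differentiable[of U] smooth_on_differentiable[of UNIV])
         (auto simp: test_fun_def)
  next
    case False
    then have "x \<notin> fsupp f" using assms by blast
    moreover have "x \<notin> fsupp (\<lambda>x. h x * f x)"
      using calculation fsupp_subset[OF closed_fsupp, of f "\<lambda>x. h x * f x"] fsupp_eq_0[of _ f] by auto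
    ultimately show ?thesis by (simp add: dirderiv_off_fsupp fsupp_eq_0)
  qed
  then have "0 = (\<integral>x. h x * dirderiv b f x + dirderiv b h x * f x \<partial>lborel)"
    using integral_dirderiv[OF 1 assms(2)] by simp
  then show ?thesis using test_fun_integrable[OF 2] test_fun_integrable[OF 3]
    by (simp add: eq_neg_iff_add_eq_0)
qed

text \<open>The fundamental lemma of the calculus of variations. Testing against
  \<open>cnj h\<close> times a bump makes the integrand continuous, nonnegative and positive at x if
  h x is nonzero, which contradicts a vanishing integral.\<close>

lemma smooth_orthogonal_eq_0:
  assumes U: "open U" "smooth_on U h" and x: "x \<in> U"
    and orth: "\<And>\<phi>. test_fun \<phi> \<Longrightarrow> fsupp \<phi> \<subseteq> U \<Longrightarrow> (\<integral>x. h x * \<phi> x \<partial>lborel) = 0"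
  shows "h x = 0"
proof (rule ccontr)
  assume hx: "h x \<noteq> 0"
  obtain e where e: "e > 0" "cball x e \<subseteq> U" using U(1) x open_contains_cball by blast
  define \<beta> where "\<beta> = bump x (e / 2)"
  have fs: "fsupp \<beta> \<subseteq> U" using fsupp_bump[of "e / 2" x] e by (auto simp: \<beta>_def)
  have tb: "test_fun \<beta>" using e by (simp add: \<beta>_def test_bump)
  have cj: "smooth_on U (\<lambda>x. cnj (h x))" by (rule smooth_on_bounded_linear[OF U(1) bounded_linear_cnj U(2)])
  let ?\<phi> = "\<lambda>x. cnj (h x) * \<beta> x"
  have t\<phi>: "test_fun ?\<phi>" by (rule test_fun_mult_smooth[OF tb U(1) fs cj])
  have fs\<phi>: "fsupp ?\<phi> \<subseteq> U"
    using fsupp_subset[OF closed_fsupp, of \<beta> ?\<phi>] fsupp_eq_0[of _ \<beta>] fs by auto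
  have t: "test_fun (\<lambda>x. h x * ?\<phi> x)" by (rule test_fun_mult_smooth[OF t\<phi> U(1) fs\<phi> U(2)])
  define k where "k z = Re (h z * ?\<phi> z)" for z
  have k: "k z = (norm (h z))\<^sup>2 * step (2 - (norm (z - x))\<^sup>2 / (e / 2)\<^sup>2)" for z
    by (simp add: k_def \<beta>_def bump_def complex_mult_cnj cmod_power2 flip: mult.assoc)
  have ck: "continuous_on UNIV k" unfolding k_def
    by (intro continuous_on_Re smooth_on_continuous test_fun_smooth t)
  have ik: "integrable lborel k" unfolding k_def by (intro integrable_Re test_fun_integrable t)
  have "(\<integral>z. k z \<partial>lborel) = Re (\<integral>z. h z * ?\<phi> z \<partial>lborel)"
    unfolding k_def using test_fun_integrable[OF t] by (rule integral_Re)
  then have "(\<integral>z. k z \<partial>lborel) = 0" using orth[OF t\<phi> fs\<phi>] by simp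
  moreover have "0 \<le> k z" for z by (simp add: k step_bounds)
  ultimately have "AE z in lborel. k z = 0"
    using integral_nonneg_eq_0_iff_AE[OF ik] by simp
  have "k x > 0" using hx by (simp add: k step_1)
  then have "\<forall>\<^sub>F z in nhds x. k z > 0"
    using ck by (intro order_tendstoD(1)[of k "k x"]) (auto simp: continuous_on_eq_continuous_at continuous_at tendsto_nhds_iff)
  then obtain d where d: "d > 0" "\<And>z. dist z x < d \<Longrightarrow> k z > 0" unfolding eventually_nhds_metric by blast
  have "ball x d \<subseteq> {z. k z \<noteq> 0}"
  proof
    fix z assume "z \<in> ball x d"
    then show "z \<in> {z. k z \<noteq> 0}" using d(2)[of z] by (simp add: dist_commute)
  qed
  then have "emeasure lborel (ball x d) \<le> emeasure lborel ({} :: 'a set)"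
    using \<open>AE z in lborel. k z = 0\<close> by (intro emeasure_mono_AE) (auto elim!: eventually_mono)
  then show False using content_ball_pos[OF d(1), of x] by (simp add: measure_def)
qed

section \<open>Distributions as limits of functions\<close>

text \<open>The restriction to an open set U is there for differences such as u minus the functional
  given by a representative, which are linear only where the representative can be integrated
  against test functions.\<close>

definition linear_on_tests :: "'a set \<Rightarrow> 'a::euclidean_space dist \<Rightarrow> bool" where
  "linear_on_tests U u \<longleftrightarrow> (\<forall>\<phi> \<psi> c. test_fun \<phi> \<longrightarrow> test_fun \<psi> \<longrightarrow> fsupp \<phi> \<subseteq> U \<longrightarrow> fsupp \<psi> \<subseteq> U \<longrightarrow>
     u (\<lambda>x. \<phi> x + c * \<psi> x) = u \<phi> + c * u \<psi>)"

lemma linear_on_testsD: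
  "linear_on_tests U u \<Longrightarrow> test_fun \<phi> \<Longrightarrow> test_fun \<psi> \<Longrightarrow> fsupp \<phi> \<subseteq> U \<Longrightarrow> fsupp \<psi> \<subseteq> U \<Longrightarrow>
     u (\<lambda>x. \<phi> x + c * \<psi> x) = u \<phi> + c * u \<psi>"
  unfolding linear_on_tests_def by blast

lemma linear_on_tests_diff:
  "linear_on_tests U u \<Longrightarrow> test_fun \<phi> \<Longrightarrow> test_fun \<psi> \<Longrightarrow> fsupp \<phi> \<subseteq> U \<Longrightarrow> fsupp \<psi> \<subseteq> U \<Longrightarrow>
     u (\<lambda>x. \<phi> x - \<psi> x) = u \<phi> - u \<psi>"
  using linear_on_testsD[of U u \<phi> \<psi> "-1"] by simp

lemma fsupp_0: "fsupp (\<lambda>_. 0) = {}"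
  by (simp add: fsupp_def)

lemma linear_on_tests_0: "linear_on_tests U u \<Longrightarrow> u (\<lambda>_. 0) = 0"
  using linear_on_testsD[of U u "\<lambda>_. 0" "\<lambda>_. 0" "-1"] by (simp add: test_fun_0 fsupp_0)

lemma fsupp_mult: "fsupp (\<lambda>x. h x * f x) \<subseteq> fsupp f" "fsupp (\<lambda>x. h x * f x) \<subseteq> fsupp h"
  for f h :: "'a::topological_space \<Rightarrow> complex"
  by (rule fsupp_subset[OF closed_fsupp], simp add: fsupp_eq_0)+

text \<open>In place of a partition of unity, \<phi> is multiplied by the factors 1 - bump one at a
  time. Each factor changes the value of u by its value on a test function with small support, hence
  by 0, and after finitely many factors nothing of \<phi> is left.\<close>

lemma tests_locality:
  assumes lin: "linear_on_tests U u" and \<phi>: "test_fun \<phi>" "fsupp \<phi> \<subseteq> U"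
    and loc: "\<And>x. x \<in> fsupp \<phi> \<Longrightarrow> \<exists>V. open V \<and> x \<in> V \<and> (\<forall>\<psi>. test_fun \<psi> \<longrightarrow> fsupp \<psi> \<subseteq> V \<inter> fsupp \<phi> \<longrightarrow> u \<psi> = 0)"
  shows "u \<phi> = 0"
proof -
  have "\<exists>r>0. \<forall>\<psi>. test_fun \<psi> \<longrightarrow> fsupp \<psi> \<subseteq> cball x (2 * r) \<inter> fsupp \<phi> \<longrightarrow> u \<psi> = 0" if x: "x \<in> fsupp \<phi>" for x
  proof -
    obtain V where V: "open V" "x \<in> V" "\<forall>\<psi>. test_fun \<psi> \<longrightarrow> fsupp \<psi> \<subseteq> V \<inter> fsupp \<phi> \<longrightarrow> u \<psi> = 0"
      using loc[OF x] by blast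
    obtain e where "e > 0" "cball x e \<subseteq> V" using V open_contains_cball by blast
    then show ?thesis using V(3) by (intro exI[of _ "e / 2"]) auto
  qed
  then obtain r where r: "\<And>x. x \<in> fsupp \<phi> \<Longrightarrow> r x > 0"
    "\<And>x \<psi>. x \<in> fsupp \<phi> \<Longrightarrow> test_fun \<psi> \<Longrightarrow> fsupp \<psi> \<subseteq> cball x (2 * r x) \<inter> fsupp \<phi> \<Longrightarrow> u \<psi> = 0"
    by metis
  have "compact (fsupp \<phi>)" using \<phi> by (simp add: test_fun_def)
  moreover have "fsupp \<phi> \<subseteq> (\<Union>x\<in>fsupp \<phi>. ball x (r x))" using r(1) by force
  ultimately obtain I where I: "I \<subseteq> fsupp \<phi>" "finite I" "fsupp \<phi> \<subseteq> (\<Union>x\<in>I. ball x (r x))"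
    using compactE_image[of "fsupp \<phi>" "fsupp \<phi>" "\<lambda>x. ball x (r x)"] by (metis open_ball)
  define p where "p J x = (\<Prod>i\<in>J. 1 - bump i (r i) x)" for J x
  have tp: "test_fun (\<lambda>x. p J x * \<phi> x)" for J
    unfolding p_def by (intro test_fun_mult \<phi> smooth_on_prod smooth_on_diff smooth_on_const smooth_bump open_UNIV)
  have claim: "u (\<lambda>x. p J x * \<phi> x) = u \<phi>" if "finite J" "J \<subseteq> fsupp \<phi>" for J
    using that
  proof (induction J rule: finite_induct)
    case (insert i J)
    let ?\<chi> = "\<lambda>x. p J x * \<phi> x"
    have b: "test_fun (\<lambda>x. bump i (r i) x * ?\<chi> x)" by (rule test_fun_mult[OF tp smooth_bump])
    have i: "i \<in> fsupp \<phi>" "r i > 0" using insert r(1) by auto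
    have "fsupp (\<lambda>x. bump i (r i) x * ?\<chi> x) \<subseteq> cball i (2 * r i) \<inter> fsupp \<phi>"
      using fsupp_mult[where h = "bump i (r i)" and f = ?\<chi>] fsupp_mult(1)[of "p J" \<phi>] fsupp_bump[OF i(2), of i] by blast
    then have 0: "u (\<lambda>x. bump i (r i) x * ?\<chi> x) = 0" by (rule r(2)[OF i(1) b])
    have "(\<lambda>x. p (insert i J) x * \<phi> x) = (\<lambda>x. ?\<chi> x - bump i (r i) x * ?\<chi> x)"
      using insert by (simp add: p_def algebra_simps)
    then have "u (\<lambda>x. p (insert i J) x * \<phi> x) = u ?\<chi> - u (\<lambda>x. bump i (r i) x * ?\<chi> x)"
    proof (simp only:, intro linear_on_tests_diff[OF lin tp b])
      show "fsupp ?\<chi> \<subseteq> U" using fsupp_mult(1)[of "p J" \<phi>] \<phi>(2) by blast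
      then show "fsupp (\<lambda>x. bump i (r i) x * ?\<chi> x) \<subseteq> U"
        using fsupp_mult(1)[of "bump i (r i)" ?\<chi>] by blast
    qed
    then show ?case using 0 insert by simp
  qed (simp add: p_def)
  have zero: "(\<lambda>x. p I x * \<phi> x) = (\<lambda>_. 0)"
  proof
    fix x
    show "p I x * \<phi> x = 0"
    proof (cases "x \<in> fsupp \<phi>")
      case True
      then obtain i where "i \<in> I" "x \<in> ball i (r i)" using I by blast
      then have "bump i (r i) x = 1" using I r(1) by (intro bump_1) auto
      then show ?thesis using \<open>i \<in> I\<close> I(2) by (auto simp: p_def)
    qed (simp add: fsupp_eq_0)
  qed
  show ?thesis using claim[OF I(2,1)] linear_on_tests_0[OF lin] by (simp add: zero)
qed

text \<open>One minus the product of finitely many factors 1 - bump equals 1 as soon as one of the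
  bumps does, so no normalisation of their sum is involved.\<close>

lemma smooth_urysohn:
  assumes "compact P" "open \<Omega>" "P \<subseteq> \<Omega>"
  obtains \<eta> :: "'a::euclidean_space \<Rightarrow> complex" and W
  where "test_fun \<eta>" "fsupp \<eta> \<subseteq> \<Omega>" "open W" "P \<subseteq> W" "\<forall>x\<in>W. \<eta> x = 1"
proof -
  have "\<exists>r>0. cball x (2 * r) \<subseteq> \<Omega>" if x: "x \<in> P" for x
  proof -
    obtain e where "e > 0" "cball x e \<subseteq> \<Omega>" using assms x open_contains_cball by blast
    then show ?thesis by (intro exI[of _ "e / 2"]) auto
  qed
  then obtain r where r: "\<And>x. x \<in> P \<Longrightarrow> r x > 0" "\<And>x. x \<in> P \<Longrightarrow> cball x (2 * r x) \<subseteq> \<Omega>" by metis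
  have "P \<subseteq> (\<Union>x\<in>P. ball x (r x))" using r(1) by force
  then obtain I where I: "I \<subseteq> P" "finite I" "P \<subseteq> (\<Union>x\<in>I. ball x (r x))"
    using compactE_image[OF assms(1), of P "\<lambda>x. ball x (r x)"] by (metis open_ball)
  define \<eta> where "\<eta> x = 1 - (\<Prod>i\<in>I. 1 - bump i (r i) x)" for x
  have s: "smooth_on UNIV \<eta>" unfolding \<eta>_def
    by (intro smooth_on_prod smooth_on_diff smooth_on_const smooth_bump open_UNIV)
  have C: "compact (\<Union>i\<in>I. cball i (2 * r i))" using I by (intro compact_UN) auto
  have 0: "\<eta> x = 0" if "x \<notin> (\<Union>i\<in>I. cball i (2 * r i))" for x
  proof -
    have "bump i (r i) x = 0" if "i \<in> I" for i
      using that I r(1)[of i] \<open>x \<notin> (\<Union>i\<in>I. cball i (2 * r i))\<close> by (intro bump_0) (auto simp: subset_eq)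
    then show ?thesis by (simp add: \<eta>_def)
  qed
  show thesis
  proof
    show "test_fun \<eta>" by (rule test_funI[OF s C 0])
    have "fsupp \<eta> \<subseteq> (\<Union>i\<in>I. cball i (2 * r i))" by (rule fsupp_subset[OF compact_imp_closed[OF C] 0])
    also have "\<dots> \<subseteq> \<Omega>" using r(2) I(1) by blast
    finally show "fsupp \<eta> \<subseteq> \<Omega>" .
    show "open (\<Union>x\<in>I. ball x (r x))" by auto
    show "P \<subseteq> (\<Union>x\<in>I. ball x (r x))" by (rule I)
    show "\<forall>x\<in>\<Union>x\<in>I. ball x (r x). \<eta> x = 1"
    proof
      fix x assume "x \<in> (\<Union>x\<in>I. ball x (r x))"
      then obtain i where i: "i \<in> I" "x \<in> ball i (r i)" by blast
      then have "bump i (r i) x = 1" using I r(1) by (intro bump_1) auto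
      then show "\<eta> x = 1" using i(1) I(2) by (auto simp: \<eta>_def)
    qed
  qed
qed

text \<open>Every distribution of the theorem arises as such a limit, which turns products and integrals into
  limits of ordinary integrals.\<close>

definition approx :: "'a set \<Rightarrow> (real \<Rightarrow> 'a \<Rightarrow> complex) \<Rightarrow> 'a::euclidean_space dist \<Rightarrow> bool" where
  "approx P w u \<longleftrightarrow> (\<forall>\<epsilon>>0. \<forall>x. x \<notin> P \<longrightarrow> w \<epsilon> x = 0) \<and>
    (\<forall>\<phi>. test_fun \<phi> \<longrightarrow> (\<forall>\<^sub>F \<epsilon> in at_right 0. integrable lborel (\<lambda>x. w \<epsilon> x * \<phi> x)) \<and>
      ((\<lambda>\<epsilon>. \<integral>x. w \<epsilon> x * \<phi> x \<partial>lborel) \<longlongrightarrow> u \<phi>) (at_right 0))"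

lemma eventually_right_pos: "\<forall>\<^sub>F \<epsilon> in at_right (0::real). 0 < \<epsilon>"
  by (rule eventually_at_right_less)

lemma approxD:
  assumes "approx P w u"
  shows "\<epsilon> > 0 \<Longrightarrow> x \<notin> P \<Longrightarrow> w \<epsilon> x = 0"
    and "test_fun \<phi> \<Longrightarrow> \<forall>\<^sub>F \<epsilon> in at_right 0. integrable lborel (\<lambda>x. w \<epsilon> x * \<phi> x)"
    and "test_fun \<phi> \<Longrightarrow> ((\<lambda>\<epsilon>. \<integral>x. w \<epsilon> x * \<phi> x \<partial>lborel) \<longlongrightarrow> u \<phi>) (at_right 0)"
  using assms unfolding approx_def by blast+

lemma approx_linear:
  assumes a: "approx P w u" shows "linear_on_tests U u"
  unfolding linear_on_tests_def
proof (intro allI impI)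
  fix \<phi> \<psi> :: "'a \<Rightarrow> complex" and c assume t: "test_fun \<phi>" "test_fun \<psi>"
  have "\<forall>\<^sub>F \<epsilon> in at_right 0. (\<integral>x. w \<epsilon> x * \<phi> x \<partial>lborel) + c * (\<integral>x. w \<epsilon> x * \<psi> x \<partial>lborel) =
      (\<integral>x. w \<epsilon> x * (\<phi> x + c * \<psi> x) \<partial>lborel)"
    using approxD(2)[OF a t(1)] approxD(2)[OF a t(2)]
  proof eventually_elim
    case (elim \<epsilon>)
    then have "(\<integral>x. w \<epsilon> x * \<phi> x + c * (w \<epsilon> x * \<psi> x) \<partial>lborel) = (\<integral>x. w \<epsilon> x * \<phi> x \<partial>lborel) + c * (\<integral>x. w \<epsilon> x * \<psi> x \<partial>lborel)"
      by simp
    then show ?case by (simp add: algebra_simps)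
  qed
  moreover have "((\<lambda>\<epsilon>. (\<integral>x. w \<epsilon> x * \<phi> x \<partial>lborel) + c * (\<integral>x. w \<epsilon> x * \<psi> x \<partial>lborel)) \<longlongrightarrow> u \<phi> + c * u \<psi>) (at_right 0)"
    by (intro tendsto_intros approxD[OF a] t)
  ultimately have "((\<lambda>\<epsilon>. \<integral>x. w \<epsilon> x * (\<phi> x + c * \<psi> x) \<partial>lborel) \<longlongrightarrow> u \<phi> + c * u \<psi>) (at_right 0)"
    by (rule Lim_transform_eventually[rotated])
  moreover have "((\<lambda>\<epsilon>. \<integral>x. w \<epsilon> x * (\<phi> x + c * \<psi> x) \<partial>lborel) \<longlongrightarrow> u (\<lambda>x. \<phi> x + c * \<psi> x)) (at_right 0)"
    by (rule approxD(3)[OF a]) (intro test_fun_add test_fun_cmult t)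
  ultimately have "u \<phi> + c * u \<psi> = u (\<lambda>x. \<phi> x + c * \<psi> x)"
    by (rule tendsto_unique[OF trivial_limit_at_right_real])
  then show "u (\<lambda>x. \<phi> x + c * \<psi> x) = u \<phi> + c * u \<psi>" by simp
qed

lemma approx_off_support:
  assumes a: "approx P w u" and \<phi>: "test_fun \<phi>" "fsupp \<phi> \<inter> P = {}"
  shows "u \<phi> = 0"
proof -
  have *: "w \<epsilon> x * \<phi> x = 0" if "\<epsilon> > 0" for \<epsilon> x
    using approxD(1)[OF a that, of x] fsupp_eq_0[of x \<phi>] \<phi>(2) by auto
  have "\<forall>\<^sub>F \<epsilon> in at_right 0. (\<integral>x. w \<epsilon> x * \<phi> x \<partial>lborel) = 0"
    by (rule eventually_mono[OF eventually_right_pos]) (simp add: *)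
  then have "((\<lambda>\<epsilon>. \<integral>x. w \<epsilon> x * \<phi> x \<partial>lborel) \<longlongrightarrow> 0) (at_right 0)" by (rule tendsto_eventually)
  then show ?thesis by (rule tendsto_unique[OF trivial_limit_at_right_real approxD(3)[OF a \<phi>(1)]])
qed

lemma approx_0: "approx P (\<lambda>_ _. 0) (\<lambda>_. 0)"
  unfolding approx_def by simp

lemma approx_add_cmult:
  assumes "approx P w u" "approx P w' u'"
  shows "approx P (\<lambda>\<epsilon> x. w \<epsilon> x + c * w' \<epsilon> x) (\<lambda>\<phi>. u \<phi> + c * u' \<phi>)"
  unfolding approx_def
proof (intro conjI allI impI)
  fix \<phi> :: "'a \<Rightarrow> complex" assume t: "test_fun \<phi>"
  note i = approxD(2)[OF assms(1) t] approxD(2)[OF assms(2) t]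
  show "\<forall>\<^sub>F \<epsilon> in at_right 0. integrable lborel (\<lambda>x. (w \<epsilon> x + c * w' \<epsilon> x) * \<phi> x)"
    using i by eventually_elim (simp add: distrib_right mult.assoc)
  have "\<forall>\<^sub>F \<epsilon> in at_right 0. (\<integral>x. w \<epsilon> x * \<phi> x \<partial>lborel) + c * (\<integral>x. w' \<epsilon> x * \<phi> x \<partial>lborel) =
      (\<integral>x. (w \<epsilon> x + c * w' \<epsilon> x) * \<phi> x \<partial>lborel)"
    using i by eventually_elim (simp add: distrib_right mult.assoc)
  then show "((\<lambda>\<epsilon>. \<integral>x. (w \<epsilon> x + c * w' \<epsilon> x) * \<phi> x \<partial>lborel) \<longlongrightarrow> u \<phi> + c * u' \<phi>) (at_right 0)"
    by (rule Lim_transform_eventually[rotated]) (intro tendsto_intros approxD[OF assms(1)] approxD[OF assms(2)] t)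
qed (simp add: approxD(1)[OF assms(1)] approxD(1)[OF assms(2)])

lemma approx_sum:
  "(\<And>i. i \<in> I \<Longrightarrow> approx P (w i) (u i)) \<Longrightarrow> approx P (\<lambda>\<epsilon> x. \<Sum>i\<in>I. c i * w i \<epsilon> x) (\<lambda>\<phi>. \<Sum>i\<in>I. c i * u i \<phi>)"
proof (induction I rule: infinite_finite_induct)
  case (insert i I)
  then show ?case
    using approx_add_cmult[of P "\<lambda>\<epsilon> x. \<Sum>i\<in>I. c i * w i \<epsilon> x" "\<lambda>\<phi>. \<Sum>i\<in>I. c i * u i \<phi>" "w i" "u i" "c i"]
    by (simp add: add.commute)
qed (simp_all add: approx_0)

lemma approx_smooth_mult:
  assumes "approx P w u" "smooth_on UNIV h"
  shows "approx P (\<lambda>\<epsilon> x. w \<epsilon> x * h x) (\<lambda>\<phi>. u (\<lambda>x. h x * \<phi> x))"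
  unfolding approx_def
  using approxD(1)[OF assms(1)] approxD(2,3)[OF assms(1) test_fun_mult[OF _ assms(2)]]
  by (simp add: mult.assoc)

text \<open>The complement of the support is a union of open sets on each of which u vanishes;
  passing to the union is the content of \<open>tests_locality\<close>.\<close>

lemma dsupp_off:
  assumes "linear_on_tests UNIV u" "test_fun \<phi>" "fsupp \<phi> \<inter> dsupp u = {}"
  shows "u \<phi> = 0"
proof (rule tests_locality[OF assms(1,2)])
  fix x assume "x \<in> fsupp \<phi>"
  then have "x \<notin> dsupp u" using assms(3) by blast
  then obtain U where "open U" "x \<in> U" "\<forall>\<phi>. test_fun \<phi> \<and> fsupp \<phi> \<subseteq> U \<longrightarrow> u \<phi> = 0"
    unfolding dsupp_def by blast
  then show "\<exists>V. open V \<and> x \<in> V \<and> (\<forall>\<psi>. test_fun \<psi> \<longrightarrow> fsupp \<psi> \<subseteq> V \<inter> fsupp \<phi> \<longrightarrow> u \<psi> = 0)"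
    by (meson Int_subset_iff)
qed simp

text \<open>Two admissible cutoffs agree near the support of u, so the value in the definite
  description does not depend on the cutoff. For a cutoff that is 1 on P it disappears under the
  integral, since the approximants vanish off P.\<close>

lemma dpair_approx:
  assumes a: "approx P w u" and P: "compact P" "P \<subseteq> \<Omega>" "open \<Omega>" and f: "smooth_on \<Omega> f"
  shows "((\<lambda>\<epsilon>. \<integral>x. w \<epsilon> x * f x \<partial>lborel) \<longlongrightarrow> dpair u f) (at_right 0)"
proof -
  note lin = approx_linear[OF a, of UNIV]
  obtain \<eta> W where \<eta>: "test_fun \<eta>" "fsupp \<eta> \<subseteq> \<Omega>" "open W" "P \<subseteq> W" "\<forall>x\<in>W. \<eta> x = 1"
    using smooth_urysohn[OF P(1,3,2)] by blast
  have "open (- P) \<and> (\<forall>\<phi>. test_fun \<phi> \<and> fsupp \<phi> \<subseteq> - P \<longrightarrow> u \<phi> = 0)"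
    using approx_off_support[OF a] compact_imp_closed[OF P(1)] by (auto simp: disjoint_eq_subset_Compl)
  then have "dsupp u \<subseteq> P" unfolding dsupp_def by blast
  then have W: "dsupp u \<subseteq> W" using \<eta>(4) by blast
  have t: "test_fun (\<lambda>x. \<eta> x * f x)" if "test_fun \<eta>" "fsupp \<eta> \<subseteq> U" "open U" "smooth_on U f" for \<eta> U
    using test_fun_mult_smooth[OF that(1,3,2,4)] by (simp add: mult.commute)
  have "dpair u f = u (\<lambda>x. \<eta> x * f x)"
    unfolding dpair_def
  proof (rule the_equality)
    show "\<exists>\<eta>' U. open U \<and> smooth_on U f \<and> test_fun \<eta>' \<and> fsupp \<eta>' \<subseteq> U \<and>
        (\<exists>W. open W \<and> dsupp u \<subseteq> W \<and> (\<forall>x\<in>W. \<eta>' x = 1)) \<and> u (\<lambda>x. \<eta> x * f x) = u (\<lambda>x. \<eta>' x * f x)"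
      using \<eta> W P(3) f by blast
  next
    fix l
    assume "\<exists>\<eta>' U. open U \<and> smooth_on U f \<and> test_fun \<eta>' \<and> fsupp \<eta>' \<subseteq> U \<and>
        (\<exists>W. open W \<and> dsupp u \<subseteq> W \<and> (\<forall>x\<in>W. \<eta>' x = 1)) \<and> l = u (\<lambda>x. \<eta>' x * f x)"
    then obtain \<eta>' U W' where *: "open U" "smooth_on U f" "test_fun \<eta>'" "fsupp \<eta>' \<subseteq> U"
      "open W'" "dsupp u \<subseteq> W'" "\<forall>x\<in>W'. \<eta>' x = 1" and l: "l = u (\<lambda>x. \<eta>' x * f x)" by blast
    note t1 = t[OF \<eta>(1,2) P(3) f] and t2 = t[OF *(3,4,1,2)]
    have "fsupp (\<lambda>x. \<eta> x * f x - \<eta>' x * f x) \<subseteq> - (W \<inter> W')"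
      by (rule fsupp_subset) (use \<eta>(3,5) *(5,7) in auto)
    then have "fsupp (\<lambda>x. \<eta> x * f x - \<eta>' x * f x) \<inter> dsupp u = {}" using W *(6) by blast
    then have "u (\<lambda>x. \<eta> x * f x - \<eta>' x * f x) = 0"
      by (rule dsupp_off[OF lin test_fun_diff[OF t1 t2]])
    then show "l = u (\<lambda>x. \<eta> x * f x)" using linear_on_tests_diff[OF lin t1 t2] l by simp
  qed
  moreover have "((\<lambda>\<epsilon>. \<integral>x. w \<epsilon> x * f x \<partial>lborel) \<longlongrightarrow> u (\<lambda>x. \<eta> x * f x)) (at_right 0)"
  proof (rule Lim_transform_eventually[OF approxD(3)[OF a t[OF \<eta>(1,2) P(3) f]]])
    show "\<forall>\<^sub>F \<epsilon> in at_right 0. (\<integral>x. w \<epsilon> x * (\<eta> x * f x) \<partial>lborel) = (\<integral>x. w \<epsilon> x * f x \<partial>lborel)"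
      using eventually_right_pos
    proof eventually_elim
      case (elim \<epsilon>)
      have "w \<epsilon> x * (\<eta> x * f x) = w \<epsilon> x * f x" for x
        using approxD(1)[OF a elim, of x] \<eta>(4,5) by (cases "x \<in> P") auto
      then show ?case by (simp only:)
    qed
  qed
  ultimately show ?thesis by simp
qed

section \<open>Products of distributions\<close>

lemma regular_cong: "(\<And>x. x \<in> fsupp \<phi> \<Longrightarrow> a x = b x) \<Longrightarrow> regular a \<phi> = regular b \<phi>"
  unfolding regular_def by (rule Bochner_Integration.integral_cong[OF HOL.refl]) (metis fsupp_eq_0 mult_zero_right)

lemma representsD: "represents U a u \<Longrightarrow> test_fun \<phi> \<Longrightarrow> fsupp \<phi> \<subseteq> U \<Longrightarrow> u \<phi> = regular a \<phi>"
  by (simp add: represents_def)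

lemma represents_unique:
  assumes U: "open U" "represents U a u" and V: "open V" "represents V b u" and x: "x \<in> U" "x \<in> V"
  shows "a x = b x"
proof -
  have s: "smooth_on (U \<inter> V) a" "smooth_on (U \<inter> V) b"
    using U V unfolding represents_def by (auto intro: smooth_on_subset)
  have "a x - b x = 0"
  proof (rule smooth_orthogonal_eq_0[of "U \<inter> V" "\<lambda>x. a x - b x"])
    show "smooth_on (U \<inter> V) (\<lambda>x. a x - b x)" using s U V by (intro smooth_on_diff) auto
    fix \<phi> assume \<phi>: "test_fun \<phi>" "fsupp \<phi> \<subseteq> U \<inter> V"
    have "integrable lborel (\<lambda>x. a x * \<phi> x)" "integrable lborel (\<lambda>x. b x * \<phi> x)"
      using \<phi> s U V by (auto intro!: test_fun_integrable test_fun_mult_smooth[of _ "U \<inter> V"])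
    then have "(\<integral>x. (a x - b x) * \<phi> x \<partial>lborel) = regular a \<phi> - regular b \<phi>"
      by (simp add: regular_def left_diff_distrib)
    also have "\<dots> = 0" using representsD[OF U(2), of \<phi>] representsD[OF V(2), of \<phi>] \<phi> by simp
    finally show "(\<integral>x. (a x - b x) * \<phi> x \<partial>lborel) = 0" .
  qed (use U V x in auto)
  then show ?thesis by simp
qed

lemma closed_sing_supp: "closed (sing_supp u)"
  unfolding sing_supp_def closed_def by auto

lemma sing_supp_subset: "closed \<Gamma> \<Longrightarrow> represents (- \<Gamma>) a u \<Longrightarrow> sing_supp u \<subseteq> \<Gamma>"
  unfolding sing_supp_def closed_def by blast

text \<open>The definition of the singular support provides only local representatives. By
  uniqueness they agree on overlaps and glue to one function, and by locality this function
  represents u on the whole complement.\<close>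

lemma represents_off_sing_supp:
  assumes lin: "linear_on_tests UNIV u"
  shows "\<exists>a. represents (- sing_supp u) a u"
proof -
  let ?S = "- sing_supp u"
  have "\<exists>U f. open U \<and> x \<in> U \<and> represents U f u" if "x \<in> ?S" for x
    using that unfolding sing_supp_def by blast
  then obtain U f where U: "\<And>x. x \<in> ?S \<Longrightarrow> open (U x)" "\<And>x. x \<in> ?S \<Longrightarrow> x \<in> U x"
    "\<And>x. x \<in> ?S \<Longrightarrow> represents (U x) (f x) u" by metis
  have US: "U x \<subseteq> ?S" if "x \<in> ?S" for x
    using U[OF that] unfolding sing_supp_def by blast
  \<comment> \<open>The representative chosen at z is evaluated at z itself; overlap agreement makes
    this equal to any other local representative there.\<close>
  define a where "a z = f z z" for z
  have a: "a z = f x z" if "x \<in> ?S" "z \<in> U x" for x z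
  proof -
    have "z \<in> ?S" using US that by blast
    then show ?thesis unfolding a_def using represents_unique[OF U(1,3) U(1,3)] U(2) that by blast
  qed
  have s: "smooth_on ?S a"
  proof (rule smooth_on_locally)
    fix x assume x: "x \<in> ?S"
    have "smooth_on (U x) a"
      by (rule smooth_on_cong[of _ "f x"]) (use U[OF x] a[OF x] in \<open>auto simp: represents_def\<close>)
    then show "\<exists>V. x \<in> V \<and> smooth_on V a" using U(2)[OF x] by blast
  qed
  have oS: "open ?S" using closed_sing_supp by blast
  have "represents ?S a u"
    unfolding represents_def
  proof (intro conjI allI impI s)
    fix \<phi> assume \<phi>: "test_fun \<phi> \<and> fsupp \<phi> \<subseteq> ?S"
    define D where "D \<psi> = u \<psi> - regular a \<psi>" for \<psi>
    have int: "integrable lborel (\<lambda>x. a x * \<psi> x)" if "test_fun \<psi>" "fsupp \<psi> \<subseteq> ?S" for \<psi>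
      by (rule test_fun_integrable[OF test_fun_mult_smooth[OF that(1) oS that(2) s]])
    have "linear_on_tests ?S D"
      unfolding linear_on_tests_def
    proof (intro allI impI)
      fix \<phi> \<psi> :: "'a \<Rightarrow> complex" and c assume t: "test_fun \<phi>" "test_fun \<psi>" "fsupp \<phi> \<subseteq> ?S" "fsupp \<psi> \<subseteq> ?S"
      have "regular a (\<lambda>x. \<phi> x + c * \<psi> x) = (\<integral>x. a x * \<phi> x + c * (a x * \<psi> x) \<partial>lborel)"
        by (simp add: regular_def algebra_simps)
      also have "\<dots> = regular a \<phi> + c * regular a \<psi>"
        using int t by (simp add: regular_def)
      finally show "D (\<lambda>x. \<phi> x + c * \<psi> x) = D \<phi> + c * D \<psi>"
        using linear_on_testsD[OF lin t(1,2), of c] by (simp add: D_def algebra_simps)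
    qed
    then have "D \<phi> = 0"
    proof (rule tests_locality)
      fix x assume "x \<in> fsupp \<phi>"
      then have x: "x \<in> ?S" using \<phi> by blast
      have "D \<psi> = 0" if "test_fun \<psi>" "fsupp \<psi> \<subseteq> U x" for \<psi>
      proof -
        have "regular a \<psi> = regular (f x) \<psi>" by (rule regular_cong) (use a[OF x] that(2) in blast)
        then show ?thesis using representsD[OF U(3)[OF x] that] by (simp add: D_def)
      qed
      then show "\<exists>V. open V \<and> x \<in> V \<and> (\<forall>\<psi>. test_fun \<psi> \<longrightarrow> fsupp \<psi> \<subseteq> V \<inter> fsupp \<phi> \<longrightarrow> D \<psi> = 0)"
        using U(1,2)[OF x] by (meson Int_subset_iff)
    qed (use \<phi> in auto)
    then show "u \<phi> = regular a \<phi>" by (simp add: D_def)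
  qed
  then show ?thesis by blast
qed

lemma test_fun_cutoff:
  assumes "closed C" "smooth_on (- C) b" "smooth_on UNIV \<eta>" "open W" "C \<subseteq> W" "\<And>x. x \<in> W \<Longrightarrow> \<eta> x = 0" "test_fun \<phi>"
  shows "test_fun (\<lambda>x. b x * \<eta> x * \<phi> x)"
proof (rule test_fun_mult[OF assms(7)])
  show "smooth_on UNIV (\<lambda>x. b x * \<eta> x)"
    by (rule smooth_on_extend[of "- C" "- W"])
       (use assms in \<open>auto intro!: smooth_on_mult intro: smooth_on_subset\<close>)
qed

text \<open>The difference \<kappa> of two cutoffs vanishes near both singular supports. On its
  support u and v are given by functions a' and b', so changing the cutoff moves the integral of a'
  b' \<kappa> \<phi> from one summand to the other. The closed sets in the assumptions may be larger
  than the singular supports.\<close>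

lemma dist_mult_eq:
  assumes lu: "linear_on_tests UNIV u" and lv: "linear_on_tests UNIV v"
    and \<eta>: "smooth_on UNIV \<eta>"
    and u: "closed \<Gamma>u" "represents (- \<Gamma>u) a u" "open Wu" "\<Gamma>u \<subseteq> Wu" "\<And>x. x \<in> Wu \<Longrightarrow> \<eta> x = 1"
    and v: "closed \<Gamma>v" "represents (- \<Gamma>v) b v" "open Wv" "\<Gamma>v \<subseteq> Wv" "\<And>x. x \<in> Wv \<Longrightarrow> \<eta> x = 0"
    and \<phi>: "test_fun \<phi>"
  shows "dist_mult u v \<phi> = u (\<lambda>x. b x * \<eta> x * \<phi> x) + v (\<lambda>x. a x * (1 - \<eta> x) * \<phi> x)"
proof -
  let ?Su = "sing_supp u" and ?Sv = "sing_supp v"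
  have Su: "?Su \<subseteq> Wu" using sing_supp_subset[OF u(1,2)] u(4) by blast
  have Sv: "?Sv \<subseteq> Wv" using sing_supp_subset[OF v(1,2)] v(4) by blast
  obtain a' where a': "represents (- ?Su) a' u" using represents_off_sing_supp[OF lu] by blast
  obtain b' where b': "represents (- ?Sv) b' v" using represents_off_sing_supp[OF lv] by blast
  have sa: "smooth_on (- ?Su) a'" and sb: "smooth_on (- ?Sv) b'" using a' b' by (auto simp: represents_def)
  have o: "open (- ?Su)" "open (- ?Sv)" "open (- \<Gamma>u)" "open (- \<Gamma>v)" using closed_sing_supp u v by blast+
  \<comment> \<open>The given representative lives on a smaller set than the canonical one; where it
    is undefined the cutoff is zero.\<close>
  have e1: "b' x * \<eta> x = b x * \<eta> x" for x
    using represents_unique[OF o(2) b' o(4) v(2), of x] sing_supp_subset[OF v(1,2)] v(4,5)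
    by (cases "x \<in> Wv") auto
  have e2: "a' x * (1 - \<eta> x) = a x * (1 - \<eta> x)" for x
    using represents_unique[OF o(1) a' o(3) u(2), of x] sing_supp_subset[OF u(1,2)] u(4,5)
    by (cases "x \<in> Wu") auto
  have "dist_mult u v \<phi> = u (\<lambda>x. b' x * \<eta> x * \<phi> x) + v (\<lambda>x. a' x * (1 - \<eta> x) * \<phi> x)"
    unfolding dist_mult_def
  proof (rule the_equality)
    show "\<exists>\<eta>' a b. smooth_on UNIV \<eta>' \<and> (\<exists>W. open W \<and> ?Sv \<subseteq> W \<and> (\<forall>x\<in>W. \<eta>' x = 0)) \<and>
       (\<exists>W. open W \<and> ?Su \<subseteq> W \<and> (\<forall>x\<in>W. \<eta>' x = 1)) \<and> represents (- ?Su) a u \<and> represents (- ?Sv) b v \<and>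
       u (\<lambda>x. b' x * \<eta> x * \<phi> x) + v (\<lambda>x. a' x * (1 - \<eta> x) * \<phi> x) =
       u (\<lambda>x. b x * \<eta>' x * \<phi> x) + v (\<lambda>x. a x * (1 - \<eta>' x) * \<phi> x)"
      using \<eta> a' b' u(3,5) v(3,5) Su Sv by blast
  next
    fix l
    assume "\<exists>\<eta>' a b. smooth_on UNIV \<eta>' \<and> (\<exists>W. open W \<and> ?Sv \<subseteq> W \<and> (\<forall>x\<in>W. \<eta>' x = 0)) \<and>
       (\<exists>W. open W \<and> ?Su \<subseteq> W \<and> (\<forall>x\<in>W. \<eta>' x = 1)) \<and> represents (- ?Su) a u \<and> represents (- ?Sv) b v \<and>
       l = u (\<lambda>x. b x * \<eta>' x * \<phi> x) + v (\<lambda>x. a x * (1 - \<eta>' x) * \<phi> x)"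
    then obtain \<eta>' a2 b2 Vv Vu where *: "smooth_on UNIV \<eta>'" "open Vv" "?Sv \<subseteq> Vv" "\<forall>x\<in>Vv. \<eta>' x = 0"
       "open Vu" "?Su \<subseteq> Vu" "\<forall>x\<in>Vu. \<eta>' x = 1" "represents (- ?Su) a2 u" "represents (- ?Sv) b2 v"
       and l: "l = u (\<lambda>x. b2 x * \<eta>' x * \<phi> x) + v (\<lambda>x. a2 x * (1 - \<eta>' x) * \<phi> x)" by blast
    have B: "b2 x * \<eta>' x = b' x * \<eta>' x" for x
      using represents_unique[OF o(2) b' o(2) *(9), of x] *(3,4) by (cases "x \<in> ?Sv") auto
    have A: "a2 x * (1 - \<eta>' x) = a' x * (1 - \<eta>' x)" for x
      using represents_unique[OF o(1) a' o(1) *(8), of x] *(6,7) by (cases "x \<in> ?Su") auto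
    have l': "l = u (\<lambda>x. b' x * \<eta>' x * \<phi> x) + v (\<lambda>x. a' x * (1 - \<eta>' x) * \<phi> x)"
      using l by (simp only: A B)
    define \<kappa> where "\<kappa> x = \<eta> x - \<eta>' x" for x
    have 1: "smooth_on UNIV (\<lambda>x. 1 - \<eta> x)" "smooth_on UNIV (\<lambda>x. 1 - \<eta>' x)" "smooth_on UNIV \<kappa>"
      unfolding \<kappa>_def by (intro smooth_on_diff smooth_on_const \<eta> *(1) open_UNIV)+
    have t: "test_fun (\<lambda>x. b' x * \<eta> x * \<phi> x)" "test_fun (\<lambda>x. b' x * \<eta>' x * \<phi> x)"
      "test_fun (\<lambda>x. a' x * (1 - \<eta> x) * \<phi> x)" "test_fun (\<lambda>x. a' x * (1 - \<eta>' x) * \<phi> x)"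
      using test_fun_cutoff[OF closed_sing_supp sb \<eta> v(3) Sv v(5) \<phi>]
        test_fun_cutoff[OF closed_sing_supp sb *(1,2,3) _ \<phi>]
        test_fun_cutoff[OF closed_sing_supp sa 1(1) u(3) Su _ \<phi>]
        test_fun_cutoff[OF closed_sing_supp sa 1(2) *(5,6) _ \<phi>] u(5) *(4,7) by simp_all
    have \<kappa>v: "\<kappa> x = 0" if "x \<in> Wv \<inter> Vv" for x using that v(5) *(4) by (simp add: \<kappa>_def)
    have \<kappa>u: "\<kappa> x = 0" if "x \<in> Wu \<inter> Vu" for x using that u(5) *(7) by (simp add: \<kappa>_def)
    have k1: "test_fun (\<lambda>x. b' x * \<kappa> x * \<phi> x)"
      by (rule test_fun_cutoff[OF closed_sing_supp sb 1(3), of "Wv \<inter> Vv"]) (use v(3) *(2,3) Sv \<kappa>v \<phi> in auto)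
    have k2: "test_fun (\<lambda>x. a' x * \<kappa> x * \<phi> x)"
      by (rule test_fun_cutoff[OF closed_sing_supp sa 1(3), of "Wu \<inter> Vu"]) (use u(3) *(5,6) Su \<kappa>u \<phi> in auto)
    have f1: "fsupp (\<lambda>x. b' x * \<kappa> x * \<phi> x) \<subseteq> - ?Su"
    proof -
      have "fsupp (\<lambda>x. b' x * \<kappa> x * \<phi> x) \<subseteq> - (Wu \<inter> Vu)"
        by (rule fsupp_subset) (use \<kappa>u u(3) *(5) in auto)
      then show ?thesis using Su *(6) by blast
    qed
    have f2: "fsupp (\<lambda>x. a' x * \<kappa> x * \<phi> x) \<subseteq> - ?Sv"
    proof -
      have "fsupp (\<lambda>x. a' x * \<kappa> x * \<phi> x) \<subseteq> - (Wv \<inter> Vv)"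
        by (rule fsupp_subset) (use \<kappa>v v(3) *(2) in auto)
      then show ?thesis using Sv *(3) by blast
    qed
    have "u (\<lambda>x. b' x * \<eta> x * \<phi> x) - u (\<lambda>x. b' x * \<eta>' x * \<phi> x) = u (\<lambda>x. b' x * \<kappa> x * \<phi> x)"
      by (subst linear_on_tests_diff[OF lu t(1,2), symmetric]) (simp_all add: \<kappa>_def algebra_simps)
    also have "\<dots> = regular a' (\<lambda>x. b' x * \<kappa> x * \<phi> x)" by (rule representsD[OF a' k1 f1])
    also have "\<dots> = regular b' (\<lambda>x. a' x * \<kappa> x * \<phi> x)" by (simp add: regular_def mult_ac)
    also have "\<dots> = v (\<lambda>x. a' x * \<kappa> x * \<phi> x)" by (rule representsD[OF b' k2 f2, symmetric])
    also have "\<dots> = v (\<lambda>x. a' x * (1 - \<eta>' x) * \<phi> x) - v (\<lambda>x. a' x * (1 - \<eta> x) * \<phi> x)"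
      by (subst linear_on_tests_diff[OF lv t(4,3), symmetric]) (simp_all add: \<kappa>_def algebra_simps)
    finally show "l = u (\<lambda>x. b' x * \<eta> x * \<phi> x) + v (\<lambda>x. a' x * (1 - \<eta> x) * \<phi> x)" using l' by (simp add: algebra_simps)
  qed
  then show ?thesis by (simp only: e1 e2)
qed

text \<open>
  Here \<open>v\<close> is smooth near \<open>y\<close> and \<open>\<kappa>\<close> is smooth except at \<open>y\<close>, so the products \<open>w \<epsilon> * \<kappa>\<close> approximate
  the product of the distributions as soon as \<open>w \<epsilon>\<close> agrees with \<open>v\<close> near \<open>y\<close>.
\<close>

lemma approx_dist_mult:
  assumes v: "approx P w v" "closed \<Gamma>" "represents (- \<Gamma>) c v" "y \<notin> \<Gamma>"
    and near: "r > 0" "\<forall>\<^sub>F \<epsilon> in at_right 0. \<forall>x\<in>ball y r. w \<epsilon> x = c x"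
    and \<kappa>: "smooth_on (- {y}) \<kappa>" "\<And>\<phi>. test_fun \<phi> \<Longrightarrow> integrable lborel (\<lambda>x. \<kappa> x * \<phi> x)"
  shows "approx P (\<lambda>\<epsilon> x. w \<epsilon> x * \<kappa> x) (dist_mult v (regular \<kappa>))"
    and "approx P (\<lambda>\<epsilon> x. w \<epsilon> x * \<kappa> x) (dist_mult (regular \<kappa>) v)"
proof -
  \<comment> \<open>The bump at y is 1 within distance e and 0 beyond 2 e. The larger ball avoids
    \<Gamma> and lies where \<open>w \<epsilon>\<close> eventually equals c.\<close>
  obtain e where e: "e > 0" "cball y (2 * e) \<subseteq> ball y r \<inter> - \<Gamma>"
  proof -
    have "open (ball y r \<inter> - \<Gamma>)" "y \<in> ball y r \<inter> - \<Gamma>" using v near by auto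
    then obtain d where "d > 0" "cball y d \<subseteq> ball y r \<inter> - \<Gamma>" using open_contains_cball by blast
    then show thesis using that[of "d / 2"] by simp
  qed
  let ?b = "bump y e"
  have b1: "?b x = 1" if "x \<in> ball y e" for x using that e by (intro bump_1) auto
  have b0: "?b x = 0" if "x \<in> - cball y (2 * e)" for x
    using that e by (intro bump_0) (auto simp: subset_eq)
  have sb: "smooth_on UNIV ?b" "smooth_on UNIV (\<lambda>x. 1 - ?b x)"
    by (intro smooth_on_diff smooth_on_const smooth_bump open_UNIV)+
  have sc: "smooth_on (- \<Gamma>) c" using v(3) by (simp add: represents_def)
  have lv: "linear_on_tests UNIV v" by (rule approx_linear[OF v(1)])
  have lk: "linear_on_tests UNIV (regular \<kappa>)"
    unfolding linear_on_tests_def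
  proof (intro allI impI)
    fix \<phi> \<psi> :: "'a \<Rightarrow> complex" and c assume t: "test_fun \<phi>" "test_fun \<psi>"
    have "regular \<kappa> (\<lambda>x. \<phi> x + c * \<psi> x) = (\<integral>x. \<kappa> x * \<phi> x + c * (\<kappa> x * \<psi> x) \<partial>lborel)"
      by (simp add: regular_def algebra_simps)
    then show "regular \<kappa> (\<lambda>x. \<phi> x + c * \<psi> x) = regular \<kappa> \<phi> + c * regular \<kappa> \<psi>"
      using \<kappa>(2) t by (simp add: regular_def)
  qed
  have rk: "represents (- {y}) \<kappa> (regular \<kappa>)" using \<kappa>(1) by (simp add: represents_def)
  have W: "open (- cball y (2 * e))" "\<Gamma> \<subseteq> - cball y (2 * e)" "open (ball y e)" "{y} \<subseteq> ball y e" using e by auto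
  have lim: "(\<forall>\<^sub>F \<epsilon> in at_right 0. integrable lborel (\<lambda>x. w \<epsilon> x * \<kappa> x * \<phi> x)) \<and>
      ((\<lambda>\<epsilon>. \<integral>x. w \<epsilon> x * \<kappa> x * \<phi> x \<partial>lborel) \<longlongrightarrow>
        v (\<lambda>x. \<kappa> x * (1 - ?b x) * \<phi> x) + regular \<kappa> (\<lambda>x. c x * ?b x * \<phi> x)) (at_right 0)"
    if \<phi>: "test_fun \<phi>" for \<phi>
  proof -
    have t1: "test_fun (\<lambda>x. \<kappa> x * (1 - ?b x) * \<phi> x)"
      by (rule test_fun_cutoff[OF _ \<kappa>(1) sb(2) W(3,4) _ \<phi>]) (auto simp: b1)
    have t2: "test_fun (\<lambda>x. c x * ?b x * \<phi> x)"
      by (rule test_fun_cutoff[OF v(2) sc sb(1) W(1,2) b0 \<phi>])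
    \<comment> \<open>Split by the bump. Away from y the factor \<kappa> is smooth and belongs to
      the test function for v. Near y the approximant already equals c, which leaves an integral
      independent of \<epsilon>.\<close>
    have ev: "\<forall>\<^sub>F \<epsilon> in at_right 0. integrable lborel (\<lambda>x. w \<epsilon> x * \<kappa> x * \<phi> x) \<and>
        (\<integral>x. w \<epsilon> x * (\<kappa> x * (1 - ?b x) * \<phi> x) \<partial>lborel) + regular \<kappa> (\<lambda>x. c x * ?b x * \<phi> x) =
        (\<integral>x. w \<epsilon> x * \<kappa> x * \<phi> x \<partial>lborel)"
      using approxD(2)[OF v(1) t1] near(2)
    proof eventually_elim
      case (elim \<epsilon>)
      have eq: "w \<epsilon> x * \<kappa> x * \<phi> x = w \<epsilon> x * (\<kappa> x * (1 - ?b x) * \<phi> x) + \<kappa> x * (c x * ?b x * \<phi> x)" for x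
      proof (cases "x \<in> cball y (2 * e)")
        case True
        then have "w \<epsilon> x = c x" using elim(2) e(2) by blast
        then show ?thesis by (simp add: algebra_simps)
      next
        case False
        then show ?thesis by (simp add: b0)
      qed
      show ?case unfolding eq using elim(1) \<kappa>(2)[OF t2] by (simp add: regular_def)
    qed
    have "((\<lambda>\<epsilon>. (\<integral>x. w \<epsilon> x * (\<kappa> x * (1 - ?b x) * \<phi> x) \<partial>lborel) + regular \<kappa> (\<lambda>x. c x * ?b x * \<phi> x)) \<longlongrightarrow>
        v (\<lambda>x. \<kappa> x * (1 - ?b x) * \<phi> x) + regular \<kappa> (\<lambda>x. c x * ?b x * \<phi> x)) (at_right 0)"
      by (intro tendsto_intros approxD(3)[OF v(1) t1])
    then show ?thesis using ev
      by (auto elim!: eventually_mono intro: Lim_transform_eventually)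
  qed
  \<comment> \<open>The cutoff of a product is 1 near the singular support of the left factor: this
    is 1 minus the bump if v stands on the left, and the bump itself if \<kappa> does.\<close>
  have m1: "dist_mult v (regular \<kappa>) \<phi> = v (\<lambda>x. \<kappa> x * (1 - ?b x) * \<phi> x) + regular \<kappa> (\<lambda>x. c x * ?b x * \<phi> x)"
    if "test_fun \<phi>" for \<phi>
    using dist_mult_eq[OF lv lk sb(2) v(2,3) W(1,2) _ _ rk W(3,4) _ that] by (simp add: b0 b1)
  have m2: "dist_mult (regular \<kappa>) v \<phi> = regular \<kappa> (\<lambda>x. c x * ?b x * \<phi> x) + v (\<lambda>x. \<kappa> x * (1 - ?b x) * \<phi> x)"
    if "test_fun \<phi>" for \<phi>
    using dist_mult_eq[OF lk lv sb(1) _ rk W(3,4) _ v(2,3) W(1,2) _ that] by (simp add: b0 b1)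
  show "approx P (\<lambda>\<epsilon> x. w \<epsilon> x * \<kappa> x) (dist_mult v (regular \<kappa>))"
    "approx P (\<lambda>\<epsilon> x. w \<epsilon> x * \<kappa> x) (dist_mult (regular \<kappa>) v)"
    unfolding approx_def using lim approxD(1)[OF v(1)] by (auto simp: m1 m2 add.commute)
qed

section \<open>Pullbacks of the delta distribution\<close>

lemma dirderiv_real: "(f has_vector_derivative d) (at x) \<Longrightarrow> dirderiv 1 f x = d"
  by (simp add: has_vector_derivative_def dirderiv_eq)

lemma smooth_real_has_vector_derivative:
  "smooth_on UNIV f \<Longrightarrow> (f has_vector_derivative dirderiv (1::real) f x) (at x)"
proof -
  assume "smooth_on UNIV f"
  then have d: "f differentiable (at x)" by (simp add: smooth_on_differentiable)
  have eq: "dirderiv r f x = r *\<^sub>R dirderiv 1 f x" for r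
    using linear_scale[OF dirderiv_linear[OF d], of r 1] by (simp only: real_scaleR_def mult_1_right)
  show ?thesis unfolding has_vector_derivative_def
    by (rule has_derivative_eq_rhs[OF has_derivative_dirderiv[OF d]]) (rule ext, rule eq)
qed

lemma smooth_on_funpow_dirderiv: "smooth_on U f \<Longrightarrow> smooth_on U ((dirderiv (1::real) ^^ j) f)"
  by (induction j) (auto intro: smooth_on_dirderiv)

lemma smooth_affine: "smooth_on UNIV f \<Longrightarrow> smooth_on UNIV (\<lambda>s. f ((t + c * s) / e))" for t c e :: real
proof (rule smooth_on_compose[of UNIV UNIV])
  have "smooth_on UNIV (\<lambda>s. (t + c * s) * (1 / e))"
    by (intro smooth_on_mult smooth_on_add smooth_on_const smooth_on_linear bounded_linear_ident open_UNIV)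
  then show "smooth_on UNIV (\<lambda>s. (t + c * s) / e)" by simp
qed auto

lemma funpow_dirderiv_affine:
  fixes f :: "real \<Rightarrow> complex"
  assumes f: "smooth_on UNIV f"
  shows "(dirderiv 1 ^^ j) (\<lambda>s. d * f ((t + c * s) / e)) = (\<lambda>s. d * of_real (c / e) ^ j * (dirderiv 1 ^^ j) f ((t + c * s) / e))"
proof (induction j)
  case (Suc j)
  let ?F = "(dirderiv 1 ^^ j) f"
  have D: "dirderiv 1 (\<lambda>s. d * of_real (c / e) ^ j * ?F ((t + c * s) / e)) =
      (\<lambda>s. d * of_real (c / e) ^ Suc j * dirderiv 1 ?F ((t + c * s) / e))"
  proof (rule ext, rule dirderiv_real)
    fix s
    have "((\<lambda>s. (t + c * s) / e) has_vector_derivative (c / e)) (at s)"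
      unfolding divide_inverse has_real_derivative_iff_has_vector_derivative[symmetric]
      by (auto intro!: derivative_eq_intros)
    from vector_diff_chain_at[OF this smooth_real_has_vector_derivative[OF smooth_on_funpow_dirderiv[OF f]]]
    have "((\<lambda>s. ?F ((t + c * s) / e)) has_vector_derivative (c / e) *\<^sub>R dirderiv 1 ?F ((t + c * s) / e)) (at s)"
      by (simp add: o_def)
    from has_vector_derivative_mult_right[OF this, of "d * of_real (c / e) ^ j"]
    show "((\<lambda>s. d * of_real (c / e) ^ j * ?F ((t + c * s) / e)) has_vector_derivative
        d * of_real (c / e) ^ Suc j * dirderiv 1 ?F ((t + c * s) / e)) (at s)"
      by (simp add: scaleR_conv_of_real mult_ac)
  qed
  show ?case by (simp only: funpow.simps(2) o_apply Suc D)
qed simp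

text \<open>The sign in \<open>delta\<close> cancels against the one that the reflection s \<mapsto>
  t - s produces in each derivative.\<close>

lemma delta_mollifier:
  fixes \<rho> :: "real \<Rightarrow> complex"
  assumes "smooth_on UNIV \<rho>"
  shows "delta j (\<lambda>s. \<rho> ((t - s) / \<epsilon>) / of_real \<epsilon>) = (dirderiv 1 ^^ j) \<rho> (t / \<epsilon>) / of_real \<epsilon> ^ Suc j"
proof -
  have "(\<lambda>s. \<rho> ((t - s) / \<epsilon>) / of_real \<epsilon>) = (\<lambda>s. inverse (of_real \<epsilon>) * \<rho> ((t + (-1) * s) / \<epsilon>))"
    by (simp add: fun_eq_iff divide_inverse mult.commute)
  then have "delta j (\<lambda>s. \<rho> ((t - s) / \<epsilon>) / of_real \<epsilon>) =
      (-1) ^ j * (inverse (of_real \<epsilon>) * of_real (- 1 / \<epsilon>) ^ j * (dirderiv 1 ^^ j) \<rho> (t / \<epsilon>))"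
    unfolding delta_def using funpow_dirderiv_affine[OF assms, of j "inverse (of_real \<epsilon>)" t "-1" \<epsilon>]
    by (simp add: fun_eq_iff)
  also have "(-1) ^ j * (inverse (of_real \<epsilon>) * complex_of_real (- 1 / \<epsilon>) ^ j * (dirderiv 1 ^^ j) \<rho> (t / \<epsilon>)) =
     ((-1) * of_real (- 1 / \<epsilon>)) ^ j * inverse (of_real \<epsilon>) * (dirderiv 1 ^^ j) \<rho> (t / \<epsilon>)"
    unfolding power_mult_distrib by (simp only: mult_ac)
  also have "\<dots> = (dirderiv 1 ^^ j) \<rho> (t / \<epsilon>) / of_real \<epsilon> ^ Suc j"
    by (simp add: divide_inverse power_inverse mult_ac)
  finally show ?thesis .
qed

section \<open>Antiderivatives of mollifiers\<close>

lemma antiderivative: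
  fixes f :: "real \<Rightarrow> complex"
  assumes f: "continuous_on UNIV f" "\<And>s. s \<le> a \<Longrightarrow> f s = 0"
  shows "\<exists>F. (\<forall>s. (F has_vector_derivative f s) (at s)) \<and> (\<forall>s\<le>a. F s = 0) \<and> (\<forall>s\<ge>a. F s = integral {a..s} f)"
proof (intro exI conjI allI impI)
  \<comment> \<open>Starting at a - 1, where f still vanishes, makes a an interior point of the
    intervals of integration, so the derivative there is two-sided.\<close>
  let ?F = "\<lambda>s. integral {a - 1..s} f"
  have z: "?F s = 0" if "s \<le> a" for s
    using integral_eq_0_iff has_integral_is_0[of "{a - 1..s}" f] f(2) that by (intro integral_unique) auto
  then show "?F s = 0" if "s \<le> a" for s using that .
  show "?F s = integral {a..s} f" if "s \<ge> a" for s
  proof -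
    have "integral {a - 1..a} f + integral {a..s} f = ?F s"
      using that by (intro Henstock_Kurzweil_Integration.integral_combine integrable_continuous_real continuous_on_subset[OF f(1)]) auto
    then show ?thesis using z[of a] by simp
  qed
  show "(?F has_vector_derivative f s) (at s)" for s
  proof (cases "s > a - 1")
    case True
    have "(?F has_vector_derivative f s) (at s within {a - 1..s + 1})"
      using True by (intro integral_has_vector_derivative continuous_on_subset[OF f(1)]) auto
    then show ?thesis using True by (simp add: at_within_Icc_at)
  next
    case False
    then have "s < a" by simp
    have "(?F has_vector_derivative 0) (at s)"
      by (rule has_vector_derivative_transform_within_open[of "\<lambda>_. 0" _ _ "{..<a}"]) (use \<open>s < a\<close> z in auto)
    then show ?thesis using f(2) \<open>s < a\<close> by simp
  qed
qed

lemma smooth_antiderivative: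
  "(\<And>s. (F has_vector_derivative f s) (at s)) \<Longrightarrow> smooth_on UNIV f \<Longrightarrow> smooth_on UNIV F \<and> dirderiv (1::real) F = f"
proof
  assume F: "\<And>s. (F has_vector_derivative f s) (at s)" and f: "smooth_on UNIV f"
  show *: "dirderiv 1 F = f" by (rule ext, rule dirderiv_real, rule F)
  show "smooth_on UNIV F"
  proof (rule smooth_on_Suc)
    show "F differentiable (at s)" for s using F[of s] unfolding has_vector_derivative_def differentiable_def by blast
    show "smooth_on UNIV (dirderiv b F)" if "b \<in> Basis" for b :: real using that * f by simp
  qed
qed

lemma test_fun_integral_Icc:
  fixes f :: "real \<Rightarrow> complex"
  assumes "test_fun f" "\<And>s. s \<notin> {a..b} \<Longrightarrow> f s = 0"
  shows "(\<integral>s. f s \<partial>lborel) = integral {a..b} f"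
proof -
  have "f integrable_on {a..b}"
    by (intro integrable_continuous_real continuous_on_subset[OF smooth_on_continuous[OF test_fun_smooth[OF assms(1)]]]) auto
  then have "(f has_integral integral {a..b} f) UNIV"
    by (intro has_integral_on_superset[OF integrable_integral]) (use assms(2) in auto)
  moreover have "(f has_integral (\<integral>s. f s \<partial>lborel)) UNIV"
    using has_integral_integral_lborel[OF test_fun_integrable[OF assms(1)]] .
  ultimately show ?thesis using has_integral_unique by blast
qed

text \<open>Two integrations reach a continuous limit: by the bound, \<epsilon> Q(s / \<epsilon>)
  tends uniformly to the positive part of s, whichever mollifier of integral 1 is taken. This is why
  pullbacks do not depend on the mollifier.\<close>

lemma mollifier_second_antiderivative:
  fixes \<rho> :: "real \<Rightarrow> complex"
  assumes \<rho>: "test_fun \<rho>" "(\<integral>s. \<rho> s \<partial>lborel) = 1"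
  shows "\<exists>Q C. smooth_on UNIV Q \<and> dirderiv 1 (dirderiv 1 Q) = \<rho> \<and> (\<forall>s. norm (Q s - of_real (max s 0)) \<le> C)"
proof -
  obtain R where R: "R > 0" "\<And>s. \<bar>s\<bar> \<ge> R \<Longrightarrow> \<rho> s = 0"
  proof -
    obtain B where B: "B > 0" "\<And>s. s \<in> fsupp \<rho> \<Longrightarrow> norm s \<le> B"
      using \<rho>(1) compact_imp_bounded[of "fsupp \<rho>"] bounded_pos[of "fsupp \<rho>"] by (auto simp: test_fun_def)
    show thesis
    proof (rule that[of "B + 1"])
      fix s :: real assume "\<bar>s\<bar> \<ge> B + 1"
      then show "\<rho> s = 0" using B(2)[of s] fsupp_eq_0[of s \<rho>] by fastforce
    qed (use B in simp)
  qed
  have c\<rho>: "continuous_on UNIV \<rho>" using smooth_on_continuous[OF test_fun_smooth[OF \<rho>(1)]] .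
  obtain P where P: "\<And>s. (P has_vector_derivative \<rho> s) (at s)" "\<And>s. s \<le> - R \<Longrightarrow> P s = 0"
    "\<And>s. s \<ge> - R \<Longrightarrow> P s = integral {- R..s} \<rho>"
  proof -
    have "\<rho> s = 0" if "s \<le> - R" for s using that R by simp
    from antiderivative[OF c\<rho> this] show thesis using that by blast
  qed
  note sP = smooth_antiderivative[OF P(1) test_fun_smooth[OF \<rho>(1)]]
  obtain Q where Q: "\<And>s. (Q has_vector_derivative P s) (at s)" "\<And>s. s \<le> - R \<Longrightarrow> Q s = 0"
    using antiderivative[OF smooth_on_continuous[OF conjunct1[OF sP]] P(2)] by blast
  note sQ = smooth_antiderivative[OF Q(1) conjunct1[OF sP]]
  \<comment> \<open>To the right of the support the first antiderivative equals the total mass 1, so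
    the second one differs from s by a constant there; to the left of the support it is 0.\<close>
  have P1: "P s = 1" if "s \<ge> R" for s
  proof -
    have "\<rho> r = 0" if "r \<notin> {- R..s}" for r
      by (rule R(2)) (use that \<open>s \<ge> R\<close> R(1) in auto)
    then show ?thesis using P(3)[of s] that R(1) test_fun_integral_Icc[OF \<rho>(1), of "- R" s] \<rho>(2) by simp
  qed
  have QR: "Q s - of_real s = Q R - of_real R" if s: "s \<ge> R" for s
  proof -
    have "((\<lambda>s. Q s - of_real s) has_vector_derivative 0) (at r within {R..s})" if "r \<in> {R..s}" for r
    proof -
      have "((\<lambda>s. Q s - of_real s) has_vector_derivative (P r - 1)) (at r)"
        by (intro has_vector_derivative_diff Q(1)) (auto intro!: derivative_eq_intros simp: has_vector_derivative_def scaleR_conv_of_real)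
      then show ?thesis using P1[of r] that by (auto intro: has_vector_derivative_at_within)
    qed
    then obtain c where "\<And>r. r \<in> {R..s} \<Longrightarrow> Q r - of_real r = c"
      using has_vector_derivative_zero_constant[of "{R..s}" "\<lambda>s. Q s - of_real s"] by auto
    then show ?thesis using s by simp
  qed
  have "compact ((\<lambda>s. Q s - of_real (max s 0)) ` {- R..R})"
    using smooth_on_continuous[OF conjunct1[OF sQ]]
    by (intro compact_continuous_image continuous_intros) (auto intro: continuous_on_subset)
  then obtain C where C': "\<forall>z\<in>(\<lambda>s. Q s - of_real (max s 0)) ` {- R..R}. norm z \<le> C"
    using compact_imp_bounded bounded_iff by blast
  have C: "norm (Q s - of_real (max s 0)) \<le> C" if "s \<in> {- R..R}" for s
    using C' that by blast
  have "norm (Q s - of_real (max s 0)) \<le> C" for s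
  proof -
    have "R \<in> {- R..R}" "- R \<in> {- R..R}" using R by auto
    note CR = C[OF this(1)] C[OF this(2)]
    consider "s \<in> {- R..R}" | "s \<ge> R" | "s \<le> - R" by fastforce
    then show ?thesis
    proof cases
      case 2
      then show ?thesis using QR[OF 2] CR(1) R by (simp add: max_def)
    next
      case 3
      then have "norm (Q s - of_real (max s 0)) = 0" using Q(2) R by (simp add: max_def)
      then show ?thesis using order_trans[OF norm_ge_zero CR(1)] by simp
    qed (rule C)
  qed
  then show ?thesis using sQ sP by blast
qed

section \<open>Moving derivatives from the mollifier to the test function\<close>

context
  fixes f :: "'a::euclidean_space \<Rightarrow> real"
  assumes f: "smooth_on UNIV f"
begin

definition grad2 :: "'a \<Rightarrow> real" where
  "grad2 x = (\<Sum>b\<in>Basis. (dirderiv b f x)\<^sup>2)"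

text \<open>The formal adjoint of the derivation along \<open>\<nabla>f / |\<nabla>f|\<^sup>2\<close>, which maps \<open>q \<circ> f\<close> to \<open>q' \<circ> f\<close>.\<close>

definition vadj :: "('a \<Rightarrow> complex) \<Rightarrow> 'a \<Rightarrow> complex" where
  "vadj \<psi> x = - (\<Sum>b\<in>Basis. dirderiv b (\<lambda>x. of_real (dirderiv b f x * inverse (grad2 x ^ 1)) * \<psi> x) x)"

lemma smooth_grad2: "smooth_on UNIV grad2"
  unfolding grad2_def[abs_def] by (intro smooth_on_sum smooth_on_power smooth_on_dirderiv f open_UNIV)

lemma open_grad2: "open {x. 0 < grad2 x}"
  using smooth_on_continuous[OF smooth_grad2] by (intro open_Collect_less) auto

lemma vfield_test:
  assumes "test_fun \<psi>" "fsupp \<psi> \<subseteq> {x. 0 < grad2 x}" "b \<in> Basis"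
  shows "test_fun (\<lambda>x. of_real (dirderiv b f x * inverse (grad2 x ^ 1)) * \<psi> x)"
proof (rule test_fun_mult_smooth[OF assms(1) open_grad2 assms(2)])
  show "smooth_on {x. 0 < grad2 x} (\<lambda>x. complex_of_real (dirderiv b f x * inverse (grad2 x ^ 1)))"
    by (intro smooth_on_of_real smooth_on_mult smooth_on_inverse open_grad2
        smooth_on_subset[OF smooth_on_dirderiv[OF f assms(3)]] smooth_on_subset[OF smooth_grad2]) auto
qed

lemma vadj_test:
  assumes "test_fun \<psi>" "fsupp \<psi> \<subseteq> {x. 0 < grad2 x}"
  shows "test_fun (vadj \<psi>)" "fsupp (vadj \<psi>) \<subseteq> fsupp \<psi>"
proof -
  have "test_fun (\<lambda>x. (-1) * (\<Sum>b\<in>Basis. dirderiv b (\<lambda>x. of_real (dirderiv b f x * inverse (grad2 x ^ 1)) * \<psi> x) x))"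
    by (intro test_fun_cmult test_fun_sum test_fun_dirderiv vfield_test assms)
  then show "test_fun (vadj \<psi>)" by (simp add: vadj_def[abs_def])
  show "fsupp (vadj \<psi>) \<subseteq> fsupp \<psi>"
  proof (rule fsupp_subset[OF closed_fsupp])
    fix x assume "x \<notin> fsupp \<psi>"
    then have "x \<notin> fsupp (\<lambda>x. of_real (dirderiv b f x * inverse (grad2 x ^ 1)) * \<psi> x)" for b
      using fsupp_mult(1)[of "\<lambda>x. complex_of_real (dirderiv b f x * inverse (grad2 x ^ 1))" \<psi>] by blast
    then show "vadj \<psi> x = 0" by (simp add: vadj_def dirderiv_off_fsupp)
  qed
qed

lemma vadj_funpow_test:
  assumes "test_fun \<psi>" "fsupp \<psi> \<subseteq> {x. 0 < grad2 x}"
  shows "test_fun ((vadj ^^ k) \<psi>) \<and> fsupp ((vadj ^^ k) \<psi>) \<subseteq> {x. 0 < grad2 x}"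
proof (induction k)
  case (Suc k)
  then show ?case using vadj_test[of "(vadj ^^ k) \<psi>"] by (auto simp: subset_iff)
qed (use assms in simp)

lemma vadj_by_parts:
  assumes \<psi>: "test_fun \<psi>" "fsupp \<psi> \<subseteq> {x. 0 < grad2 x}" and q: "smooth_on UNIV q"
  shows "(\<integral>x. dirderiv 1 q (f x) * \<psi> x \<partial>lborel) = (\<integral>x. q (f x) * vadj \<psi> x \<partial>lborel)"
proof -
  let ?v = "\<lambda>b x. of_real (dirderiv b f x * inverse (grad2 x ^ 1)) * \<psi> x"
  have sq: "smooth_on UNIV (\<lambda>x. q (f x))" by (rule smooth_on_compose[OF open_UNIV open_UNIV _ q f]) simp
  have d: "dirderiv b (\<lambda>x. q (f x)) x = of_real (dirderiv b f x) * dirderiv 1 q (f x)" for b x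
    using smooth_on_differentiable[OF f, of x] smooth_on_differentiable[OF q, of "f x"]
    by (subst dirderiv_compose) (auto simp: scaleR_conv_of_real)
  \<comment> \<open>Where the gradient is nonzero, the weights formed by the squares of the partial
    derivatives divided by \<open>grad2\<close> sum to 1; elsewhere \<psi> vanishes.\<close>
  have "dirderiv 1 q (f x) * \<psi> x = (\<Sum>b\<in>Basis. dirderiv b (\<lambda>x. q (f x)) x * ?v b x)" for x
  proof (cases "0 < grad2 x")
    case True
    have "(\<Sum>b\<in>Basis. dirderiv b (\<lambda>x. q (f x)) x * ?v b x) =
        of_real ((\<Sum>b\<in>Basis. (dirderiv b f x)\<^sup>2) * inverse (grad2 x)) * (dirderiv 1 q (f x) * \<psi> x)"
      by (simp add: d sum_distrib_right sum_distrib_left power2_eq_square mult_ac)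
    then show ?thesis using True by (simp add: grad2_def[symmetric])
  next
    case False
    then have "\<psi> x = 0" using \<psi>(2) fsupp_eq_0[of x \<psi>] by blast
    then show ?thesis by simp
  qed
  then have "(\<integral>x. dirderiv 1 q (f x) * \<psi> x \<partial>lborel) = (\<integral>x. (\<Sum>b\<in>Basis. dirderiv b (\<lambda>x. q (f x)) x * ?v b x) \<partial>lborel)"
    by (simp only:)
  also have "\<dots> = (\<Sum>b\<in>Basis. (\<integral>x. dirderiv b (\<lambda>x. q (f x)) x * ?v b x \<partial>lborel))"
    by (intro Bochner_Integration.integral_sum test_fun_integrable test_fun_mult vfield_test \<psi> smooth_on_dirderiv sq)
  also have "\<dots> = (\<Sum>b\<in>Basis. - (\<integral>x. q (f x) * dirderiv b (?v b) x \<partial>lborel))"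
    by (intro sum.cong HOL.refl) (subst integral_by_parts[OF vfield_test[OF \<psi>] _ sq]; simp)
  also have "\<dots> = - (\<Sum>b\<in>Basis. (\<integral>x. q (f x) * dirderiv b (?v b) x \<partial>lborel))" by (simp only: sum_negf)
  also have "\<dots> = - (\<integral>x. (\<Sum>b\<in>Basis. q (f x) * dirderiv b (?v b) x) \<partial>lborel)"
  proof -
    have "integrable lborel (\<lambda>x. q (f x) * dirderiv b (?v b) x)" if "b \<in> Basis" for b
      by (intro test_fun_integrable test_fun_mult sq test_fun_dirderiv vfield_test \<psi> that)
    then show ?thesis by (subst Bochner_Integration.integral_sum) simp_all
  qed
  also have "\<dots> = (\<integral>x. q (f x) * vadj \<psi> x \<partial>lborel)"
    by (simp add: vadj_def sum_distrib_left)
  finally show ?thesis .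
qed

lemma vadj_by_parts_funpow:
  assumes \<psi>: "test_fun \<psi>" "fsupp \<psi> \<subseteq> {x. 0 < grad2 x}" and q: "smooth_on UNIV q"
  shows "(\<integral>x. (dirderiv 1 ^^ k) q (f x) * \<psi> x \<partial>lborel) = (\<integral>x. q (f x) * (vadj ^^ k) \<psi> x \<partial>lborel)"
  using q
proof (induction k arbitrary: q)
  case (Suc k)
  have "(dirderiv 1 ^^ Suc k) q = (dirderiv 1 ^^ k) (dirderiv 1 q)" by (simp add: funpow_swap1)
  then have "(\<integral>x. (dirderiv 1 ^^ Suc k) q (f x) * \<psi> x \<partial>lborel) = (\<integral>x. dirderiv 1 q (f x) * (vadj ^^ k) \<psi> x \<partial>lborel)"
    using Suc.IH[of "dirderiv 1 q"] smooth_on_dirderiv[OF Suc.prems, of 1] by simp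
  then show ?case using vadj_by_parts[of "(vadj ^^ k) \<psi>" q] vadj_funpow_test[OF \<psi>, of k] Suc.prems by simp
qed simp

text \<open>After cutting \<phi> off to the region of nonzero gradient, repeated integration by
  parts replaces the derivative of the mollifier by \<epsilon> Q(f / \<epsilon>), which converges
  uniformly to the positive part of f. The limit is an integral in which \<rho> no longer
  occurs.\<close>

lemma mollifier_limit:
  assumes nondeg: "\<And>x. f x = 0 \<Longrightarrow> 0 < grad2 x" and \<phi>: "test_fun \<phi>"
  shows "\<exists>l. \<forall>\<rho>. test_fun \<rho> \<and> (\<integral>s. \<rho> s \<partial>lborel) = 1 \<longrightarrow>
    ((\<lambda>\<epsilon>. \<integral>x. (dirderiv 1 ^^ j) \<rho> (f x / \<epsilon>) / of_real \<epsilon> ^ Suc j * \<phi> x \<partial>lborel) \<longlongrightarrow> l) (at_right 0)"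
proof -
  have cf: "continuous_on UNIV f" by (rule smooth_on_continuous[OF f])
  have c: "compact ({x. f x = 0} \<inter> fsupp \<phi>)"
    using \<phi> cf by (intro closed_Int_compact closed_Collect_eq) (auto simp: test_fun_def)
  have sub: "{x. f x = 0} \<inter> fsupp \<phi> \<subseteq> {x. 0 < grad2 x}" using nondeg by auto
  obtain \<eta> W where \<eta>: "test_fun \<eta>" "fsupp \<eta> \<subseteq> {x. 0 < grad2 x}" "open W"
    "{x. f x = 0} \<inter> fsupp \<phi> \<subseteq> W" "\<forall>x\<in>W. \<eta> x = 1"
    using smooth_urysohn[OF c open_grad2 sub] by blast
  let ?\<psi> = "\<lambda>x. \<eta> x * \<phi> x"
  have t: "test_fun ?\<psi>" by (rule test_fun_mult[OF \<phi> test_fun_smooth[OF \<eta>(1)]])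
  have ft: "fsupp ?\<psi> \<subseteq> {x. 0 < grad2 x}" using fsupp_mult(2)[of \<eta> \<phi>] \<eta>(2) by blast
  \<comment> \<open>There are j derivatives to move for the order of the delta distribution, and two
    more to reach the second antiderivative of the mollifier.\<close>
  let ?\<psi>' = "(vadj ^^ (j + 2)) ?\<psi>"
  have t': "test_fun ?\<psi>'" using vadj_funpow_test[OF t ft] by blast
  \<comment> \<open>On the part of the support of \<phi> where the cutoff may differ from 1, |f| is
    bounded below by some d > 0. As soon as R \<epsilon> < d the mollified function vanishes there,
    so the cutoff costs nothing.\<close>
  have "compact (fsupp \<phi> - W)" using \<phi> \<eta>(3) by (intro compact_diff) (auto simp: test_fun_def)
  moreover have "f x \<noteq> 0" if "x \<in> fsupp \<phi> - W" for x using \<eta>(4) that by auto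
  ultimately obtain d where d: "d > 0" "\<And>x. x \<in> fsupp \<phi> - W \<Longrightarrow> d \<le> \<bar>f x\<bar>"
  proof (cases "fsupp \<phi> - W = {}")
    case False
    assume *: "compact (fsupp \<phi> - W)" "\<And>x. x \<in> fsupp \<phi> - W \<Longrightarrow> f x \<noteq> 0"
    have "continuous_on (fsupp \<phi> - W) (\<lambda>x. \<bar>f x\<bar>)" by (intro continuous_intros continuous_on_subset[OF cf]) auto
    then obtain x where "x \<in> fsupp \<phi> - W" "\<And>z. z \<in> fsupp \<phi> - W \<Longrightarrow> \<bar>f x\<bar> \<le> \<bar>f z\<bar>"
      using continuous_attains_inf[OF *(1) False] by blast
    then show ?thesis using *(2)[of x] that[of "\<bar>f x\<bar>"] by auto
  qed (rule that[of 1], auto)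
  show ?thesis
  proof (intro exI allI impI)
    fix \<rho> :: "real \<Rightarrow> complex" assume \<rho>: "test_fun \<rho> \<and> (\<integral>s. \<rho> s \<partial>lborel) = 1"
    obtain Q C where Q: "smooth_on UNIV Q" "dirderiv 1 (dirderiv 1 Q) = \<rho>" "\<And>s. norm (Q s - of_real (max s 0)) \<le> C"
      using mollifier_second_antiderivative[of \<rho>] \<rho> by blast
    have C0: "0 \<le> C" using Q(3)[of 0] norm_ge_zero order_trans by blast
    obtain R where R: "R > 0" "\<And>s. s \<in> fsupp \<rho> \<Longrightarrow> \<bar>s\<bar> \<le> R"
      using \<rho> compact_imp_bounded[of "fsupp \<rho>"] bounded_pos[of "fsupp \<rho>"] by (auto simp: test_fun_def)
    have \<rho>0: "(dirderiv 1 ^^ j) \<rho> s = 0" if "\<bar>s\<bar> > R" for s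
    proof -
      have "fsupp ((dirderiv 1 ^^ j) \<rho>) \<subseteq> fsupp \<rho>"
      proof (induction j)
        case (Suc j)
        have "fsupp ((dirderiv 1 ^^ Suc j) \<rho>) \<subseteq> fsupp ((dirderiv 1 ^^ j) \<rho>)"
          by (rule fsupp_subset[OF closed_fsupp]) (simp add: dirderiv_off_fsupp)
        then show ?case using Suc by blast
      qed simp
      then have "s \<notin> fsupp ((dirderiv 1 ^^ j) \<rho>)" using R(2)[of s] that by fastforce
      then show ?thesis by (rule fsupp_eq_0)
    qed
    have iQ: "integrable lborel (\<lambda>x. of_real \<epsilon> * Q (f x / \<epsilon>) * ?\<psi>' x)" if "\<epsilon> > 0" for \<epsilon>
    proof -
      have "smooth_on UNIV (\<lambda>x. Q ((0 + 1 * f x) / \<epsilon>))"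
        by (rule smooth_on_compose[OF open_UNIV open_UNIV _ smooth_affine[OF Q(1)] f]) simp
      then show ?thesis
        by (intro test_fun_integrable test_fun_mult[OF t'] smooth_on_mult smooth_on_const) auto
    qed
    have i0: "integrable lborel (\<lambda>x. of_real (max (f x) 0) * ?\<psi>' x)"
      using t' cf smooth_on_continuous[OF test_fun_smooth[OF t']]
      by (intro integrable_compact_supp[of _ "fsupp ?\<psi>'"] continuous_intros)
         (auto simp: test_fun_def fsupp_eq_0)
    have ev: "\<forall>\<^sub>F \<epsilon> in at_right 0. (\<integral>x. of_real \<epsilon> * Q (f x / \<epsilon>) * ?\<psi>' x \<partial>lborel) =
        (\<integral>x. (dirderiv 1 ^^ j) \<rho> (f x / \<epsilon>) / of_real \<epsilon> ^ Suc j * \<phi> x \<partial>lborel)"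
    proof -
      have "0 < d / (2 * R)" using d R by simp
      then have "\<forall>\<^sub>F \<epsilon> in at_right 0. \<epsilon> < d / (2 * R)" by (rule eventually_at_right_real[THEN eventually_mono]) simp
      then show ?thesis using eventually_right_pos
      proof eventually_elim
        case (elim \<epsilon>)
        let ?q = "\<lambda>s. of_real \<epsilon> * Q ((0 + 1 * s) / \<epsilon>)"
        have sq: "smooth_on UNIV ?q"
          by (intro smooth_on_mult smooth_on_const smooth_affine Q(1) open_UNIV)
        have qd: "(dirderiv 1 ^^ (j + 2)) ?q s = (dirderiv 1 ^^ j) \<rho> (s / \<epsilon>) / of_real \<epsilon> ^ Suc j" for s
        proof -
          have "(dirderiv 1 ^^ (j + 2)) Q = (dirderiv 1 ^^ j) \<rho>"
            by (simp only: funpow_add o_apply) (simp add: numeral_2_eq_2 Q(2))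
          then show ?thesis using elim
            by (subst funpow_dirderiv_affine[OF Q(1)]) (simp add: field_simps)
        qed
        have eq: "(dirderiv 1 ^^ j) \<rho> (f x / \<epsilon>) / of_real \<epsilon> ^ Suc j * \<phi> x =
            (dirderiv 1 ^^ j) \<rho> (f x / \<epsilon>) / of_real \<epsilon> ^ Suc j * ?\<psi> x" for x
        proof (cases "x \<in> fsupp \<phi> - W")
          case True
          have "2 * (R * \<epsilon>) < d" using elim(1) R(1) by (simp add: pos_less_divide_eq mult_ac)
          moreover have "0 < R * \<epsilon>" using elim(2) R(1) by simp
          ultimately have "R * \<epsilon> < d" by linarith
          then have "R < \<bar>f x / \<epsilon>\<bar>" using d(2)[OF True] elim by (simp add: field_simps)
          then show ?thesis by (simp add: \<rho>0)
        next
          case False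
          then show ?thesis using \<eta>(5) fsupp_eq_0[of x \<phi>] by auto
        qed
        show ?case
          unfolding eq using vadj_by_parts_funpow[OF t ft sq, of "j + 2"] unfolding qd by simp
      qed
    qed
    have "((\<lambda>\<epsilon>. \<integral>x. of_real \<epsilon> * Q (f x / \<epsilon>) * ?\<psi>' x \<partial>lborel) \<longlongrightarrow> (\<integral>x. of_real (max (f x) 0) * ?\<psi>' x \<partial>lborel)) (at_right 0)"
    proof (rule LIM_zero_cancel, rule tendsto_norm_zero_cancel)
      let ?N = "\<integral>x. norm (?\<psi>' x) \<partial>lborel"
      show "((\<lambda>\<epsilon>. norm ((\<integral>x. of_real \<epsilon> * Q (f x / \<epsilon>) * ?\<psi>' x \<partial>lborel) - (\<integral>x. of_real (max (f x) 0) * ?\<psi>' x \<partial>lborel))) \<longlongrightarrow> 0) (at_right 0)"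
      proof (rule tendsto_sandwich[OF _ _ tendsto_const])
        show "((\<lambda>\<epsilon>. C * \<epsilon> * ?N) \<longlongrightarrow> 0) (at_right 0)" by (auto intro!: tendsto_eq_intros)
        show "\<forall>\<^sub>F \<epsilon> in at_right 0. norm ((\<integral>x. of_real \<epsilon> * Q (f x / \<epsilon>) * ?\<psi>' x \<partial>lborel) -
            (\<integral>x. of_real (max (f x) 0) * ?\<psi>' x \<partial>lborel)) \<le> C * \<epsilon> * ?N"
          using eventually_right_pos
        proof eventually_elim
          case (elim \<epsilon>)
          have b: "norm (of_real \<epsilon> * Q (f x / \<epsilon>) * ?\<psi>' x - of_real (max (f x) 0) * ?\<psi>' x) \<le> C * \<epsilon> * norm (?\<psi>' x)" for x
          proof -
            have "max (f x) 0 = \<epsilon> * max (f x / \<epsilon>) 0" using elim by (simp add: max_mult_distrib_left)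
            then have "of_real \<epsilon> * Q (f x / \<epsilon>) * ?\<psi>' x - of_real (max (f x) 0) * ?\<psi>' x =
                of_real \<epsilon> * (Q (f x / \<epsilon>) - of_real (max (f x / \<epsilon>) 0)) * ?\<psi>' x"
              by (simp add: algebra_simps)
            also have "norm \<dots> = \<epsilon> * norm (Q (f x / \<epsilon>) - of_real (max (f x / \<epsilon>) 0)) * norm (?\<psi>' x)"
              using elim by (simp add: norm_mult)
            also have "\<dots> \<le> \<epsilon> * C * norm (?\<psi>' x)"
              using elim Q(3) by (intro mult_right_mono mult_left_mono) auto
            finally show ?thesis by (simp add: mult_ac)
          qed
          have "norm ((\<integral>x. of_real \<epsilon> * Q (f x / \<epsilon>) * ?\<psi>' x \<partial>lborel) - (\<integral>x. of_real (max (f x) 0) * ?\<psi>' x \<partial>lborel)) =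
              norm (\<integral>x. of_real \<epsilon> * Q (f x / \<epsilon>) * ?\<psi>' x - of_real (max (f x) 0) * ?\<psi>' x \<partial>lborel)"
            by (simp only: Bochner_Integration.integral_diff[OF iQ[OF elim] i0])
          also have "\<dots> \<le> (\<integral>x. C * \<epsilon> * norm (?\<psi>' x) \<partial>lborel)"
            by (rule order_trans[OF integral_norm_bound integral_mono[OF
                integrable_norm[OF Bochner_Integration.integrable_diff[OF iQ[OF elim] i0]]
                integrable_mult_right[OF integrable_norm[OF test_fun_integrable[OF t']]] b]])
          finally show ?case by simp
        qed
      qed auto
    qed
    then show "((\<lambda>\<epsilon>. \<integral>x. (dirderiv 1 ^^ j) \<rho> (f x / \<epsilon>) / of_real \<epsilon> ^ Suc j * \<phi> x \<partial>lborel) \<longlongrightarrow>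
        (\<integral>x. of_real (max (f x) 0) * ?\<psi>' x \<partial>lborel)) (at_right 0)"
      using ev by (rule Lim_transform_eventually)
  qed
qed

text \<open>A number that is the limit for every mollifier is determined by a single one; the given
  \<rho> serves for uniqueness in the definite description, and \<open>mollifier_limit\<close> for
  existence.\<close>

lemma pullback_delta:
  assumes nondeg: "\<And>x. f x = 0 \<Longrightarrow> \<exists>b\<in>Basis. dirderiv b f x \<noteq> 0" and \<phi>: "test_fun \<phi>"
    and \<rho>: "test_fun \<rho>" "(\<integral>s. \<rho> s \<partial>lborel) = 1"
  shows "((\<lambda>\<epsilon>. \<integral>x. (dirderiv 1 ^^ j) \<rho> (f x / \<epsilon>) / of_real \<epsilon> ^ Suc j * \<phi> x \<partial>lborel) \<longlongrightarrow> pullback (delta j) f \<phi>) (at_right 0)"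
proof -
  have g: "0 < grad2 x" if "f x = 0" for x
    using nondeg[OF that] unfolding grad2_def by (auto intro!: sum_pos2)
  obtain l where l: "\<And>\<rho>. test_fun \<rho> \<Longrightarrow> (\<integral>s. \<rho> s \<partial>lborel) = 1 \<Longrightarrow>
    ((\<lambda>\<epsilon>. \<integral>x. (dirderiv 1 ^^ j) \<rho> (f x / \<epsilon>) / of_real \<epsilon> ^ Suc j * \<phi> x \<partial>lborel) \<longlongrightarrow> l) (at_right 0)"
    using mollifier_limit[OF g \<phi>, of j] by blast
  have eq: "regular (\<lambda>x. delta j (\<lambda>s. \<rho> ((f x - s) / \<epsilon>) / complex_of_real \<epsilon>)) \<phi> =
      (\<integral>x. (dirderiv 1 ^^ j) \<rho> (f x / \<epsilon>) / of_real \<epsilon> ^ Suc j * \<phi> x \<partial>lborel)" if "test_fun \<rho>" for \<rho> \<epsilon>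
    by (simp only: regular_def delta_mollifier[OF test_fun_smooth[OF that]])
  have "pullback (delta j) f \<phi> = l"
    unfolding pullback_def
  proof (rule the_equality)
    show "\<forall>\<rho>. test_fun \<rho> \<and> (\<integral>s. \<rho> s \<partial>lborel) = 1 \<longrightarrow>
      ((\<lambda>\<epsilon>. regular (\<lambda>x. delta j (\<lambda>s. \<rho> ((f x - s) / \<epsilon>) / complex_of_real \<epsilon>)) \<phi>) \<longlongrightarrow> l) (at_right 0)"
      using l by (simp add: eq del: of_nat_Suc power_Suc)
    fix l' assume "\<forall>\<rho>. test_fun \<rho> \<and> (\<integral>s. \<rho> s \<partial>lborel) = 1 \<longrightarrow>
      ((\<lambda>\<epsilon>. regular (\<lambda>x. delta j (\<lambda>s. \<rho> ((f x - s) / \<epsilon>) / complex_of_real \<epsilon>)) \<phi>) \<longlongrightarrow> l') (at_right 0)"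
    then have "((\<lambda>\<epsilon>. \<integral>x. (dirderiv 1 ^^ j) \<rho> (f x / \<epsilon>) / of_real \<epsilon> ^ Suc j * \<phi> x \<partial>lborel) \<longlongrightarrow> l') (at_right 0)"
      using \<rho> by (simp only: eq[OF \<rho>(1), symmetric])
    then show "l' = l" by (rule tendsto_unique[OF trivial_limit_at_right_real _ l[OF \<rho>]])
  qed
  then show ?thesis using l[OF \<rho>] by simp
qed

end

section \<open>Grassmann algebras\<close>

lemmas gcoef_ring [simp] = zero_grass.rep_eq one_grass.rep_eq plus_grass.rep_eq minus_grass.rep_eq uminus_grass.rep_eq

lemma gcoef_times: "gcoef (a * b) C = (\<Sum>A\<in>Pow C. (-1) ^ inversions A (C - A) * gcoef a A * gcoef b (C - A))"
  by (simp add: times_grass.rep_eq)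

lemma gcoef_infinite: "infinite A \<Longrightarrow> gcoef a A = 0"
  using gcoef[of a] by auto

lemma grass_eqI: "(\<And>A. finite A \<Longrightarrow> gcoef a A = gcoef b A) \<Longrightarrow> a = b"
  by (metis gcoef_infinite gcoef_inject ext)

lemma gcoef_mkgrass: "gcoef (mkgrass f) A = (if finite A then f A else 0)"
  by (simp add: mkgrass.rep_eq)

lemma gcoef_gconst: "gcoef (gconst c) A = (if A = {} then c else 0)"
  by (auto simp: gconst_def gcoef_mkgrass)

lemma gcoef_gmono: "finite B \<Longrightarrow> gcoef (gmono A) B = (if B = A then 1 else 0)"
  by (simp add: gmono_def gcoef_mkgrass)

lemma gcoef_gmap: "h 0 = 0 \<Longrightarrow> gcoef (gmap h a) A = h (gcoef a A)"
  by (simp add: gmap_def gcoef_mkgrass gcoef_infinite)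

lemma gcoef_sum: "gcoef (\<Sum>i\<in>I. f i) A = (\<Sum>i\<in>I. gcoef (f i) A)"
  by (induction I rule: infinite_finite_induct) auto

lemma gcoef_gconst_times [simp]: "gcoef (gconst c * a) C = c * gcoef a C"
proof (cases "finite C")
  case True
  then have "gcoef (gconst c * a) C = (\<Sum>A\<in>{{}}. (-1) ^ inversions A (C - A) * gcoef (gconst c) A * gcoef a (C - A))"
    unfolding gcoef_times by (intro sum.mono_neutral_right) (auto simp: gcoef_gconst)
  then show ?thesis by (simp add: gcoef_gconst)
qed (simp add: gcoef_infinite)

lemma gcoef_times_gconst [simp]: "gcoef (a * gconst c) C = gcoef a C * c"
proof (cases "finite C")
  case True
  then have "gcoef (a * gconst c) C = (\<Sum>A\<in>{C}. (-1) ^ inversions A (C - A) * gcoef a A * gcoef (gconst c) (C - A))"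
    unfolding gcoef_times by (intro sum.mono_neutral_right) (auto simp: gcoef_gconst)
  then show ?thesis by (simp add: gcoef_gconst)
qed (simp add: gcoef_infinite)

lemma gconst_add: "gconst (a + b) = gconst a + gconst b"
  and gconst_mult: "gconst (a * b) = gconst a * gconst b"
  and gconst_uminus: "gconst (- a) = - gconst a"
  and gconst_diff: "gconst (a - b) = gconst a - gconst b"
  and gconst_0: "gconst 0 = 0" and gconst_1: "gconst 1 = 1"
  for a b :: "'a::ring_1"
  by (auto intro!: grass_eqI simp: gcoef_gconst)

lemma gconst_commute_gmono: "gmono A * gconst c = gconst c * gmono A"
  by (rule grass_eqI) (auto simp: gcoef_gmono)

lemma gmono_mult:
  assumes "finite A" "finite B" "A \<inter> B = {}"
  shows "gmono A * gmono B = gconst ((-1) ^ inversions A B) * gmono (A \<union> B)"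
proof (rule grass_eqI)
  fix C :: "nat set" assume C: "finite C"
  have "gcoef (gmono A * gmono B :: 'a grass) C =
      (\<Sum>D\<in>Pow C. if D = A then (-1) ^ inversions A (C - A) * (if C - A = B then 1 else 0) else 0)"
    unfolding gcoef_times using C by (intro sum.cong) (auto simp: gcoef_gmono finite_subset)
  also have "\<dots> = (if A \<subseteq> C \<and> C - A = B then (-1) ^ inversions A B else 0)"
    using C by (auto simp: sum.delta)
  also have "\<dots> = gcoef (gconst ((-1) ^ inversions A B) * gmono (A \<union> B)) C"
    using assms C by (auto simp: gcoef_gmono)
  finally show "gcoef (gmono A * gmono B) C = gcoef (gconst ((-1) ^ inversions A B) * gmono (A \<union> B) :: 'a grass) C" .
qed

lemma gmono_insert_least:
  assumes "finite A" "\<And>a. a \<in> A \<Longrightarrow> b < a"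
  shows "gmono (insert b A) = (gmono {b} * gmono A :: 'a::ring_1 grass)"
proof -
  have "{(i, j). i \<in> {b} \<and> j \<in> A \<and> j < i} = {}" using assms(2) by (auto dest: less_asym)
  then have "inversions {b} A = 0" unfolding inversions_def by (simp only: card.empty)
  moreover have "{b} \<inter> A = {}" using assms(2) by auto
  ultimately show ?thesis using gmono_mult[of "{b}" A, where 'a = 'a] assms(1) by (simp add: gconst_1)
qed

lemma grass_expand:
  assumes "\<And>A. gcoef v A \<noteq> 0 \<Longrightarrow> A \<subseteq> S" "finite S"
  shows "v = (\<Sum>A\<in>Pow S. gconst (gcoef v A) * gmono A)"
proof (rule grass_eqI)
  fix B :: "nat set" assume B: "finite B"
  have "gcoef (\<Sum>A\<in>Pow S. gconst (gcoef v A) * gmono A) B = (\<Sum>A\<in>Pow S. if A = B then gcoef v B else 0)"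
    unfolding gcoef_sum using B by (intro sum.cong) (auto simp: gcoef_gmono)
  then show "gcoef v B = gcoef (\<Sum>A\<in>Pow S. gconst (gcoef v A) * gmono A) B"
    using assms by (auto simp: sum.delta')
qed

text \<open>The grading automorphism. It carries the signs in the odd Leibniz rule, and those that
  arise when an odd element passes an arbitrary one.\<close>

definition gflip :: "'c::ring_1 grass \<Rightarrow> 'c grass" where
  "gflip a = mkgrass (\<lambda>A. (-1) ^ card A * gcoef a A)"

lemma gcoef_gflip [simp]: "gcoef (gflip a) A = (-1) ^ card A * gcoef a A"
  by (simp add: gflip_def gcoef_mkgrass gcoef_infinite)

lemma minus_one_power_commute: "x * ((-1) ^ k * y) = (-1) ^ k * (x * y)" for x y :: "'a::ring_1"
  by (cases "even k") simp_all

lemma gflip_mult: "gflip (a * b) = gflip a * gflip b"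
proof (rule grass_eqI)
  fix C :: "nat set" assume C: "finite C"
  have "(-1) ^ card C * ((-1) ^ inversions A (C - A) * gcoef a A * gcoef b (C - A)) =
      (-1) ^ inversions A (C - A) * ((-1) ^ card A * gcoef a A) * ((-1) ^ card (C - A) * gcoef b (C - A))"
    if "A \<in> Pow C" for A
  proof -
    have "card C = card A + card (C - A)" using that C by (simp add: card_Diff_subset finite_subset card_mono)
    then show ?thesis by (simp add: minus_one_power_iff)
  qed
  then show "gcoef (gflip (a * b)) C = gcoef (gflip a * gflip b) C"
    unfolding gcoef_gflip gcoef_times sum_distrib_left by (intro sum.cong) auto
qed

lemma gflip_linear:
  "gflip (a + b) = gflip a + gflip b" "gflip (a - b) = gflip a - gflip b" "gflip (- a) = - gflip a"
  "gflip 0 = 0" "gflip 1 = 1" "gflip (gconst c) = gconst c"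
  by (auto intro!: grass_eqI simp: algebra_simps gcoef_gconst)

lemma gflip_sum: "gflip (\<Sum>i\<in>I. f i) = (\<Sum>i\<in>I. gflip (f i))"
  by (induction I rule: infinite_finite_induct) (auto simp: gflip_linear)

lemma minus_one_power_twice: "(-1) ^ k * ((-1) ^ k * x) = x" for x :: "'a::ring_1"
  by (cases "even k") simp_all

lemma gflip_gflip: "gflip (gflip a) = a"
  by (rule grass_eqI) (simp add: minus_one_power_twice)

lemma gflip_gmono_single: "gflip (gmono {j}) = - gmono {j}"
  by (rule grass_eqI) (auto simp: gcoef_gmono)

section \<open>Odd derivatives\<close>

lemma gcoef_gpartial: "gcoef (gpartial j a) A =
    (if j \<in> A then 0 else (-1) ^ card {k \<in> A. k < j} * gcoef a (insert j A))"
  by (simp add: gpartial_def gcoef_mkgrass gcoef_infinite)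

lemma gpartial_linear:
  "gpartial j (a + b) = gpartial j a + gpartial j b" "gpartial j (a - b) = gpartial j a - gpartial j b"
  "gpartial j (- a) = - gpartial j a" "gpartial j 0 = 0" "gpartial j (gconst c) = 0"
  "gpartial j (a * gconst c) = gpartial j a * gconst c" "gpartial j (gconst c * a) = gconst c * gpartial j a"
  by (auto intro!: grass_eqI simp: gcoef_gpartial algebra_simps gcoef_gconst minus_one_power_commute)

lemma gpartial_sum: "gpartial j (\<Sum>i\<in>I. f i) = (\<Sum>i\<in>I. gpartial j (f i))"
  by (induction I rule: infinite_finite_induct) (auto simp: gpartial_linear)

lemma gpartial_gmono: "j \<notin> B \<Longrightarrow> gpartial j (gmono B) = 0"
  by (rule grass_eqI) (auto simp: gcoef_gpartial gcoef_gmono)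

lemma gpartial_gmono_single: "gpartial i (gmono {j}) = (if i = j then 1 else 0)"
proof (rule grass_eqI)
  fix A :: "nat set" assume "finite A"
  then have "insert i A = {j} \<and> i \<notin> A \<longleftrightarrow> A = {} \<and> i = j" by auto
  then show "gcoef (gpartial i (gmono {j})) A = gcoef (if i = j then 1 else 0 :: 'a grass) A"
    using \<open>finite A\<close> by (auto simp: gcoef_gpartial gcoef_gmono)
qed

lemma Pow_insert_sum:
  assumes "finite C" "j \<notin> C"
  shows "(\<Sum>A\<in>Pow (insert j C). f A) = (\<Sum>A\<in>Pow C. f (insert j A)) + (\<Sum>A\<in>Pow C. f A)"
proof -
  have "inj_on (insert j) (Pow C)" using assms by (intro inj_onI) (metis PowD insert_ident subsetD)
  moreover have "Pow C \<inter> insert j ` Pow C = {}" using assms by auto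
  ultimately show ?thesis using assms
    by (simp add: Pow_insert sum.union_disjoint sum.reindex add.commute)
qed

lemma card_less_greater:
  assumes "finite A" "j \<notin> A"
  shows "card A = card {k \<in> A. j < k} + card {k \<in> A. k < (j::nat)}"
proof -
  have "A = {k \<in> A. j < k} \<union> {k \<in> A. k < j}"
  proof (intro equalityI subsetI)
    fix k assume "k \<in> A"
    then have "k \<noteq> j" using assms by auto
    then show "k \<in> {k \<in> A. j < k} \<union> {k \<in> A. k < j}" using \<open>k \<in> A\<close> by auto
  qed auto
  then have "card A = card ({k \<in> A. j < k} \<union> {k \<in> A. k < j})" by (rule arg_cong)
  also have "\<dots> = card {k \<in> A. j < k} + card {k \<in> A. k < j}"
    using assms by (intro card_Un_disjoint) auto
  finally show ?thesis .
qed

lemma card_less_subset: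
  assumes "finite C" "A \<subseteq> C"
  shows "card {k \<in> C. k < j} = card {k \<in> A. k < (j::nat)} + card {k \<in> C - A. k < j}"
proof -
  have "{k \<in> C. k < j} = {k \<in> A. k < j} \<union> {k \<in> C - A. k < j}" using assms by auto
  moreover have "finite A" using assms finite_subset by blast
  ultimately show ?thesis using assms by (simp only:) (intro card_Un_disjoint; auto)
qed

text \<open>Comparison of coefficients at C. If j lies in C, the terms on the right cancel in pairs,
  A in the first product against \<open>insert j A\<close> in the second. Otherwise the subsets of
  \<open>insert j C\<close> are split according to whether they contain j, and inversions are
  counted modulo 2.\<close>

lemma gpartial_mult: "gpartial j (a * b) = gpartial j a * b + gflip a * gpartial j b"
proof (rule grass_eqI)
  fix C :: "nat set" assume C: "finite C"
  let ?l = "\<lambda>A. card {k \<in> A. k < j}"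
  show "gcoef (gpartial j (a * b)) C = gcoef (gpartial j a * b + gflip a * gpartial j b) C"
  proof (cases "j \<in> C")
    case True
    define D where "D = C - {j}"
    have D: "finite D" "j \<notin> D" "C = insert j D" using True C by (auto simp: D_def)
    have "(-1) ^ inversions A (C - A) * gcoef (gpartial j a) A * gcoef b (C - A) +
        (-1) ^ inversions (insert j A) (C - insert j A) * gcoef (gflip a) (insert j A) * gcoef (gpartial j b) (C - insert j A) = 0"
      if "A \<in> Pow D" for A
    proof -
      have A: "j \<notin> A" "finite A" "C - insert j A = D - A" "C - A = insert j (D - A)" "j \<notin> D - A"
        using that D finite_subset by auto
      have "inversions A (C - A) = inversions A {j} + inversions A (D - A)"
        using A D inversions_Un_right[of "{j}" "D - A" A] by simp
      moreover have "inversions (insert j A) (D - A) = inversions {j} (D - A) + inversions A (D - A)"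
        using A D inversions_Un_left[of "{j}" A "D - A"] by simp
      moreover have "inversions {j} (D - A) = ?l (D - A)"
        unfolding inversions_def
        by (rule bij_betw_same_card[of snd]) (auto simp: bij_betw_def inj_on_def image_iff)
      moreover have "inversions A {j} = card {k \<in> A. j < k}"
        unfolding inversions_def
        by (rule bij_betw_same_card[of fst]) (auto simp: bij_betw_def inj_on_def image_iff)
      moreover have "card A = card {k \<in> A. j < k} + ?l A"
        using A by (intro card_less_greater) auto
      ultimately have "even (inversions A (C - A) + ?l A) \<longleftrightarrow>
          odd (inversions (insert j A) (D - A) + card (insert j A) + ?l (D - A))"
        using A by auto
      then have "(-1) ^ inversions A (C - A) * gcoef (gpartial j a) A * gcoef b (C - A) =
          - ((-1) ^ inversions (insert j A) (C - insert j A) * gcoef (gflip a) (insert j A) * gcoef (gpartial j b) (C - insert j A))"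
        unfolding A(3) gcoef_gpartial gcoef_gflip A(4)[symmetric] using A(1,5) by (auto simp: minus_one_power_iff)
      then show ?thesis by simp
    qed
    moreover have "gcoef (gpartial j a) (insert j A) = 0" "gcoef (gpartial j b) (C - A) = 0" if "A \<in> Pow D" for A
      using that D by (auto simp: gcoef_gpartial)
    ultimately have "gcoef (gpartial j a * b + gflip a * gpartial j b) C = 0"
      unfolding plus_grass.rep_eq gcoef_times sum.distrib[symmetric]
      by (subst D(3), subst Pow_insert_sum[OF D(1,2)], unfold D(3)[symmetric] sum.distrib[symmetric])
         (intro sum.neutral, auto simp: add.commute)
    then show ?thesis using True by (simp add: gcoef_gpartial)
  next
    case False
    have lC: "?l C = ?l A + ?l (C - A)" if "A \<subseteq> C" for A
      by (rule card_less_subset[OF C that])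
    have 1: "(-1) ^ ?l C * ((-1) ^ inversions (insert j A) (insert j C - insert j A) * gcoef a (insert j A) * gcoef b (insert j C - insert j A)) =
        (-1) ^ inversions A (C - A) * gcoef (gpartial j a) A * gcoef b (C - A)" if "A \<in> Pow C" for A
    proof -
      have A: "j \<notin> A" "finite A" "insert j C - insert j A = C - A" using that False C finite_subset by auto
      have "inversions (insert j A) (C - A) = inversions {j} (C - A) + inversions A (C - A)"
        using A C inversions_Un_left[of "{j}" A "C - A"] by simp
      moreover have "inversions {j} (C - A) = ?l (C - A)"
        unfolding inversions_def
        by (rule bij_betw_same_card[of snd]) (auto simp: bij_betw_def inj_on_def image_iff)
      ultimately have "even (?l C + inversions (insert j A) (C - A)) \<longleftrightarrow> even (inversions A (C - A) + ?l A)"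
        using lC that by auto
      then show ?thesis unfolding A(3) using A(1) by (auto simp: gcoef_gpartial minus_one_power_iff)
    qed
    have 2: "(-1) ^ ?l C * ((-1) ^ inversions A (insert j C - A) * gcoef a A * gcoef b (insert j C - A)) =
        (-1) ^ inversions A (C - A) * gcoef (gflip a) A * gcoef (gpartial j b) (C - A)" if "A \<in> Pow C" for A
    proof -
      have A: "j \<notin> A" "j \<notin> C - A" "finite A" "insert j C - A = insert j (C - A)" using that False C finite_subset by auto
      have "inversions A (insert j (C - A)) = inversions A {j} + inversions A (C - A)"
        using A C inversions_Un_right[of "{j}" "C - A" A] by simp
      moreover have "inversions A {j} = card {k \<in> A. j < k}"
        unfolding inversions_def
        by (rule bij_betw_same_card[of fst]) (auto simp: bij_betw_def inj_on_def image_iff)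
      moreover have "card A = card {k \<in> A. j < k} + ?l A"
        using A by (intro card_less_greater) auto
      ultimately have "even (?l C + inversions A (insert j (C - A))) \<longleftrightarrow> even (inversions A (C - A) + card A + ?l (C - A))"
        using lC that by auto
      then show ?thesis unfolding A(4) using A(2) by (auto simp: gcoef_gpartial minus_one_power_iff)
    qed
    let ?f = "\<lambda>A. (-1) ^ inversions A (insert j C - A) * gcoef a A * gcoef b (insert j C - A)"
    have "gcoef (gpartial j (a * b)) C = (-1) ^ ?l C * (\<Sum>A\<in>Pow (insert j C). ?f A)"
      using False by (simp add: gcoef_gpartial gcoef_times)
    also have "\<dots> = (\<Sum>A\<in>Pow C. (-1) ^ ?l C * ?f (insert j A)) + (\<Sum>A\<in>Pow C. (-1) ^ ?l C * ?f A)"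
      unfolding Pow_insert_sum[OF C False] distrib_left sum_distrib_left ..
    also have "\<dots> = gcoef (gpartial j a * b) C + gcoef (gflip a * gpartial j b) C"
      unfolding gcoef_times by (intro arg_cong2[where f = "(+)"] sum.cong 1 2 HOL.refl)
    finally show ?thesis by simp
  qed
qed

lemma gpartial_swap: "gpartial i (gpartial j a) = - gpartial j (gpartial i a)"
proof (rule grass_eqI)
  fix A :: "nat set" assume A: "finite A"
  have c: "card {k \<in> insert i A. k < j} = card {k \<in> A. k < j} + (if i < j then 1 else 0)" if "i \<notin> A" for i j
  proof -
    have "{k \<in> insert i A. k < j} = (if i < j then insert i {k \<in> A. k < j} else {k \<in> A. k < j})" by auto
    then show ?thesis using that A by simp
  qed
  show "gcoef (gpartial i (gpartial j a)) A = gcoef (- gpartial j (gpartial i a)) A"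
  proof (cases "i \<in> A \<or> j \<in> A \<or> i = j")
    case False
    have "i < j \<or> j < i" using False by auto
    moreover have "insert j (insert i A) = insert i (insert j A)" by blast
    ultimately show ?thesis using False c[of i j] c[of j i]
      unfolding gcoef_ring gcoef_gpartial by (auto simp: minus_one_power_iff)
  qed (auto simp: gcoef_gpartial)
qed

lemma gpartial_twice: "gpartial j (gpartial j a) = 0"
  by (rule grass_eqI) (auto simp: gcoef_gpartial)

lemma gpartial_fold_uminus: "fold gpartial js (- a) = - fold gpartial js a"
  by (induction js arbitrary: a) (simp_all add: gpartial_linear)

lemma gpartial_fold_0: "fold gpartial js 0 = 0"
  by (induction js) (simp_all add: gpartial_linear)

text \<open>The odd counterpart of a derivative having integral zero: the given derivative
  anticommutes past the others until it meets its own copy, and its square is zero.\<close>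

lemma gpartial_fold_gpartial: "j \<in> set js \<Longrightarrow> fold gpartial js (gpartial j a) = 0"
proof (induction js arbitrary: a)
  case (Cons i js)
  show ?case
  proof (cases "i = j")
    case False
    then show ?thesis using Cons by (simp add: gpartial_swap[of i j] gpartial_fold_uminus)
  qed (simp add: gpartial_twice gpartial_fold_0)
qed simp

lemma gpartial_fold_linear:
  "fold gpartial js (a + b) = fold gpartial js a + fold gpartial js b"
  "fold gpartial js (gconst c * a) = gconst c * fold gpartial js a"
  by (induction js arbitrary: a b) (simp_all add: gpartial_linear)

section \<open>Changing the ring of coefficients\<close>

definition ring_hom :: "('c::ring_1 \<Rightarrow> 'd::ring_1) \<Rightarrow> bool" where
  "ring_hom h \<longleftrightarrow> h 0 = 0 \<and> h 1 = 1 \<and> (\<forall>a b. h (a + b) = h a + h b \<and> h (a * b) = h a * h b)"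

lemma ring_homD:
  assumes "ring_hom h"
  shows "h 0 = 0" "h 1 = 1" "h (a + b) = h a + h b" "h (a * b) = h a * h b" "h (- a) = - h a" "h (a - b) = h a - h b"
    "h (\<Sum>i\<in>I. f i) = (\<Sum>i\<in>I. h (f i))" "h ((-1) ^ k) = (-1) ^ k"
proof -
  show 1: "h 0 = 0" "h 1 = 1" "h (a + b) = h a + h b" "h (a * b) = h a * h b" for a b
    using assms by (auto simp: ring_hom_def)
  show 2: "h (- a) = - h a" for a using 1(3)[of "- a" a] 1(1) by (simp add: eq_neg_iff_add_eq_0)
  show "h (a - b) = h a - h b" using 1(3)[of a "- b"] 2 by simp
  show "h (\<Sum>i\<in>I. f i) = (\<Sum>i\<in>I. h (f i))" by (induction I rule: infinite_finite_induct) (auto simp: 1)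
  show "h ((-1) ^ k) = (-1) ^ k" by (cases "even k") (simp_all add: 1 2)
qed

lemma gmap_hom:
  assumes h: "ring_hom h"
  shows "gmap h (a + b) = gmap h a + gmap h b" "gmap h (a - b) = gmap h a - gmap h b" "gmap h (- a) = - gmap h a"
    "gmap h (a * b) = gmap h a * gmap h b" "gmap h 0 = 0" "gmap h 1 = 1"
    "gmap h (gconst c) = gconst (h c)" "gmap h (gmono A) = gmono A"
    "gmap h (gflip a) = gflip (gmap h a)" "gmap h (gpartial j a) = gpartial j (gmap h a)"
proof -
  note hh = ring_homD[OF h]
  note g = gcoef_gmap[of h, OF hh(1)]
  show "gmap h (a * b) = gmap h a * gmap h b"
    by (rule grass_eqI) (simp add: g gcoef_times hh mult.assoc)
  show "gmap h (a + b) = gmap h a + gmap h b" "gmap h (a - b) = gmap h a - gmap h b" "gmap h (- a) = - gmap h a"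
    "gmap h 0 = 0" "gmap h 1 = 1" "gmap h (gconst c) = gconst (h c)" "gmap h (gmono A) = gmono A"
    "gmap h (gflip a) = gflip (gmap h a)" "gmap h (gpartial j a) = gpartial j (gmap h a)"
    by (rule grass_eqI; simp add: g hh gcoef_gconst gcoef_gmono gcoef_gpartial)+
qed

lemma gmap_sum: "ring_hom h \<Longrightarrow> gmap h (\<Sum>i\<in>I. f i) = (\<Sum>i\<in>I. gmap h (f i))"
  by (induction I rule: infinite_finite_induct) (auto simp: gmap_hom)

lemma gmap_power: "ring_hom h \<Longrightarrow> gmap h (a ^ k) = gmap h a ^ k"
  by (induction k) (auto simp: gmap_hom)

lemma ring_hom_cst: "ring_hom cst"
  by (simp add: ring_hom_def cst_0 cst_1 cst_add cst_mult)

lemma ring_hom_of_real: "ring_hom complex_of_real"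
  by (simp add: ring_hom_def)

lemmas cst_hom = ring_homD[OF ring_hom_cst]
lemmas emb_hom = gmap_hom[OF ring_hom_cst]
lemmas emb_sum = gmap_sum[OF ring_hom_cst]
lemmas emb_power = gmap_power[OF ring_hom_cst]

lemma scal_hom: "scal (a + b) = scal a + scal b" "scal (a * b) = scal a * scal b" "scal (- a) = - scal a"
  "scal (a - b) = scal a - scal b" "scal 0 = 0" "scal 1 = 1"
  by (simp_all add: cst_hom gconst_add gconst_mult gconst_uminus gconst_diff gconst_0 gconst_1)

lemma scal_sum: "scal (\<Sum>i\<in>I. f i) = (\<Sum>i\<in>I. scal (f i))"
  by (induction I rule: infinite_finite_induct) (auto simp: scal_hom)

lemma scal_of_nat: "scal (of_nat k) = of_nat k"
  by (induction k) (auto simp: scal_hom)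

lemma scal_central: "a * scal c = scal c * a"
  by (rule grass_eqI) (simp add: cst_central)

lemma scal_left_commute: "a * (scal c * b) = scal c * (a * b)"
  by (metis mult.assoc scal_central)

lemma emb_gconst_commute: "emb a * gconst c = gconst c * emb a"
  by (rule grass_eqI) (simp add: gcoef_gmap cst_hom cst_central)

text \<open>Each pair from A and B is an inversion in exactly one of the two orders.\<close>

lemma inversions_swap:
  assumes "finite A" "finite B" "A \<inter> B = {}"
  shows "inversions A B + inversions B A = card A * card B"
proof -
  have "inversions B A = card {(i, j). i \<in> A \<and> j \<in> B \<and> i < j}"
    unfolding inversions_def by (rule bij_betw_same_card[of prod.swap]) (auto simp: bij_betw_def inj_on_def image_iff)
  moreover have "{(i, j). i \<in> A \<and> j \<in> B \<and> j < i} \<union> {(i, j). i \<in> A \<and> j \<in> B \<and> i < j} = A \<times> B"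
  proof (intro equalityI subsetI)
    fix p assume "p \<in> A \<times> B"
    moreover from this have "fst p \<noteq> snd p" using assms(3) by auto
    ultimately show "p \<in> {(i, j). i \<in> A \<and> j \<in> B \<and> j < i} \<union> {(i, j). i \<in> A \<and> j \<in> B \<and> i < j}"
      by (cases p) auto
  qed auto
  moreover have "finite {(i, j). i \<in> A \<and> j \<in> B \<and> j < i}" "finite {(i, j). i \<in> A \<and> j \<in> B \<and> i < j}"
    by (rule finite_subset[of _ "A \<times> B"]; use assms in force)+
  moreover have "{(i, j). i \<in> A \<and> j \<in> B \<and> j < i} \<inter> {(i, j). i \<in> A \<and> j \<in> B \<and> i < j} = {}" by auto
  ultimately show ?thesis
    using card_Un_disjoint[of "{(i, j). i \<in> A \<and> j \<in> B \<and> j < i}" "{(i, j). i \<in> A \<and> j \<in> B \<and> i < j}"]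
    by (simp add: inversions_def card_cartesian_product)
qed

text \<open>The coefficients of b may be noncommuting Clifford elements, but those of a are scalars
  and hence central. So only the Grassmann sign matters, and \<open>inversions_swap\<close> gives
  its parity.\<close>

lemma emb_commute_parity:
  assumes s: "\<And>A. gcoef a A \<noteq> 0 \<Longrightarrow> even (card A) \<longleftrightarrow> p"
  shows "emb a * b = (if p then b else gflip b) * emb a"
proof (rule grass_eqI)
  fix C :: "nat set" assume C: "finite C"
  have t: "(-1) ^ inversions A (C - A) * cst (gcoef a A) * gcoef b (C - A) =
      (-1) ^ inversions (C - A) A * gcoef (if p then b else gflip b) (C - A) * cst (gcoef a A)" if A: "A \<subseteq> C" for A
  proof (cases "gcoef a A = 0")
    case False
    have "inversions A (C - A) + inversions (C - A) A = card A * card (C - A)"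
      using A C by (intro inversions_swap) (auto intro: finite_subset)
    then have "even (inversions A (C - A)) \<longleftrightarrow> even (inversions (C - A) A + (if p then 0 else card (C - A)))"
    proof -
      assume "inversions A (C - A) + inversions (C - A) A = card A * card (C - A)"
      then have "even (inversions A (C - A) + inversions (C - A) A) \<longleftrightarrow> even (card A * card (C - A))"
        by (simp only:)
      then show ?thesis using s[OF False] by (cases p) auto
    qed
    then show ?thesis by (cases p) (auto simp: minus_one_power_iff cst_central)
  qed (simp add: cst_hom)
  have "gcoef (emb a * b) C = (\<Sum>A\<in>Pow C. (-1) ^ inversions (C - A) A * gcoef (if p then b else gflip b) (C - A) * cst (gcoef a A))"
    unfolding gcoef_times by (intro sum.cong) (auto simp: t gcoef_gmap cst_hom)
  also have "\<dots> = gcoef ((if p then b else gflip b) * emb a) C"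
    unfolding gcoef_times
    by (rule sum.reindex_bij_witness[of _ "\<lambda>A. C - A" "\<lambda>A. C - A"]) (auto simp: double_diff gcoef_gmap cst_hom)
  finally show "gcoef (emb a * b) C = gcoef ((if p then b else gflip b) * emb a) C" .
qed

lemma emb_even_central:
  assumes "gflip a = a" shows "emb a * b = b * emb a"
proof -
  have "even (card A)" if "gcoef a A \<noteq> 0" for A
    using arg_cong[OF assms, of "\<lambda>a. gcoef a A"] that by (cases "even (card A)") auto
  with emb_commute_parity[of a True b] show ?thesis by auto
qed

lemma emb_odd_commute:
  assumes "gflip a = - a" shows "emb a * b = gflip b * emb a"
proof -
  have "\<not> even (card A)" if "gcoef a A \<noteq> 0" for A
    using arg_cong[OF assms, of "\<lambda>a. gcoef a A"] that by (cases "even (card A)") auto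
  with emb_commute_parity[of a False b] show ?thesis by auto
qed

lemma gcoef_power_degree:
  assumes a: "\<And>A. gcoef a A \<noteq> 0 \<Longrightarrow> A \<subseteq> S \<and> d \<le> card A"
  shows "gcoef (a ^ k) A \<noteq> 0 \<Longrightarrow> finite A \<Longrightarrow> A \<subseteq> S \<and> d * k \<le> card A"
proof (induction k arbitrary: A)
  case (Suc k)
  then have "(\<Sum>B\<in>Pow A. (-1) ^ inversions B (A - B) * gcoef a B * gcoef (a ^ k) (A - B)) \<noteq> 0"
    by (simp add: gcoef_times)
  then obtain B where B: "B \<in> Pow A" "(-1) ^ inversions B (A - B) * gcoef a B * gcoef (a ^ k) (A - B) \<noteq> 0"
    by (meson sum.neutral)
  then have "gcoef a B \<noteq> 0" "gcoef (a ^ k) (A - B) \<noteq> 0" by auto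
  then have "B \<subseteq> S \<and> d \<le> card B" "A - B \<subseteq> S \<and> d * k \<le> card (A - B)" using a Suc by auto
  moreover have "card A = card B + card (A - B)" using B(1) Suc.prems(2) by (simp add: card_Diff_subset finite_subset card_mono)
  ultimately show ?case by auto
qed (auto split: if_splits)

lemma nilpotent_degree:
  assumes a: "\<And>A. gcoef a A \<noteq> 0 \<Longrightarrow> A \<subseteq> S \<and> d \<le> card A" and S: "finite S" "card S < d * k"
  shows "a ^ k = 0"
proof (rule grass_eqI)
  fix A :: "nat set" assume "finite A"
  then show "gcoef (a ^ k) A = gcoef 0 A"
    using gcoef_power_degree[of a S d k A, OF a] S card_mono[of S A] by fastforce
qed

section \<open>The Clifford-Weyl generators\<close>

definition acomm :: "'a::ring_1 \<Rightarrow> 'a \<Rightarrow> 'a" where "acomm x y = x * y + y * x"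
definition comm :: "'a::ring_1 \<Rightarrow> 'a \<Rightarrow> 'a" where "comm x y = x * y - y * x"

lemma acomm_bilinear:
  "acomm (x + x') y = acomm x y + acomm x' y" "acomm x (y + y') = acomm x y + acomm x y'"
  "acomm (x - x') y = acomm x y - acomm x' y" "acomm x (y - y') = acomm x y - acomm x y'"
  "comm (x + x') y = comm x y + comm x' y" "comm x (y + y') = comm x y + comm x y'"
  "comm (x - x') y = comm x y - comm x' y" "comm x (y - y') = comm x y - comm x y'"
  "acomm (- x) y = - acomm x y" "acomm x (- y) = - acomm x y" "comm (- x) y = - comm x y" "comm x (- y) = - comm x y"
  "acomm (gconst x) (gconst y) = gconst (acomm x y)" "comm (gconst x) (gconst y) = gconst (comm x y)"
  by (simp_all add: acomm_def comm_def algebra_simps gconst_add gconst_diff gconst_mult)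

lemma cst_left_commute: "a * (cst c * b) = cst c * (a * b)"
proof -
  have "a * (cst c * b) = (a * cst c) * b" by (simp only: mult.assoc)
  also have "\<dots> = cst c * (a * b)" by (simp only: cst_central[symmetric] mult.assoc)
  finally show ?thesis .
qed

lemma acomm_cst:
  "acomm (cst c * x) y = cst c * acomm x y" "acomm x (cst c * y) = cst c * acomm x y"
  "comm (cst c * x) y = cst c * comm x y" "comm x (cst c * y) = cst c * comm x y"
  by (simp_all add: acomm_def comm_def distrib_left right_diff_distrib mult.assoc cst_left_commute)

lemma acomm_gens:
  "acomm (orth_gen i) (orth_gen j) = cst (if i = j then - 2 else 0)"
  "acomm (orth_gen i) (symp_gen k) = cst 0" "acomm (symp_gen k) (orth_gen i) = cst 0"
  "comm (symp_gen k) (symp_gen l) = cst (symp_form k l)"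
proof -
  have "cst (- 2) + (cst 1 + cst 1) = (cst 0 :: 'a cliff)"
    by (simp only: cst_add[symmetric]) simp
  then have "cst (- 2) = (- 2 :: 'a cliff)"
    by (simp add: cst_0 cst_1 eq_neg_iff_add_eq_0)
  then show "acomm (orth_gen i) (orth_gen j) = (cst (if i = j then - 2 else 0) :: 'a cliff)"
    by (simp add: acomm_def orth_orth cst_0)
  show "acomm (orth_gen i) (symp_gen k) = cst 0" "acomm (symp_gen k) (orth_gen i) = cst 0"
    using orth_symp[of i k] by (simp_all add: acomm_def cst_0 add.commute)
  show "comm (symp_gen k) (symp_gen l) = cst (symp_form k l)"
    by (simp add: comm_def symp_symp)
qed

lemma symp_form_pairs:
  assumes "1 \<le> j" "1 \<le> k"
  shows "symp_form (2 * j - Suc 0) (2 * k - Suc 0) = 0" "symp_form (2 * j) (2 * k) = 0"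
    "symp_form (2 * j - Suc 0) (2 * k) = (if j = k then 1 else 0)" "symp_form (2 * j) (2 * k - Suc 0) = (if j = k then - 1 else 0)"
  using assms by (auto simp: symp_form_def) presburger+

lemmas cst_collect = cst_mult[symmetric] cst_add[symmetric] cst_hom(6)[symmetric] cst_hom(5)[symmetric]

text \<open>A Witt basis: two isotropic families in duality. The factors 1/2 and the sign of
  \<open>ff_dag\<close> make the dual pairs anticommute to 1.\<close>

lemma ff_relations:
  "acomm (ff j) (ff k) = 0" "acomm (ff_dag j) (ff_dag k) = 0"
  "acomm (ff j) (ff_dag k) = scal (if j = k then 1 else 0)"
  by (simp_all add: ff_def ff_dag_def acomm_bilinear acomm_cst acomm_gens cst_collect)
     (simp_all add: cst_hom gconst_0)

text \<open>The symplectic counterpart, with commutators. The value -i/2 is the coefficient with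
  which the odd variables enter |Z|^2.\<close>

lemma fs_relations:
  assumes "1 \<le> j" "1 \<le> k"
  shows "comm (fs j) (fs k) = 0" "comm (fs_dag j) (fs_dag k) = 0"
    "comm (fs j) (fs_dag k) = scal (if j = k then - \<i> / 2 else 0)"
  by (simp_all add: fs_def fs_dag_def acomm_bilinear acomm_cst acomm_gens symp_form_pairs[OF assms] symp_form_pairs[OF assms(2) assms(2)] cst_collect)
     (simp_all add: cst_hom gconst_0)

lemma mixed_relations:
  "acomm (ff j) (fs k) = 0" "acomm (ff j) (fs_dag k) = 0" "acomm (ff_dag j) (fs k) = 0" "acomm (ff_dag j) (fs_dag k) = 0"
  by (simp_all add: ff_def ff_dag_def fs_def fs_dag_def acomm_bilinear acomm_cst acomm_gens cst_collect)
     (simp_all add: cst_hom gconst_0)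

section \<open>Odd variables and the Berezin integral\<close>

lemma double_eq_0: "x + x = 0 \<Longrightarrow> x = 0" for x :: "'m::finite cgrass"
proof -
  assume "x + x = 0"
  moreover have "scal (1/2) + scal (1/2) = (1 :: 'm cgrass)"
    by (simp only: scal_hom(1)[symmetric]) (simp add: scal_hom)
  then have "scal (1/2) * (x + x) = x" by (simp only: distrib_left distrib_right[symmetric] mult_1_left)
  ultimately show ?thesis by simp
qed

text \<open>The odd coordinates of Z - U.\<close>

definition theta :: "nat \<Rightarrow> nat \<Rightarrow> complex grass" where
  "theta n j = gmono {j} - gmono {2 * n + j}"

definition et :: "nat \<Rightarrow> nat \<Rightarrow> 'm::finite cgrass" where
  "et n j = emb (theta n j)"

lemma gflip_et: "gflip (et n j) = - et n j"
  by (simp add: et_def theta_def emb_hom gflip_linear gflip_gmono_single)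

lemma gmono_single_commute: "gmono {j} * b = gflip b * gmono {j}" for b :: "'m::finite cgrass"
  using emb_odd_commute[of "gmono {j}" b] by (simp add: gflip_gmono_single emb_hom)

lemma et_commute: "et n j * b = gflip b * et n j"
  unfolding et_def
  by (rule emb_odd_commute) (simp add: theta_def gflip_linear gflip_gmono_single)

lemma et_square: "et n j * et n j = 0"
proof (rule double_eq_0)
  have "et n j * et n j = - (et n j * et n j)"
    by (subst (1) et_commute) (simp only: gflip_et mult_minus_left)
  then show "et n j * et n j + et n j * et n j = 0" by (simp only: eq_neg_iff_add_eq_0)
qed

lemma et_anticommute: "et n i * et n j = - (et n j * et n i)"
  by (subst et_commute) (simp only: gflip_et mult_minus_left)

lemma gpartial_et:
  "i \<in> {1..2 * n} \<Longrightarrow> j \<in> {1..2 * n} \<Longrightarrow> gpartial i (et n j) = (if i = j then 1 else 0)"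
  by (auto simp: et_def theta_def emb_hom gpartial_linear gpartial_gmono_single)

definition et_prod :: "nat \<Rightarrow> nat list \<Rightarrow> 'm::finite cgrass" where
  "et_prod n js = prod_list (map (et n) js)"

lemma et_prod_Cons: "et_prod n (j # js) = et n j * et_prod n js"
  by (simp add: et_prod_def)

lemma et_prod_mult_member: "j \<in> set js \<Longrightarrow> et_prod n js * et n j = 0"
proof (induction js)
  case (Cons i js)
  show ?case
  proof (cases "j \<in> set js")
    case True
    then show ?thesis using Cons by (simp add: et_prod_def mult.assoc)
  next
    case False
    then have "i = j" using Cons.prems by simp
    have eq: "et_prod n js * et n j = et n j * gflip (et_prod n js)"
      by (simp only: et_commute[of n j "gflip (et_prod n js)"] gflip_gflip)
    have "et_prod n (i # js) * et n j = et n j * et n j * gflip (et_prod n js)"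
      by (simp only: \<open>i = j\<close> et_prod_Cons mult.assoc eq)
    then show ?thesis by (simp add: et_square)
  qed
qed simp

lemma gpartial_et_prod_0:
  assumes "i \<in> {1..2 * n}" "gpartial i w = 0"
  shows "i \<notin> set js \<Longrightarrow> set js \<subseteq> {1..2 * n} \<Longrightarrow> gpartial i (et_prod n js * w) = 0"
proof (induction js)
  case (Cons j js)
  have "gpartial i (et n j * (et_prod n js * w)) = 0"
    using Cons assms by (simp add: gpartial_mult[of i "et n j"] gpartial_linear gpartial_et)
  then show ?case by (simp add: et_prod_def mult.assoc)
qed (simp add: et_prod_def assms)

text \<open>The derivative that is applied first belongs to the leftmost factor, so differentiation
  removes the factors in order and no sign appears.\<close>

lemma fold_gpartial_et_prod:
  "distinct js \<Longrightarrow> set js \<subseteq> {1..2 * n} \<Longrightarrow> (\<And>i. i \<in> set js \<Longrightarrow> gpartial i w = 0) \<Longrightarrow>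
    fold gpartial js (et_prod n js * w) = w"
proof (induction js)
  case (Cons j js)
  have "gpartial j (et n j * (et_prod n js * w)) = et_prod n js * w"
    using Cons.prems by (simp add: gpartial_mult[of j "et n j"] gpartial_et gpartial_et_prod_0)
  then have "gpartial j (et_prod n (j # js) * w) = et_prod n js * w" by (simp add: et_prod_def mult.assoc)
  then show ?case using Cons by simp
qed (simp add: et_prod_def)

section \<open>Pairs of odd variables and the odd delta function\<close>

definition et_pair :: "nat \<Rightarrow> nat \<Rightarrow> 'm::finite cgrass" where
  "et_pair n j = et n (2 * j - 1) * et n (2 * j)"

lemma et_pair_commute: "et_pair n j * b = b * et_pair n j"
  using et_commute[of n "2 * j" b] et_commute[of n "2 * j - 1" "gflip b"]
  by (simp add: et_pair_def mult.assoc gflip_gflip) (simp flip: mult.assoc)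

lemma et_pair_square: "et_pair n j * et_pair n j = 0"
proof -
  have "et_pair n j * et_pair n j = et n (2 * j - 1) * (et n (2 * j) * et_pair n j)"
    by (simp add: et_pair_def mult.assoc)
  also have "et n (2 * j) * et_pair n j = et_pair n j * et n (2 * j)" by (rule et_pair_commute[symmetric])
  also have "\<dots> = 0" by (simp add: et_pair_def mult.assoc et_square)
  finally show ?thesis by simp
qed

lemma et_prod_Suc: "et_prod n [1..<2 * Suc k + 1] = et_prod n [1..<2 * k + 1] * et_pair n (Suc k)"
proof -
  have "[1..<2 * Suc k + 1] = [1..<2 * k + 1] @ [2 * k + 1, 2 * k + 2]"
    by (simp add: upt_rec[of "Suc (2 * k)"])
  then show ?thesis by (simp add: et_prod_def et_pair_def)
qed

lemma gflip_et_prod: "gflip (et_prod n [1..<2 * k + 1]) = et_prod n [1..<2 * k + 1]"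
proof (induction k)
  case (Suc k)
  show ?case unfolding et_prod_Suc gflip_mult Suc by (simp add: et_pair_def gflip_mult gflip_et)
qed (simp add: et_prod_def gflip_linear)

lemma power_add_square_zero:
  fixes S q :: "'a::ring_1"
  assumes c: "\<And>b. q * b = b * q" and q: "q * q = 0"
  shows "(S + q) ^ Suc p = S ^ Suc p + of_nat (Suc p) * (S ^ p * q)"
proof (induction p)
  case (Suc p)
  have "q * (of_nat (Suc p) * (S ^ p * q)) = of_nat (Suc p) * (S ^ p * q) * q" by (rule c)
  also have "\<dots> = of_nat (Suc p) * (S ^ p * (q * q))" by (simp only: mult.assoc)
  finally have qS: "q * S ^ Suc p = S ^ Suc p * q" "q * (of_nat (Suc p) * (S ^ p * q)) = of_nat (Suc p) * (S ^ p * (q * q))"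
    using c[of "S ^ Suc p"] by blast+
  have "(S + q) ^ Suc (Suc p) = S * (S + q) ^ Suc p + q * (S + q) ^ Suc p"
    by (simp add: distrib_right)
  also have "\<dots> = S * S ^ Suc p + S * (of_nat (Suc p) * (S ^ p * q)) + (S ^ Suc p * q + 0)"
    unfolding Suc distrib_left qS by (simp only: q mult_zero_right)
  also have "S * (of_nat (Suc p) * (S ^ p * q)) = of_nat (Suc p) * (S ^ Suc p * q)"
    by (simp only: mult.assoc[symmetric] mult_of_nat_commute[symmetric] power_Suc)
  finally show ?case by (simp add: algebra_simps)
qed simp

text \<open>The pairs are central with square zero, so in the k-th power of a sum of k pairs only
  the k! orderings of the full product survive, and the next power is zero.\<close>

lemma et_pair_sum_power:
  "(\<Sum>j=1..k. et_pair n j :: 'm::finite cgrass) ^ k = of_nat (fact k) * et_prod n [1..<2 * k + 1] \<and>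
    (\<Sum>j=1..k. et_pair n j :: 'm::finite cgrass) ^ Suc k = 0"
proof (induction k)
  case (Suc k)
  let ?S = "\<Sum>j=1..k. et_pair n j :: 'm cgrass" and ?q = "et_pair n (Suc k) :: 'm cgrass"
  have e: "(\<Sum>j=1..Suc k. et_pair n j) = ?S + ?q" by simp
  note p = power_add_square_zero[of ?q ?S, OF et_pair_commute et_pair_square]
  note IH1 = conjunct1[OF Suc] and IH2 = conjunct2[OF Suc]
  have f: "of_nat (fact (Suc k)) = (of_nat (Suc k) * of_nat (fact k) :: 'm cgrass)"
    by (simp only: fact_Suc of_nat_mult of_nat_id)
  have "(?S + ?q) ^ Suc k = of_nat (fact (Suc k)) * et_prod n [1..<2 * Suc k + 1]"
    unfolding p et_prod_Suc f IH1 IH2 by (simp only: mult.assoc add_0_left)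
  moreover have "?S ^ Suc (Suc k) = 0" by (subst power_Suc) (simp only: IH2 mult_zero_right)
  then have "(?S + ?q) ^ Suc (Suc k) = 0"
    unfolding p IH2 by (simp only: mult_zero_left mult_zero_right add_0_left)
  ultimately show ?case unfolding e by blast
qed (simp add: et_prod_def)

text \<open>Up to normalisation the odd delta function at y, the product of all differences of odd
  coordinates.\<close>

definition berezin_top :: "nat \<Rightarrow> 'm::finite cgrass" where
  "berezin_top n = et_prod n [1..<2 * n + 1]"

text \<open>The product of all differences is annihilated by each single difference, so next to it
  an odd coordinate of x may be exchanged for that of y. In a monomial this is done factor by
  factor, using that the product is even and commutes with the factors already exchanged.\<close>

lemma berezin_top_at_y:
  fixes v :: "'m::finite cgrass"
  assumes v: "\<And>A. gcoef v A \<noteq> 0 \<Longrightarrow> A \<subseteq> {1..2 * n}"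
  shows "berezin_top n * v = berezin_top n * at_y n v"
proof -
  let ?T = "berezin_top n :: 'm cgrass"
  have s: "?T * gmono {j} = ?T * gmono {2 * n + j}" if "j \<in> {1..2 * n}" for j
  proof -
    have "?T * et n j = 0" unfolding berezin_top_def by (rule et_prod_mult_member) (use that in auto)
    then show ?thesis by (simp add: et_def theta_def emb_hom right_diff_distrib)
  qed
  have m: "?T * gmono A = ?T * gmono ((+) (2 * n) ` A)" if "finite A" "A \<subseteq> {1..2 * n}" for A
    using that
  proof (induction A rule: finite_linorder_min_induct)
    case (insert b A)
    have c: "gmono {2 * n + b} * ?T = ?T * gmono {2 * n + b}"
      unfolding gmono_single_commute[of "2 * n + b" ?T] by (simp only: berezin_top_def gflip_et_prod)
    have "?T * gmono (insert b A) = ?T * gmono {b} * gmono A"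
      using insert by (simp add: gmono_insert_least mult.assoc)
    also have "\<dots> = ?T * gmono {2 * n + b} * gmono A" using s insert by simp
    also have "\<dots> = gmono {2 * n + b} * (?T * gmono A)" by (simp only: c[symmetric] mult.assoc)
    also have "\<dots> = gmono {2 * n + b} * ?T * gmono ((+) (2 * n) ` A)" using insert by (simp add: mult.assoc)
    also have "\<dots> = ?T * (gmono {2 * n + b} * gmono ((+) (2 * n) ` A))" by (simp only: c mult.assoc)
    also have "gmono {2 * n + b} * gmono ((+) (2 * n) ` A) = gmono ((+) (2 * n) ` insert b A)"
      unfolding image_insert by (rule gmono_insert_least[symmetric]) (use insert in auto)
    finally show ?case .
  qed simp
  have "?T * v = ?T * (\<Sum>A\<in>Pow {1..2 * n}. gconst (gcoef v A) * gmono A)"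
    using grass_expand[of v "{1..2 * n}"] v by simp
  also have "\<dots> = ?T * (\<Sum>A\<in>Pow {1..2 * n}. gmono A * gconst (gcoef v A))"
    by (simp only: gconst_commute_gmono)
  also have "\<dots> = ?T * (\<Sum>A\<in>Pow {1..2 * n}. gmono ((+) (2 * n) ` A) * gconst (gcoef v A))"
    unfolding sum_distrib_left mult.assoc[symmetric]
    by (intro sum.cong HOL.refl arg_cong2[where f = "(*)"] m) (auto intro: finite_subset)
  also have "\<dots> = ?T * at_y n v" by (simp only: gconst_commute_gmono at_y_def)
  finally show ?thesis .
qed

text \<open>After the exchange of variables, v contains only coordinates of y, which the odd
  derivatives treat as constants.\<close>

lemma fold_gpartial_berezin_top:
  fixes v :: "'m::finite cgrass"
  assumes v: "\<And>A. gcoef v A \<noteq> 0 \<Longrightarrow> A \<subseteq> {1..2 * n}"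
  shows "fold gpartial [1..<2 * n + 1] (berezin_top n * v) = at_y n v"
proof (subst berezin_top_at_y[OF v], assumption, unfold berezin_top_def, rule fold_gpartial_et_prod)
  fix i assume "i \<in> set [1..<2 * n + 1]"
  then have "i \<notin> (+) (2 * n) ` A" if "A \<in> Pow {1..2 * n}" for A using that by force
  then show "gpartial i (at_y n v) = 0"
    unfolding at_y_def gpartial_sum by (intro sum.neutral ballI) (simp add: gpartial_linear gpartial_gmono)
qed auto

lemma berezin_linear:
  "berezin n (a + b) = berezin n a + berezin n b" "berezin n (scal c * a) = scal c * berezin n a"
  by (simp_all only: berezin_def gpartial_fold_linear distrib_left scal_left_commute[of "scal c"])

lemma berezin_gpartial: "j \<in> {1..2 * n} \<Longrightarrow> berezin n (gpartial j a) = 0"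
  by (simp add: berezin_def gpartial_fold_gpartial del: upt_Suc)

section \<open>The vector variables\<close>

lemma emb_zs: "emb (zs (theta n) j) = et n (2 * j - 1) + scal \<i> * et n (2 * j)"
  and emb_zs_conj: "emb (zs_conj (theta n) j) = et n (2 * j - 1) - scal \<i> * et n (2 * j)"
  by (simp_all add: zs_def zs_conj_def emb_hom et_def)

lemma gflip_zs: "gflip (emb (zs (theta n) j)) = - emb (zs (theta n) j)"
  and gflip_zs_conj: "gflip (emb (zs_conj (theta n) j)) = - emb (zs_conj (theta n) j)"
  by (simp_all add: emb_zs emb_zs_conj gflip_linear gflip_mult gflip_et)

lemma zs_commute: "emb (zs (theta n) j) * b = gflip b * emb (zs (theta n) j)"
  and zs_conj_commute: "emb (zs_conj (theta n) j) * b = gflip b * emb (zs_conj (theta n) j)"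
  by (simp_all add: emb_zs emb_zs_conj distrib_right distrib_left left_diff_distrib right_diff_distrib
      mult.assoc et_commute scal_left_commute)

text \<open>The nilpotent part of |Z - U|^2 in real odd coordinates; \<open>nil_norm_eq\<close>
  compares it with the form in complex coordinates.\<close>

definition nil_norm :: "nat \<Rightarrow> 'm::finite cgrass" where
  "nil_norm n = - (\<Sum>j=1..n. et_pair n j)"

lemma zs_zs_conj: "scal (- \<i> / 2) * (emb (zs (theta n) j) * emb (zs_conj (theta n) j)) = - (et_pair n j :: 'm::finite cgrass)"
proof -
  let ?a = "et n (2 * j - 1) :: 'm cgrass" and ?b = "et n (2 * j) :: 'm cgrass"
  have "emb (zs (theta n) j) * (emb (zs_conj (theta n) j) :: 'm cgrass) = ?a * ?a - scal \<i> * (?a * ?b) + scal \<i> * (?b * ?a) - scal \<i> * (scal \<i> * (?b * ?b))"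
    by (simp add: emb_zs emb_zs_conj distrib_right distrib_left left_diff_distrib right_diff_distrib
        mult.assoc scal_left_commute[where a = "et n k" for k])
  also have "\<dots> = - (scal \<i> * et_pair n j) - scal \<i> * et_pair n j"
    by (simp only: et_anticommute[of n "2 * j" "2 * j - 1"] et_square et_pair_def) simp
  also have "\<dots> = scal (- 2 * \<i>) * et_pair n j"
  proof -
    have "scal (- 2 * \<i>) = - scal \<i> - (scal \<i> :: 'm cgrass)"
      by (simp only: scal_hom(3,4)[symmetric]) (rule arg_cong[where f = scal], simp)
    then show ?thesis by (simp only: left_diff_distrib mult_minus_left)
  qed
  finally have "scal (- \<i> / 2) * (emb (zs (theta n) j) * emb (zs_conj (theta n) j) :: 'm cgrass) =
      scal (- \<i> / 2 * (- 2 * \<i>)) * et_pair n j"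
    by (simp only: mult.assoc[symmetric] scal_hom(2))
  then show ?thesis by (simp add: scal_hom)
qed

lemma nil_norm_eq: "nil_norm n = scal (- \<i> / 2) * (\<Sum>j=1..n. emb (zs (theta n) j) * emb (zs_conj (theta n) j))"
  by (simp only: nil_norm_def sum_distrib_left zs_zs_conj sum_negf)

lemma nil_norm_commute: "nil_norm n * b = b * nil_norm n"
  by (simp add: nil_norm_def sum_distrib_left sum_distrib_right et_pair_commute)

text \<open>The signs of the n pairs and their n! orderings give the factor. It cancels later
  against the sign and the factorial of the n-th Taylor coefficient of the kernel.\<close>

lemma nil_norm_power: "nil_norm n ^ n = (scal ((-1) ^ n * fact n) * berezin_top n :: 'm::finite cgrass)"
  and nil_norm_power_Suc: "nil_norm n ^ Suc n = (0 :: 'm cgrass)"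
proof -
  let ?S = "\<Sum>j=1..n. et_pair n j :: 'm cgrass"
  have "nil_norm n ^ n = (-1) ^ n * ?S ^ n" "nil_norm n ^ Suc n = (-1) ^ Suc n * ?S ^ Suc n"
    unfolding nil_norm_def by (rule power_minus)+
  moreover have "(-1) ^ n * (of_nat (fact n) * a) = scal ((-1) ^ n * fact n) * a" for a :: "'m cgrass"
    by (cases "even n") (simp_all add: scal_hom flip: scal_of_nat)
  ultimately show "nil_norm n ^ n = scal ((-1) ^ n * fact n) * (berezin_top n :: 'm cgrass)"
    "nil_norm n ^ Suc n = (0 :: 'm cgrass)"
    using et_pair_sum_power[of n n, where 'm = 'm] by (simp_all only: berezin_top_def mult_zero_right)
qed

lemma body_zs: "gcoef (zs (theta n) j * zs_conj (theta n) j) {} = 0"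
  by (simp add: gcoef_times zs_def theta_def gcoef_gmono)

lemma normsq_body: "gcoef (normsq n x (theta n)) {} = (\<Sum>j\<in>UNIV. zc x j * cnj (zc x j))"
  by (simp add: normsq_def gcoef_gconst gcoef_sum body_zs)

lemma emb_nilpart_normsq: "emb (nilpart (normsq n x (theta n))) = nil_norm n"
  and emb_normsq: "emb (normsq n x (theta n)) = scal (\<Sum>j\<in>UNIV. zc x j * cnj (zc x j)) + nil_norm n"
  by (simp_all add: nilpart_def body_def normsq_body)
     (simp_all add: normsq_def emb_hom emb_sum nil_norm_eq scal_hom)

lemma acomm_sum: "acomm (\<Sum>i\<in>I. f i) b = (\<Sum>i\<in>I. acomm (f i) b)" "acomm b (\<Sum>i\<in>I. f i) = (\<Sum>i\<in>I. acomm b (f i))"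
  by (simp_all add: acomm_def sum_distrib_left sum_distrib_right sum.distrib)

lemma acomm_scal: "acomm (scal c * a) b = scal c * acomm a b" "acomm a (scal c * b) = scal c * acomm a b"
  by (simp_all add: acomm_def distrib_left mult.assoc scal_left_commute)

lemma acomm_even_odd:
  assumes "p * emb a = emb a * p" "acomm p q = 0"
  shows "acomm p (emb a * q) = 0" "acomm (emb a * q) p = 0"
proof -
  have "p * (emb a * q) = emb a * (p * q)" by (simp only: mult.assoc[symmetric] assms)
  then have "acomm p (emb a * q) = emb a * acomm p q" "acomm (emb a * q) p = emb a * acomm p q"
    by (simp_all add: acomm_def distrib_left mult.assoc add.commute)
  then show "acomm p (emb a * q) = 0" "acomm (emb a * q) p = 0" using assms by simp_all
qed

text \<open>Anticommuting coefficients turn a commutator into an anticommutator. Hence the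
  commutation relations of the symplectic generators make odd directions behave like the orthogonal
  ones.\<close>

lemma acomm_odd_odd:
  fixes p q :: "'m::finite cgrass"
  assumes "emb b * emb a = - (emb a * emb b :: 'm cgrass)" "p * emb b = emb b * p" "q * emb a = emb a * q"
  shows "acomm (emb a * p) (emb b * q) = emb a * emb b * comm p q"
proof -
  have "emb a * p * (emb b * q) = emb a * (p * emb b) * q" by (simp only: mult.assoc)
  also have "\<dots> = emb a * emb b * (p * q)" by (simp only: assms(2) mult.assoc)
  finally have 1: "emb a * p * (emb b * q) = emb a * emb b * (p * q)" .
  have "emb b * q * (emb a * p) = emb b * (q * emb a) * p" by (simp only: mult.assoc)
  also have "\<dots> = emb b * emb a * (q * p)" by (simp only: assms(3) mult.assoc)
  also have "\<dots> = - (emb a * emb b * (q * p))" by (simp add: assms(1))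
  finally show ?thesis using 1 by (simp add: acomm_def comm_def right_diff_distrib)
qed

lemma gens_emb_commute:
  "ff j * emb a = emb a * ff j" "ff_dag j * emb a = emb a * ff_dag j" "fs k * emb a = emb a * fs k" "fs_dag k * emb a = emb a * fs_dag k"
  by (simp_all only: ff_def ff_dag_def fs_def fs_dag_def emb_gconst_commute)

lemma odd_anticommute:
  "emb (zs (theta n) k) * emb (zs (theta n) j) = - (emb (zs (theta n) j) * emb (zs (theta n) k))"
  "emb (zs_conj (theta n) k) * emb (zs (theta n) j) = - (emb (zs (theta n) j) * emb (zs_conj (theta n) k))"
  "emb (zs_conj (theta n) k) * emb (zs_conj (theta n) j) = - (emb (zs_conj (theta n) j) * emb (zs_conj (theta n) k))"
  using zs_commute[of n k "emb (zs (theta n) j)"] zs_conj_commute[of n k "emb (zs (theta n) j)"]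
    zs_conj_commute[of n k "emb (zs_conj (theta n) j)"]
  by (simp_all add: gflip_zs gflip_zs_conj)

lemma mixed_acomm:
  "acomm (ff j) (emb a * fs k) = 0" "acomm (emb a * fs k) (ff j) = 0"
  "acomm (ff j) (emb a * fs_dag k) = 0" "acomm (emb a * fs_dag k) (ff j) = 0"
  "acomm (ff_dag j) (emb a * fs k) = 0" "acomm (emb a * fs k) (ff_dag j) = 0"
  "acomm (ff_dag j) (emb a * fs_dag k) = 0" "acomm (emb a * fs_dag k) (ff_dag j) = 0"
  by (rule acomm_even_odd[OF gens_emb_commute(1) mixed_relations(1)] acomm_even_odd[OF gens_emb_commute(1) mixed_relations(2)]
      acomm_even_odd[OF gens_emb_commute(2) mixed_relations(3)] acomm_even_odd[OF gens_emb_commute(2) mixed_relations(4)])+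

lemma odd_acomm:
  assumes "1 \<le> j" "1 \<le> k"
  shows "acomm (emb (zs (theta n) j) * fs j) (emb (zs (theta n) k) * fs k) = 0"
    "acomm (emb (zs_conj (theta n) j) * fs_dag j) (emb (zs_conj (theta n) k) * fs_dag k) = 0"
    "acomm (emb (zs (theta n) j) * fs j) (emb (zs_conj (theta n) k) * fs_dag k) =
       (if j = k then scal (- \<i> / 2) * (emb (zs (theta n) j) * emb (zs_conj (theta n) j)) else 0)"
proof -
  note c = gens_emb_commute(3,4)
  show "acomm (emb (zs (theta n) j) * fs j) (emb (zs (theta n) k) * fs k) = 0"
    by (simp only: acomm_odd_odd[OF odd_anticommute(1) c(1) c(1)] fs_relations[OF assms] mult_zero_right)
  show "acomm (emb (zs_conj (theta n) j) * fs_dag j) (emb (zs_conj (theta n) k) * fs_dag k) = 0"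
    by (simp only: acomm_odd_odd[OF odd_anticommute(3) c(2) c(2)] fs_relations[OF assms] mult_zero_right)
  show "acomm (emb (zs (theta n) j) * fs j) (emb (zs_conj (theta n) k) * fs_dag k) =
       (if j = k then scal (- \<i> / 2) * (emb (zs (theta n) j) * emb (zs_conj (theta n) j)) else 0)"
    unfolding acomm_odd_odd[OF odd_anticommute(2) c(1) c(2)] fs_relations(3)[OF assms]
    by (cases "j = k") (simp_all only: if_True if_False scal_central scal_hom(5) mult_zero_left mult_zero_right simp_thms)
qed

text \<open>Twice the square is the anticommutator with itself, in which all terms vanish because
  the even and the odd generators of Z are isotropic and anticommute with each other.\<close>

lemma ZZ_square: "ZZ n x (theta n) * ZZ n x (theta n) = 0"
proof (rule double_eq_0)
  have "acomm (ZZ n x (theta n)) (ZZ n x (theta n)) = 0"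
    unfolding ZZ_def acomm_bilinear acomm_sum
    by (simp add: acomm_scal ff_relations mixed_acomm odd_acomm)
  then show "ZZ n x (theta n) * ZZ n x (theta n) + ZZ n x (theta n) * ZZ n x (theta n) = 0" by (simp add: acomm_def)
qed

lemma ZZ_dag_square: "ZZ_dag n x (theta n) * ZZ_dag n x (theta n) = 0"
proof (rule double_eq_0)
  have "acomm (ZZ_dag n x (theta n)) (ZZ_dag n x (theta n)) = 0"
    unfolding ZZ_dag_def acomm_bilinear acomm_sum
    by (simp add: acomm_scal ff_relations mixed_acomm odd_acomm)
  then show "ZZ_dag n x (theta n) * ZZ_dag n x (theta n) + ZZ_dag n x (theta n) * ZZ_dag n x (theta n) = 0"
    by (simp add: acomm_def)
qed

lemma ZZ_acomm: "acomm (ZZ n x (theta n)) (ZZ_dag n x (theta n)) = emb (normsq n x (theta n))"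
proof -
  have if_mult: "scal a * (scal b * scal (if P then 1 else 0)) = (if P then scal (a * b) else 0)" for a b P
    by (simp add: scal_hom)
  show ?thesis
    unfolding ZZ_def ZZ_dag_def acomm_bilinear acomm_sum
    by (simp add: acomm_scal ff_relations mixed_acomm odd_acomm if_mult sum.delta sum.delta' emb_normsq nil_norm_eq mult.commute[of "cnj _"]
        scal_sum sum_distrib_left)
qed

section \<open>Right odd derivatives\<close>

text \<open>The right derivative, which sends the j-th generator to 1. The sign and the flip are
  those that arise from the Leibniz rule for \<open>gflip a * b\<close> when an odd derivative is
  moved from b to a under the Berezin integral.\<close>

definition rpartial :: "nat \<Rightarrow> 'm::finite cgrass \<Rightarrow> 'm cgrass" where
  "rpartial j a = - gpartial j (gflip a)"

definition rz :: "nat \<Rightarrow> 'm::finite cgrass \<Rightarrow> 'm cgrass" where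
  "rz j a = scal (1/2) * (rpartial (2 * j - 1) a - scal \<i> * rpartial (2 * j) a)"

definition rzc :: "nat \<Rightarrow> 'm::finite cgrass \<Rightarrow> 'm cgrass" where
  "rzc j a = scal (1/2) * (rpartial (2 * j - 1) a + scal \<i> * rpartial (2 * j) a)"

lemma rpartial_rules:
  "rpartial j (a + b) = rpartial j a + rpartial j b" "rpartial j (gconst c) = 0"
  "rpartial j (a * b) = a * rpartial j b + rpartial j a * gflip b"
  "rpartial j (gconst c * a) = gconst c * rpartial j a"
  by (simp_all add: rpartial_def gflip_linear gflip_mult gflip_gflip gpartial_linear gpartial_mult)

lemma rz_rules:
  "rz j (a + b) = rz j a + rz j b" "rz j (gconst c) = 0"
  "rz j (a * b) = a * rz j b + rz j a * gflip b" "rz j (scal d * a) = scal d * rz j a" "rz j (a * gconst c) = rz j a * gconst c"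
  "rzc j (a + b) = rzc j a + rzc j b" "rzc j (gconst c) = 0"
  "rzc j (a * b) = a * rzc j b + rzc j a * gflip b" "rzc j (scal d * a) = scal d * rzc j a" "rzc j (a * gconst c) = rzc j a * gconst c"
  by (simp_all only: rz_def rzc_def rpartial_rules gflip_linear mult_zero_right add_0_left add_0_right diff_self
      scal_left_commute[of a] scal_left_commute[of "scal d"] distrib_left distrib_right right_diff_distrib
      left_diff_distrib mult.assoc)
    (simp_all add: algebra_simps)

lemma rz_sum: "rz j (\<Sum>i\<in>I. f i) = (\<Sum>i\<in>I. rz j (f i))" "rzc j (\<Sum>i\<in>I. f i) = (\<Sum>i\<in>I. rzc j (f i))"
  using rz_rules(2)[of j 0] rz_rules(7)[of j 0]
  by (induction I rule: infinite_finite_induct) (auto simp: rz_rules gconst_0)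

lemma rz_zs:
  assumes "j \<in> {1..n}" "k \<in> {1..n}"
  shows "rz j (emb (zs (theta n) k)) = (if j = k then 1 else 0 :: 'm::finite cgrass)" "rz j (emb (zs_conj (theta n) k)) = (0 :: 'm cgrass)"
    "rzc j (emb (zs (theta n) k)) = (0 :: 'm cgrass)" "rzc j (emb (zs_conj (theta n) k)) = (if j = k then 1 else 0 :: 'm cgrass)"
proof -
  have r: "rpartial i (et n l) = (if i = l then 1 else 0 :: 'm cgrass)" if "i \<in> {1..2 * n}" "l \<in> {1..2 * n}" for i l
    using that by (simp add: rpartial_def gflip_et gpartial_linear gpartial_et)
  have i: "2 * j - 1 \<in> {1..2 * n}" "2 * j \<in> {1..2 * n}" "2 * k - 1 \<in> {1..2 * n}" "2 * k \<in> {1..2 * n}" using assms by auto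
  have ne: "2 * j - 1 \<noteq> 2 * k" "2 * j \<noteq> 2 * k - 1" "2 * j - 1 = 2 * k - 1 \<longleftrightarrow> j = k" using assms by auto presburger+
  have rp: "rpartial l (et n a + scal c * et n b) = rpartial l (et n a) + scal c * rpartial l (et n b :: 'm cgrass)"
    "rpartial l (et n a - scal c * et n b) = rpartial l (et n a) - scal c * rpartial l (et n b :: 'm cgrass)" for l a b c
    using rpartial_rules(1)[of l "et n a" "scal (- c) * et n b :: 'm cgrass"]
    by (simp_all add: rpartial_rules(1,4) scal_hom)
      (simp add: rpartial_def gflip_linear gpartial_linear gflip_mult)
  have hi: "scal (1/2) * (1 + 1) = (1 :: 'm cgrass)" "scal \<i> * scal \<i> = (- 1 :: 'm cgrass)"
  proof -
    have "scal (1/2) + scal (1/2) = (1 :: 'm cgrass)"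
      by (simp only: scal_hom(1)[symmetric]) (simp add: scal_hom)
    then show "scal (1/2) * (1 + 1) = (1 :: 'm cgrass)" by (simp only: distrib_left mult_1_right)
    show "scal \<i> * scal \<i> = (- 1 :: 'm cgrass)" by (simp only: scal_hom(2)[symmetric]) (simp add: scal_hom)
  qed
  show "rz j (emb (zs (theta n) k)) = (if j = k then 1 else 0 :: 'm cgrass)" "rz j (emb (zs_conj (theta n) k)) = (0 :: 'm cgrass)"
    "rzc j (emb (zs (theta n) k)) = (0 :: 'm cgrass)" "rzc j (emb (zs_conj (theta n) k)) = (if j = k then 1 else 0 :: 'm cgrass)"
    by (simp_all only: rz_def rzc_def emb_zs emb_zs_conj rp r[OF i(1,3)] r[OF i(1,4)] r[OF i(2,3)] r[OF i(2,4)] ne)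
      (use hi in \<open>auto simp: ne\<close>)
qed

lemma rz_ZZ:
  assumes "j \<in> {1..n}"
  shows "rz j (ZZ n (x :: 'm::finite pt) (theta n)) = fs j" "rzc j (ZZ n x (theta n)) = 0"
    "rz j (ZZ_dag n x (theta n)) = 0" "rzc j (ZZ_dag n x (theta n)) = fs_dag j"
proof -
  have f: "rz j (a * ff l) = rz j a * ff l" "rz j (a * ff_dag l) = rz j a * ff_dag l" "rz j (a * fs k) = rz j a * fs k"
    "rz j (a * fs_dag k) = rz j a * fs_dag k" "rzc j (a * ff l) = rzc j a * ff l" "rzc j (a * ff_dag l) = rzc j a * ff_dag l"
    "rzc j (a * fs k) = rzc j a * fs k" "rzc j (a * fs_dag k) = rzc j a * fs_dag k" for l :: 'm and a k
    unfolding ff_def ff_dag_def fs_def fs_dag_def by (simp_all only: rz_rules(5,10))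
  note s = rz_rules(1,2,6,7) rz_sum f
  have i: "(\<Sum>k=1..n. (if j = k then 1 else 0) * h k) = h j" for h :: "nat \<Rightarrow> 'm cgrass"
    using assms by (simp add: if_distrib[of "\<lambda>a. a * _"] sum.delta cong: if_cong)
  show "rz j (ZZ n x (theta n)) = fs j" "rzc j (ZZ n x (theta n)) = 0"
    "rz j (ZZ_dag n x (theta n)) = 0" "rzc j (ZZ_dag n x (theta n)) = fs_dag j"
    using assms by (simp_all add: ZZ_def ZZ_dag_def s rz_zs i[unfolded One_nat_def])
qed

lemma rz_nil_norm:
  assumes "j \<in> {1..n}"
  shows "rz j (nil_norm n) = (scal (\<i> / 2) * emb (zs_conj (theta n) j) :: 'm::finite cgrass)"
    "rzc j (nil_norm n) = (- (scal (\<i> / 2) * emb (zs (theta n) j)) :: 'm cgrass)"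
proof -
  have i: "(\<Sum>k=1..n. (if j = k then 1 else 0) * h k) = h j" "(\<Sum>k=1..n. h k * (if j = k then 1 else 0)) = h j" for h :: "nat \<Rightarrow> 'm cgrass"
    using assms by (simp_all add: if_distrib[of "\<lambda>a. a * _"] if_distrib[of "\<lambda>a. _ * a"] sum.delta cong: if_cong)
  have "rz j (nil_norm n :: 'm cgrass) = scal (- \<i> / 2) * (\<Sum>k=1..n. (if j = k then 1 else 0) * (- emb (zs_conj (theta n) k)))"
    unfolding nil_norm_eq rz_rules(4) rz_sum
    by (intro arg_cong2[where f = "(*)"] sum.cong HOL.refl) (use assms in \<open>auto simp: rz_rules(3) rz_zs gflip_zs_conj\<close>)
  then show "rz j (nil_norm n :: 'm cgrass) = scal (\<i> / 2) * emb (zs_conj (theta n) j)" unfolding i by (simp add: scal_hom)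
  have "rzc j (nil_norm n :: 'm cgrass) = scal (- \<i> / 2) * (\<Sum>k=1..n. emb (zs (theta n) k) * (if j = k then 1 else 0))"
    unfolding nil_norm_eq rz_rules(9) rz_sum
    by (intro arg_cong2[where f = "(*)"] sum.cong HOL.refl) (use assms in \<open>auto simp: rz_rules(8) rz_zs gflip_zs_conj\<close>)
  then show "rzc j (nil_norm n :: 'm cgrass) = - (scal (\<i> / 2) * emb (zs (theta n) j))" unfolding i by (simp add: scal_hom)
qed

section \<open>Functions of an element with nilpotent part\<close>

text \<open>The Taylor expansion \<open>\<phi>(t + M)\<close>, where \<open>c j\<close> is the \<open>j\<close>-th derivative of \<open>\<phi>\<close> at \<open>t\<close>.\<close>

definition taylor :: "nat \<Rightarrow> (nat \<Rightarrow> complex) \<Rightarrow> 'm::finite cgrass \<Rightarrow> 'm cgrass" where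
  "taylor n c M = (\<Sum>j\<le>n. scal (c j / fact j) * M ^ j)"

lemma power_central:
  assumes M: "\<And>b. M * b = b * (M :: 'a::monoid_mult)"
  shows "M ^ j * b = b * M ^ j"
proof (induction j)
  case (Suc j)
  have "M ^ Suc j * b = M * (b * M ^ j)" by (simp add: mult.assoc Suc)
  also have "\<dots> = b * M * M ^ j" by (simp only: M[of b] mult.assoc[symmetric])
  finally show ?case by (simp add: mult.assoc)
qed simp

lemma taylor_commute: "(\<And>b. M * b = b * M) \<Longrightarrow> taylor n c M * b = b * taylor n c M"
proof -
  assume M: "\<And>b. M * b = b * M"
  have "M ^ j * b = b * M ^ j" for j b by (rule power_central[OF M])
  then show ?thesis by (simp add: taylor_def sum_distrib_left sum_distrib_right mult.assoc scal_left_commute)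
qed

lemma derivation_power:
  assumes D: "D 1 = 0" "\<And>b. D (M * b) = M * D b + D M * b" and M: "\<And>b. M * b = b * (M::'m::finite cgrass)"
  shows "D (M ^ Suc k) = of_nat (Suc k) * (M ^ k * D M)"
proof (induction k)
  case 0
  then show ?case by simp
next
  case (Suc k)
  have "D M * M ^ Suc k = M ^ Suc k * D M"
    by (rule power_central[OF M, symmetric])
  then show ?case using Suc D(2)[of "M ^ Suc k"]
    by (simp add: distrib_right distrib_left mult.assoc mult_of_nat_commute)
qed

text \<open>Here \<open>E k\<close> is the derivative of \<open>M ^ k\<close>, and \<open>d\<close> that of \<open>M\<close>.\<close>

lemma taylor_derivative_sum:
  fixes M d :: "'m::finite cgrass"
  assumes E: "E 0 = 0" "\<And>k. E (Suc k) = of_nat (Suc k) * (M ^ k * d)" "E (Suc n) = 0"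
  shows "(\<Sum>j\<le>n. scal (c j / fact j) * E j) = taylor n (\<lambda>j. c (Suc j)) M * d"
proof -
  have s: "scal (a / fact (Suc k)) * (of_nat (Suc k) * b) = scal (a / fact k) * b" for a k and b :: "'m cgrass"
  proof -
    have "scal (a / fact (Suc k)) * (of_nat (Suc k) * b) = scal (a / fact (Suc k) * of_nat (Suc k)) * b"
      by (simp only: scal_hom(2) scal_of_nat mult.assoc)
    also have "a / fact (Suc k) * of_nat (Suc k) = a / fact k" by (simp add: field_simps del: of_nat_Suc)
    finally show ?thesis .
  qed
  \<comment> \<open>The derivative of the zero element \<open>M ^ Suc n\<close> is (n + 1)
    \<open>M ^ n * d\<close>. So the term of degree n, which the truncated expansion does not
    produce after differentiation, is zero.\<close>
  have top: "M ^ n * d = 0"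
  proof -
    have "scal (1 / fact (Suc n)) * (of_nat (Suc n) * (M ^ n * d)) = 0" using E(2)[of n] E(3) by simp
    then have "scal (fact n) * (scal (1 / fact n) * (M ^ n * d)) = 0" by (simp only: s) simp
    moreover have "scal (fact n) * (scal (1 / fact n) * (M ^ n * d)) = scal (fact n * (1 / fact n)) * (M ^ n * d)"
      by (simp only: scal_hom(2) mult.assoc)
    ultimately show ?thesis by (simp add: scal_hom(6))
  qed
  have "(\<Sum>j\<le>n. scal (c j / fact j) * E j) = (\<Sum>j<n. scal (c (Suc j) / fact (Suc j)) * E (Suc j))"
    by (subst sum.atMost_shift) (simp add: E(1))
  also have "\<dots> = (\<Sum>j<n. scal (c (Suc j) / fact j) * (M ^ j * d))"
    by (simp only: E(2) s)
  also have "\<dots> = (\<Sum>j\<le>n. scal (c (Suc j) / fact j) * (M ^ j * d))"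
    by (simp add: lessThan_Suc_atMost[symmetric] top)
  finally show ?thesis by (simp add: taylor_def sum_distrib_right mult.assoc)
qed

lemma derivation_taylor:
  assumes D: "\<And>a b. D (a + b) = D a + D b" "\<And>c a. D (scal c * a) = scal c * D a" "D 1 = 0" "\<And>b. D (M * b) = M * D b + D M * b"
    and M: "\<And>b. M * b = b * (M::'m::finite cgrass)" "M ^ Suc n = 0"
  shows "D (taylor n c M) = taylor n (\<lambda>j. c (Suc j)) M * D M"
proof -
  have D0: "D 0 = 0" using D(1)[of 0 0] by simp
  have Ds: "D (\<Sum>i\<in>I. f i) = (\<Sum>i\<in>I. D (f i))" for I :: "nat set" and f
    by (induction I rule: infinite_finite_induct) (auto simp: D D0)
  have "D (taylor n c M) = (\<Sum>j\<le>n. scal (c j / fact j) * D (M ^ j))"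
    by (simp add: taylor_def Ds D(2))
  also have "\<dots> = taylor n (\<lambda>j. c (Suc j)) M * D M"
    by (rule taylor_derivative_sum) (use D(3) D0 M(2) derivation_power[of D M, OF D(3,4) M(1)] in simp_all)
  finally show ?thesis .
qed

section \<open>Functions with values in a finite-dimensional subspace\<close>

lemma ccoef_linear:
  "ccoef (a + b) A e = ccoef a A e + ccoef b A e" "ccoef (scal c * a) A e = c * ccoef a A e"
  "ccoef 0 A e = 0" "ccoef (a - b) A e = ccoef a A e - ccoef b A e" "ccoef (- a) A e = - ccoef a A e"
  by (simp_all add: ccoef_def cliff.representation_add cliff.representation_scale cliff.representation_zero
      cliff.representation_diff cliff.representation_neg cliff_basis)

lemma ccoef_sum: "ccoef (\<Sum>i\<in>I. f i) A e = (\<Sum>i\<in>I. ccoef (f i :: 'm::finite cgrass) A e)"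
  by (induction I rule: infinite_finite_induct) (auto simp: ccoef_linear)

lemma ccoef_basis: "ccoef a A e \<noteq> 0 \<Longrightarrow> e \<in> cliff_basis"
  unfolding ccoef_def by (rule cliff.representation_ne_zero)

lemma finite_ccoef: "finite {e. ccoef a A e \<noteq> 0}"
  unfolding ccoef_def by (rule cliff.finite_representation)

lemma gcoef_ccoef_superset:
  assumes "finite B" "\<And>e. e \<notin> B \<Longrightarrow> ccoef a A e = 0"
  shows "gcoef a A = (\<Sum>e\<in>B. cst (ccoef a A e) * e)"
proof -
  have "gcoef a A = (\<Sum>e | ccoef a A e \<noteq> 0. cst (ccoef a A e) * e)"
    unfolding ccoef_def by (simp add: cliff.sum_nonzero_representation_eq cliff_basis)
  also have "\<dots> = (\<Sum>e\<in>B. cst (ccoef a A e) * e)"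
    by (rule sum.mono_neutral_left) (use assms in \<open>auto simp: cst_hom\<close>)
  finally show ?thesis .
qed

lemma ccoef_eqI: "(\<And>A e. e \<in> cliff_basis \<Longrightarrow> ccoef a A e = ccoef b A e) \<Longrightarrow> a = b"
proof (rule grass_eqI)
  fix A assume *: "\<And>A e. e \<in> cliff_basis \<Longrightarrow> ccoef a A e = ccoef b A e"
  have "ccoef a A e = ccoef b A e" for e using * ccoef_basis[of a A e] ccoef_basis[of b A e] by metis
  then show "gcoef a A = gcoef b A"
    using gcoef_ccoef_superset[OF finite_ccoef[of a A], of a A] gcoef_ccoef_superset[OF finite_ccoef[of a A], of b A] by simp
qed

lemma ccoef_expand:
  assumes S: "\<And>A. gcoef v A \<noteq> 0 \<Longrightarrow> A \<subseteq> S" "finite S" and B: "finite B" "\<And>A e. e \<notin> B \<Longrightarrow> ccoef v A e = 0"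
  shows "v = (\<Sum>A\<in>Pow S. \<Sum>e\<in>B. scal (ccoef v A e) * (gconst e * gmono A))"
proof -
  have gs: "gconst (\<Sum>e\<in>B. f e) = (\<Sum>e\<in>B. gconst (f e))" for f :: "('a + 'a) cliff \<Rightarrow> ('a + 'a) cliff"
    by (induction B rule: infinite_finite_induct) (auto simp: gconst_add gconst_0)
  have "v = (\<Sum>A\<in>Pow S. gconst (gcoef v A) * gmono A)" by (rule grass_expand[OF S])
  also have "\<dots> = (\<Sum>A\<in>Pow S. \<Sum>e\<in>B. scal (ccoef v A e) * (gconst e * gmono A))"
    by (rule sum.cong[OF HOL.refl])
       (simp add: gcoef_ccoef_superset[OF B] gs sum_distrib_right gconst_mult mult.assoc)
  finally show ?thesis .
qed

text \<open>\<open>lift_op\<close> sums over the basis vectors with nonzero component, and a sum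
  over an infinite set is 0 by convention. The finite set B is what makes it act
  componentwise.\<close>

lemma ccoef_lift_op:
  assumes B: "finite B" "\<And>e. e \<in> cliff_basis \<Longrightarrow> e \<notin> B \<Longrightarrow> T (\<lambda>x. ccoef (F x) A e) = 0"
    and A: "finite A" and e: "e \<in> cliff_basis"
  shows "ccoef (lift_op T F) A e = T (\<lambda>x. ccoef (F x) A e)"
proof -
  define t where "t e = T (\<lambda>x. ccoef (F x) A e)" for e
  let ?B = "{b \<in> cliff_basis. t b \<noteq> 0}"
  have f: "finite ?B" using B by (auto simp: t_def intro: finite_subset)
  have "ccoef (lift_op T F) A e = cliff.representation cliff_basis (\<Sum>b\<in>?B. cst (t b) * b) e"
    using A by (simp add: ccoef_def lift_op_def gcoef_mkgrass t_def)
  also have "\<dots> = (\<Sum>b\<in>?B. t b * (if b = e then 1 else 0))"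
    by (subst cliff.representation_sum)
       (auto simp: cliff_basis cliff.representation_scale cliff.representation_basis[OF cliff_basis(1)] intro!: sum.cong)
  also have "\<dots> = t e" using f e by (simp add: if_distrib[of "\<lambda>a. _ * a"] sum.delta' cong: if_cong)
  finally show ?thesis by (simp add: t_def)
qed

text \<open>On U the function F is a finite sum of scalar functions from the class S times constant
  elements. Values in an infinite-dimensional algebra do not guarantee this; with it, rule induction
  reduces statements to a single scalar function. S is instantiated by smooth, integrable, test and
  radial functions.\<close>

inductive dec :: "(('a \<Rightarrow> complex) \<Rightarrow> bool) \<Rightarrow> 'a set \<Rightarrow> ('a \<Rightarrow> 'm::finite cgrass) \<Rightarrow> bool" for S U where
  base: "S f \<Longrightarrow> (\<And>x. x \<in> U \<Longrightarrow> F x = scal (f x) * v) \<Longrightarrow> dec S U F"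
| zero: "(\<And>x. x \<in> U \<Longrightarrow> F x = 0) \<Longrightarrow> dec S U F"
| plus: "dec S U F \<Longrightarrow> dec S U G \<Longrightarrow> (\<And>x. x \<in> U \<Longrightarrow> H x = F x + G x) \<Longrightarrow> dec S U H"

lemma dec_cong: "dec S U F \<Longrightarrow> (\<And>x. x \<in> U \<Longrightarrow> G x = F x) \<Longrightarrow> dec S U G"
  by (rule dec.plus[OF _ dec.zero[of U "\<lambda>_. 0"]]) auto

lemma dec_add: "dec S U F \<Longrightarrow> dec S U G \<Longrightarrow> dec S U (\<lambda>x. F x + G x)"
  by (rule dec.plus) auto

lemma dec_sum: "(\<And>i. i \<in> I \<Longrightarrow> dec S U (F i)) \<Longrightarrow> dec S U (\<lambda>x. \<Sum>i\<in>I. F i x)"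
  by (induction I rule: infinite_finite_induct) (auto intro: dec.zero dec_add)

lemma dec_scal: "S f \<Longrightarrow> dec S U (\<lambda>x. scal (f x) * v)"
  by (rule dec.base) auto

lemma dec_mono:
  assumes "dec S U F" and S: "\<And>f. S f \<Longrightarrow> S' f" and V: "V \<subseteq> U"
  shows "dec S' V F"
  using assms(1)
proof (induction rule: dec.induct)
  case (base f F v)
  show ?case by (rule dec.base[of S' f V F v, OF S[OF base(1)]]) (use base(2) V in blast)
next
  case (zero F)
  show ?case by (rule dec.zero) (use zero V in blast)
next
  case (plus F G H)
  show ?case by (rule dec.plus[OF plus.IH]) (use plus.hyps(3) V in blast)
qed

definition glinear :: "('m::finite cgrass \<Rightarrow> 'm cgrass) \<Rightarrow> bool" where
  "glinear L \<longleftrightarrow> (\<forall>a b c. L (a + b) = L a + L b \<and> L (scal c * a) = scal c * L a)"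

lemma glinearD:
  assumes L: "glinear L"
  shows "L (a + b) = L a + L b" "L (scal c * a) = scal c * L a" "L 0 = 0"
proof -
  have 2: "L (scal c * a) = scal c * L a" for c a using L unfolding glinear_def by blast
  show "L (a + b) = L a + L b" using L unfolding glinear_def by blast
  show "L (scal c * a) = scal c * L a" by (rule 2)
  show "L 0 = 0" using 2[of 0 0] by (simp add: scal_hom)
qed

lemma dec_glinear:
  assumes "dec S U F" "glinear L" shows "dec S U (\<lambda>x. L (F x))"
  using assms(1)
proof (induction rule: dec.induct)
  case (base f F v)
  then show ?case by (intro dec.base[of S f _ _ "L v"]) (auto simp: glinearD[OF assms(2)])
next
  case (zero F)
  then show ?case by (intro dec.zero) (auto simp: glinearD[OF assms(2)])
next
  case (plus F G H)
  show ?case by (rule dec.plus[OF plus.IH]) (simp add: plus.hyps(3) glinearD(1)[OF assms(2)])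
qed

lemma dec_mult:
  assumes m: "\<And>f g. S f \<Longrightarrow> S' g \<Longrightarrow> S'' (\<lambda>x. f x * g x)" and F: "dec S U F" and G: "dec S' U G"
  shows "dec S'' U (\<lambda>x. F x * G x)"
  using F
proof (induction rule: dec.induct)
  case b: (base f F v)
  show ?case using G
  proof (induction rule: dec.induct)
    case (base g G w)
    show ?case
      by (rule dec.base[where f = "\<lambda>x. f x * g x" and v = "v * w"], rule m[OF b(1) base(1)])
         (simp only: b(2) base(2) scal_hom(2) mult.assoc scal_left_commute[of v])
  next
    case (zero G)
    then show ?case by (intro dec.zero) auto
  next
    case (plus F G H)
    show ?case by (rule dec.plus[OF plus.IH]) (simp add: plus.hyps(3) distrib_left)
  qed
next
  case (zero F)
  then show ?case by (intro dec.zero) auto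
next
  case (plus F G H)
  show ?case by (rule dec.plus[OF plus.IH]) (simp add: plus.hyps(3) distrib_right)
qed

definition lin_closed :: "(('a \<Rightarrow> complex) \<Rightarrow> bool) \<Rightarrow> 'a set \<Rightarrow> bool" where
  "lin_closed S U \<longleftrightarrow> S (\<lambda>_. 0) \<and> (\<forall>f c. S f \<longrightarrow> S (\<lambda>x. f x * c)) \<and> (\<forall>f g. S f \<longrightarrow> S g \<longrightarrow> S (\<lambda>x. f x + g x)) \<and>
     (\<forall>f g. (\<forall>x\<in>U. f x = g x) \<longrightarrow> S f \<longrightarrow> S g)"

lemma lin_closed_smooth: "open U \<Longrightarrow> lin_closed (smooth_on U) U"
  by (auto simp: lin_closed_def intro: smooth_on_const smooth_on_mult smooth_on_add smooth_on_cong)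

lemma lin_closed_integrable: "lin_closed (integrable lborel) UNIV"
  by (auto simp: lin_closed_def fun_eq_iff[symmetric])

lemma lin_closed_test: "lin_closed test_fun UNIV"
  using test_fun_0 test_fun_add test_fun_mult_left[OF _ smooth_on_const]
  by (auto simp: lin_closed_def fun_eq_iff[symmetric])

lemma lin_closedD:
  assumes S: "lin_closed S U"
  shows "S (\<lambda>_. 0)" "S f \<Longrightarrow> S (\<lambda>x. f x * c)" "S f \<Longrightarrow> S g \<Longrightarrow> S (\<lambda>x. f x + g x)"
    "S f \<Longrightarrow> (\<And>x. x \<in> U \<Longrightarrow> f x = g x) \<Longrightarrow> S g"
proof -
  note S' = S[unfolded lin_closed_def]
  show "S (\<lambda>_. 0)" by (rule conjunct1[OF S'])
  show "S f \<Longrightarrow> S (\<lambda>x. f x * c)" by (rule S'[THEN conjunct2, THEN conjunct1, rule_format])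
  show "S f \<Longrightarrow> S g \<Longrightarrow> S (\<lambda>x. f x + g x)" by (rule S'[THEN conjunct2, THEN conjunct2, THEN conjunct1, rule_format])
  show "S f \<Longrightarrow> (\<And>x. x \<in> U \<Longrightarrow> f x = g x) \<Longrightarrow> S g"
    by (rule S'[THEN conjunct2, THEN conjunct2, THEN conjunct2, rule_format, of f g])
qed

lemma dec_ccoef:
  assumes S: "lin_closed S U" and F: "dec S U F" shows "S (\<lambda>x. ccoef (F x) A e)"
proof -
  note D = lin_closedD[OF S]
  show ?thesis using F
proof (induction rule: dec.induct)
  case (base f F v)
  show ?case
    by (rule D(4)[OF D(2)[OF base(1), of "ccoef v A e"], of "\<lambda>x. ccoef (F x) A e"]) (simp add: base(2) ccoef_linear)
next
  case (zero F)
  show ?case by (rule D(4)[OF D(1), of "\<lambda>x. ccoef (F x) A e"]) (simp add: zero ccoef_linear)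
next
  case (plus F G H)
  have "S (\<lambda>x. ccoef (F x) A e + ccoef (G x) A e)" by (rule D(3)[OF plus.IH])
  from D(4)[OF this, of "\<lambda>x. ccoef (H x) A e"] show ?case
    by (simp add: plus.hyps(3) ccoef_linear)
qed
qed

lemma dec_finite: "dec S U F \<Longrightarrow> \<exists>B. finite B \<and> B \<subseteq> cliff_basis \<and> (\<forall>x\<in>U. \<forall>e. e \<notin> B \<longrightarrow> ccoef (F x) A e = 0)"
proof (induction rule: dec.induct)
  case (base f F v)
  then show ?case
    by (intro exI[of _ "{e. ccoef v A e \<noteq> 0}"]) (auto simp: ccoef_linear finite_ccoef ccoef_basis)
next
  case (zero F)
  then show ?case by (intro exI[of _ "{}"]) (auto simp: ccoef_linear)
next
  case (plus F G H)
  obtain B where "finite B" "B \<subseteq> cliff_basis" "\<forall>x\<in>U. \<forall>e. e \<notin> B \<longrightarrow> ccoef (F x) A e = 0"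
    using plus.IH(1) by blast
  moreover obtain B' where "finite B'" "B' \<subseteq> cliff_basis" "\<forall>x\<in>U. \<forall>e. e \<notin> B' \<longrightarrow> ccoef (G x) A e = 0"
    using plus.IH(2) by blast
  ultimately show ?case using plus.hyps(3) by (intro exI[of _ "B \<union> B'"]) (auto simp: ccoef_linear)
qed

section \<open>Integrals of algebra-valued functions\<close>

definition gint :: "('a::euclidean_space \<Rightarrow> 'm::finite cgrass) \<Rightarrow> 'm cgrass" where
  "gint F = lift_op (\<lambda>f. \<integral>x. f x \<partial>lborel) F"

lemma ccoef_infinite: "infinite A \<Longrightarrow> ccoef a A e = 0"
  by (simp add: ccoef_def gcoef_infinite cliff.representation_zero)

lemma ccoef_gint:
  assumes "dec (integrable lborel) UNIV F"
  shows "ccoef (gint F) A e = (\<integral>x. ccoef (F x) A e \<partial>lborel)"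
proof -
  obtain B where B: "finite B" "\<And>x e. e \<notin> B \<Longrightarrow> ccoef (F x) A e = 0"
    using dec_finite[OF assms, of A] by auto
  consider "infinite A" | "e \<notin> cliff_basis" | "finite A" "e \<in> cliff_basis" by blast
  then show ?thesis
  proof cases
    case 1
    then show ?thesis by (simp add: ccoef_infinite)
  next
    case 2
    then have "ccoef a A e = 0" for a :: "'b cgrass" using ccoef_basis by blast
    then show ?thesis by simp
  next
    case 3
    then show ?thesis unfolding gint_def
      by (intro ccoef_lift_op[OF B(1)]) (simp_all add: B(2))
  qed
qed

lemma ccoef_eqI': "(\<And>A e. ccoef a A e = ccoef b A e) \<Longrightarrow> a = b"
  by (rule ccoef_eqI)

lemma gint_add:
  assumes "dec (integrable lborel) UNIV F" "dec (integrable lborel) UNIV G"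
  shows "gint (\<lambda>x. F x + G x) = gint F + gint G"
  by (rule ccoef_eqI')
     (simp add: ccoef_gint assms dec_add ccoef_linear dec_ccoef[OF lin_closed_integrable])

lemma gint_scal: "integrable lborel f \<Longrightarrow> gint (\<lambda>x. scal (f x) * v) = scal (\<integral>x. f x \<partial>lborel) * v"
  by (rule ccoef_eqI') (simp add: ccoef_gint dec_scal ccoef_linear)

lemma gint_0: "gint (\<lambda>_. 0) = 0"
  by (rule ccoef_eqI') (simp add: ccoef_gint dec.zero ccoef_linear)

lemma gint_glinear:
  assumes "dec (integrable lborel) UNIV F" "glinear L"
  shows "gint (\<lambda>x. L (F x)) = L (gint F)"
  using assms(1)
proof (induction rule: dec.induct)
  case (base f F v)
  then have "F = (\<lambda>x. scal (f x) * v)" by auto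
  then show ?case using base(1) by (simp add: glinearD[OF assms(2)] gint_scal)
next
  case (zero F)
  then have "F = (\<lambda>x. 0)" by auto
  then show ?case by (simp add: glinearD[OF assms(2)] gint_0)
next
  case (plus F G H)
  then have "H = (\<lambda>x. F x + G x)" by auto
  then show ?case using plus.hyps(1,2) plus.IH by (simp add: glinearD[OF assms(2)] gint_add dec_glinear[OF _ assms(2)])
qed

lemma gint_sum:
  "(\<And>i. i \<in> I \<Longrightarrow> dec (integrable lborel) UNIV (F i)) \<Longrightarrow> gint (\<lambda>x. \<Sum>i\<in>I. F i x) = (\<Sum>i\<in>I. gint (F i))"
  by (induction I rule: infinite_finite_induct) (auto simp: gint_0 gint_add dec_sum)

section \<open>Partial derivatives\<close>

lemma axis_Basis: "axis i (1::real) \<in> Basis"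
  by (auto simp: Basis_vec_def)

lemma ccoef_pd:
  assumes U: "open U" "x \<in> U" and F: "dec (smooth_on U) U F"
  shows "ccoef (pd i F x) A e = dirderiv (axis i 1) (\<lambda>x. ccoef (F x) A e) x"
proof -
  obtain B where B: "finite B" "\<And>x e. x \<in> U \<Longrightarrow> e \<notin> B \<Longrightarrow> ccoef (F x) A e = 0"
    using dec_finite[OF F, of A] by auto
  have z: "dirderiv (axis i 1) (\<lambda>_. 0 :: complex) x = 0" by (rule dirderiv_eq) (rule has_derivative_const)
  consider "infinite A" | "e \<notin> cliff_basis" | "finite A" "e \<in> cliff_basis" by blast
  then show ?thesis
  proof cases
    case 1
    then show ?thesis by (simp add: ccoef_infinite z)
  next
    case 2
    then have "ccoef a A e = 0" for a :: "'a cgrass" using ccoef_basis by blast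
    then show ?thesis by (simp add: z)
  next
    case 3
    show ?thesis unfolding pd_def
    proof (rule ccoef_lift_op[OF B(1) _ 3])
      fix e assume "e \<notin> B"
      have "dirderiv (axis i 1) (\<lambda>x. ccoef (F x) A e) x = dirderiv (axis i 1) (\<lambda>_. 0) x"
        by (rule dirderiv_cong[OF U]) (use B(2) \<open>e \<notin> B\<close> in auto)
      then show "dirderiv (axis i 1) (\<lambda>x. ccoef (F x) A e) x = 0" by (simp add: z)
    qed
  qed
qed

lemma pd_cong:
  assumes U: "open U" "x \<in> U" and F: "\<And>z. z \<in> U \<Longrightarrow> F z = G z"
  shows "pd i F x = pd i G x"
proof -
  have "dirderiv (axis i 1) (\<lambda>x. ccoef (F x) A e) x = dirderiv (axis i 1) (\<lambda>x. ccoef (G x) A e) x" for A e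
    by (rule dirderiv_cong[OF U]) (simp add: F)
  then show ?thesis unfolding pd_def lift_op_def by simp
qed

lemma smooth_differentiable_ccoef:
  "open U \<Longrightarrow> x \<in> U \<Longrightarrow> dec (smooth_on U) U F \<Longrightarrow> (\<lambda>x. ccoef (F x) A e) differentiable (at x)"
  by (rule smooth_on_differentiable[OF dec_ccoef[OF lin_closed_smooth]])

lemma pd_add:
  assumes "open U" "x \<in> U" "dec (smooth_on U) U F" "dec (smooth_on U) U G"
  shows "pd i (\<lambda>x. F x + G x) x = pd i F x + pd i G x"
  by (rule ccoef_eqI')
     (simp add: ccoef_pd[OF assms(1,2)] assms dec_add ccoef_linear
       dirderiv_add[OF smooth_differentiable_ccoef[OF assms(1,2,3)] smooth_differentiable_ccoef[OF assms(1,2,4)]])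

lemma pd_scal:
  assumes "open U" "x \<in> U" "smooth_on U f"
  shows "pd i (\<lambda>x. scal (f x) * v) x = scal (dirderiv (axis i 1) f x) * v"
proof (rule ccoef_eqI')
  fix A e
  have "dirderiv (axis i 1) (\<lambda>x. f x * ccoef v A e) x = dirderiv (axis i 1) f x * ccoef v A e"
    using smooth_on_differentiable[OF assms(3,2)]
    by (rule dirderiv_bounded_linear[OF bounded_linear_mult_left])
  then show "ccoef (pd i (\<lambda>x. scal (f x) * v) x) A e = ccoef (scal (dirderiv (axis i 1) f x) * v) A e"
    by (simp add: ccoef_pd[OF assms(1,2) dec_scal[of "smooth_on U", OF assms(3)]] ccoef_linear)
qed

lemma pd_0: "pd i (\<lambda>_. 0) x = 0"
  by (rule ccoef_eqI') (simp add: ccoef_pd[of UNIV] dec.zero ccoef_linear dirderiv_eq[OF has_derivative_const])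

lemma pd_sum:
  "open U \<Longrightarrow> x \<in> U \<Longrightarrow> (\<And>k. k \<in> I \<Longrightarrow> dec (smooth_on U) U (F k)) \<Longrightarrow> pd i (\<lambda>x. \<Sum>k\<in>I. F k x) x = (\<Sum>k\<in>I. pd i (F k) x)"
  by (induction I rule: infinite_finite_induct) (auto simp: pd_0 pd_add[of U] dec_sum)

lemma pd_glinear:
  assumes U: "open U" "x \<in> U" and L: "glinear L" and F: "dec (smooth_on U) U F"
  shows "pd i (\<lambda>x. L (F x)) x = L (pd i F x)"
  using F
proof (induction rule: dec.induct)
  case (base f F v)
  have "pd i F x = scal (dirderiv (axis i 1) f x) * v"
    using pd_scal[OF U base(1)] pd_cong[OF U, of F "\<lambda>x. scal (f x) * v"] base(2) by simp
  moreover have "pd i (\<lambda>x. L (F x)) x = scal (dirderiv (axis i 1) f x) * L v"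
    using pd_scal[OF U base(1)] pd_cong[OF U, of "\<lambda>x. L (F x)" "\<lambda>x. scal (f x) * L v"] base(2)
    by (simp add: glinearD[OF L])
  ultimately show ?case by (simp add: glinearD[OF L])
next
  case (zero F)
  then show ?case using pd_cong[OF U, of F "\<lambda>_. 0"] pd_cong[OF U, of "\<lambda>x. L (F x)" "\<lambda>_. 0"]
    by (simp add: glinearD[OF L] pd_0)
next
  case (plus F G H)
  then show ?case
    using pd_cong[OF U, of H "\<lambda>x. F x + G x"] pd_cong[OF U, of "\<lambda>x. L (H x)" "\<lambda>x. L (F x) + L (G x)"]
    by (simp add: glinearD[OF L] pd_add[OF U] dec_glinear[OF _ L])
qed

lemma glinear_mult: "glinear (\<lambda>a. a * b)" "glinear (\<lambda>a. b * a)"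
  by (simp_all add: glinear_def distrib_left distrib_right mult.assoc scal_left_commute[of b])

lemma dec_pd:
  assumes U: "open U" and F: "dec (smooth_on U) U F"
  shows "dec (smooth_on U) U (pd i F)"
  using F
proof (induction rule: dec.induct)
  case (base f F v)
  show ?case
  proof (rule dec.base[of _ "dirderiv (axis i 1) f"])
    show "smooth_on U (dirderiv (axis i 1) f)" by (rule smooth_on_dirderiv[OF base(1) axis_Basis])
    show "pd i F x = scal (dirderiv (axis i 1) f x) * v" if x: "x \<in> U" for x
      using pd_scal[OF U x base(1)] pd_cong[OF U x, of F "\<lambda>x. scal (f x) * v"] base(2) by simp
  qed
next
  case (zero F)
  have "pd i F x = 0" if x: "x \<in> U" for x
    using pd_cong[OF U x, of F "\<lambda>_. 0"] zero by (simp add: pd_0)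
  then show ?case by (rule dec.zero)
next
  case (plus F G H)
  show ?case
  proof (rule dec.plus[OF plus.IH])
    show "pd i H x = pd i F x + pd i G x" if x: "x \<in> U" for x
      using pd_cong[OF U x, of H "\<lambda>x. F x + G x"] plus by (simp add: pd_add[OF U x])
  qed
qed

lemma dec_smooth_mult:
  "open U \<Longrightarrow> dec (smooth_on U) U F \<Longrightarrow> dec (smooth_on U) U G \<Longrightarrow> dec (smooth_on U) U (\<lambda>x. F x * G x)"
  by (rule dec_mult) (auto intro: smooth_on_mult)

lemma pd_mult:
  assumes U: "open U" "x \<in> U" and F: "dec (smooth_on U) U F" and G: "dec (smooth_on U) U G"
  shows "pd i (\<lambda>x. F x * G x) x = pd i F x * G x + F x * pd i G x"
  using F
proof (induction rule: dec.induct)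
  case b: (base f F v)
  have pF: "pd i F x = scal (dirderiv (axis i 1) f x) * v"
    using pd_scal[OF U b(1)] pd_cong[OF U, of F "\<lambda>x. scal (f x) * v"] b(2) by simp
  show ?case using G
  proof (induction rule: dec.induct)
    case (base g G w)
    have pG: "pd i G x = scal (dirderiv (axis i 1) g x) * w"
      using pd_scal[OF U base(1)] pd_cong[OF U, of G "\<lambda>x. scal (g x) * w"] base(2) by simp
    have "pd i (\<lambda>x. F x * G x) x = pd i (\<lambda>x. scal (f x * g x) * (v * w)) x"
      by (rule pd_cong[OF U]) (simp only: b(2) base(2) scal_hom(2) mult.assoc scal_left_commute[of v])
    also have "\<dots> = scal (dirderiv (axis i 1) (\<lambda>x. f x * g x) x) * (v * w)"
      by (rule pd_scal[OF U smooth_on_mult[OF U(1) b(1) base(1)]])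
    also have "dirderiv (axis i 1) (\<lambda>x. f x * g x) x = f x * dirderiv (axis i 1) g x + dirderiv (axis i 1) f x * g x"
      using smooth_on_differentiable[OF b(1) U(2)] smooth_on_differentiable[OF base(1) U(2)]
      by (rule dirderiv_bilinear[OF bounded_bilinear_mult])
    finally show ?case using b(2)[OF U(2)] base(2)[OF U(2)]
      by (simp only: pF pG scal_hom(1,2) distrib_right mult.assoc scal_left_commute[of v] add.commute)
  next
    case (zero G)
    then show ?case using pd_cong[OF U, of G "\<lambda>_. 0"] pd_cong[OF U, of "\<lambda>x. F x * G x" "\<lambda>_. 0"] U(2) by (simp add: pd_0)
  next
    case (plus G G' H)
    have dF: "dec (smooth_on U) U F" using b by (rule dec.base)
    have "pd i (\<lambda>x. F x * H x) x = pd i (\<lambda>x. F x * G x + F x * G' x) x"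
      by (rule pd_cong[OF U]) (simp add: plus.hyps(3) distrib_left)
    moreover have "pd i H x = pd i G x + pd i G' x"
      using pd_cong[OF U, of H "\<lambda>x. G x + G' x"] plus by (simp add: pd_add[OF U])
    ultimately show ?case using plus U
      by (simp add: pd_add[OF U] dec_smooth_mult dF distrib_left)
  qed
next
  case (zero F)
  then show ?case using pd_cong[OF U, of F "\<lambda>_. 0"] pd_cong[OF U, of "\<lambda>x. F x * G x" "\<lambda>_. 0"] U(2) by (simp add: pd_0)
next
  case (plus F F' H)
  have "pd i (\<lambda>x. H x * G x) x = pd i (\<lambda>x. F x * G x + F' x * G x) x"
    by (rule pd_cong[OF U]) (simp add: plus.hyps(3) distrib_right)
  moreover have "pd i H x = pd i F x + pd i F' x"
    using pd_cong[OF U, of H "\<lambda>x. F x + F' x"] plus by (simp add: pd_add[OF U])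
  ultimately show ?case using plus U
    by (simp add: pd_add[OF U] dec_smooth_mult G distrib_right)
qed

lemma dec_const: "S (\<lambda>_. 1) \<Longrightarrow> dec S U (\<lambda>_. v)"
  by (rule dec.base[of S "\<lambda>_. 1"]) (auto simp: scal_hom)

lemma dec_smooth_const: "dec (smooth_on U) U (\<lambda>_. v)"
  by (rule dec_const) (rule smooth_on_const)

lemma pd_const: "pd i (\<lambda>_. v) x = 0"
  using pd_scal[of UNIV x "\<lambda>_. 1" i v, OF _ _ smooth_on_const]
  by (simp add: dirderiv_eq[OF has_derivative_const] scal_hom)

lemma gint_pd: "dec test_fun UNIV F \<Longrightarrow> gint (pd i F) = 0"
proof (rule ccoef_eqI')
  fix A e assume F: "dec test_fun UNIV F"
  have sF: "dec (smooth_on UNIV) UNIV F" by (rule dec_mono[OF F]) (auto simp: test_fun_smooth)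
  have "dec test_fun UNIV (pd i F)" using F
  proof (induction rule: dec.induct)
    case (base f F v)
    then have "F = (\<lambda>x. scal (f x) * v)" by auto
    then show ?case using base(1) pd_scal[of UNIV _ f i v]
      by (intro dec.base[of _ "dirderiv (axis i 1) f"]) (auto simp: test_fun_dirderiv axis_Basis test_fun_smooth)
  next
    case (zero F)
    then have "F = (\<lambda>x. 0)" by auto
    then show ?case by (intro dec.zero) (simp add: pd_0)
  next
    case (plus F G H)
    then have H: "H = (\<lambda>x. F x + G x)" by auto
    have "dec (smooth_on UNIV) UNIV F" "dec (smooth_on UNIV) UNIV G"
      using plus.hyps(1,2) by (auto elim!: dec_mono simp: test_fun_smooth)
    then show ?case by (intro dec.plus[OF plus.IH]) (simp add: H pd_add[of UNIV])
  qed
  then have "dec (integrable lborel) UNIV (pd i F)" by (rule dec_mono) (auto simp: test_fun_integrable)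
  then show "ccoef (gint (pd i F)) A e = ccoef 0 A e"
    by (simp add: ccoef_gint ccoef_pd[OF open_UNIV UNIV_I sF] ccoef_linear
        integral_dirderiv[OF dec_ccoef[OF lin_closed_test F] axis_Basis])
qed

lemma dec_power: "open U \<Longrightarrow> dec (smooth_on U) U M \<Longrightarrow> dec (smooth_on U) U (\<lambda>x. M x ^ k)"
  by (induction k) (auto intro: dec_smooth_const dec_smooth_mult)

lemma dec_taylor:
  assumes "open U" "dec (smooth_on U) U M" "\<And>j. smooth_on U (c j)"
  shows "dec (smooth_on U) U (\<lambda>x. taylor n (\<lambda>j. c j x) (M x))"
proof -
  have "smooth_on U (\<lambda>x. c j x * (1 / fact j))" for j
    by (intro smooth_on_mult smooth_on_const assms)
  then have "dec (smooth_on U) U (\<lambda>x. scal (c j x / fact j) * M x ^ j)" for j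
    using dec_smooth_mult[OF assms(1) dec_scal[of "smooth_on U" _ U 1] dec_power[OF assms(1,2)]] by fastforce
  then show ?thesis unfolding taylor_def by (intro dec_sum)
qed

text \<open>The chain rule for \<phi>(t + M) when both the body t and M depend on x. Differentiating
  the coefficients shifts them by one index with factor d, differentiating the powers shifts them
  with factor \<open>pd i M x\<close>, and both give the expansion of the derivative of
  \<phi>.\<close>

lemma pd_taylor:
  assumes U: "open U" "x \<in> U" and c: "\<And>j. smooth_on U (c j)" "\<And>j. dirderiv (axis i 1) (c j) x = c (Suc j) x * d"
    and M: "dec (smooth_on U) U M" "\<And>b. M x * b = b * M x" "\<And>z. z \<in> U \<Longrightarrow> M z ^ Suc n = 0"
  shows "pd i (\<lambda>x. taylor n (\<lambda>j. c j x) (M x)) x = taylor n (\<lambda>j. c (Suc j) x) (M x) * (scal d + pd i M x)"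
proof -
  note Mp = dec_power[OF U(1) M(1)]
  have s: "smooth_on U (\<lambda>x. c j x * (1 / fact j))" for j
    by (intro smooth_on_mult smooth_on_const c U)
  have t: "pd i (\<lambda>x. scal (c j x / fact j) * M x ^ j) x =
      scal (c (Suc j) x / fact j) * M x ^ j * scal d + scal (c j x / fact j) * pd i (\<lambda>x. M x ^ j) x" for j
  proof -
    have d: "dec (smooth_on U) U (\<lambda>x. scal (c j x * (1 / fact j)) * 1)"
      by (rule dec_scal[of "smooth_on U", OF s])
    have "pd i (\<lambda>x. scal (c j x * (1 / fact j)) * 1 * M x ^ j) x =
        pd i (\<lambda>x. scal (c j x * (1 / fact j)) * 1) x * M x ^ j + scal (c j x * (1 / fact j)) * 1 * pd i (\<lambda>x. M x ^ j) x"
      by (rule pd_mult[OF U d Mp])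
    also have "pd i (\<lambda>x. scal (c j x * (1 / fact j)) * 1) x = scal (c (Suc j) x * d * (1 / fact j)) * 1"
      unfolding pd_scal[OF U s] using smooth_on_differentiable[OF c(1) U(2)]
      by (subst dirderiv_bounded_linear[OF bounded_linear_mult_left]) (simp_all add: c(2))
    also have "scal (c (Suc j) x * d * (1 / fact j)) * 1 * M x ^ j = scal (c (Suc j) x / fact j) * M x ^ j * scal d"
    proof -
      have eq: "c (Suc j) x * d * (1 / fact j) = c (Suc j) x / fact j * d" by simp
      show ?thesis unfolding eq scal_hom(2) mult_1_right by (simp only: mult.assoc scal_central[of "M x ^ j"])
    qed
    finally show ?thesis by simp
  qed
  have d: "dec (smooth_on U) U (\<lambda>x. scal (c j x / fact j) * M x ^ j)" for j
    using dec_smooth_mult[OF U(1) dec_scal[of "smooth_on U", OF s[of j], of U 1] Mp[of j]] by simp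
  have E: "pd i (\<lambda>x. M x ^ Suc k) x = of_nat (Suc k) * (M x ^ k * pd i M x)" for k
  proof (induction k)
    case (Suc k)
    have "pd i (\<lambda>x. M x ^ Suc (Suc k)) x = pd i M x * M x ^ Suc k + M x * pd i (\<lambda>x. M x ^ Suc k) x"
      unfolding power_Suc[of _ "Suc k"] by (rule pd_mult[OF U M(1) Mp])
    also have "pd i M x * M x ^ Suc k = M x ^ Suc k * pd i M x" by (rule power_central[OF M(2), symmetric])
    also have "M x * pd i (\<lambda>x. M x ^ Suc k) x = of_nat (Suc k) * (M x ^ Suc k * pd i M x)"
      unfolding Suc by (simp only: mult.assoc[symmetric] power_Suc M(2)[of "of_nat (Suc k)"])
    finally show ?case by (simp add: distrib_right)
  qed simp
  have E0: "pd i (\<lambda>x. M x ^ Suc n) x = 0"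
    using pd_cong[OF U, of "\<lambda>x. M x ^ Suc n" "\<lambda>_. 0"] M(3) by (simp add: pd_0)
  have "pd i (\<lambda>x. taylor n (\<lambda>j. c j x) (M x)) x = (\<Sum>j\<le>n. scal (c (Suc j) x / fact j) * M x ^ j * scal d) +
      (\<Sum>j\<le>n. scal (c j x / fact j) * pd i (\<lambda>x. M x ^ j) x)"
    unfolding taylor_def by (simp only: pd_sum[OF U d] t sum.distrib)
  also have "(\<Sum>j\<le>n. scal (c j x / fact j) * pd i (\<lambda>x. M x ^ j) x) = taylor n (\<lambda>j. c (Suc j) x) (M x) * pd i M x"
    by (rule taylor_derivative_sum[of "\<lambda>j. pd i (\<lambda>x. M x ^ j) x", OF _ E E0]) (simp add: pd_const)
  finally show ?thesis by (simp add: taylor_def sum_distrib_right distrib_left)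
qed

section \<open>Limits and the superintegral\<close>

definition vlim :: "(real \<Rightarrow> 'm::finite cgrass) \<Rightarrow> 'm cgrass \<Rightarrow> bool" where
  "vlim f l \<longleftrightarrow> (\<forall>A e. ((\<lambda>\<epsilon>. ccoef (f \<epsilon>) A e) \<longlongrightarrow> ccoef l A e) (at_right 0))"

lemma vlim_unique: "vlim f l \<Longrightarrow> vlim f l' \<Longrightarrow> l = l'"
  unfolding vlim_def by (intro ccoef_eqI') (meson tendsto_unique trivial_limit_at_right_real)

lemma vlim_cong: "vlim f l \<Longrightarrow> \<forall>\<^sub>F \<epsilon> in at_right 0. f \<epsilon> = f' \<epsilon> \<Longrightarrow> vlim f' l"
  unfolding vlim_def by (intro allI) (erule allE, erule allE, erule Lim_transform_eventually, auto elim: eventually_mono)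

lemma vlim_const: "vlim (\<lambda>_. l) l"
  by (simp add: vlim_def)

lemma vlim_add: "vlim f a \<Longrightarrow> vlim h b \<Longrightarrow> vlim (\<lambda>\<epsilon>. f \<epsilon> + h \<epsilon>) (a + b)"
  and vlim_diff: "vlim f a \<Longrightarrow> vlim h b \<Longrightarrow> vlim (\<lambda>\<epsilon>. f \<epsilon> - h \<epsilon>) (a - b)"
  unfolding vlim_def ccoef_linear by (auto intro: tendsto_intros)

lemma vlim_scal: "(c \<longlongrightarrow> l) (at_right 0) \<Longrightarrow> vlim (\<lambda>\<epsilon>. scal (c \<epsilon>) * v) (scal l * v)"
  unfolding vlim_def ccoef_linear by (auto intro: tendsto_intros)

lemma vlim_sum: "(\<And>i. i \<in> I \<Longrightarrow> vlim (f i) (l i)) \<Longrightarrow> vlim (\<lambda>\<epsilon>. \<Sum>i\<in>I. f i \<epsilon>) (\<Sum>i\<in>I. l i)"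
  unfolding vlim_def ccoef_sum by (auto intro: tendsto_intros)

lemma glinear_berezin: "glinear (berezin n)"
  by (simp add: glinear_def berezin_linear)

lemma glinear_sum: "glinear L \<Longrightarrow> L (\<Sum>i\<in>I. f i) = (\<Sum>i\<in>I. L (f i))"
  by (induction I rule: infinite_finite_induct) (auto simp: glinearD)

text \<open>W and F take values in fixed finite-dimensional subspaces, so the superintegral is a
  finite sum of scalar pairings with constant coefficients. Each pairing is a limit of integrals by
  \<open>dpair_approx\<close>, and the same expansion holds for the product under the
  integral.\<close>

lemma super_int_limit:
  fixes F :: "'m::finite pt \<Rightarrow> 'm cgrass" and W :: "real \<Rightarrow> 'm pt \<Rightarrow> 'm cgrass"
  assumes P: "compact P" "P \<subseteq> \<Omega>" "open \<Omega>"
    and a: "\<And>A e. A \<subseteq> {1..4 * n} \<Longrightarrow> e \<in> cliff_basis \<Longrightarrow> approx P (\<lambda>\<epsilon> x. ccoef (W \<epsilon> x) A e) (\<alpha> A e)"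
    and W0: "\<And>\<epsilon> x. \<epsilon> > 0 \<Longrightarrow> x \<notin> P \<Longrightarrow> W \<epsilon> x = 0"
    and BW: "finite B" "B \<subseteq> cliff_basis" "\<And>\<epsilon> x A e. e \<notin> B \<Longrightarrow> ccoef (W \<epsilon> x) A e = 0"
    and WS: "\<And>\<epsilon> x A. gcoef (W \<epsilon> x) A \<noteq> 0 \<Longrightarrow> A \<subseteq> {1..4 * n}"
    and F: "dec (smooth_on \<Omega>) \<Omega> F" "\<And>x A. x \<in> \<Omega> \<Longrightarrow> gcoef (F x) A \<noteq> 0 \<Longrightarrow> A \<subseteq> {1..4 * n}"
  shows "vlim (\<lambda>\<epsilon>. gint (\<lambda>x. berezin n (W \<epsilon> x * F x))) (super_int n \<alpha> F)"
proof -
  let ?Q = "Pow {1..4 * n}"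
  have "\<exists>C. \<forall>A. finite (C A) \<and> C A \<subseteq> cliff_basis \<and> (\<forall>x\<in>\<Omega>. \<forall>e. e \<notin> C A \<longrightarrow> ccoef (F x) A e = 0)"
    using dec_finite[OF F(1)] by (intro choice) blast
  then obtain C0 where C0: "\<And>A. finite (C0 A)" "\<And>A. C0 A \<subseteq> cliff_basis" "\<And>A x e. x \<in> \<Omega> \<Longrightarrow> e \<notin> C0 A \<Longrightarrow> ccoef (F x) A e = 0"
    by blast
  define C where "C = (\<Union>A\<in>?Q. C0 A)"
  have C: "finite C" "C \<subseteq> cliff_basis" using C0 by (auto simp: C_def)
  have CF: "ccoef (F x) A e = 0" if "x \<in> \<Omega>" "e \<notin> C" for x A e
  proof (cases "A \<in> ?Q")
    case True
    then show ?thesis using C0(3)[OF that(1), of e A] that(2) by (auto simp: C_def)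
  next
    case False
    then have "gcoef (F x) A = 0" using F(2)[OF that(1)] by blast
    then show ?thesis by (simp add: ccoef_def cliff.representation_zero)
  qed
  define D where "D A b E c = dpair (\<alpha> A b) (\<lambda>x. ccoef (F x) E c)" for A b E c
  define I where "I \<epsilon> A b E c = (\<integral>x. ccoef (W \<epsilon> x) A b * ccoef (F x) E c \<partial>lborel)" for \<epsilon> A b E c
  define V where "V A b E c = berezin n (gconst b * gmono A * gconst c * gmono E :: 'm cgrass)" for A b E c
  note sF = dec_ccoef[OF lin_closed_smooth[OF P(3)] F(1)]
  have lim: "((\<lambda>\<epsilon>. I \<epsilon> A b E c) \<longlongrightarrow> D A b E c) (at_right 0)" if "A \<in> ?Q" "b \<in> cliff_basis" for A b E c
    unfolding I_def D_def using that by (intro dpair_approx[OF a P sF]) auto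
  \<comment> \<open>The definition of the superintegral sums over all pairs of basis vectors with
    nonzero pairing. Outside B \<times> C a pairing is the limit of integrals that are zero, hence
    zero itself.\<close>
  have D0: "D A b E c = 0" if "A \<in> ?Q" "b \<in> cliff_basis" "b \<notin> B \<or> c \<notin> C" for A b E c
  proof -
    have "\<forall>\<^sub>F \<epsilon> in at_right 0. 0 = I \<epsilon> A b E c"
      using eventually_right_pos
    proof eventually_elim
      case (elim \<epsilon>)
      have z: "ccoef (W \<epsilon> x) A b * ccoef (F x) E c = 0" for x
        using that(3) BW(3)[of b \<epsilon> x A] CF[of x c E] W0[OF elim, of x] P(2) by (cases "x \<in> P") (auto simp: ccoef_linear)
      show ?case unfolding I_def z by simp
    qed
    then have "((\<lambda>\<epsilon>. I \<epsilon> A b E c) \<longlongrightarrow> 0) (at_right 0)"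
      by (rule Lim_transform_eventually[OF tendsto_const])
    then show ?thesis using tendsto_unique[OF trivial_limit_at_right_real lim[OF that(1,2)]] by blast
  qed
  have int: "\<forall>\<^sub>F \<epsilon> in at_right 0. integrable lborel (\<lambda>x. ccoef (W \<epsilon> x) A b * ccoef (F x) E c)"
    if "A \<in> ?Q" "b \<in> cliff_basis" for A b E c
  proof -
    \<comment> \<open>F is smooth only on \<Omega>; inserting a cutoff that is 1 near P produces a
      test function and does not change the product with \<open>W \<epsilon>\<close>.\<close>
    obtain \<eta> Y where \<eta>: "test_fun \<eta>" "fsupp \<eta> \<subseteq> \<Omega>" "open Y" "P \<subseteq> Y" "\<forall>x\<in>Y. \<eta> x = 1"
      using smooth_urysohn[OF P(1,3,2)] by blast
    have t: "test_fun (\<lambda>x. ccoef (F x) E c * \<eta> x)" by (rule test_fun_mult_smooth[OF \<eta>(1) P(3) \<eta>(2) sF])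
    have "A \<subseteq> {1..4 * n}" using that by blast
    from approxD(2)[OF a[OF this that(2)] t] eventually_right_pos show ?thesis
    proof eventually_elim
      case (elim \<epsilon>)
      have "ccoef (W \<epsilon> x) A b * (ccoef (F x) E c * \<eta> x) = ccoef (W \<epsilon> x) A b * ccoef (F x) E c" for x
        using W0[OF elim(2), of x] \<eta>(4,5) by (cases "x \<in> P") (auto simp: ccoef_linear)
      then show ?case using elim(1) by (simp only:)
    qed
  qed
  have S: "super_int n \<alpha> F = (\<Sum>A\<in>?Q. \<Sum>E\<in>?Q. \<Sum>b\<in>B. \<Sum>c\<in>C. scal (D A b E c) * V A b E c)"
    unfolding super_int_def D_def[symmetric] V_def[symmetric]
  proof (intro sum.cong HOL.refl)
    fix A E assume A: "A \<in> ?Q"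
    have "{(b, c). b \<in> cliff_basis \<and> c \<in> cliff_basis \<and> D A b E c \<noteq> 0} \<subseteq> B \<times> C" using D0[OF A] by blast
    then have "(\<Sum>(b, c) | b \<in> cliff_basis \<and> c \<in> cliff_basis \<and> D A b E c \<noteq> 0. scal (D A b E c) * V A b E c) =
        (\<Sum>(b, c)\<in>B \<times> C. scal (D A b E c) * V A b E c)"
      by (intro sum.mono_neutral_left) (use BW(1,2) C in \<open>auto simp: scal_hom\<close>)
    then show "(\<Sum>(b, c) | b \<in> cliff_basis \<and> c \<in> cliff_basis \<and> D A b E c \<noteq> 0. scal (D A b E c) * V A b E c) =
        (\<Sum>b\<in>B. \<Sum>c\<in>C. scal (D A b E c) * V A b E c)"
      by (simp add: sum.cartesian_product)
  qed
  have G: "\<forall>\<^sub>F \<epsilon> in at_right 0. (\<Sum>A\<in>?Q. \<Sum>E\<in>?Q. \<Sum>b\<in>B. \<Sum>c\<in>C. scal (I \<epsilon> A b E c) * V A b E c) =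
      gint (\<lambda>x. berezin n (W \<epsilon> x * F x))"
  proof -
    have "\<forall>\<^sub>F \<epsilon> in at_right 0. \<forall>A\<in>?Q. \<forall>E\<in>?Q. \<forall>b\<in>B. \<forall>c\<in>C. integrable lborel (\<lambda>x. ccoef (W \<epsilon> x) A b * ccoef (F x) E c)"
      using int BW(1,2) C(1) by (auto intro!: eventually_ball_finite)
    then show ?thesis using eventually_right_pos
    proof eventually_elim
      case (elim \<epsilon>)
      have eq: "berezin n (W \<epsilon> x * F x) =
          (\<Sum>A\<in>?Q. \<Sum>E\<in>?Q. \<Sum>b\<in>B. \<Sum>c\<in>C. scal (ccoef (W \<epsilon> x) A b * ccoef (F x) E c) * V A b E c)" for x
      proof (cases "x \<in> P")
        case True
        then have x: "x \<in> \<Omega>" using P(2) by blast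
        have w: "W \<epsilon> x = (\<Sum>A\<in>?Q. \<Sum>b\<in>B. scal (ccoef (W \<epsilon> x) A b) * (gconst b * gmono A))"
          by (rule ccoef_expand[OF WS _ BW(1,3)]) auto
        have f: "F x = (\<Sum>E\<in>?Q. \<Sum>c\<in>C. scal (ccoef (F x) E c) * (gconst c * gmono E))"
          by (rule ccoef_expand[OF F(2)[OF x] _ C(1) CF[OF x]]) auto
        have t: "scal p * (gconst b * gmono A) * (scal q * (gconst c * gmono E)) =
            scal (p * q) * (gconst b * gmono A * gconst c * gmono E)" for p q b c A E
          by (simp only: scal_hom(2) mult.assoc scal_left_commute[of "gmono A"] scal_left_commute[of "gconst b"])
        have "W \<epsilon> x * F x = (\<Sum>A\<in>?Q. \<Sum>b\<in>B. \<Sum>E\<in>?Q. \<Sum>c\<in>C. scal (ccoef (W \<epsilon> x) A b * ccoef (F x) E c) *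
            (gconst b * gmono A * gconst c * gmono E))"
          by (subst w, subst f) (simp only: sum_distrib_right, simp only: sum_distrib_left t)
        also have "\<dots> = (\<Sum>A\<in>?Q. \<Sum>E\<in>?Q. \<Sum>b\<in>B. \<Sum>c\<in>C. scal (ccoef (W \<epsilon> x) A b * ccoef (F x) E c) *
            (gconst b * gmono A * gconst c * gmono E))"
          by (intro sum.cong HOL.refl) (rule sum.swap)
        finally show ?thesis
          by (simp only: glinear_sum[OF glinear_berezin] berezin_linear V_def)
      next
        case False
        then show ?thesis using W0[OF elim(2)] glinearD(3)[OF glinear_berezin, of n]
          by (simp add: ccoef_linear scal_hom)
      qed
      have d: "dec (integrable lborel) UNIV (\<lambda>x. scal (ccoef (W \<epsilon> x) A b * ccoef (F x) E c) * V A b E c)"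
        if "A \<in> ?Q" "E \<in> ?Q" "b \<in> B" "c \<in> C" for A b E c
        using elim(1) that by (intro dec_scal) blast
      have "gint (\<lambda>x. berezin n (W \<epsilon> x * F x)) =
          (\<Sum>A\<in>?Q. \<Sum>E\<in>?Q. \<Sum>b\<in>B. \<Sum>c\<in>C. gint (\<lambda>x. scal (ccoef (W \<epsilon> x) A b * ccoef (F x) E c) * V A b E c))"
        unfolding eq by (subst gint_sum, (intro dec_sum d; assumption), rule sum.cong[OF HOL.refl])+ (rule HOL.refl)
      also have "\<dots> = (\<Sum>A\<in>?Q. \<Sum>E\<in>?Q. \<Sum>b\<in>B. \<Sum>c\<in>C. scal (I \<epsilon> A b E c) * V A b E c)"
        unfolding I_def using elim(1) by (intro sum.cong HOL.refl gint_scal) blast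
      finally show ?case by simp
    qed
  qed
  have "vlim (\<lambda>\<epsilon>. \<Sum>A\<in>?Q. \<Sum>E\<in>?Q. \<Sum>b\<in>B. \<Sum>c\<in>C. scal (I \<epsilon> A b E c) * V A b E c) (super_int n \<alpha> F)"
    unfolding S using BW(2) by (intro vlim_sum vlim_scal lim) auto
  then show ?thesis by (rule vlim_cong[OF _ G])
qed

section \<open>Radial singular integrals\<close>

text \<open>A limit from the right is reduced to sequences, for which dominated convergence is
  available. The exceptional point a, where convergence may fail, is a null set.\<close>

lemma tendsto_at_right_dominated:
  fixes s :: "real \<Rightarrow> 'a::euclidean_space \<Rightarrow> complex"
  assumes w: "integrable lborel w" and m: "\<And>\<epsilon>. \<epsilon> > 0 \<Longrightarrow> s \<epsilon> \<in> borel_measurable borel" "f \<in> borel_measurable borel"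
    and b: "\<And>\<epsilon> x. \<epsilon> > 0 \<Longrightarrow> norm (s \<epsilon> x) \<le> w x"
    and l: "\<And>x. x \<noteq> a \<Longrightarrow> ((\<lambda>\<epsilon>. s \<epsilon> x) \<longlongrightarrow> f x) (at_right 0)"
  shows "((\<lambda>\<epsilon>. \<integral>x. s \<epsilon> x \<partial>lborel) \<longlongrightarrow> (\<integral>x. f x \<partial>lborel)) (at_right 0)"
proof (rule tendsto_at_right_sequentially[of 0 1])
  fix S :: "nat \<Rightarrow> real" assume S: "\<And>n. 0 < S n" "S \<longlonglongrightarrow> 0"
  have Sl: "filterlim S (at_right 0) sequentially"
    using S(2) S(1)[THEN less_imp_neq, THEN not_sym] S(1) by (simp add: filterlim_at)
  have ae: "AE x in lborel. x \<noteq> a" by (rule AE_lborel_singleton)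
  show "(\<lambda>n. \<integral>x. s (S n) x \<partial>lborel) \<longlonglongrightarrow> (\<integral>x. f x \<partial>lborel)"
  proof (rule integral_dominated_convergence[OF _ _ w])
    show "AE x in lborel. (\<lambda>n. s (S n) x) \<longlonglongrightarrow> f x"
      using ae by eventually_elim (rule filterlim_compose[OF l Sl])
  qed (use m b S in auto)
qed auto

text \<open>Dyadic balls bound the integral of the singularity by a geometric series.\<close>

lemma integrable_norm_power:
  fixes a :: "'a::euclidean_space"
  assumes N: "p < DIM('a)"
  shows "integrable lborel (\<lambda>x. indicator (ball a 1) x * inverse (norm (x - a) ^ p))"
proof (rule integrableI_bounded)
  let ?f = "\<lambda>x. indicator (ball a 1) x * inverse (norm (x - a) ^ p)"
  show "?f \<in> borel_measurable lborel"
    by (intro borel_measurable_times borel_measurable_inverse borel_measurable_power borel_measurable_norm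
        borel_measurable_diff borel_measurable_indicator) auto
  define V where "V = unit_ball_vol (real DIM('a))"
  have V0: "0 \<le> V" by (simp add: V_def)
  have le: "ennreal (norm (?f x)) \<le> (suminf (\<lambda>k. ennreal (2 ^ (p * Suc k)) * indicator (ball a ((1/2) ^ k)) x))" for x
  proof (cases "x \<in> ball a 1 \<and> x \<noteq> a")
    case False
    \<comment> \<open>At x = a the integrand is the inverse of 0, which is 0, unless p = 0; in that
      case it is 1 and the summand with index 0 bounds it.\<close>
    then show ?thesis
      by (cases "p = 0")
        (auto simp: indicator_def dist_norm norm_minus_commute zero_power intro!: order_trans[OF _ sum_le_suminf[of _ "{0}"]])
  next
    case True
    let ?r = "norm (x - a)"
    have r: "0 < ?r" "?r < 1" using True by (auto simp: dist_norm norm_minus_commute)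
    have "\<exists>k. (1/2::real) ^ k \<le> ?r" using real_arch_pow_inv[of ?r "1/2"] r by (auto intro: less_imp_le)
    \<comment> \<open>For the least k with \<open>(1/2) ^ k\<close> at most the distance r, the
      power of 1/r is bounded by \<open>2 ^ (p * k)\<close>, and x lies in the ball of the next
      larger dyadic radius.\<close>
    define k where "k = (LEAST k. (1/2::real) ^ k \<le> ?r)"
    have k: "(1/2::real) ^ k \<le> ?r" unfolding k_def using \<open>\<exists>k. (1/2::real) ^ k \<le> ?r\<close> by (rule LeastI_ex)
    have "k \<noteq> 0" using k r by (intro notI) simp
    then obtain j where j: "k = Suc j" by (cases k) auto
    have "\<not> (1/2::real) ^ j \<le> ?r" using not_less_Least[of j "\<lambda>k. (1/2::real) ^ k \<le> ?r"] j by (simp add: k_def)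
    then have xj: "x \<in> ball a ((1/2) ^ j)" by (simp add: dist_norm norm_minus_commute)
    have "inverse (?r ^ p) \<le> inverse (((1/2) ^ Suc j) ^ p)"
      using k r j by (intro le_imp_inverse_le power_mono) auto
    also have "\<dots> = 2 ^ (p * Suc j)" by (simp add: power_mult[symmetric] power_add power_one_over mult.commute)
    finally have "ennreal (norm (?f x)) \<le> ennreal (2 ^ (p * Suc j)) * indicator (ball a ((1/2) ^ j)) x"
      using xj True r by (simp add: indicator_def ennreal_leI)
    also have "\<dots> \<le> (suminf (\<lambda>k. ennreal (2 ^ (p * Suc k)) * indicator (ball a ((1/2) ^ k)) x))"
    proof -
      have "f j \<le> suminf f" for f :: "nat \<Rightarrow> ennreal" using sum_le_suminf[of f "{j}"] by simp
      then show ?thesis .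
    qed
    finally show ?thesis .
  qed
  have "(\<integral>\<^sup>+x. ennreal (norm (?f x)) \<partial>lborel) \<le>
      (\<integral>\<^sup>+x. (suminf (\<lambda>k. ennreal (2 ^ (p * Suc k)) * indicator (ball a ((1/2) ^ k)) x)) \<partial>lborel)"
    by (rule nn_integral_mono) (rule le)
  also have "\<dots> = (suminf (\<lambda>k. ennreal (2 ^ (p * Suc k)) * emeasure lborel (ball a ((1/2) ^ k))))"
  proof (subst nn_integral_suminf)
    show "(\<lambda>x. ennreal (2 ^ (p * Suc i)) * indicator (ball a ((1/2) ^ i)) x) \<in> borel_measurable lborel" for i
      by (intro borel_measurable_times_ennreal borel_measurable_const borel_measurable_indicator) simp
  qed (simp only: nn_integral_cmult_indicator sets_lborel borel_open open_ball)
  also have "\<dots> = (suminf (\<lambda>k. ennreal (2 ^ (p * Suc k) * (V * ((1/2) ^ k) ^ DIM('a)))))"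
  proof (rule arg_cong[of _ _ suminf], rule ext)
    fix k
    have "emeasure lborel (ball a ((1/2) ^ k)) = ennreal (V * ((1/2) ^ k) ^ DIM('a))"
      unfolding V_def by (rule emeasure_ball) simp
    then show "ennreal (2 ^ (p * Suc k)) * emeasure lborel (ball a ((1/2) ^ k)) = ennreal (2 ^ (p * Suc k) * (V * ((1/2) ^ k) ^ DIM('a)))"
      using V0 by (simp only: ennreal_mult[symmetric] zero_le_power zero_le_numeral mult_nonneg_nonneg zero_le_divide_1_iff)
  qed
  \<comment> \<open>The volumes decay at least by the factor \<open>2 ^ (p + 1)\<close> per step,
    since p is smaller than the dimension, while the values grow by \<open>2 ^ p\<close>; the
    quotient 1/2 is left.\<close>
  also have "\<dots> \<le> (suminf (\<lambda>k. ennreal (2 ^ p * V * (1/2) ^ k)))"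
  proof (intro suminf_le allI ennreal_leI)
    fix k
    have "2 ^ (p * Suc k) * ((1/2::real) ^ k) ^ DIM('a) = 2 ^ p * (2 ^ (p * k) / 2 ^ (DIM('a) * k))"
    proof -
      have "(2::real) ^ (p * Suc k) = 2 ^ p * 2 ^ (p * k)" by (simp only: mult_Suc_right power_add)
      moreover have "((1/2::real) ^ k) ^ DIM('a) = 1 / 2 ^ (DIM('a) * k)"
        by (simp only: power_one_over power_mult[symmetric] mult.commute[of k])
      ultimately show ?thesis by (simp only: times_divide_eq_right mult_1_right mult.assoc)
    qed
    also have "\<dots> \<le> 2 ^ p * (1/2) ^ k"
    proof -
      have "Suc p * k \<le> DIM('a) * k" using N by (intro mult_le_mono1) simp
      then have "(2::real) ^ (p * k) * 2 ^ k \<le> 2 ^ (DIM('a) * k)"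
        unfolding power_add[symmetric] by (intro power_increasing) simp_all
      then have "(2::real) ^ (p * k) / 2 ^ (DIM('a) * k) \<le> 1 / 2 ^ k" by (simp add: field_simps)
      then show ?thesis unfolding power_one_over by (intro mult_left_mono) simp_all
    qed
    finally show "2 ^ (p * Suc k) * (V * ((1/2) ^ k) ^ DIM('a)) \<le> 2 ^ p * V * (1/2) ^ k"
      using V0 mult_left_mono[of "2 ^ (p * Suc k) * ((1/2::real) ^ k) ^ DIM('a)" "2 ^ p * (1/2) ^ k" V] by (simp add: mult_ac)
  qed auto
  also have "\<dots> = ennreal (suminf (\<lambda>k. 2 ^ p * V * (1/2) ^ k))"
    using V0 by (intro suminf_ennreal2) (auto intro!: summable_mult summable_geometric)
  finally show "(\<integral>\<^sup>+x. ennreal (norm (?f x)) \<partial>lborel) < \<infinity>" by (simp add: le_less_trans)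
qed

lemma radial_bound:
  fixes a :: "'a::euclidean_space"
  assumes \<phi>: "test_fun \<phi>" and q: "q < DIM('a)"
  shows "\<exists>w. integrable lborel w \<and> (\<forall>x. inverse (norm (x - a) ^ q) * norm (\<phi> x) \<le> w x)"
proof -
  obtain B where B: "\<And>x. norm (\<phi> x) \<le> B" using test_fun_bounded[OF \<phi>] by blast
  have B0: "0 \<le> B" using B[of 0] norm_ge_zero order_trans by blast
  have i: "integrable lborel (\<lambda>x. B * (indicator (ball a 1) x * inverse (norm (x - a) ^ q)) + norm (\<phi> x))"
    by (intro Bochner_Integration.integrable_add integrable_mult_right integrable_norm_power q
        integrable_norm test_fun_integrable \<phi>)
  have "inverse (norm (x - a) ^ q) * norm (\<phi> x) \<le> B * (indicator (ball a 1) x * inverse (norm (x - a) ^ q)) + norm (\<phi> x)" for x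
  proof (cases "x \<in> ball a 1")
    case True
    then show ?thesis using mult_right_mono[OF B[of x], of "inverse (norm (x - a) ^ q)"]
      by (simp add: mult.commute add_increasing2)
  next
    case False
    then have "1 \<le> norm (x - a) ^ q" by (intro one_le_power) (auto simp: dist_norm norm_minus_commute)
    then have "inverse (norm (x - a) ^ q) \<le> 1" by (rule inverse_le_1_iff[THEN iffD2, OF disjI2])
    then show ?thesis using False mult_right_mono[of "inverse (norm (x - a) ^ q)" 1 "norm (\<phi> x)"] by simp
  qed
  then show ?thesis using i by blast
qed

text \<open>The bound is uniform in \<epsilon> and locally integrable because q is less than the
  dimension, so dominated convergence applies against any test function.\<close>

lemma radial_limit:
  fixes \<kappa> :: "real \<Rightarrow> 'a::euclidean_space \<Rightarrow> complex"
  assumes q: "q < DIM('a)" and m: "\<And>\<epsilon>. \<epsilon> \<ge> 0 \<Longrightarrow> \<kappa> \<epsilon> \<in> borel_measurable borel" "\<kappa>0 \<in> borel_measurable borel"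
    and b: "\<And>\<epsilon> x. \<epsilon> \<ge> 0 \<Longrightarrow> x \<noteq> a \<Longrightarrow> norm (\<kappa> \<epsilon> x) \<le> C * inverse (norm (x - a) ^ q)"
    and l: "\<And>x. x \<noteq> a \<Longrightarrow> ((\<lambda>\<epsilon>. \<kappa> \<epsilon> x) \<longlongrightarrow> \<kappa>0 x) (at_right 0)" and \<phi>: "test_fun \<phi>"
  shows "\<epsilon> \<ge> 0 \<Longrightarrow> integrable lborel (\<lambda>x. \<kappa> \<epsilon> x * \<phi> x)"
    and "((\<lambda>\<epsilon>. \<integral>x. \<kappa> \<epsilon> x * \<phi> x \<partial>lborel) \<longlongrightarrow> (\<integral>x. \<kappa>0 x * \<phi> x \<partial>lborel)) (at_right 0)"
proof -
  obtain w where w: "integrable lborel w" "\<And>x. inverse (norm (x - a) ^ q) * norm (\<phi> x) \<le> w x"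
    using radial_bound[OF \<phi> q, of a] by blast
  have iw: "integrable lborel (\<lambda>x. \<bar>C\<bar> * \<bar>w x\<bar>)" using w(1) by auto
  have m\<phi>: "\<phi> \<in> borel_measurable borel" using borel_measurable_integrable[OF test_fun_integrable[OF \<phi>]] by simp
  have mk: "(\<lambda>x. \<kappa> \<epsilon> x * \<phi> x) \<in> borel_measurable borel" if "\<epsilon> \<ge> 0" for \<epsilon>
    by (intro borel_measurable_times m(1) that m\<phi>)
  have le: "norm (\<kappa> \<epsilon> x * \<phi> x) \<le> \<bar>C\<bar> * \<bar>w x\<bar>" if "\<epsilon> \<ge> 0" "x \<noteq> a" for \<epsilon> x
  proof -
    have "norm (\<kappa> \<epsilon> x * \<phi> x) \<le> C * inverse (norm (x - a) ^ q) * norm (\<phi> x)"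
      unfolding norm_mult by (intro mult_right_mono b that) auto
    also have "\<dots> \<le> \<bar>C\<bar> * (inverse (norm (x - a) ^ q) * norm (\<phi> x))"
      unfolding mult.assoc by (intro mult_right_mono) auto
    also have "\<dots> \<le> \<bar>C\<bar> * \<bar>w x\<bar>" by (intro mult_left_mono order_trans[OF w(2)]) auto
    finally show ?thesis .
  qed
  have ae: "AE x in lborel. x \<noteq> a" by (rule AE_lborel_singleton)
  show "integrable lborel (\<lambda>x. \<kappa> \<epsilon> x * \<phi> x)" if "\<epsilon> \<ge> 0"
  proof (rule Bochner_Integration.integrable_bound[OF iw])
    show "(\<lambda>x. \<kappa> \<epsilon> x * \<phi> x) \<in> borel_measurable lborel" using mk[OF that] by simp
    show "AE x in lborel. norm (\<kappa> \<epsilon> x * \<phi> x) \<le> norm (\<bar>C\<bar> * \<bar>w x\<bar>)"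
      using ae by eventually_elim (use le[OF that] in simp)
  qed
  let ?s = "\<lambda>\<epsilon> x. if x = a then 0 else \<kappa> \<epsilon> x * \<phi> x"
  have ms: "?s \<epsilon> \<in> borel_measurable borel" if "\<epsilon> \<ge> 0" for \<epsilon>
    by (rule measurable_If) (use mk[OF that] in auto)
  have eq: "(\<integral>x. ?s \<epsilon> x \<partial>lborel) = (\<integral>x. \<kappa> \<epsilon> x * \<phi> x \<partial>lborel)" if "\<epsilon> > 0" for \<epsilon>
  proof (rule integral_cong_AE)
    show "AE x in lborel. ?s \<epsilon> x = \<kappa> \<epsilon> x * \<phi> x" using ae by eventually_elim simp
  qed (use mk[of \<epsilon>] ms[of \<epsilon>] that in simp_all)
  have "((\<lambda>\<epsilon>. \<integral>x. ?s \<epsilon> x \<partial>lborel) \<longlongrightarrow> (\<integral>x. \<kappa>0 x * \<phi> x \<partial>lborel)) (at_right 0)"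
  proof (rule tendsto_at_right_dominated[OF iw, where a = a])
    show "?s \<epsilon> \<in> borel_measurable borel" if "\<epsilon> > 0" for \<epsilon> using ms[of \<epsilon>] that by simp
    show "norm (?s \<epsilon> x) \<le> \<bar>C\<bar> * \<bar>w x\<bar>" if "\<epsilon> > 0" for \<epsilon> x using le[of \<epsilon> x] that by simp
    show "((\<lambda>\<epsilon>. ?s \<epsilon> x) \<longlongrightarrow> \<kappa>0 x * \<phi> x) (at_right 0)" if "x \<noteq> a" for x
      using that by (auto intro!: tendsto_intros l)
  qed (use m(2) m\<phi> in measurable)
  then show "((\<lambda>\<epsilon>. \<integral>x. \<kappa> \<epsilon> x * \<phi> x \<partial>lborel) \<longlongrightarrow> (\<integral>x. \<kappa>0 x * \<phi> x \<partial>lborel)) (at_right 0)"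
    by (rule Lim_transform_eventually) (rule eventually_mono[OF eventually_right_pos], rule eq)
qed

text \<open>The layer cake formula, with \<open>(1 + s)\<^bsup>-(m + 1)\<^esup>\<close> written as an integral over \<open>t \<ge> s\<close>.\<close>

lemma nn_integral_inverse_power:
  assumes D: "DIM('a::euclidean_space) = 2 * m"
  shows "(\<integral>\<^sup>+u. ennreal (inverse ((1 + (norm (u::'a))\<^sup>2) ^ Suc m)) \<partial>lborel) = ennreal (pi ^ m / fact m)"
proof -
  let ?h = "\<lambda>t::real. real (Suc m) * inverse ((1 + t) ^ Suc (Suc m))"
  have DF: "((\<lambda>t. - inverse ((1 + t) ^ Suc m)) has_real_derivative ?h t) (at t)" if "0 \<le> t" for t :: real
  proof -
    have d: "((\<lambda>t. inverse ((1 + t) ^ Suc m)) has_real_derivative - real (Suc m) * inverse ((1 + t) ^ Suc (Suc m)) * 1) (at t)"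
      by (rule DERIV_chain2[OF DERIV_inverse_power]) (use that in \<open>auto intro!: derivative_eq_intros\<close>)
    show ?thesis by (rule DERIV_cong[OF DERIV_minus[OF d]]) (simp only: mult_minus_left minus_minus mult_1_right)
  qed
  have lim: "((\<lambda>t::real. inverse ((1 + t) ^ Suc p)) \<longlongrightarrow> 0) at_top" for p
    by (intro tendsto_inverse_0_at_top filterlim_pow_at_top filterlim_tendsto_add_at_top[OF tendsto_const] filterlim_ident) auto
  have tail: "ennreal (inverse ((1 + s) ^ Suc m)) = (\<integral>\<^sup>+t. ennreal (?h t) * indicator {s..} t \<partial>lborel)" if "0 \<le> s" for s
  proof -
    have "(\<integral>\<^sup>+t. ennreal (?h t) * indicator {s..} t \<partial>lborel) = ennreal (0 - (- inverse ((1 + s) ^ Suc m)))"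
    proof (rule nn_integral_FTC_atLeast)
      show "?h \<in> borel_measurable borel" by measurable
      show "((\<lambda>t. - inverse ((1 + t) ^ Suc m)) has_real_derivative ?h t) (at t)" if "s \<le> t" for t
        using \<open>0 \<le> s\<close> that by (intro DF) linarith
      show "0 \<le> ?h t" if "s \<le> t" for t
        using \<open>0 \<le> s\<close> that by (intro mult_nonneg_nonneg of_nat_0_le_iff iffD2[OF inverse_nonnegative_iff_nonnegative] zero_le_power) linarith
      show "((\<lambda>t::real. - inverse ((1 + t) ^ Suc m)) \<longlongrightarrow> 0) at_top"
        using tendsto_minus[OF lim[of m]] by (simp only: minus_zero)
    qed
    then show ?thesis by (simp only: diff_0 minus_minus)
  qed
  have "(\<integral>\<^sup>+u. ennreal (inverse ((1 + (norm (u::'a))\<^sup>2) ^ Suc m)) \<partial>lborel) =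
      (\<integral>\<^sup>+u. (\<integral>\<^sup>+t. ennreal (?h t) * indicator {(norm (u::'a))\<^sup>2..} t \<partial>lborel) \<partial>lborel)"
    by (subst tail) auto
  also have "\<dots> = (\<integral>\<^sup>+t. (\<integral>\<^sup>+u. ennreal (?h t) * indicator {(norm (u::'a))\<^sup>2..} t \<partial>lborel) \<partial>lborel)"
  proof (rule lborel_pair.Fubini')
    have "(\<lambda>(t, u::'a). ennreal (?h t) * indicator {p. (norm (snd p))\<^sup>2 \<le> fst p} (t, u)) \<in> borel_measurable (lborel \<Otimes>\<^sub>M lborel)"
      by measurable
    then show "(\<lambda>(t, u). ennreal (?h t) * indicator {(norm (u::'a))\<^sup>2..} t) \<in> borel_measurable (lborel \<Otimes>\<^sub>M lborel)"
      by (simp add: indicator_def case_prod_beta cong: if_cong)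
  qed
  \<comment> \<open>For fixed t \<ge> 0 the inner integral is the volume of the ball of radius sqrt
    t, which in dimension 2m is \<open>pi ^ m / fact m * t ^ m\<close>.\<close>
  also have "\<dots> = (\<integral>\<^sup>+t. ennreal (pi ^ m / fact m) * (ennreal (real (Suc m) * t ^ m * inverse ((1 + t) ^ Suc (Suc m))) * indicator {0..} t) \<partial>lborel)"
  proof (rule nn_integral_cong)
    fix t :: real
    show "(\<integral>\<^sup>+u. ennreal (?h t) * indicator {(norm (u::'a))\<^sup>2..} t \<partial>lborel) =
        ennreal (pi ^ m / fact m) * (ennreal (real (Suc m) * t ^ m * inverse ((1 + t) ^ Suc (Suc m))) * indicator {0..} t)"
    proof (cases "0 \<le> t")
      case True
      have "indicator {(norm (u::'a))\<^sup>2..} t = (indicator (cball 0 (sqrt t)) u :: ennreal)" for u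
        using True real_sqrt_le_iff[of "(norm u)\<^sup>2" t] by (auto simp: indicator_def)
      then have "(\<integral>\<^sup>+u. ennreal (?h t) * indicator {(norm (u::'a))\<^sup>2..} t \<partial>lborel) =
          ennreal (?h t) * emeasure lborel (cball (0::'a) (sqrt t))"
        by (simp add: nn_integral_cmult_indicator)
      also have "emeasure lborel (cball (0::'a) (sqrt t)) = ennreal (pi ^ m / fact m * t ^ m)"
        using True D unit_ball_vol_even[of m] by (simp add: emeasure_cball power_mult real_sqrt_pow2)
      finally show ?thesis using True by (simp add: ennreal_mult[symmetric] mult_ac)
    next
      case False
      then have "indicator {(norm (u::'a))\<^sup>2..} t = (0 :: ennreal)" for u
        using order_trans[OF zero_le_power2[of "norm u"], of t] by (auto simp: indicator_def)
      then show ?thesis using False by simp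
    qed
  qed
  also have "\<dots> = ennreal (pi ^ m / fact m) * (\<integral>\<^sup>+t. ennreal (real (Suc m) * t ^ m * inverse ((1 + t) ^ Suc (Suc m))) * indicator {0..} t \<partial>lborel)"
    by (rule nn_integral_cmult) simp
  also have "(\<integral>\<^sup>+t. ennreal (real (Suc m) * t ^ m * inverse ((1 + t) ^ Suc (Suc m))) * indicator {0..} t \<partial>lborel) = ennreal (1 - 0)"
  \<comment> \<open>The antiderivative \<open>(t / (1 + t)) ^ Suc m\<close> increases from 0 at t =
    0 to 1 at infinity.\<close>
  proof (rule nn_integral_FTC_atLeast[where F = "\<lambda>t. (t / (1 + t)) ^ Suc m" and a = 0, THEN HOL.trans])
    fix t :: real assume t: "0 \<le> t"
    have "((\<lambda>t. t / (1 + t)) has_real_derivative inverse ((1 + t)\<^sup>2)) (at t)"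
      using t by (auto intro!: derivative_eq_intros simp: field_simps power2_eq_square)
    from DERIV_power[OF this, of "Suc m"]
    show "((\<lambda>t. (t / (1 + t)) ^ Suc m) has_real_derivative real (Suc m) * t ^ m * inverse ((1 + t) ^ Suc (Suc m))) (at t)"
      by (rule DERIV_cong) (use t in \<open>simp add: field_simps power2_eq_square\<close>)
    show "0 \<le> real (Suc m) * t ^ m * inverse ((1 + t) ^ Suc (Suc m))" using t by simp
  next
    have "((\<lambda>t::real. 1 - inverse (1 + t)) \<longlongrightarrow> 1 - 0) at_top"
      using lim[of 0] by (intro tendsto_intros) simp
    then have "((\<lambda>t::real. 1 - inverse (1 + t)) \<longlongrightarrow> 1) at_top" by simp
    then have "((\<lambda>t::real. t / (1 + t)) \<longlongrightarrow> 1) at_top"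
      by (rule Lim_transform_eventually) (rule eventually_mono[OF eventually_gt_at_top[of 0]], simp add: field_simps)
    from tendsto_power[OF this, of "Suc m"] show "((\<lambda>t::real. (t / (1 + t)) ^ Suc m) \<longlongrightarrow> 1) at_top" by simp
  qed auto
  finally show ?thesis by simp
qed

lemma integral_inverse_power:
  assumes D: "DIM('a::euclidean_space) = 2 * m"
  shows "integrable lborel (\<lambda>u::'a. inverse ((1 + (norm u)\<^sup>2) ^ Suc m))"
    and "(\<integral>u. inverse ((1 + (norm (u::'a))\<^sup>2) ^ Suc m) \<partial>lborel) = pi ^ m / fact m"
proof -
  have pos: "0 \<le> inverse ((1 + (norm u)\<^sup>2) ^ Suc m)" for u :: 'a
    by (intro iffD2[OF inverse_nonnegative_iff_nonnegative] zero_le_power add_nonneg_nonneg) auto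
  have "has_bochner_integral lborel (\<lambda>u::'a. inverse ((1 + (norm u)\<^sup>2) ^ Suc m)) (pi ^ m / fact m)"
    by (rule has_bochner_integral_nn_integral[OF _ _ _ nn_integral_inverse_power[OF D]]) (use pos in auto)
  then show "integrable lborel (\<lambda>u::'a. inverse ((1 + (norm u)\<^sup>2) ^ Suc m))"
    "(\<integral>u. inverse ((1 + (norm (u::'a))\<^sup>2) ^ Suc m) \<partial>lborel) = pi ^ m / fact m"
    by (simp_all add: has_bochner_integral_iff)
qed

lemma lborel_integral_scale:
  fixes f :: "'a::euclidean_space \<Rightarrow> complex"
  assumes c: "c \<noteq> 0" and f: "f \<in> borel_measurable borel"
  shows "(\<integral>x. f x \<partial>lborel) = of_real (\<bar>c\<bar> ^ DIM('a)) * (\<integral>u. f (a + c *\<^sub>R u) \<partial>lborel)"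
proof -
  have "(\<integral>x. f x \<partial>lborel) = (\<integral>x. f x \<partial>density (distr lborel borel (\<lambda>u. a + c *\<^sub>R u)) (\<lambda>_. ennreal (\<bar>c\<bar> ^ DIM('a))))"
    by (subst lborel_affine[OF c, of a]) (rule HOL.refl)
  also have "\<dots> = (\<integral>x. (\<bar>c\<bar> ^ DIM('a)) *\<^sub>R f x \<partial>distr lborel borel (\<lambda>u. a + c *\<^sub>R u))"
    using f by (intro integral_density) auto
  also have "\<dots> = (\<integral>u. (\<bar>c\<bar> ^ DIM('a)) *\<^sub>R f (a + c *\<^sub>R u) \<partial>lborel)"
    using f by (intro integral_distr) auto
  finally show ?thesis by (simp add: scaleR_conv_of_real)
qed

text \<open>The substitution x = a + sqrt \<epsilon> u has Jacobian \<open>\<epsilon> ^ m\<close> in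
  dimension 2m; together with the prefactor \<epsilon> this matches the exponent m + 1 exactly. The
  weight becomes independent of \<epsilon>, and \<open>integral_inverse_power\<close> gives its
  mass.\<close>

lemma approximate_identity:
  fixes \<phi> :: "'a::euclidean_space \<Rightarrow> complex"
  assumes D: "DIM('a) = 2 * m" and \<phi>: "test_fun \<phi>"
  shows "((\<lambda>\<epsilon>. \<integral>x. of_real (\<epsilon> * inverse (((norm (x - a))\<^sup>2 + \<epsilon>) ^ Suc m)) * \<phi> x \<partial>lborel) \<longlongrightarrow> of_real (pi ^ m / fact m) * \<phi> a) (at_right 0)"
proof -
  let ?g = "\<lambda>u::'a. inverse ((1 + (norm u)\<^sup>2) ^ Suc m)"
  obtain B where B: "\<And>x. norm (\<phi> x) \<le> B" using test_fun_bounded[OF \<phi>] by blast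
  have c\<phi>: "continuous_on UNIV \<phi>" by (rule smooth_on_continuous[OF test_fun_smooth[OF \<phi>]])
  have m\<phi>: "\<phi> \<in> borel_measurable borel" by (rule borel_measurable_continuous_onI[OF c\<phi>])
  have pos: "0 \<le> ?g u" for u :: 'a
    by (intro iffD2[OF inverse_nonnegative_iff_nonnegative] zero_le_power add_nonneg_nonneg) auto
  have eq: "(\<integral>x. of_real (\<epsilon> * inverse (((norm (x - a))\<^sup>2 + \<epsilon>) ^ Suc m)) * \<phi> x \<partial>lborel) =
      (\<integral>u. of_real (?g u) * \<phi> (a + sqrt \<epsilon> *\<^sub>R u) \<partial>lborel)" if e: "\<epsilon> > 0" for \<epsilon>
  proof -
    have s: "\<bar>sqrt \<epsilon>\<bar> ^ DIM('a) = \<epsilon> ^ m" using e D by (simp add: power_mult real_sqrt_pow2)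
    have i: "\<epsilon> ^ m * (\<epsilon> * inverse (((norm (a + sqrt \<epsilon> *\<^sub>R u - a))\<^sup>2 + \<epsilon>) ^ Suc m)) = ?g u" for u :: 'a
    proof -
      have "(norm (a + sqrt \<epsilon> *\<^sub>R u - a))\<^sup>2 + \<epsilon> = \<epsilon> * (1 + (norm u)\<^sup>2)"
        using e by (simp add: power_mult_distrib algebra_simps)
      moreover have "\<epsilon> ^ m * (\<epsilon> * inverse ((\<epsilon> * s) ^ Suc m)) = inverse (s ^ Suc m)" if "s > 0" for s
        using e that by (simp add: power_mult_distrib field_simps)
      moreover have "0 < 1 + (norm u)\<^sup>2" by (simp add: add_pos_nonneg)
      ultimately show ?thesis by metis
    qed
    have "(\<integral>x. of_real (\<epsilon> * inverse (((norm (x - a))\<^sup>2 + \<epsilon>) ^ Suc m)) * \<phi> x \<partial>lborel) =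
        of_real (\<epsilon> ^ m) * (\<integral>u. of_real (\<epsilon> * inverse (((norm (a + sqrt \<epsilon> *\<^sub>R u - a))\<^sup>2 + \<epsilon>) ^ Suc m)) * \<phi> (a + sqrt \<epsilon> *\<^sub>R u) \<partial>lborel)"
    proof -
      have "(\<lambda>x. complex_of_real (\<epsilon> * inverse (((norm (x - a))\<^sup>2 + \<epsilon>) ^ Suc m)) * \<phi> x) \<in> borel_measurable borel"
        using m\<phi> by measurable
      from lborel_integral_scale[OF _ this, of "sqrt \<epsilon>" a] show ?thesis using e unfolding s by (simp only: real_sqrt_eq_zero_cancel_iff less_imp_neq[THEN not_sym] not_False_eq_True True_implies_equals)
    qed
    also have "\<dots> = (\<integral>u. of_real (\<epsilon> ^ m * (\<epsilon> * inverse (((norm (a + sqrt \<epsilon> *\<^sub>R u - a))\<^sup>2 + \<epsilon>) ^ Suc m))) * \<phi> (a + sqrt \<epsilon> *\<^sub>R u) \<partial>lborel)"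
      by (simp add: mult.assoc flip: integral_mult_right_zero)
    finally show ?thesis by (simp only: i)
  qed
  have "((\<lambda>\<epsilon>. \<integral>u. of_real (?g u) * \<phi> (a + sqrt \<epsilon> *\<^sub>R u) \<partial>lborel) \<longlongrightarrow> (\<integral>u. of_real (?g u) * \<phi> a \<partial>lborel)) (at_right 0)"
  proof (rule tendsto_at_right_dominated[where a = 0])
    show "integrable lborel (\<lambda>u::'a. ?g u * B)" using integral_inverse_power(1)[OF D] by simp
    show "norm (of_real (?g u) * \<phi> (a + sqrt \<epsilon> *\<^sub>R u)) \<le> ?g u * B" for \<epsilon> and u :: 'a
      using pos[of u] B unfolding norm_mult norm_of_real abs_of_nonneg[OF pos] by (intro mult_left_mono) auto
    show "((\<lambda>\<epsilon>. of_real (?g u) * \<phi> (a + sqrt \<epsilon> *\<^sub>R u)) \<longlongrightarrow> of_real (?g u) * \<phi> a) (at_right 0)" for u :: 'a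
    proof (intro tendsto_intros)
      have "isCont \<phi> a" using c\<phi> by (simp add: continuous_on_eq_continuous_at)
      moreover have "((\<lambda>\<epsilon>. a + sqrt \<epsilon> *\<^sub>R u) \<longlongrightarrow> a) (at_right 0)"
        by (auto intro!: tendsto_eq_intros)
      ultimately show "((\<lambda>\<epsilon>. \<phi> (a + sqrt \<epsilon> *\<^sub>R u)) \<longlongrightarrow> \<phi> a) (at_right 0)" by (rule isCont_tendsto_compose)
    qed
    show "(\<lambda>u. of_real (?g u) * \<phi> (a + sqrt \<epsilon> *\<^sub>R u)) \<in> borel_measurable borel" for \<epsilon> using m\<phi> by measurable
    show "(\<lambda>u. of_real (?g u) * \<phi> a) \<in> borel_measurable borel" by measurable
  qed
  moreover have "(\<integral>u. of_real (?g u) * \<phi> a \<partial>lborel) = of_real (pi ^ m / fact m) * \<phi> a"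
    by (simp only: integral_mult_left_zero integral_complex_of_real integral_inverse_power(2)[OF D])
  ultimately have "((\<lambda>\<epsilon>. \<integral>u. of_real (?g u) * \<phi> (a + sqrt \<epsilon> *\<^sub>R u) \<partial>lborel) \<longlongrightarrow> of_real (pi ^ m / fact m) * \<phi> a) (at_right 0)"
    by simp
  then show ?thesis
    by (rule Lim_transform_eventually) (rule eventually_mono[OF eventually_right_pos], simp only: eq)
qed

section \<open>The regularised kernel\<close>

lemma zc_norm: "(\<Sum>j\<in>UNIV. zc x j * cnj (zc x j)) = complex_of_real ((norm x)\<^sup>2)" for x :: "'m::finite pt"
proof -
  have "(norm x)\<^sup>2 = (\<Sum>i\<in>UNIV. (x $ i)\<^sup>2)"
    by (simp add: norm_vec_def L2_set_def real_sqrt_pow2 sum_nonneg)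
  also have "\<dots> = (\<Sum>j\<in>UNIV. (x $ Inl j)\<^sup>2) + (\<Sum>j\<in>UNIV. (x $ Inr j)\<^sup>2)"
    unfolding UNIV_Plus_UNIV[symmetric] by (subst sum.Plus) auto
  finally have "(norm x)\<^sup>2 = (\<Sum>j\<in>UNIV. (x $ Inl j)\<^sup>2 + (x $ Inr j)\<^sup>2)" by (simp add: sum.distrib)
  moreover have "zc x j * cnj (zc x j) = complex_of_real ((x $ Inl j)\<^sup>2 + (x $ Inr j)\<^sup>2)" for j
    by (simp add: zc_def complex_eq_iff power2_eq_square)
  ultimately show ?thesis by simp
qed

text \<open>The j-th derivative in t of \<open>inverse ((t + \<epsilon>) ^ k)\<close>.\<close>

definition rk :: "nat \<Rightarrow> real \<Rightarrow> nat \<Rightarrow> real \<Rightarrow> real" where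
  "rk k \<epsilon> j t = (-1) ^ j * pochhammer (real k) j * inverse ((t + \<epsilon>) ^ (k + j))"

definition kc :: "nat \<Rightarrow> real \<Rightarrow> nat \<Rightarrow> 'm::finite pt \<Rightarrow> 'm pt \<Rightarrow> complex" where
  "kc k \<epsilon> j y x = complex_of_real (rk k \<epsilon> j ((norm (x - y))\<^sup>2))"

lemma smooth_kc:
  assumes U: "open U" "\<And>x. x \<in> U \<Longrightarrow> 0 < (norm (x - y))\<^sup>2 + \<epsilon>"
  shows "smooth_on U (kc k \<epsilon> j y)"
  unfolding kc_def[abs_def] rk_def
  by (intro smooth_on_of_real smooth_on_mult smooth_on_const smooth_on_inverse smooth_on_add
      smooth_on_subset[OF smooth_on_norm_sq] subset_UNIV U)

lemma smooth_kc_pos: "\<epsilon> > 0 \<Longrightarrow> smooth_on UNIV (kc k \<epsilon> j y)"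
  by (rule smooth_kc) (auto intro: add_nonneg_pos)

lemma rk_deriv:
  assumes "0 < t + \<epsilon>"
  shows "(rk k \<epsilon> j has_real_derivative rk k \<epsilon> (Suc j) t) (at t)"
proof -
  have "((\<lambda>t. inverse ((t + \<epsilon>) ^ (k + j))) has_real_derivative - real (k + j) * inverse ((t + \<epsilon>) ^ Suc (k + j)) * 1) (at t)"
    by (rule DERIV_chain2[OF DERIV_inverse_power]) (use assms in \<open>auto intro!: derivative_eq_intros\<close>)
  from DERIV_cmult[OF this, of "(-1) ^ j * pochhammer (real k) j"] show ?thesis
    unfolding rk_def[abs_def] by (rule DERIV_cong) (simp add: pochhammer_Suc algebra_simps)
qed

lemma dirderiv_kc:
  assumes "0 < (norm (x - y))\<^sup>2 + \<epsilon>"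
  shows "dirderiv b (kc k \<epsilon> j y) x = kc k \<epsilon> (Suc j) y x * complex_of_real (2 * ((x - y) \<bullet> b))"
proof -
  have 1: "((\<lambda>x. (norm (x - y))\<^sup>2) has_derivative (\<lambda>h. 2 * ((x - y) \<bullet> h))) (at x)"
    unfolding power2_norm_eq_inner
    by (auto intro!: derivative_eq_intros simp: inner_commute)
  have "((\<lambda>x. rk k \<epsilon> j ((norm (x - y))\<^sup>2)) has_derivative (\<lambda>h. rk k \<epsilon> (Suc j) ((norm (x - y))\<^sup>2) * (2 * ((x - y) \<bullet> h)))) (at x)"
    using has_derivative_compose[OF 1 rk_deriv[OF assms, unfolded has_field_derivative_def]] by simp
  then have "((\<lambda>x. complex_of_real (rk k \<epsilon> j ((norm (x - y))\<^sup>2))) has_derivative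
      (\<lambda>h. complex_of_real (rk k \<epsilon> (Suc j) ((norm (x - y))\<^sup>2) * (2 * ((x - y) \<bullet> h))))) (at x)"
    by (rule has_derivative_of_real)
  then show ?thesis
    unfolding kc_def[abs_def] by (subst dirderiv_eq) auto
qed

lemma taylor_linear:
  "taylor n c M + taylor n c' M = taylor n (\<lambda>j. c j + c' j) M" "scal a * taylor n c M = taylor n (\<lambda>j. a * c j) M"
proof -
  show "taylor n c M + taylor n c' M = taylor n (\<lambda>j. c j + c' j) M"
    by (simp add: taylor_def add_divide_distrib scal_hom(1) distrib_right sum.distrib)
  show "scal a * taylor n c M = taylor n (\<lambda>j. a * c j) M"
    unfolding taylor_def sum_distrib_left times_divide_eq_right[symmetric] scal_hom(2) by (simp only: mult.assoc)
qed

text \<open>Differentiation followed by multiplication by M counts the degree: the power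
  \<open>M ^ j\<close> is reproduced with factor j. The term of degree n + 1 that arises on the way
  is zero.\<close>

lemma taylor_shift:
  assumes M: "M ^ Suc n = (0 :: 'm::finite cgrass)"
  shows "M * taylor n (\<lambda>j. c (Suc j)) M = taylor n (\<lambda>j. of_nat j * c j) M"
proof -
  have "M * taylor n (\<lambda>j. c (Suc j)) M = (\<Sum>j\<le>n. scal (c (Suc j) / fact j) * M ^ Suc j)"
    unfolding taylor_def sum_distrib_left by (simp add: scal_left_commute[of M])
  also have "\<dots> = (\<Sum>j<n. scal (c (Suc j) / fact j) * M ^ Suc j)"
    unfolding lessThan_Suc_atMost[symmetric] sum.lessThan_Suc by (simp only: M mult_zero_right add_0_right)
  also have "\<dots> = (\<Sum>j<n. scal (of_nat (Suc j) * c (Suc j) / fact (Suc j)) * M ^ Suc j)"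
  proof (rule sum.cong[OF HOL.refl])
    fix j
    have "of_nat (Suc j) * c (Suc j) / fact (Suc j) = c (Suc j) / fact j"
      by (simp add: field_simps del: of_nat_Suc)
    then show "scal (c (Suc j) / fact j) * M ^ Suc j = scal (of_nat (Suc j) * c (Suc j) / fact (Suc j)) * M ^ Suc j"
      by (simp only:)
  qed
  also have "\<dots> = taylor n (\<lambda>j. of_nat j * c j) M"
    unfolding taylor_def by (subst sum.atMost_shift) (simp add: scal_hom)
  finally show ?thesis .
qed

text \<open>The j-th derivative of k \<phi> + t \<phi>' = k \<epsilon>
  \<open>(t + \<epsilon>)^(-k-1)\<close>, where \<phi>(t) = \<open>(t + \<epsilon>)^(-k)\<close>.
  The term with factor j comes from differentiating the coefficient t.\<close>

lemma rk_identity: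
  assumes "0 < t + \<epsilon>"
  shows "real k * rk k \<epsilon> j t + (t * rk k \<epsilon> (Suc j) t + real j * rk k \<epsilon> j t) = real k * \<epsilon> * rk (Suc k) \<epsilon> j t"
proof -
  let ?s = "t + \<epsilon>"
  have p: "real k * pochhammer (real (Suc k)) j = pochhammer (real k) j * (real k + real j)"
    using pochhammer_rec[of "real k" j] pochhammer_Suc[of "real k" j] by (simp add: add.commute)
  have i: "inverse (?s ^ (k + j)) = ?s * inverse (?s ^ Suc (k + j))" using assms by simp
  have "real k * rk k \<epsilon> j t + (t * rk k \<epsilon> (Suc j) t + real j * rk k \<epsilon> j t) =
      (-1) ^ j * (pochhammer (real k) j * (real k + real j)) * (?s * inverse (?s ^ Suc (k + j)) - t * inverse (?s ^ Suc (k + j)))"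
    unfolding rk_def i pochhammer_Suc by (simp add: algebra_simps)
  also have "\<dots> = real k * \<epsilon> * rk (Suc k) \<epsilon> j t"
    unfolding p[symmetric] rk_def by (simp add: algebra_simps)
  finally show ?thesis .
qed

text \<open>The same identity with t replaced by |Z - U|^2. In each degree the body contributes the
  factor t and the nilpotent part, through \<open>taylor_shift\<close>, the factor j.\<close>

lemma kc_identity:
  assumes "0 < (norm (x - y))\<^sup>2 + \<epsilon>"
  shows "scal (of_nat k) * taylor n (\<lambda>j. kc k \<epsilon> j y x) (nil_norm n) +
      (scal (complex_of_real ((norm (x - y))\<^sup>2)) + nil_norm n) * taylor n (\<lambda>j. kc k \<epsilon> (Suc j) y x) (nil_norm n) =
      scal (of_real (real k * \<epsilon>)) * taylor n (\<lambda>j. kc (Suc k) \<epsilon> j y x) (nil_norm n)"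
proof -
  have "complex_of_real (real k * rk k \<epsilon> j ((norm (x - y))\<^sup>2) + ((norm (x - y))\<^sup>2 * rk k \<epsilon> (Suc j) ((norm (x - y))\<^sup>2) +
      real j * rk k \<epsilon> j ((norm (x - y))\<^sup>2))) = complex_of_real (real k * \<epsilon> * rk (Suc k) \<epsilon> j ((norm (x - y))\<^sup>2))" for j
    by (simp only: rk_identity[OF assms])
  then have "of_nat k * kc k \<epsilon> j y x + (complex_of_real ((norm (x - y))\<^sup>2) * kc k \<epsilon> (Suc j) y x + of_nat j * kc k \<epsilon> j y x) =
      of_real (real k * \<epsilon>) * kc (Suc k) \<epsilon> j y x" for j
    by (simp add: kc_def)
  then show ?thesis
    by (simp only: distrib_right taylor_shift[OF nil_norm_power_Suc, of n "\<lambda>j. kc k \<epsilon> j y x"] taylor_linear)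
qed

definition kernel_const :: "'m::finite pt \<Rightarrow> nat \<Rightarrow> complex" where
  "kernel_const y n = complex_of_real (2 / sphere_area CARD('m) n)"

text \<open>The kernel without its normalising constant, with |Z - U|^2 + \<epsilon> in the
  denominator and exponent M/2 = m - n. The companion \<open>kd\<close> is its Hermitian
  conjugate.\<close>

definition kp :: "nat \<Rightarrow> real \<Rightarrow> 'm::finite pt \<Rightarrow> 'm pt \<Rightarrow> 'm cgrass" where
  "kp n \<epsilon> y x = ZZ n (x - y) (theta n) * taylor n (\<lambda>j. kc (CARD('m) - n) \<epsilon> j y x) (nil_norm n)"

definition kd :: "nat \<Rightarrow> real \<Rightarrow> 'm::finite pt \<Rightarrow> 'm pt \<Rightarrow> 'm cgrass" where
  "kd n \<epsilon> y x = ZZ_dag n (x - y) (theta n) * taylor n (\<lambda>j. kc (CARD('m) - n) \<epsilon> j y x) (nil_norm n)"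

lemma emb_inv_norm_pow:
  fixes x :: "'m::finite pt"
  assumes n: "n < CARD('m)"
  shows "emb (inv_norm_pow n (x - y) (theta n)) = taylor n (\<lambda>j. kc (CARD('m) - n) 0 j y x) (nil_norm n)"
proof -
  let ?k = "CARD('m) - n" and ?t = "(norm (x - y))\<^sup>2"
  have p: "- (2 * real CARD('m) - 2 * real n) / 2 = - real ?k" using n by (simp add: of_nat_diff)
  have b: "Re (body (normsq n (x - y) (theta n))) = ?t"
    by (simp only: body_def normsq_body zc_norm Re_complex_of_real)
  have pr: "(\<Prod>i<j. - real ?k - real i) = (-1) ^ j * pochhammer (real ?k) j" for j
    by (induction j) (simp_all add: pochhammer_Suc algebra_simps)
  \<comment> \<open>At x = y both sides are 0, since 0 to a real power is 0 and so is the inverse of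
    0; the exponent k + j is positive.\<close>
  have pw: "?t powr (- real ?k - real j) = inverse ((?t + 0) ^ (?k + j))" for j
  proof (cases "?t = 0")
    case True
    then show ?thesis using n by (simp add: zero_power)
  next
    case False
    then have "0 < ?t" by simp
    moreover have "- real ?k - real j = - real (?k + j)" by simp
    ultimately show ?thesis by (simp only: powr_minus powr_realpow add_0_right)
  qed
  have c: "complex_of_real ((\<Prod>i<j. - real ?k - real i) / fact j * ?t powr (- real ?k - real j)) = kc ?k 0 j y x / fact j" for j
    unfolding pr pw kc_def rk_def by simp
  show ?thesis
    unfolding inv_norm_pow_def spow_def p b c taylor_def
    by (simp add: emb_sum emb_hom emb_power emb_nilpart_normsq)
qed

lemma Psi_kp: "n < CARD('m) \<Longrightarrow> Psi n (x - y) (theta n) = scal (kernel_const y n) * kp n 0 y (x :: 'm::finite pt)"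
  and Psi_dag_kd: "n < CARD('m) \<Longrightarrow> Psi_dag n (x - y) (theta n) = scal (kernel_const y n) * kd n 0 y (x :: 'm::finite pt)"
  by (simp_all add: Psi_def Psi_dag_def kp_def kd_def kernel_const_def emb_inv_norm_pow mult.assoc)

section \<open>Derivatives of the vector variables and of the regularised denominator\<close>

lemma bounded_linear_zc: "bounded_linear (\<lambda>x. zc x j)"
proof -
  have "(\<lambda>x. zc x j) = (\<lambda>x. complex_of_real (x $ Inl j) + \<i> * complex_of_real (x $ Inr j))"
    by (simp add: zc_def complex_eq_iff fun_eq_iff)
  moreover have "bounded_linear (\<lambda>x. complex_of_real (x $ Inl j) + \<i> * complex_of_real (x $ Inr j))"
    by (intro bounded_linear_add bounded_linear_mult_right[THEN bounded_linear_compose]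
        bounded_linear_of_real[THEN bounded_linear_compose] bounded_linear_vec_nth)
  ultimately show ?thesis by simp
qed

lemma smooth_shift_linear: "bounded_linear h \<Longrightarrow> smooth_on U (\<lambda>x. h (x - y))"
proof (rule smooth_on_subset[of UNIV])
  assume h: "bounded_linear h"
  have "smooth_on UNIV (\<lambda>x. h x - h y)"
    by (intro smooth_on_diff smooth_on_const smooth_on_linear h open_UNIV)
  then show "smooth_on UNIV (\<lambda>x. h (x - y))"
    by (simp add: linear_diff[OF bounded_linear.linear[OF h]])
qed auto

lemma dirderiv_shift_linear: "bounded_linear h \<Longrightarrow> dirderiv b (\<lambda>x. h (x - y)) x = h b"
proof (rule dirderiv_eq)
  assume h: "bounded_linear h"
  have "((\<lambda>x. x - y) has_derivative (\<lambda>x. x)) (at x)" by (auto intro!: derivative_eq_intros)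
  from bounded_linear.has_derivative[OF h this] show "((\<lambda>x. h (x - y)) has_derivative h) (at x)" .
qed

lemma bounded_linear_cnj_zc: "bounded_linear (\<lambda>x. cnj (zc x j))"
  using bounded_linear_compose[OF bounded_linear_cnj bounded_linear_zc] .

lemma zc_axis:
  "zc (axis (Inl l) 1) j = (if j = l then 1 else 0)" "zc (axis (Inr l) 1) j = (if j = l then \<i> else 0)"
  by (auto simp: zc_def axis_def complex_eq_iff)

lemma dec_ZZ: "dec (smooth_on U) U (\<lambda>x. ZZ n (x - y) (theta n))" "dec (smooth_on U) U (\<lambda>x. ZZ_dag n (x - y) (theta n))"
  unfolding ZZ_def ZZ_dag_def
  by (intro dec_add dec_sum dec_smooth_const dec_scal smooth_shift_linear bounded_linear_zc bounded_linear_cnj_zc)+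

lemma pd_ZZ:
  "pd i (\<lambda>x. ZZ n (x - y) (theta n)) x = (\<Sum>j\<in>UNIV. scal (zc (axis i 1) j) * ff j)"
  "pd i (\<lambda>x. ZZ_dag n (x - y) (theta n)) x = (\<Sum>j\<in>UNIV. scal (cnj (zc (axis i 1) j)) * ff_dag j)"
proof -
  have d: "dec (smooth_on UNIV) UNIV (\<lambda>x. scal (zc (x - y) j) * v)" "dec (smooth_on UNIV) UNIV (\<lambda>x. scal (cnj (zc (x - y) j)) * v)" for j v
    by (intro dec_scal smooth_shift_linear bounded_linear_zc bounded_linear_cnj_zc)+
  have p: "pd i (\<lambda>x. scal (zc (x - y) j) * v) x = scal (zc (axis i 1) j) * v"
    "pd i (\<lambda>x. scal (cnj (zc (x - y) j)) * v) x = scal (cnj (zc (axis i 1) j)) * v" for j v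
    by (subst pd_scal[OF open_UNIV UNIV_I smooth_shift_linear[OF bounded_linear_zc]]
          pd_scal[OF open_UNIV UNIV_I smooth_shift_linear[OF bounded_linear_cnj_zc]],
        subst dirderiv_shift_linear, rule bounded_linear_zc bounded_linear_cnj_zc, rule HOL.refl)+
  show "pd i (\<lambda>x. ZZ n (x - y) (theta n)) x = (\<Sum>j\<in>UNIV. scal (zc (axis i 1) j) * ff j)"
    "pd i (\<lambda>x. ZZ_dag n (x - y) (theta n)) x = (\<Sum>j\<in>UNIV. scal (cnj (zc (axis i 1) j)) * ff_dag j)"
    unfolding ZZ_def ZZ_dag_def
    by (simp_all only: pd_add[OF open_UNIV UNIV_I dec_sum dec_smooth_const] pd_sum[OF open_UNIV UNIV_I] d p pd_const add_0_right)
qed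

lemma scal_half: "scal (1/2) * (a + a) = a" "scal (1/2) * (a - scal \<i> * (scal \<i> * a)) = a"
  "scal (1/2) * (a + scal \<i> * (scal \<i> * a)) = 0" for a :: "'m::finite cgrass"
proof -
  have h: "scal (1/2) + scal (1/2) = (1 :: 'm cgrass)"
    by (simp only: scal_hom(1)[symmetric]) (simp add: scal_hom)
  have i: "scal \<i> * scal \<i> = (- 1 :: 'm cgrass)" by (simp only: scal_hom(2)[symmetric]) (simp add: scal_hom)
  show 1: "scal (1/2) * (a + a) = a" by (simp only: distrib_left distrib_right[symmetric] h mult_1_left)
  have "scal \<i> * (scal \<i> * a) = - a" by (simp only: mult.assoc[symmetric] i) simp
  then show "scal (1/2) * (a - scal \<i> * (scal \<i> * a)) = a" "scal (1/2) * (a + scal \<i> * (scal \<i> * a)) = 0"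
    using 1 by simp_all
qed

lemma pd_z_ZZ:
  "pd_z l (\<lambda>x. ZZ n (x - y) (theta n)) x = ff l" "pd_zc l (\<lambda>x. ZZ n (x - y) (theta n)) x = 0"
  "pd_z l (\<lambda>x. ZZ_dag n (x - y) (theta n)) x = 0" "pd_zc l (\<lambda>x. ZZ_dag n (x - y) (theta n)) x = ff_dag l"
proof -
  have s: "(\<Sum>j\<in>UNIV. scal (if j = l then c else 0) * v j) = scal c * (v l :: 'a cgrass)" for c and v :: "'a \<Rightarrow> 'a cgrass"
  proof -
    have "(\<Sum>j\<in>UNIV. scal (if j = l then c else 0) * v j) = (\<Sum>j\<in>UNIV. if j = l then scal c * v j else 0)"
      by (intro sum.cong) (auto simp: scal_hom)
    then show ?thesis by simp
  qed
  have c: "cnj (if j = l then 1 else 0) = (if j = l then 1 else 0)" "cnj (if j = l then \<i> else 0) = (if j = l then - \<i> else 0)" for j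
    by auto
  have m: "scal \<i> * (scal (- \<i>) * a) = - (scal \<i> * (scal \<i> * a))" for a :: "'a cgrass" by (simp add: scal_hom)
  show "pd_z l (\<lambda>x. ZZ n (x - y) (theta n)) x = ff l" "pd_zc l (\<lambda>x. ZZ n (x - y) (theta n)) x = 0"
    "pd_z l (\<lambda>x. ZZ_dag n (x - y) (theta n)) x = 0" "pd_zc l (\<lambda>x. ZZ_dag n (x - y) (theta n)) x = ff_dag l"
    by (simp_all only: pd_z_def pd_zc_def pd_ZZ zc_axis c s m scal_hom(6) mult_1_left scal_half diff_minus_eq_add
        diff_conv_add_uminus[symmetric])
qed

lemma pd_z_mult:
  assumes "open U" "x \<in> U" "dec (smooth_on U) U F" "dec (smooth_on U) U G"
  shows "pd_z l (\<lambda>x. F x * G x) x = pd_z l F x * G x + F x * pd_z l G x"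
    "pd_zc l (\<lambda>x. F x * G x) x = pd_zc l F x * G x + F x * pd_zc l G x"
  unfolding pd_z_def pd_zc_def pd_mult[OF assms]
  by (simp_all add: distrib_left distrib_right right_diff_distrib left_diff_distrib mult.assoc scal_left_commute[of "F x"] del: mult_minus_left)

lemma pd_z_glinear:
  assumes "open U" "x \<in> U" "glinear L" "dec (smooth_on U) U F"
  shows "pd_z l (\<lambda>x. L (F x)) x = L (pd_z l F x)" "pd_zc l (\<lambda>x. L (F x)) x = L (pd_zc l F x)"
proof -
  have m: "L (a - b) = L a - L b" for a b
    using glinearD(1)[OF assms(3), of "a - b" b] by (simp add: algebra_simps)
  show "pd_z l (\<lambda>x. L (F x)) x = L (pd_z l F x)" "pd_zc l (\<lambda>x. L (F x)) x = L (pd_zc l F x)"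
    unfolding pd_z_def pd_zc_def pd_glinear[OF assms] by (simp_all add: glinearD[OF assms(3)] m)
qed

lemma dec_pd_z:
  assumes "open U" "dec (smooth_on U) U F"
  shows "dec (smooth_on U) U (pd_z l F)" "dec (smooth_on U) U (pd_zc l F)"
proof -
  have d: "dec (smooth_on U) U (\<lambda>x. scal (1/2) * (pd (Inl l) F x + scal c * pd (Inr l) F x))" for c
    by (intro dec_glinear[OF _ glinear_mult(2)] dec_add dec_pd assms)
  show "dec (smooth_on U) U (pd_z l F)"
    using d[of "- \<i>"] unfolding pd_z_def[abs_def] by (simp add: scal_hom)
  show "dec (smooth_on U) U (pd_zc l F)"
    using d[of \<i>] unfolding pd_zc_def[abs_def] by simp
qed

lemma dec_taylor_kc:
  assumes "open U" "\<And>x. x \<in> U \<Longrightarrow> 0 < (norm (x - y))\<^sup>2 + \<epsilon>"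
  shows "dec (smooth_on U) U (\<lambda>x. taylor n (\<lambda>j. kc k \<epsilon> j y x) (nil_norm n))"
  by (rule dec_taylor[OF assms(1) dec_smooth_const smooth_kc[OF assms]])

lemma pd_taylor_kc:
  assumes "\<epsilon> > 0"
  shows "pd i (\<lambda>x. taylor n (\<lambda>j. kc k \<epsilon> j y x) (nil_norm n)) x =
    taylor n (\<lambda>j. kc k \<epsilon> (Suc j) y x) (nil_norm n) * scal (complex_of_real (2 * (x - y) $ i))"
proof -
  have pos: "0 < (norm (x - y))\<^sup>2 + \<epsilon>" for x using assms by (simp add: add_nonneg_pos)
  have "(x - y) \<bullet> axis i 1 = (x - y) $ i" by (simp add: inner_axis)
  then have "pd i (\<lambda>x. taylor n (\<lambda>j. kc k \<epsilon> j y x) (nil_norm n)) x =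
      taylor n (\<lambda>j. kc k \<epsilon> (Suc j) y x) (nil_norm n) * (scal (complex_of_real (2 * (x - y) $ i)) + pd i (\<lambda>_. nil_norm n) x)"
    using dirderiv_kc[OF pos, where b = "axis i 1" and k = k and x = x]
    by (intro pd_taylor[OF open_UNIV UNIV_I smooth_kc_pos[OF assms] _ dec_smooth_const nil_norm_commute nil_norm_power_Suc]) simp
  then show ?thesis by (simp add: pd_const)
qed

text \<open>The complex derivatives of |x - y|^2 are the conjugate coordinate and the coordinate
  itself; the factor 2 of the real derivatives is cancelled by the 1/2 in \<open>pd_z\<close> and
  \<open>pd_zc\<close>.\<close>

lemma pd_z_taylor_kc:
  assumes "\<epsilon> > 0"
  shows "pd_z l (\<lambda>x. taylor n (\<lambda>j. kc k \<epsilon> j y x) (nil_norm n)) x =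
      taylor n (\<lambda>j. kc k \<epsilon> (Suc j) y x) (nil_norm n) * scal (cnj (zc (x - y) l))"
    "pd_zc l (\<lambda>x. taylor n (\<lambda>j. kc k \<epsilon> j y x) (nil_norm n)) x =
      taylor n (\<lambda>j. kc k \<epsilon> (Suc j) y x) (nil_norm n) * scal (zc (x - y) l)"
proof -
  let ?T = "taylor n (\<lambda>j. kc k \<epsilon> (Suc j) y x) (nil_norm n)"
  let ?a = "complex_of_real (2 * (x - y) $ Inl l)" and ?b = "complex_of_real (2 * (x - y) $ Inr l)"
  have e: "cnj (zc (x - y) l) = 1/2 * (?a - \<i> * ?b)" "zc (x - y) l = 1/2 * (?a + \<i> * ?b)"
    by (simp_all add: zc_def complex_eq_iff)
  have m: "scal \<i> * (?T * scal c) = ?T * (scal \<i> * scal c)" "scal (1/2) * (?T * b) = ?T * (scal (1/2) * b)" for b c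
    by (simp_all only: scal_left_commute[of ?T])
  show "pd_z l (\<lambda>x. taylor n (\<lambda>j. kc k \<epsilon> j y x) (nil_norm n)) x = ?T * scal (cnj (zc (x - y) l))"
    unfolding pd_z_def pd_taylor_kc[OF assms] e(1)
    by (simp only: m scal_hom(1,2,4) distrib_left right_diff_distrib)
  show "pd_zc l (\<lambda>x. taylor n (\<lambda>j. kc k \<epsilon> j y x) (nil_norm n)) x = ?T * scal (zc (x - y) l)"
    unfolding pd_zc_def pd_taylor_kc[OF assms] e(2)
    by (simp only: m scal_hom(1,2,4) distrib_left right_diff_distrib)
qed

lemma gflip_nil_norm: "gflip (nil_norm n) = nil_norm n"
  by (simp add: nil_norm_def gflip_linear gflip_sum et_pair_def gflip_mult gflip_et)

lemma gflip_power: "gflip (M ^ j) = gflip M ^ j"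
  by (induction j) (simp_all add: gflip_linear gflip_mult)

lemma gflip_taylor: "gflip (taylor n c (nil_norm n)) = taylor n c (nil_norm n)"
  by (simp add: taylor_def gflip_sum gflip_mult gflip_linear gflip_power gflip_nil_norm)

text \<open>M is even, so on its powers the flip in the twisted Leibniz rule disappears and the
  ordinary power rule results.\<close>

lemma odd_derivation_taylor:
  fixes M :: "'m::finite cgrass"
  assumes D: "\<And>a b. D (a + b) = D a + D b" "\<And>c a. D (scal c * a) = scal c * D a" "D 1 = 0" "\<And>a b. D (a * b) = a * D b + D a * gflip b"
    and M: "\<And>b. M * b = b * M" "gflip M = M" "M ^ Suc n = 0"
  shows "D (taylor n c M) = taylor n (\<lambda>j. c (Suc j)) M * D M"
proof -
  have p: "D (M ^ Suc k) = of_nat (Suc k) * (M ^ k * D M)" for k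
  proof (induction k)
    case 0
    then show ?case by simp
  next
    case (Suc k)
    have "D (M ^ Suc (Suc k)) = M * D (M ^ Suc k) + D M * gflip (M ^ Suc k)"
      unfolding power_Suc[of M "Suc k"] by (rule D(4))
    also have "D M * gflip (M ^ Suc k) = M ^ Suc k * D M"
      by (simp only: gflip_power M(2) power_central[of M, OF M(1), symmetric])
    also have "M * D (M ^ Suc k) = of_nat (Suc k) * (M ^ Suc k * D M)"
      unfolding Suc.IH by (simp only: M(1)[of "of_nat (Suc k) * (M ^ k * D M)"] power_Suc mult.assoc M(1)[of "D M", symmetric])
        (simp only: mult.assoc[symmetric] power_commutes)
    finally show ?case by (simp add: distrib_right)
  qed
  have z: "D 0 = 0" using D(1)[of 0 0] by simp
  have "D (taylor n c M) = (\<Sum>j\<le>n. scal (c j / fact j) * D (M ^ j))"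
    unfolding taylor_def using D(2)[of "c 0" 1] by (induction n) (simp_all add: D(1,2))
  also have "\<dots> = taylor n (\<lambda>j. c (Suc j)) M * D M"
    by (rule taylor_derivative_sum) (simp_all only: p power_0 D(3) M(3) z)
  finally show ?thesis .
qed

lemma rz_taylor:
  "rz j (taylor n c (nil_norm n)) = taylor n (\<lambda>j. c (Suc j)) (nil_norm n) * rz j (nil_norm n)"
  "rzc j (taylor n c (nil_norm n)) = taylor n (\<lambda>j. c (Suc j)) (nil_norm n) * rzc j (nil_norm n)"
proof -
  have 1: "rz j 1 = 0" "rzc j 1 = 0" using rz_rules(2,7)[of j 1] by (simp_all add: gconst_1)
  show "rz j (taylor n c (nil_norm n)) = taylor n (\<lambda>j. c (Suc j)) (nil_norm n) * rz j (nil_norm n)"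
    by (rule odd_derivation_taylor[OF rz_rules(1,4) 1(1) rz_rules(3) nil_norm_commute gflip_nil_norm nil_norm_power_Suc])
  show "rzc j (taylor n c (nil_norm n)) = taylor n (\<lambda>j. c (Suc j)) (nil_norm n) * rzc j (nil_norm n)"
    by (rule odd_derivation_taylor[OF rz_rules(6,9) 1(2) rz_rules(8) nil_norm_commute gflip_nil_norm nil_norm_power_Suc])
qed

section \<open>Integration by parts for the Dirac operators\<close>

lemma dec_diff: "dec S U F \<Longrightarrow> dec S U G \<Longrightarrow> dec S U (\<lambda>x. F x - G x)"
proof -
  assume F: "dec S U F" "dec S U G"
  have "dec S U (\<lambda>x. F x + scal (- 1) * G x)" by (intro dec_add dec_glinear[OF _ glinear_mult(2)] F)
  then show ?thesis by (rule dec_cong) (simp add: scal_hom)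
qed

lemma glinear_rz: "glinear (rz j)" "glinear (rzc j)"
  by (simp_all add: glinear_def rz_rules)

lemma glinear_uminus: "glinear L \<Longrightarrow> L (- a) = - L a"
  using glinearD(2)[of L "- 1" a] by (simp add: scal_hom)

lemma glinear_diff: "glinear L \<Longrightarrow> L (a - b) = L a - L b"
  using glinearD(1)[of L a "- b"] glinear_uminus[of L b] by simp

lemma dec_smooth_test_mult:
  "dec (smooth_on UNIV) UNIV a \<Longrightarrow> dec test_fun UNIV \<Phi> \<Longrightarrow> dec test_fun UNIV (\<lambda>x. a x * \<Phi> x)"
  by (rule dec_mult[of "smooth_on UNIV" test_fun]) (rule test_fun_mult)

lemma dec_test_smooth: "dec test_fun UNIV \<Phi> \<Longrightarrow> dec (smooth_on UNIV) UNIV \<Phi>"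
  by (erule dec_mono) (auto intro: test_fun_smooth)

lemma dec_test_integrable: "dec test_fun UNIV \<Phi> \<Longrightarrow> dec (integrable lborel) UNIV \<Phi>"
  by (erule dec_mono) (auto intro: test_fun_integrable)

lemma dec_pd_test: "dec test_fun UNIV F \<Longrightarrow> dec test_fun UNIV (pd i F)"
proof (induction rule: dec.induct)
  case (base f F v)
  have "pd i F x = scal (dirderiv (axis i 1) f x) * v" for x
    by (subst pd_cong[OF open_UNIV UNIV_I, of F "\<lambda>x. scal (f x) * v"], rule base(2), simp,
        rule pd_scal[OF open_UNIV UNIV_I test_fun_smooth[OF base(1)]])
  then show ?case by (intro dec.base[of test_fun "dirderiv (axis i 1) f"] test_fun_dirderiv base(1) axis_Basis)
next
  case (zero F)
  have "pd i F x = 0" for x by (subst pd_cong[OF open_UNIV UNIV_I, of F "\<lambda>_. 0"]) (simp_all add: zero pd_0)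
  then show ?case by (intro dec.zero)
next
  case (plus F G H)
  have "pd i H x = pd i F x + pd i G x" for x
    by (subst pd_cong[OF open_UNIV UNIV_I, of H "\<lambda>x. F x + G x"], rule plus.hyps(3), simp,
        rule pd_add[OF open_UNIV UNIV_I plus.hyps(1,2)[THEN dec_test_smooth]])
  then show ?case by (rule dec.plus[OF plus.IH])
qed

lemma dec_pd_z_test:
  assumes "dec test_fun UNIV F"
  shows "dec test_fun UNIV (pd_z l F)" "dec test_fun UNIV (pd_zc l F)"
proof -
  have d: "dec test_fun UNIV (\<lambda>x. scal (1/2) * (pd (Inl l) F x + scal c * pd (Inr l) F x))" for c
    by (intro dec_glinear[OF _ glinear_mult(2)] dec_add dec_pd_test assms)
  show "dec test_fun UNIV (pd_z l F)"
    using d[of "- \<i>"] unfolding pd_z_def[abs_def] by (simp add: scal_hom)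
  show "dec test_fun UNIV (pd_zc l F)"
    using d[of \<i>] unfolding pd_zc_def[abs_def] by simp
qed

lemma gint_pd_z:
  assumes F: "dec test_fun UNIV F"
  shows "gint (pd_z l F) = 0" "gint (pd_zc l F) = 0"
proof -
  have "gint (\<lambda>x. scal (1/2) * (pd (Inl l) F x + scal c * pd (Inr l) F x)) = 0" for c
  proof -
    have d: "dec (integrable lborel) UNIV (pd i F)" for i by (rule dec_test_integrable[OF dec_pd_test[OF F]])
    have "gint (\<lambda>x. scal (1/2) * (pd (Inl l) F x + scal c * pd (Inr l) F x)) =
        scal (1/2) * (gint (pd (Inl l) F) + scal c * gint (pd (Inr l) F))"
      by (simp only: gint_glinear[OF dec_add[OF d dec_glinear[OF d glinear_mult(2)]] glinear_mult(2)]
          gint_add[OF d dec_glinear[OF d glinear_mult(2)]] gint_glinear[OF d glinear_mult(2)])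
    then show ?thesis by (simp add: gint_pd[OF F])
  qed
  from this[of "- \<i>"] this[of \<i>] show "gint (pd_z l F) = 0" "gint (pd_zc l F) = 0"
    unfolding pd_z_def[abs_def] pd_zc_def[abs_def] by (simp_all add: scal_hom)
qed

lemma berezin_diff: "berezin n (a - b) = berezin n a - berezin n b"
  by (rule glinear_diff[OF glinear_berezin])

lemma berezin_by_parts:
  assumes "j \<in> {1..2 * n}"
  shows "berezin n (a * gpartial j b) = berezin n (rpartial j a * b)"
proof -
  have "gpartial j (gflip a * b) = gpartial j (gflip a) * b + a * gpartial j b"
    by (simp only: gpartial_mult gflip_gflip)
  then have "a * gpartial j b = gpartial j (gflip a * b) + rpartial j a * b"
    by (simp add: rpartial_def)
  then show ?thesis by (simp only: berezin_linear berezin_gpartial[OF assms] add_0_left)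
qed

lemma berezin_by_parts_z:
  assumes "j \<in> {1..n}"
  shows "berezin n (a * pd_zs j b) = berezin n (rz j a * b)" "berezin n (a * pd_zsc j b) = berezin n (rzc j a * b)"
proof -
  have j: "2 * j - 1 \<in> {1..2 * n}" "2 * j \<in> {1..2 * n}" using assms by auto
  have "a * pd_zs j b = scal (1/2) * (a * gpartial (2 * j - 1) b - scal \<i> * (a * gpartial (2 * j) b))"
    "a * pd_zsc j b = scal (1/2) * (a * gpartial (2 * j - 1) b + scal \<i> * (a * gpartial (2 * j) b))"
    by (simp_all only: pd_zs_def pd_zsc_def scal_left_commute[of a] right_diff_distrib[of a] distrib_left[of a])
  then show "berezin n (a * pd_zs j b) = berezin n (rz j a * b)" "berezin n (a * pd_zsc j b) = berezin n (rzc j a * b)"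
    by (simp_all only: rz_def rzc_def berezin_linear berezin_diff berezin_by_parts[OF j(1)] berezin_by_parts[OF j(2)]
        mult.assoc left_diff_distrib distrib_right)
qed

text \<open>This operator and \<open>right_dirac_dag\<close> are the negative transposes of the
  Dirac operators under the superintegral. Even integration by parts produces a sign and odd
  integration by parts into a right derivative does not, hence the reversed sign of the odd
  part.\<close>

definition right_dirac :: "nat \<Rightarrow> ('m::finite pt \<Rightarrow> 'm cgrass) \<Rightarrow> 'm pt \<Rightarrow> 'm cgrass" where
  "right_dirac n a x = (\<Sum>l\<in>UNIV. pd_z l a x * ff_dag l) - scal (2 * \<i>) * (\<Sum>j=1..n. rz j (a x) * fs_dag j)"

definition right_dirac_dag :: "nat \<Rightarrow> ('m::finite pt \<Rightarrow> 'm cgrass) \<Rightarrow> 'm pt \<Rightarrow> 'm cgrass" where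
  "right_dirac_dag n a x = (\<Sum>l\<in>UNIV. pd_zc l a x * ff l) + scal (2 * \<i>) * (\<Sum>j=1..n. rzc j (a x) * fs j)"

lemma dec_right_dirac:
  assumes a: "dec (smooth_on UNIV) UNIV a"
  shows "dec (smooth_on UNIV) UNIV (right_dirac n a)" "dec (smooth_on UNIV) UNIV (right_dirac_dag n a)"
  unfolding right_dirac_def[abs_def] right_dirac_dag_def[abs_def]
  by (intro dec_diff dec_add dec_sum dec_glinear[OF _ glinear_mult(1)] dec_glinear[OF _ glinear_mult(2)]
      dec_glinear[OF _ glinear_rz(1)] dec_glinear[OF _ glinear_rz(2)] dec_pd_z open_UNIV a)+

lemma dirac_by_parts:
  assumes a: "dec (smooth_on UNIV) UNIV a" and \<Phi>: "dec test_fun UNIV \<Phi>"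
  shows "dec (integrable lborel) UNIV (\<lambda>x. berezin n (a x * dirac n \<Phi> x))"
    "gint (\<lambda>x. berezin n (a x * dirac n \<Phi> x)) = - gint (\<lambda>x. berezin n (right_dirac n a x * \<Phi> x))"
    "dec (integrable lborel) UNIV (\<lambda>x. berezin n (a x * dirac_dag n \<Phi> x))"
    "gint (\<lambda>x. berezin n (a x * dirac_dag n \<Phi> x)) = - gint (\<lambda>x. berezin n (right_dirac_dag n a x * \<Phi> x))"
proof -
  have d: "dec test_fun UNIV (\<lambda>x. a x * v * \<Phi> x)" for v
    by (rule dec_smooth_test_mult[OF dec_glinear[OF a glinear_mult(1)] \<Phi>])
  have av: "dec (smooth_on UNIV) UNIV (\<lambda>x. a x * v)" for v by (rule dec_glinear[OF a glinear_mult(1)])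
  have pm: "a x * (v * pd_z l \<Phi> x) = pd_z l (\<lambda>x. a x * v * \<Phi> x) x - pd_z l a x * v * \<Phi> x"
    "a x * (v * pd_zc l \<Phi> x) = pd_zc l (\<lambda>x. a x * v * \<Phi> x) x - pd_zc l a x * v * \<Phi> x" for x v l
    by (simp_all only: pd_z_mult[OF open_UNIV UNIV_I av dec_test_smooth[OF \<Phi>]] pd_z_glinear[OF open_UNIV UNIV_I glinear_mult(1) a])
       (simp_all add: mult.assoc)
  have gm: "berezin n (a x * (fs_dag j * pd_zs j b)) = berezin n (rz j (a x) * fs_dag j * b)"
    "berezin n (a x * (fs j * pd_zsc j b)) = berezin n (rzc j (a x) * fs j * b)" if "j \<in> {1..n}" for x j b
    using berezin_by_parts_z[OF that, of "a x * fs_dag j" b] berezin_by_parts_z[OF that, of "a x * fs j" b]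
    by (simp_all add: mult.assoc fs_def fs_dag_def rz_rules(5,10))
  let ?Z = "\<lambda>x. \<Sum>l\<in>UNIV. pd_z l (\<lambda>x. a x * ff_dag l * \<Phi> x) x" and ?Zc = "\<lambda>x. \<Sum>l\<in>UNIV. pd_zc l (\<lambda>x. a x * ff l * \<Phi> x) x"
  have bs: "berezin n (\<Sum>i\<in>I. f i) = (\<Sum>i\<in>I. berezin n (f i))" for I :: "nat set" and f by (rule glinear_sum[OF glinear_berezin])
  have e: "berezin n (a x * dirac n \<Phi> x) = berezin n (?Z x) + scal (- 1) * berezin n (right_dirac n a x * \<Phi> x)" for x
  proof -
    have "a x * dirac n \<Phi> x = (?Z x - (\<Sum>l\<in>UNIV. pd_z l a x * ff_dag l) * \<Phi> x) + scal (2 * \<i>) * (\<Sum>j=1..n. a x * (fs_dag j * pd_zs j (\<Phi> x)))"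
      unfolding dirac_def distrib_left scal_left_commute[of "a x"] sum_distrib_left pm sum_subtractf sum_distrib_right by (rule HOL.refl)
    moreover have "berezin n (\<Sum>j=1..n. a x * (fs_dag j * pd_zs j (\<Phi> x))) = berezin n ((\<Sum>j=1..n. rz j (a x) * fs_dag j) * \<Phi> x)"
      unfolding sum_distrib_right bs by (rule sum.cong[OF HOL.refl gm(1)])
    ultimately show ?thesis
      by (simp only: berezin_linear berezin_diff right_dirac_def left_diff_distrib mult.assoc scal_hom) simp
  qed
  have e': "berezin n (a x * dirac_dag n \<Phi> x) = berezin n (?Zc x) + scal (- 1) * berezin n (right_dirac_dag n a x * \<Phi> x)" for x
  proof -
    have "a x * dirac_dag n \<Phi> x = (?Zc x - (\<Sum>l\<in>UNIV. pd_zc l a x * ff l) * \<Phi> x) - scal (2 * \<i>) * (\<Sum>j=1..n. a x * (fs j * pd_zsc j (\<Phi> x)))"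
      unfolding dirac_dag_def right_diff_distrib scal_left_commute[of "a x"] sum_distrib_left pm sum_subtractf sum_distrib_right by (rule HOL.refl)
    moreover have "berezin n (\<Sum>j=1..n. a x * (fs j * pd_zsc j (\<Phi> x))) = berezin n ((\<Sum>j=1..n. rzc j (a x) * fs j) * \<Phi> x)"
      unfolding sum_distrib_right bs by (rule sum.cong[OF HOL.refl gm(2)])
    ultimately show ?thesis
      by (simp only: berezin_linear berezin_diff right_dirac_dag_def distrib_right mult.assoc scal_hom) simp
  qed
  have iz: "dec (integrable lborel) UNIV (\<lambda>x. berezin n (?Z x))" "dec (integrable lborel) UNIV (\<lambda>x. berezin n (?Zc x))"
    by (intro dec_glinear[OF _ glinear_berezin] dec_sum dec_test_integrable[OF dec_pd_z_test(1)[OF d]] dec_test_integrable[OF dec_pd_z_test(2)[OF d]])+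
  have ir: "dec (integrable lborel) UNIV (\<lambda>x. berezin n (right_dirac n a x * \<Phi> x))" "dec (integrable lborel) UNIV (\<lambda>x. berezin n (right_dirac_dag n a x * \<Phi> x))"
    by (intro dec_glinear[OF _ glinear_berezin] dec_test_integrable dec_smooth_test_mult dec_right_dirac a \<Phi>)+
  have sc: "dec (integrable lborel) UNIV (\<lambda>x. scal c * F x)" if "dec (integrable lborel) UNIV F" for c and F :: "'a pt \<Rightarrow> 'a cgrass"
    using that by (rule dec_glinear[OF _ glinear_mult(2)])
  have z: "gint (\<lambda>x. berezin n (?Z x)) = 0" "gint (\<lambda>x. berezin n (?Zc x)) = 0"
  proof -
    have i: "dec (integrable lborel) UNIV (\<lambda>x. pd_z l (\<lambda>x. a x * ff_dag l * \<Phi> x) x)" "dec (integrable lborel) UNIV (\<lambda>x. pd_zc l (\<lambda>x. a x * ff l * \<Phi> x) x)" for l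
      by (intro dec_test_integrable[OF dec_pd_z_test(1)[OF d]] dec_test_integrable[OF dec_pd_z_test(2)[OF d]])+
    have "gint ?Z = (\<Sum>l\<in>UNIV. gint (\<lambda>x. pd_z l (\<lambda>x. a x * ff_dag l * \<Phi> x) x))"
      "gint ?Zc = (\<Sum>l\<in>UNIV. gint (\<lambda>x. pd_zc l (\<lambda>x. a x * ff l * \<Phi> x) x))"
      by (rule gint_sum, rule i)+
    then have "gint ?Z = 0" "gint ?Zc = 0" by (simp_all add: gint_pd_z[OF d])
    moreover have "gint (\<lambda>x. berezin n (?Z x)) = berezin n (gint ?Z)" "gint (\<lambda>x. berezin n (?Zc x)) = berezin n (gint ?Zc)"
      by (rule gint_glinear[OF dec_sum glinear_berezin], rule i)+
    ultimately show "gint (\<lambda>x. berezin n (?Z x)) = 0" "gint (\<lambda>x. berezin n (?Zc x)) = 0"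
      by (simp_all only: glinearD(3)[OF glinear_berezin])
  qed
  show "dec (integrable lborel) UNIV (\<lambda>x. berezin n (a x * dirac n \<Phi> x))" unfolding e by (intro dec_add iz ir sc)
  show "dec (integrable lborel) UNIV (\<lambda>x. berezin n (a x * dirac_dag n \<Phi> x))" unfolding e' by (intro dec_add iz ir sc)
  show "gint (\<lambda>x. berezin n (a x * dirac n \<Phi> x)) = - gint (\<lambda>x. berezin n (right_dirac n a x * \<Phi> x))"
    unfolding e gint_add[OF iz(1) sc[OF ir(1)]] gint_glinear[OF ir(1) glinear_mult(2)] z by (simp add: scal_hom)
  show "gint (\<lambda>x. berezin n (a x * dirac_dag n \<Phi> x)) = - gint (\<lambda>x. berezin n (right_dirac_dag n a x * \<Phi> x))"
    unfolding e' gint_add[OF iz(2) sc[OF ir(2)]] gint_glinear[OF ir(2) glinear_mult(2)] z by (simp add: scal_hom)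
qed

section \<open>The regularised kernel is nearly monogenic\<close>

text \<open>A function of |Z - U|^2 contributes its derivative times the conjugate vector variable,
  respectively the vector variable. The factor 2i in the Dirac operators is what removes the factor
  i/2 of the odd derivatives of the nilpotent norm, so that even and odd parts assemble to one
  vector variable.\<close>

lemma right_dirac_taylor:
  fixes A :: "'m::finite pt \<Rightarrow> 'm cgrass"
  assumes A: "dec (smooth_on UNIV) UNIV A" and \<epsilon>: "\<epsilon> > 0"
  shows "right_dirac n (\<lambda>x. A x * taylor n (\<lambda>j. kc k \<epsilon> j y x) (nil_norm n)) x =
      right_dirac n A x * taylor n (\<lambda>j. kc k \<epsilon> j y x) (nil_norm n) +
      A x * ZZ_dag n (x - y) (theta n) * taylor n (\<lambda>j. kc k \<epsilon> (Suc j) y x) (nil_norm n)"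
    "right_dirac_dag n (\<lambda>x. A x * taylor n (\<lambda>j. kc k \<epsilon> j y x) (nil_norm n)) x =
      right_dirac_dag n A x * taylor n (\<lambda>j. kc k \<epsilon> j y x) (nil_norm n) +
      A x * ZZ n (x - y) (theta n) * taylor n (\<lambda>j. kc k \<epsilon> (Suc j) y x) (nil_norm n)"
proof -
  let ?T = "\<lambda>x. taylor n (\<lambda>j. kc k \<epsilon> j y x) (nil_norm n) :: 'm cgrass"
  let ?T' = "taylor n (\<lambda>j. kc k \<epsilon> (Suc j) y x) (nil_norm n) :: 'm cgrass"
  have c: "?T x * b = b * ?T x" "?T' * b = b * ?T'" for b by (rule taylor_commute[OF nil_norm_commute])+
  have pos: "0 < (norm (x - y))\<^sup>2 + \<epsilon>" for x using \<epsilon> by (simp add: add_nonneg_pos)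
  note pT = pd_z_mult[OF open_UNIV UNIV_I A dec_taylor_kc[OF open_UNIV pos]]
  have s1: "pd_z l (\<lambda>x. A x * ?T x) x * v = pd_z l A x * v * ?T x + A x * (scal (cnj (zc (x - y) l)) * v) * ?T'"
    "pd_zc l (\<lambda>x. A x * ?T x) x * v = pd_zc l A x * v * ?T x + A x * (scal (zc (x - y) l) * v) * ?T'" for l v
    by (simp_all only: pT pd_z_taylor_kc[OF \<epsilon>] distrib_right mult.assoc c[of v] c(2)[of "scal b * v" for b])
  have s2: "rz j (A x * ?T x) * v = rz j (A x) * v * ?T x + A x * (rz j (nil_norm n) * v) * ?T'"
    "rzc j (A x * ?T x) * v = rzc j (A x) * v * ?T x + A x * (rzc j (nil_norm n) * v) * ?T'" for j v
    by (simp_all only: rz_rules(3,8) rz_taylor gflip_taylor distrib_right mult.assoc c[of v] c(2)[of "b * v" for b] add.commute)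
  have s3: "(\<Sum>j=1..n. rz j (nil_norm n) * fs_dag j) = scal (\<i> / 2) * (\<Sum>j=1..n. emb (zs_conj (theta n) j) * (fs_dag j :: 'm cgrass))"
    "(\<Sum>j=1..n. rzc j (nil_norm n) * fs j) = scal (- (\<i> / 2)) * (\<Sum>j=1..n. emb (zs (theta n) j) * (fs j :: 'm cgrass))"
    unfolding sum_distrib_left by (intro sum.cong HOL.refl; simp only: rz_nil_norm mult.assoc scal_hom(3) mult_minus_left)+
  have s4: "scal (2 * \<i>) * (scal (\<i> / 2) * b) = - b" "scal (2 * \<i>) * (scal (- (\<i> / 2)) * b) = b" for b :: "'m cgrass"
    unfolding mult.assoc[symmetric] scal_hom(2)[symmetric] by (simp_all add: scal_hom)
  have g: "(\<Sum>i\<in>I. f i * ?T x + A x * h i * ?T') = (\<Sum>i\<in>I. f i) * ?T x + A x * (\<Sum>i\<in>I. h i) * ?T'" for I :: "'k set" and f h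
    unfolding sum.distrib sum_distrib_right sum_distrib_left by (rule HOL.refl)
  have d: "scal c * (p * ?T x + A x * q * ?T') = scal c * p * ?T x + A x * (scal c * q) * ?T'" for c p q
    by (simp only: distrib_left mult.assoc scal_left_commute[of "A x"])
  show "right_dirac n (\<lambda>x. A x * ?T x) x = right_dirac n A x * ?T x + A x * ZZ_dag n (x - y) (theta n) * ?T'"
    unfolding right_dirac_def s1 s2 g s3 d s4 ZZ_dag_def
    by (simp only: left_diff_distrib distrib_right distrib_left mult_minus_right mult_minus_left) simp
  show "right_dirac_dag n (\<lambda>x. A x * ?T x) x = right_dirac_dag n A x * ?T x + A x * ZZ n (x - y) (theta n) * ?T'"
    unfolding right_dirac_dag_def s1 s2 g s3 d s4 ZZ_def
    by (simp only: distrib_right distrib_left) simp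
qed

text \<open>The superdimension: in the sum of the two diagonal terms every even dual pair gives 1
  through its anticommutator, and every odd one gives -1, the product of 2i and i/2 coming from its
  commutator.\<close>

lemma right_dirac_ZZ:
  fixes x y :: "'m::finite pt"
  shows "right_dirac n (\<lambda>x. ZZ_dag n (x - y) (theta n)) x = 0" "right_dirac_dag n (\<lambda>x. ZZ n (x - y) (theta n)) x = 0"
    "n < CARD('m) \<Longrightarrow> right_dirac n (\<lambda>x. ZZ n (x - y) (theta n)) x + right_dirac_dag n (\<lambda>x. ZZ_dag n (x - y) (theta n)) x = scal (of_nat (CARD('m) - n))"
proof -
  have z: "(\<Sum>j=1..n. rz j (ZZ_dag n (x - y) (theta n)) * fs_dag j) = (0 :: 'm cgrass)"
    "(\<Sum>j=1..n. rzc j (ZZ n (x - y) (theta n)) * fs j) = (0 :: 'm cgrass)"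
    by (intro sum.neutral ballI; simp only: rz_ZZ mult_zero_left)+
  show "right_dirac n (\<lambda>x. ZZ_dag n (x - y) (theta n)) x = 0" "right_dirac_dag n (\<lambda>x. ZZ n (x - y) (theta n)) x = 0"
    by (simp_all only: right_dirac_def right_dirac_dag_def pd_z_ZZ z) simp_all
  have s: "(\<Sum>j=1..n. rz j (ZZ n (x - y) (theta n)) * fs_dag j) = (\<Sum>j=1..n. fs j * fs_dag j :: 'm cgrass)"
    "(\<Sum>j=1..n. rzc j (ZZ_dag n (x - y) (theta n)) * fs j) = (\<Sum>j=1..n. fs_dag j * fs j :: 'm cgrass)"
    by (intro sum.cong HOL.refl; simp only: rz_ZZ)+
  assume n: "n < CARD('m)"
  have 1: "(\<Sum>l\<in>UNIV. ff l * ff_dag l) + (\<Sum>l\<in>UNIV. ff_dag l * ff l) = (scal (of_nat CARD('m)) :: 'm cgrass)"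
    using ff_relations(3)[of "j :: 'm" j for j] by (simp add: sum.distrib[symmetric] acomm_def scal_hom(6) scal_of_nat)
  have "(\<Sum>j=1..n. fs j * fs_dag j) - (\<Sum>j=1..n. fs_dag j * fs j) = (\<Sum>j=1..n. scal (- \<i> / 2) :: 'm cgrass)"
    unfolding sum_subtractf[symmetric] 
  proof (rule sum.cong[OF HOL.refl])
    fix j assume "j \<in> {1..n}"
    then show "fs j * fs_dag j - fs_dag j * fs j = (scal (- \<i> / 2) :: 'm cgrass)"
      using fs_relations(3)[of j j] unfolding comm_def by simp
  qed
  also have "\<dots> = scal (of_nat n * (- \<i> / 2))"
    by (simp only: sum_constant scal_hom(2) scal_of_nat card_atLeastAtMost) simp
  finally have 2: "(\<Sum>j=1..n. fs j * fs_dag j) - (\<Sum>j=1..n. fs_dag j * fs j) = (scal (of_nat n * (- \<i> / 2)) :: 'm cgrass)" .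
  have "right_dirac n (\<lambda>x. ZZ n (x - y) (theta n)) x + right_dirac_dag n (\<lambda>x. ZZ_dag n (x - y) (theta n)) x =
     ((\<Sum>l\<in>UNIV. ff l * ff_dag l) + (\<Sum>l\<in>UNIV. ff_dag l * ff l)) - scal (2 * \<i>) * ((\<Sum>j=1..n. fs j * fs_dag j) - (\<Sum>j=1..n. fs_dag j * fs j) :: 'm cgrass)"
    unfolding right_dirac_def right_dirac_dag_def pd_z_ZZ s by (simp add: algebra_simps)
  also have "\<dots> = scal (of_nat CARD('m) - 2 * \<i> * (of_nat n * (- \<i> / 2)))"
    unfolding 1 2 by (simp only: scal_hom(2,4))
  also have "of_nat CARD('m) - 2 * \<i> * (of_nat n * (- \<i> / 2)) = (of_nat (CARD('m) - n) :: complex)"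
    using n by (simp add: of_nat_diff mult.left_commute[of \<i>])
  finally show "right_dirac n (\<lambda>x. ZZ n (x - y) (theta n)) x + right_dirac_dag n (\<lambda>x. ZZ_dag n (x - y) (theta n)) x = scal (of_nat (CARD('m) - n))" .
qed

text \<open>On the diagonal the products of the vector variable with its conjugate add up to |Z -
  U|^2, and with the superdimension \<open>kc_identity\<close> leaves a multiple of \<epsilon>. Off
  the diagonal only squares of the two isotropic vector variables occur, and these vanish.\<close>

lemma right_dirac_kernel:
  fixes x y :: "'m::finite pt"
  assumes \<epsilon>: "\<epsilon> > 0" and n: "n < CARD('m)"
  shows "right_dirac n (kp n \<epsilon> y) x + right_dirac_dag n (kd n \<epsilon> y) x =
      scal (of_real (real (CARD('m) - n) * \<epsilon>)) * taylor n (\<lambda>j. kc (Suc (CARD('m) - n)) \<epsilon> j y x) (nil_norm n)"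
    "right_dirac n (kd n \<epsilon> y) x + right_dirac_dag n (kp n \<epsilon> y) x = 0"
proof -
  let ?k = "CARD('m) - n"
  let ?T' = "taylor n (\<lambda>j. kc ?k \<epsilon> (Suc j) y x) (nil_norm n) :: 'm cgrass"
  let ?Z = "ZZ n (x - y) (theta n)" and ?D = "ZZ_dag n (x - y) (theta n)"
  have pos: "0 < (norm (x - y))\<^sup>2 + \<epsilon>" using \<epsilon> by (simp add: add_nonneg_pos)
  have N: "?Z * ?D + ?D * ?Z = scal (complex_of_real ((norm (x - y))\<^sup>2)) + (nil_norm n :: 'm cgrass)"
    using ZZ_acomm[of n "x - y"] by (simp only: acomm_def emb_normsq zc_norm)
  show "right_dirac n (kd n \<epsilon> y) x + right_dirac_dag n (kp n \<epsilon> y) x = 0"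
    unfolding kp_def[abs_def] kd_def[abs_def] right_dirac_taylor[OF dec_ZZ(1) \<epsilon>] right_dirac_taylor[OF dec_ZZ(2) \<epsilon>] right_dirac_ZZ
      ZZ_square ZZ_dag_square by simp
  have "right_dirac n (kp n \<epsilon> y) x + right_dirac_dag n (kd n \<epsilon> y) x =
     (right_dirac n (\<lambda>x. ZZ n (x - y) (theta n)) x + right_dirac_dag n (\<lambda>x. ZZ_dag n (x - y) (theta n)) x) * taylor n (\<lambda>j. kc ?k \<epsilon> j y x) (nil_norm n) +
     (?Z * ?D + ?D * ?Z) * ?T'"
    unfolding kp_def[abs_def] kd_def[abs_def] right_dirac_taylor[OF dec_ZZ(1) \<epsilon>] right_dirac_taylor[OF dec_ZZ(2) \<epsilon>]
    by (simp only: distrib_right add_ac)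
  then show "right_dirac n (kp n \<epsilon> y) x + right_dirac_dag n (kd n \<epsilon> y) x =
      scal (of_real (real ?k * \<epsilon>)) * taylor n (\<lambda>j. kc (Suc ?k) \<epsilon> j y x) (nil_norm n)"
    unfolding right_dirac_ZZ(3)[OF n] N kc_identity[OF pos] .
qed

section \<open>Singular kernels as limits\<close>

text \<open>A family whose singularity at y is bounded uniformly in \<epsilon> by a locally
  integrable power. The parameter is paired with the point, so that \<open>dec\<close> decomposes
  the whole family with constants independent of \<epsilon>.\<close>

definition radial :: "'m::finite pt \<Rightarrow> (real \<times> 'm pt \<Rightarrow> complex) \<Rightarrow> bool" where
  "radial y f \<longleftrightarrow> (\<exists>q C. q < DIM('m pt) \<and> (\<forall>\<epsilon>\<ge>0. (\<lambda>x. f (\<epsilon>, x)) \<in> borel_measurable borel) \<and>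
     (\<forall>\<epsilon>\<ge>0. \<forall>x. x \<noteq> y \<longrightarrow> norm (f (\<epsilon>, x)) \<le> C * inverse (norm (x - y) ^ q)) \<and>
     (\<forall>x. x \<noteq> y \<longrightarrow> ((\<lambda>\<epsilon>. f (\<epsilon>, x)) \<longlongrightarrow> f (0, x)) (at_right 0)))"

lemma radialD:
  assumes "radial y f" "test_fun \<phi>"
  shows "\<epsilon> \<ge> 0 \<Longrightarrow> integrable lborel (\<lambda>x. f (\<epsilon>, x) * \<phi> x)"
    and "((\<lambda>\<epsilon>. \<integral>x. f (\<epsilon>, x) * \<phi> x \<partial>lborel) \<longlongrightarrow> (\<integral>x. f (0, x) * \<phi> x \<partial>lborel)) (at_right 0)"
proof -
  obtain q C where r: "q < DIM('a pt)" "\<forall>\<epsilon>\<ge>0. (\<lambda>x. f (\<epsilon>, x)) \<in> borel_measurable borel"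
    "\<forall>\<epsilon>\<ge>0. \<forall>x. x \<noteq> y \<longrightarrow> norm (f (\<epsilon>, x)) \<le> C * inverse (norm (x - y) ^ q)"
    "\<forall>x. x \<noteq> y \<longrightarrow> ((\<lambda>\<epsilon>. f (\<epsilon>, x)) \<longlongrightarrow> f (0, x)) (at_right 0)"
    using assms(1) unfolding radial_def by blast
  have m: "(\<lambda>x. f (\<epsilon>, x)) \<in> borel_measurable borel" if "\<epsilon> \<ge> 0" for \<epsilon> using r(2) that by blast
  have b: "norm (f (\<epsilon>, x)) \<le> C * inverse (norm (x - y) ^ q)" if "\<epsilon> \<ge> 0" "x \<noteq> y" for \<epsilon> x using r(3) that by blast
  have l: "((\<lambda>\<epsilon>. f (\<epsilon>, x)) \<longlongrightarrow> f (0, x)) (at_right 0)" if "x \<noteq> y" for x using r(4) that by blast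
  note r = radial_limit[where \<kappa> = "\<lambda>\<epsilon> x. f (\<epsilon>, x)", OF r(1) m m[OF order_refl] b l assms(2)]
  show "\<epsilon> \<ge> 0 \<Longrightarrow> integrable lborel (\<lambda>x. f (\<epsilon>, x) * \<phi> x)" by (rule r(1))
  show "((\<lambda>\<epsilon>. \<integral>x. f (\<epsilon>, x) * \<phi> x \<partial>lborel) \<longlongrightarrow> (\<integral>x. f (0, x) * \<phi> x \<partial>lborel)) (at_right 0)" by (rule r(2))
qed

definition gcont :: "(real \<Rightarrow> 'm::finite pt \<Rightarrow> 'm cgrass) \<Rightarrow> bool" where
  "gcont G \<longleftrightarrow> (\<forall>\<epsilon>\<ge>0. dec (integrable lborel) UNIV (G \<epsilon>)) \<and> vlim (\<lambda>\<epsilon>. gint (G \<epsilon>)) (gint (G 0))"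

lemma vlim_cong_pos: "vlim f l \<Longrightarrow> (\<And>\<epsilon>. \<epsilon> > 0 \<Longrightarrow> f \<epsilon> = f' \<epsilon>) \<Longrightarrow> vlim f' l"
  by (erule vlim_cong) (rule eventually_mono[OF eventually_right_pos], blast)

lemma gcont_cong:
  assumes "gcont G" "\<And>\<epsilon> x. \<epsilon> \<ge> 0 \<Longrightarrow> H \<epsilon> x = G \<epsilon> x"
  shows "gcont H"
proof -
  have "H \<epsilon> = G \<epsilon>" if "\<epsilon> \<ge> 0" for \<epsilon> using assms(2)[OF that] by blast
  then show ?thesis using assms(1) vlim_cong_pos[of "\<lambda>\<epsilon>. gint (G \<epsilon>)" "gint (G 0)" "\<lambda>\<epsilon>. gint (H \<epsilon>)"] unfolding gcont_def by simp
qed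

lemma gcont_add: "gcont G \<Longrightarrow> gcont H \<Longrightarrow> gcont (\<lambda>\<epsilon> x. G \<epsilon> x + H \<epsilon> x)"
proof -
  assume G: "gcont G" "gcont H"
  then have d: "dec (integrable lborel) UNIV (G \<epsilon>)" "dec (integrable lborel) UNIV (H \<epsilon>)" if "\<epsilon> \<ge> 0" for \<epsilon>
    using that by (simp_all add: gcont_def)
  have "vlim (\<lambda>\<epsilon>. gint (G \<epsilon>) + gint (H \<epsilon>)) (gint (G 0) + gint (H 0))"
    using G by (intro vlim_add) (simp_all add: gcont_def)
  then have "vlim (\<lambda>\<epsilon>. gint (\<lambda>x. G \<epsilon> x + H \<epsilon> x)) (gint (G 0) + gint (H 0))"
    by (rule vlim_cong_pos) (simp add: gint_add d)
  then show ?thesis unfolding gcont_def by (simp add: gint_add d dec_add)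
qed

lemma gcont_0: "gcont (\<lambda>_ _. 0)"
  by (simp add: gcont_def dec.zero vlim_const)

lemma gcont_scal:
  assumes "radial y f" "test_fun \<phi>"
  shows "gcont (\<lambda>\<epsilon> x. scal (f (\<epsilon>, x) * \<phi> x) * w)"
proof -
  have "vlim (\<lambda>\<epsilon>. scal (\<integral>x. f (\<epsilon>, x) * \<phi> x \<partial>lborel) * w) (scal (\<integral>x. f (0, x) * \<phi> x \<partial>lborel) * w)"
    by (rule vlim_scal[OF radialD(2)[OF assms]])
  then have "vlim (\<lambda>\<epsilon>. gint (\<lambda>x. scal (f (\<epsilon>, x) * \<phi> x) * w)) (scal (\<integral>x. f (0, x) * \<phi> x \<partial>lborel) * w)"
    by (rule vlim_cong_pos) (simp only: gint_scal radialD(1)[OF assms] less_imp_le)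
  then show ?thesis unfolding gcont_def
    by (auto simp only: gint_scal radialD(1)[OF assms] order_refl intro!: dec.base[of "integrable lborel"] radialD(1)[OF assms])
qed

lemma gcont_radial_scal:
  assumes f: "radial y f" and L: "glinear L"
  shows "dec test_fun UNIV \<Psi> \<Longrightarrow> gcont (\<lambda>\<epsilon> x. L (scal (f (\<epsilon>, x)) * v * \<Psi> x))"
proof (induction rule: dec.induct)
  case (base \<phi> F w)
  have "scal (f (\<epsilon>, x)) * v * F x = scal (f (\<epsilon>, x) * \<phi> x) * (v * w)" for \<epsilon> x
    by (simp only: base(2)[OF UNIV_I] scal_hom(2) mult.assoc scal_left_commute[of v])
  then have "L (scal (f (\<epsilon>, x)) * v * F x) = scal (f (\<epsilon>, x) * \<phi> x) * L (v * w)" for \<epsilon> x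
    by (simp only: glinearD(2)[OF L])
  then show ?case by (rule gcont_cong[OF gcont_scal[OF f base(1)]])
next
  case (zero F)
  show ?case by (rule gcont_cong[OF gcont_0]) (simp add: zero glinearD(3)[OF L])
next
  case (plus F G H)
  show ?case by (rule gcont_cong[OF gcont_add[OF plus.IH]]) (simp only: plus.hyps(3)[OF UNIV_I] distrib_left glinearD(1)[OF L])
qed

lemma gcont_radial:
  assumes \<Psi>: "dec test_fun UNIV \<Psi>" and L: "glinear L"
  shows "dec (radial y) ({0..} \<times> UNIV) K \<Longrightarrow> gcont (\<lambda>\<epsilon> x. L (K (\<epsilon>, x) * \<Psi> x))"
proof (induction rule: dec.induct)
  case (base f F v)
  show ?case by (rule gcont_cong[OF gcont_radial_scal[OF base(1) L \<Psi>, where v = v]]) (simp add: base(2))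
next
  case (zero F)
  show ?case by (rule gcont_cong[OF gcont_0]) (simp add: zero glinearD(3)[OF L])
next
  case (plus F G H)
  show ?case by (rule gcont_cong[OF gcont_add[OF plus.IH]]) (simp add: plus.hyps(3) distrib_right glinearD(1)[OF L])
qed

lemma kc_measurable: "kc k \<epsilon> j y \<in> borel_measurable borel"
  unfolding kc_def[abs_def] rk_def by measurable

lemma kc_tendsto:
  assumes "x \<noteq> y" shows "((\<lambda>\<epsilon>. kc k \<epsilon> j y x) \<longlongrightarrow> kc k 0 j y x) (at_right 0)"
  unfolding kc_def rk_def
  by (intro tendsto_of_real tendsto_mult tendsto_const tendsto_inverse tendsto_power tendsto_add tendsto_ident_at) (use assms in simp)

lemma norm_kc_le:
  assumes "\<epsilon> \<ge> 0" "x \<noteq> y"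
  shows "norm (kc k \<epsilon> j y x) \<le> pochhammer (real k) j * inverse (norm (x - y) ^ (2 * (k + j)))"
proof -
  have "0 < norm (x - y) ^ (2 * (k + j))" using assms by simp
  moreover have "norm (x - y) ^ (2 * (k + j)) \<le> ((norm (x - y))\<^sup>2 + \<epsilon>) ^ (k + j)"
    unfolding power_mult using assms by (intro power_mono) auto
  ultimately have "inverse (((norm (x - y))\<^sup>2 + \<epsilon>) ^ (k + j)) \<le> inverse (norm (x - y) ^ (2 * (k + j)))"
    by (intro le_imp_inverse_le)
  moreover have "0 \<le> pochhammer (real k) j" by (simp add: pochhammer_of_nat)
  moreover have "norm (kc k \<epsilon> j y x) = pochhammer (real k) j * inverse (((norm (x - y))\<^sup>2 + \<epsilon>) ^ (k + j))"
  proof -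
    have "\<bar>(-1) ^ j * pochhammer (real k) j * inverse (((norm (x - y))\<^sup>2 + \<epsilon>) ^ (k + j))\<bar> = pochhammer (real k) j * inverse (((norm (x - y))\<^sup>2 + \<epsilon>) ^ (k + j))"
      using assms \<open>0 \<le> pochhammer (real k) j\<close> by (simp add: abs_mult power_abs)
    then show ?thesis by (simp only: kc_def rk_def norm_of_real)
  qed
  ultimately show ?thesis by (simp only: mult_left_mono)
qed

lemma radial_kc:
  fixes y :: "'m::finite pt"
  assumes "k + j < CARD('m)" shows "radial y (\<lambda>p. kc k (fst p) j y (snd p))"
  unfolding radial_def using assms
  by (intro exI[of _ "2 * (k + j)"] exI[of _ "pochhammer (real k) j"]) (auto simp: kc_measurable kc_tendsto norm_kc_le[unfolded add_mult_distrib2])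

text \<open>The linear factor lowers the order of the singularity by one. This admits k + j = m,
  which for k = m - n is the top nilpotent degree.\<close>

lemma radial_linear_kc:
  fixes y :: "'m::finite pt"
  assumes "k + j \<le> CARD('m)" "0 < k" and h: "bounded_linear h"
  shows "radial y (\<lambda>p. h (snd p - y) * kc k (fst p) j y (snd p))"
proof -
  obtain B where B: "\<And>x. norm (h x) \<le> norm x * B" using bounded_linear.bounded[OF h] by blast
  let ?p = "pochhammer (real k) j"
  have "norm (h (x - y) * kc k \<epsilon> j y x) \<le> (B * ?p) * inverse (norm (x - y) ^ (2 * (k + j) - 1))" if "\<epsilon> \<ge> 0" "x \<noteq> y" for \<epsilon> x
  proof -
    have "norm (h (x - y) * kc k \<epsilon> j y x) \<le> (norm (x - y) * B) * (?p * inverse (norm (x - y) ^ (2 * (k + j))))"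
      unfolding norm_mult by (intro mult_mono B norm_kc_le that order_trans[OF norm_ge_zero B]) auto
    also have "norm (x - y) ^ (2 * (k + j)) = norm (x - y) * norm (x - y) ^ (2 * (k + j) - 1)"
      using assms(2) unfolding power_Suc[symmetric] by (intro arg_cong2[of _ _ _ _ power]) auto
    also have "(norm (x - y) * B) * (?p * inverse (norm (x - y) * norm (x - y) ^ (2 * (k + j) - 1))) = (B * ?p) * inverse (norm (x - y) ^ (2 * (k + j) - 1))"
      using that(2) by (simp add: field_simps)
    finally show ?thesis .
  qed
  moreover have "(\<lambda>x. h (x - y)) \<in> borel_measurable borel"
    by (rule borel_measurable_continuous_onI) (intro bounded_linear.continuous_on[OF h] continuous_intros)
  ultimately show ?thesis
    unfolding radial_def using assms(1,2)
    by (intro exI[of _ "2 * (k + j) - 1"] exI[of _ "B * ?p"])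
       (auto intro!: borel_measurable_times kc_measurable tendsto_mult tendsto_const kc_tendsto)
qed

text \<open>The prefactor \<epsilon> is at most \<open>(norm (x - y))\<^sup>2 + \<epsilon>\<close>
  and cancels one power of the denominator in the bound; away from y it makes the family tend to
  0.\<close>

lemma radial_source:
  fixes y :: "'m::finite pt"
  assumes "k + j < CARD('m)" shows "radial y (\<lambda>p. of_real (real c * fst p) * kc (Suc k) (fst p) j y (snd p))"
proof -
  let ?p = "pochhammer (real (Suc k)) j"
  have "norm (of_real (real c * \<epsilon>) * kc (Suc k) \<epsilon> j y x) \<le> (real c * ?p) * inverse (norm (x - y) ^ (2 * (k + j)))" if "\<epsilon> \<ge> 0" "x \<noteq> y" for \<epsilon> x
  proof -
    let ?s = "(norm (x - y))\<^sup>2 + \<epsilon>"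
    have s: "0 < ?s" using that by (simp add: add_pos_nonneg)
    have p: "0 \<le> ?p" by (intro pochhammer_nonneg) simp
    have "norm (of_real (real c * \<epsilon>) * kc (Suc k) \<epsilon> j y x) = real c * ?p * (\<epsilon> * inverse (?s ^ Suc (k + j)))"
    proof -
      have "\<bar>real c * \<epsilon> * ((-1) ^ j * ?p * inverse (?s ^ Suc (k + j)))\<bar> = real c * ?p * (\<epsilon> * inverse (?s ^ Suc (k + j)))"
        using that s p by (simp add: abs_mult power_abs del: power_Suc)
      then show ?thesis by (simp only: kc_def rk_def of_real_mult[symmetric] norm_of_real add_Suc)
    qed
    also have "\<epsilon> * inverse (?s ^ Suc (k + j)) \<le> ?s * inverse (?s ^ Suc (k + j))"
      using s by (intro mult_right_mono) auto
    also have "?s * inverse (?s ^ Suc (k + j)) = inverse (?s ^ (k + j))" using s by simp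
    also have "\<dots> \<le> inverse (norm (x - y) ^ (2 * (k + j)))"
      unfolding power_mult using that by (intro le_imp_inverse_le power_mono) auto
    finally show ?thesis using p by (simp add: mult_left_mono)
  qed
  moreover have "((\<lambda>\<epsilon>. of_real (real c * \<epsilon>) * kc (Suc k) \<epsilon> j y x) \<longlongrightarrow> 0) (at_right 0)" if "x \<noteq> y" for x
  proof -
    have "((\<lambda>\<epsilon>. of_real (real c * \<epsilon>) * kc (Suc k) \<epsilon> j y x) \<longlongrightarrow> of_real (real c * 0) * kc (Suc k) 0 j y x) (at_right 0)"
      by (intro tendsto_mult tendsto_of_real tendsto_const tendsto_ident_at kc_tendsto that)
    then show ?thesis by (simp del: of_real_mult)
  qed
  ultimately show ?thesis
    unfolding radial_def using assms
    by (intro exI[of _ "2 * (k + j)"] exI[of _ "real c * ?p"])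
       (auto intro!: borel_measurable_times borel_measurable_const kc_measurable tendsto_mult tendsto_of_real tendsto_const tendsto_ident_at kc_tendsto simp del: of_real_mult)
qed

text \<open>The n-th power of the nilpotent norm contains every odd difference, so any further one
  annihilates it.\<close>

lemma zs_nil_norm:
  assumes "j \<in> {1..n}"
  shows "emb (zs (theta n) j) * v * nil_norm n ^ n = (0 :: 'm::finite cgrass)" "emb (zs_conj (theta n) j) * v * nil_norm n ^ n = 0"
proof -
  have b: "berezin_top n * et n i = (0 :: 'm cgrass)" if "i \<in> {1..2 * n}" for i
    unfolding berezin_top_def using that by (intro et_prod_mult_member) auto
  have b': "berezin_top n * et n (2 * j - Suc 0) = (0 :: 'm cgrass)" "berezin_top n * et n (2 * j) = (0 :: 'm cgrass)"
    using assms by (intro b; auto)+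
  have "berezin_top n * emb (zs (theta n) j) = (0 :: 'm cgrass)" "berezin_top n * emb (zs_conj (theta n) j) = (0 :: 'm cgrass)"
    using assms by (simp_all add: emb_zs emb_zs_conj distrib_left right_diff_distrib scal_left_commute[of "berezin_top n"] b')
  then have "nil_norm n ^ n * emb (zs (theta n) j) = (0 :: 'm cgrass)" "nil_norm n ^ n * emb (zs_conj (theta n) j) = (0 :: 'm cgrass)"
    by (simp_all add: nil_norm_power mult.assoc)
  then show "emb (zs (theta n) j) * v * nil_norm n ^ n = (0 :: 'm cgrass)" "emb (zs_conj (theta n) j) * v * nil_norm n ^ n = 0"
    by (simp_all only: power_central[OF nil_norm_commute, symmetric] mult.assoc[symmetric] mult_zero_left)
qed

text \<open>Each even coordinate softens the singularity through \<open>radial_linear_kc\<close>.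
  The odd part w has no such factor, but its product with the n-th power of the nilpotent norm is
  zero, so the most singular term is absent and the remaining ones are locally integrable.\<close>

lemma dec_radial_vector_taylor:
  fixes y :: "'m::finite pt" and v :: "'m \<Rightarrow> 'm cgrass"
  assumes n: "n < CARD('m)" and h: "\<And>l. bounded_linear (h l)" and o: "w * nil_norm n ^ n = 0"
  shows "dec (radial y) U (\<lambda>p. ((\<Sum>l\<in>(UNIV :: 'm set). scal (h l (snd p - y)) * v l) + w) * taylor n (\<lambda>j. kc (CARD('m) - n) (fst p) j y (snd p)) (nil_norm n))"
proof -
  let ?k = "CARD('m) - n"
  let ?c = "\<lambda>p j. kc ?k (fst p) j y (snd p)" and ?N = "nil_norm n :: 'm cgrass"
  have d: "dec (radial y) U (\<lambda>p. (\<Sum>l\<in>(UNIV :: 'm set). \<Sum>j\<le>n. scal (h l (snd p - y) * ?c p j) * (scal (1 / fact j) * (v l * ?N ^ j))) +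
      (\<Sum>j<n. scal (?c p j) * (scal (1 / fact j) * (w * ?N ^ j))))"
    using n by (intro dec_add dec_sum dec_scal radial_linear_kc radial_kc h) auto
  show ?thesis
  proof (rule dec_cong[OF d])
    fix p
    have 1: "(scal a * u) * (scal (c / f) * M) = scal (a * c) * (scal (1 / f) * (u * M))" for a c f :: complex and u M :: "'m cgrass"
    proof -
      have "c / f = c * (1 / f)" by simp
      then show ?thesis by (simp only: scal_hom(2) mult.assoc scal_left_commute[of u])
    qed
    have 2: "w * (scal (c / f) * M) = scal c * (scal (1 / f) * (w * M))" for c f :: complex and M :: "'m cgrass"
      using 1[of 1 w c f M] by (simp add: scal_hom)
    have "w * taylor n (?c p) ?N = (\<Sum>j\<le>n. scal (?c p j) * (scal (1 / fact j) * (w * ?N ^ j)))"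
      unfolding taylor_def sum_distrib_left 2 ..
    also have "\<dots> = (\<Sum>j<n. scal (?c p j) * (scal (1 / fact j) * (w * ?N ^ j)))"
      unfolding lessThan_Suc_atMost[symmetric] sum.lessThan_Suc by (simp only: o mult_zero_right add_0_right)
    finally have 3: "w * taylor n (?c p) ?N = (\<Sum>j<n. scal (?c p j) * (scal (1 / fact j) * (w * ?N ^ j)))" .
    have 4: "(\<Sum>l\<in>(UNIV :: 'm set). scal (h l (snd p - y)) * v l) * taylor n (?c p) ?N =
        (\<Sum>l\<in>(UNIV :: 'm set). \<Sum>j\<le>n. scal (h l (snd p - y) * ?c p j) * (scal (1 / fact j) * (v l * ?N ^ j)))"
      unfolding taylor_def sum_distrib_right unfolding sum_distrib_left 1 ..
    show "((\<Sum>l\<in>(UNIV :: 'm set). scal (h l (snd p - y)) * v l) + w) * taylor n (?c p) ?N =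
      (\<Sum>l\<in>(UNIV :: 'm set). \<Sum>j\<le>n. scal (h l (snd p - y) * ?c p j) * (scal (1 / fact j) * (v l * ?N ^ j))) +
      (\<Sum>j<n. scal (?c p j) * (scal (1 / fact j) * (w * ?N ^ j)))"
      by (simp only: distrib_right 3 4)
  qed
qed

lemma dec_radial_kernel:
  fixes y :: "'m::finite pt"
  assumes n: "n < CARD('m)"
  shows "dec (radial y) U (\<lambda>p. kp n (fst p) y (snd p))" "dec (radial y) U (\<lambda>p. kd n (fst p) y (snd p))"
proof -
  have z: "(\<Sum>j=1..n. emb (zs (theta n) j) * fs j) * nil_norm n ^ n = (0 :: 'm cgrass)"
    "(\<Sum>j=1..n. emb (zs_conj (theta n) j) * fs_dag j) * nil_norm n ^ n = (0 :: 'm cgrass)"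
    unfolding sum_distrib_right by (intro sum.neutral ballI zs_nil_norm; assumption)+
  show "dec (radial y) U (\<lambda>p. kp n (fst p) y (snd p))" "dec (radial y) U (\<lambda>p. kd n (fst p) y (snd p))"
    unfolding kp_def kd_def ZZ_def ZZ_dag_def
    by (intro dec_radial_vector_taylor n bounded_linear_zc bounded_linear_cnj_zc z)+
qed

lemma gint_approximate_identity:
  fixes \<Phi> :: "'m::finite pt \<Rightarrow> 'm cgrass"
  assumes L: "glinear L"
  shows "dec test_fun UNIV \<Phi> \<Longrightarrow>
    (\<forall>\<epsilon>>0. dec (integrable lborel) UNIV (\<lambda>x. L (scal (of_real \<epsilon> * kc (Suc CARD('m)) \<epsilon> 0 a x) * \<Phi> x))) \<and>
    vlim (\<lambda>\<epsilon>. gint (\<lambda>x. L (scal (of_real \<epsilon> * kc (Suc CARD('m)) \<epsilon> 0 a x) * \<Phi> x))) (scal (of_real (pi ^ CARD('m) / fact CARD('m))) * L (\<Phi> a))"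
proof (induction rule: dec.induct)
  case (base \<phi> F v)
  let ?d = "\<lambda>\<epsilon> x. of_real \<epsilon> * kc (Suc CARD('m)) \<epsilon> 0 a x"
  have e: "L (scal (?d \<epsilon> x) * F x) = scal (?d \<epsilon> x * \<phi> x) * L v" for \<epsilon> x
    by (simp only: base(2)[OF UNIV_I] scal_hom(2) glinearD(2)[OF L] mult.assoc)
  have i: "integrable lborel (\<lambda>x. ?d \<epsilon> x * \<phi> x)" if "\<epsilon> > 0" for \<epsilon>
    by (intro test_fun_integrable test_fun_mult base(1) smooth_on_mult smooth_on_const smooth_kc_pos that open_UNIV)
  have d: "?d \<epsilon> x = of_real (\<epsilon> * inverse (((norm (x - a))\<^sup>2 + \<epsilon>) ^ Suc CARD('m)))" for \<epsilon> x
    by (simp add: kc_def rk_def del: power_Suc)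
  have "((\<lambda>\<epsilon>. \<integral>x. ?d \<epsilon> x * \<phi> x \<partial>lborel) \<longlongrightarrow> of_real (pi ^ CARD('m) / fact CARD('m)) * \<phi> a) (at_right 0)"
    unfolding d by (rule approximate_identity[OF _ base(1)]) simp
  from vlim_scal[OF this, of "L v"]
  have "vlim (\<lambda>\<epsilon>. gint (\<lambda>x. L (scal (?d \<epsilon> x) * F x))) (scal (of_real (pi ^ CARD('m) / fact CARD('m)) * \<phi> a) * L v)"
    unfolding e by (rule vlim_cong_pos) (simp only: gint_scal i)
  moreover have "scal (of_real (pi ^ CARD('m) / fact CARD('m)) * \<phi> a) * L v = scal (of_real (pi ^ CARD('m) / fact CARD('m))) * L (F a)"
    by (simp only: base(2)[OF UNIV_I] glinearD(2)[OF L] scal_hom(2) mult.assoc)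
  moreover have "dec (integrable lborel) UNIV (\<lambda>x. scal (?d \<epsilon> x * \<phi> x) * L v)" if "\<epsilon> > 0" for \<epsilon>
    by (rule dec.base[of "integrable lborel" "\<lambda>x. ?d \<epsilon> x * \<phi> x"], rule i[OF that], rule HOL.refl)
  ultimately show ?case unfolding e by simp
next
  case (zero F)
  then show ?case by (auto simp: glinearD(3)[OF L] gint_0 vlim_const intro: dec.zero)
next
  case (plus F G H)
  let ?d = "\<lambda>\<epsilon> x. of_real \<epsilon> * kc (Suc CARD('m)) \<epsilon> 0 a x"
  have e: "L (scal (?d \<epsilon> x) * H x) = L (scal (?d \<epsilon> x) * F x) + L (scal (?d \<epsilon> x) * G x)" for \<epsilon> x
    by (simp only: plus.hyps(3)[OF UNIV_I] distrib_left glinearD(1)[OF L])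
  have i: "dec (integrable lborel) UNIV (\<lambda>x. L (scal (?d \<epsilon> x) * F x))" "dec (integrable lborel) UNIV (\<lambda>x. L (scal (?d \<epsilon> x) * G x))" if "\<epsilon> > 0" for \<epsilon>
    using plus.IH that by blast+
  have "vlim (\<lambda>\<epsilon>. gint (\<lambda>x. L (scal (?d \<epsilon> x) * F x)) + gint (\<lambda>x. L (scal (?d \<epsilon> x) * G x)))
    (scal (of_real (pi ^ CARD('m) / fact CARD('m))) * L (F a) + scal (of_real (pi ^ CARD('m) / fact CARD('m))) * L (G a))"
    using plus.IH by (intro vlim_add) blast+
  then have "vlim (\<lambda>\<epsilon>. gint (\<lambda>x. L (scal (?d \<epsilon> x) * H x))) (scal (of_real (pi ^ CARD('m) / fact CARD('m))) * L (H a))"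
    unfolding e by (simp only: plus.hyps(3)[OF UNIV_I] glinearD(1)[OF L] distrib_left) (erule vlim_cong_pos, simp only: gint_add i)
  moreover have "dec (integrable lborel) UNIV (\<lambda>x. L (scal (?d \<epsilon> x) * F x) + L (scal (?d \<epsilon> x) * G x))" if "\<epsilon> > 0" for \<epsilon>
    by (intro dec_add i that)
  ultimately show ?case unfolding e by blast
qed

text \<open>With k = m - n the kernel constant is (k - 1)! divided by \<open>pi ^ k\<close>.
  Multiplying (k - 1)! by k and by the rising product (k + 1) ... (k + n) gives m!, which cancels
  against the mass of the approximate identity and leaves \<open>pi ^ (m - k)\<close>.\<close>

lemma kernel_const_eq:
  assumes "n < CARD('m)"
  shows "kernel_const (y :: 'm::finite pt) n * (of_real (real (CARD('m) - n) * pochhammer (real (Suc (CARD('m) - n))) n * (pi ^ CARD('m) / fact CARD('m)))) = of_real pi ^ n"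
proof -
  define k where "k = CARD('m) - n"
  have k: "0 < k" "CARD('m) = k + n" using assms by (auto simp: k_def)
  have M: "(2 * real CARD('m) - 2 * real n) / 2 = real k" using k by simp
  have "fact (k - 1) * real k = (fact k :: real)" using fact_reduce[OF k(1), where 'a = real] by (simp add: mult.commute)
  moreover have "fact k * pochhammer (real (Suc k)) n = (fact (k + n) :: real)"
    using pochhammer_product'[of "1::real" k n] by (simp add: pochhammer_fact add.commute)
  ultimately have f: "fact (k - 1) * (real k * pochhammer (real (Suc k)) n) = (fact (k + n) :: real)"
    by (simp add: mult.assoc[symmetric])
  have "Gamma (real k) = fact (k - 1)" using Gamma_fact[of "k - 1", where 'a = real] k by (simp add: of_nat_diff)
  then have "2 / sphere_area CARD('m) n = fact (k - 1) / pi ^ k"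
    unfolding sphere_area_def Let_def M by (simp add: powr_realpow)
  then have "(2 / sphere_area CARD('m) n) * (real k * pochhammer (real (Suc k)) n * (pi ^ (k + n) / fact (k + n))) =
      (fact (k - 1) * (real k * pochhammer (real (Suc k)) n)) / fact (k + n) * (pi ^ (k + n) / pi ^ k)"
    by (simp only: times_divide_eq_right times_divide_eq_left mult_ac)
  also have "\<dots> = pi ^ n" unfolding f by (simp add: power_add)
  finally have "(2 / sphere_area CARD('m) n) * (real k * pochhammer (real (Suc k)) n * (pi ^ (k + n) / fact (k + n))) = pi ^ n" .
  then show ?thesis
    unfolding kernel_const_def k(2)[symmetric] k_def[symmetric] of_real_mult[symmetric] of_real_power[symmetric] by (simp only:)
qed

lemma glinear_pd_zs: "glinear (pd_zs j)" "glinear (pd_zsc j)"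
  unfolding glinear_def pd_zs_def pd_zsc_def gpartial_linear
  by (simp_all only: distrib_left right_diff_distrib scal_left_commute[of "scal c" for c]) (simp_all add: algebra_simps)

lemma dec_dirac_test:
  assumes "dec test_fun UNIV \<Phi>"
  shows "dec test_fun UNIV (dirac n \<Phi>)" "dec test_fun UNIV (dirac_dag n \<Phi>)"
  unfolding dirac_def[abs_def] dirac_dag_def[abs_def]
  by (intro dec_add dec_diff dec_sum dec_glinear[OF _ glinear_mult(2)] dec_glinear[OF _ glinear_pd_zs(1)] dec_glinear[OF _ glinear_pd_zs(2)] dec_pd_z_test assms)+

text \<open>The Taylor expansion is split at degree n. Below n the factor \<epsilon> outweighs the
  singularity and the limit is 0. In degree n the exponent is k + 1 + n = m + 1, which is the
  approximate identity, multiplied by the odd delta function.\<close>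

lemma vlim_source:
  fixes \<Phi> :: "'m::finite pt \<Rightarrow> 'm cgrass"
  assumes n: "n < CARD('m)" and \<Phi>: "dec test_fun UNIV \<Phi>"
  shows "vlim (\<lambda>\<epsilon>. gint (\<lambda>x. berezin n (scal (of_real (real (CARD('m) - n) * \<epsilon>)) * taylor n (\<lambda>j. kc (Suc (CARD('m) - n)) \<epsilon> j y x) (nil_norm n) * \<Phi> x)))
    (scal (of_real (real (CARD('m) - n) * pochhammer (real (Suc (CARD('m) - n))) n * (pi ^ CARD('m) / fact CARD('m)))) * berezin n (berezin_top n * \<Phi> y))"
proof -
  let ?k = "CARD('m) - n" and ?m = "CARD('m)" and ?N = "nil_norm n :: 'm cgrass"
  let ?c = "\<lambda>\<epsilon> j x. of_real (real ?k * \<epsilon>) * kc (Suc ?k) \<epsilon> j y x"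
  define L where "L = (\<lambda>b :: 'm cgrass. berezin n (scal (of_real (real ?k * pochhammer (real (Suc ?k)) n)) * (berezin_top n * b)))"
  have L: "glinear L" unfolding glinear_def L_def
    by (simp only: distrib_left berezin_linear scal_left_commute[of "berezin_top n"] scal_left_commute[of "scal b" for b]) simp
  define K where "K = (\<lambda>p. \<Sum>j<n. scal (?c (fst p) j (snd p)) * (scal (1 / fact j) * ?N ^ j))"
  have "dec (radial y) ({0..} \<times> UNIV) K"
    unfolding K_def using n by (intro dec_sum dec_scal radial_source) auto
  from gcont_radial[OF \<Phi> glinear_berezin[of n] this] have g: "gcont (\<lambda>\<epsilon> x. berezin n (K (\<epsilon>, x) * \<Phi> x))" .
  \<comment> \<open>Every coefficient of K carries the factor \<epsilon>, so the value at \<epsilon>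
    = 0, and with it the limit, is zero.\<close>
  have "K (0, x) = 0" for x by (simp add: K_def scal_hom)
  then have v1: "vlim (\<lambda>\<epsilon>. gint (\<lambda>x. berezin n (K (\<epsilon>, x) * \<Phi> x))) 0"
    and i1: "\<epsilon> > 0 \<Longrightarrow> dec (integrable lborel) UNIV (\<lambda>x. berezin n (K (\<epsilon>, x) * \<Phi> x))" for \<epsilon>
    using g by (auto simp: gcont_def gint_0 glinearD(3)[OF glinear_berezin])
  let ?d = "\<lambda>\<epsilon> x. of_real \<epsilon> * kc (Suc ?m) \<epsilon> 0 y x"
  have v2: "vlim (\<lambda>\<epsilon>. gint (\<lambda>x. L (scal (?d \<epsilon> x) * \<Phi> x))) (scal (of_real (pi ^ ?m / fact ?m)) * L (\<Phi> y))"
    and i2: "\<epsilon> > 0 \<Longrightarrow> dec (integrable lborel) UNIV (\<lambda>x. L (scal (?d \<epsilon> x) * \<Phi> x))" for \<epsilon>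
    using gint_approximate_identity[OF L \<Phi>, of y] by blast+
  have e: "berezin n (scal (of_real (real ?k * \<epsilon>)) * taylor n (\<lambda>j. kc (Suc ?k) \<epsilon> j y x) ?N * \<Phi> x) =
      berezin n (K (\<epsilon>, x) * \<Phi> x) + L (scal (?d \<epsilon> x) * \<Phi> x)" for \<epsilon> x
  proof -
    \<comment> \<open>The sign and the factorial of the n-th power of the nilpotent norm cancel
      those of the Taylor coefficient of order n.\<close>
    have c: "?c \<epsilon> n x / fact n * ((-1) ^ n * fact n) = of_real (real ?k * pochhammer (real (Suc ?k)) n) * ?d \<epsilon> x"
      using n by (simp add: kc_def rk_def mult_ac)
    have "scal (of_real (real ?k * \<epsilon>)) * taylor n (\<lambda>j. kc (Suc ?k) \<epsilon> j y x) ?N = taylor n (\<lambda>j. ?c \<epsilon> j x) ?N"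
      by (rule taylor_linear(2))
    also have "\<dots> = (\<Sum>j<n. scal (?c \<epsilon> j x / fact j) * ?N ^ j) + scal (?c \<epsilon> n x / fact n) * ?N ^ n"
      unfolding taylor_def lessThan_Suc_atMost[symmetric] sum.lessThan_Suc ..
    also have "(\<Sum>j<n. scal (?c \<epsilon> j x / fact j) * ?N ^ j) = K (\<epsilon>, x)"
    proof -
      have d: "scal (a / f) * M = scal a * (scal (1 / f) * M)" for a f :: complex and M :: "'m cgrass"
        unfolding mult.assoc[symmetric] scal_hom(2)[symmetric] by simp
      show ?thesis unfolding K_def fst_conv snd_conv by (rule sum.cong[OF HOL.refl]) (rule d)
    qed
    also have "scal (?c \<epsilon> n x / fact n) * ?N ^ n = scal (of_real (real ?k * pochhammer (real (Suc ?k)) n)) * (berezin_top n * scal (?d \<epsilon> x))"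
    proof -
      have 1: "scal a * (scal b * M) = scal (a * b) * M" "scal (a * b) * M = scal a * (M * scal b)" for a b and M :: "'m cgrass"
        by (simp_all only: scal_hom(2) mult.assoc scal_central[of M])
      show ?thesis unfolding nil_norm_power 1(1) c by (rule 1(2))
    qed
    finally show ?thesis unfolding L_def by (simp only: distrib_right berezin_linear(1) mult.assoc)
  qed
  have "vlim (\<lambda>\<epsilon>. gint (\<lambda>x. berezin n (K (\<epsilon>, x) * \<Phi> x)) + gint (\<lambda>x. L (scal (?d \<epsilon> x) * \<Phi> x))) (0 + scal (of_real (pi ^ ?m / fact ?m)) * L (\<Phi> y))"
    by (rule vlim_add[OF v1 v2])
  then have "vlim (\<lambda>\<epsilon>. gint (\<lambda>x. berezin n (scal (of_real (real ?k * \<epsilon>)) * taylor n (\<lambda>j. kc (Suc ?k) \<epsilon> j y x) ?N * \<Phi> x))) (0 + scal (of_real (pi ^ ?m / fact ?m)) * L (\<Phi> y))"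
    unfolding e by (rule vlim_cong_pos) (simp only: gint_add i1 i2)
  moreover have "scal (of_real (pi ^ ?m / fact ?m)) * L (\<Phi> y) =
     scal (of_real (real ?k * pochhammer (real (Suc ?k)) n * (pi ^ ?m / fact ?m))) * berezin n (berezin_top n * \<Phi> y)"
  proof -
    have 1: "scal a * berezin n (scal b * X) = scal (b * a) * berezin n X" for a b and X :: "'m cgrass"
      by (simp only: berezin_linear(2) scal_hom(2) mult.assoc scal_left_commute[of "scal a" b])
    show ?thesis unfolding L_def 1 by (simp only: of_real_mult)
  qed
  ultimately show ?thesis by simp
qed

text \<open>Integrate by parts against the regularised kernel and let \<open>\<epsilon>\<close> tend to 0.\<close>

lemma kernel_dirac:
  fixes \<Phi> :: "'m::finite pt \<Rightarrow> 'm cgrass"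
  assumes n: "n < CARD('m)" and \<Phi>: "dec test_fun UNIV \<Phi>" and s: "\<And>x A. gcoef (\<Phi> x) A \<noteq> 0 \<Longrightarrow> A \<subseteq> {1..2 * n}"
  shows "gint (\<lambda>x. berezin n (Psi n (x - y) (theta n) * dirac n \<Phi> x)) +
      gint (\<lambda>x. berezin n (Psi_dag n (x - y) (theta n) * dirac_dag n \<Phi> x)) = - at_y n (\<Phi> y)"
    "gint (\<lambda>x. berezin n (Psi_dag n (x - y) (theta n) * dirac n \<Phi> x)) +
      gint (\<lambda>x. berezin n (Psi n (x - y) (theta n) * dirac_dag n \<Phi> x)) = 0"
proof -
  let ?k = "CARD('m) - n" and ?m = "CARD('m)"
  note test = dec_dirac_test[OF \<Phi>]
  have g: "gcont (\<lambda>\<epsilon> x. berezin n (kp n \<epsilon> y x * \<Psi> x))" "gcont (\<lambda>\<epsilon> x. berezin n (kd n \<epsilon> y x * \<Psi> x))" if "dec test_fun UNIV \<Psi>" for \<Psi>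
    using gcont_radial[OF that glinear_berezin[of n] dec_radial_kernel(1)[OF n]] gcont_radial[OF that glinear_berezin[of n] dec_radial_kernel(2)[OF n]]
    by simp_all
  have v: "vlim (\<lambda>\<epsilon>. gint (\<lambda>x. berezin n (kp n \<epsilon> y x * \<Psi> x))) (gint (\<lambda>x. berezin n (kp n 0 y x * \<Psi> x)))"
    "vlim (\<lambda>\<epsilon>. gint (\<lambda>x. berezin n (kd n \<epsilon> y x * \<Psi> x))) (gint (\<lambda>x. berezin n (kd n 0 y x * \<Psi> x)))" if "dec test_fun UNIV \<Psi>" for \<Psi>
    using g[OF that] by (simp_all add: gcont_def)
  have i: "dec (integrable lborel) UNIV (\<lambda>x. berezin n (kp n 0 y x * \<Psi> x))" "dec (integrable lborel) UNIV (\<lambda>x. berezin n (kd n 0 y x * \<Psi> x))" if "dec test_fun UNIV \<Psi>" for \<Psi>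
    using g[OF that] by (simp_all add: gcont_def)
  have sm: "dec (smooth_on UNIV) UNIV (kp n \<epsilon> y)" "dec (smooth_on UNIV) UNIV (kd n \<epsilon> y)" if "\<epsilon> > 0" for \<epsilon>
  proof -
    have "0 < (norm (x - y))\<^sup>2 + \<epsilon>" for x using that by (simp add: add_nonneg_pos)
    then show "dec (smooth_on UNIV) UNIV (kp n \<epsilon> y)" "dec (smooth_on UNIV) UNIV (kd n \<epsilon> y)"
      unfolding kp_def[abs_def] kd_def[abs_def] by (intro dec_smooth_mult dec_ZZ dec_taylor_kc open_UNIV; assumption)+
  qed
  have ri: "dec (integrable lborel) UNIV (\<lambda>x. berezin n (r x * \<Phi> x))" if "dec (smooth_on UNIV) UNIV r" for r
    by (intro dec_glinear[OF _ glinear_berezin] dec_test_integrable dec_smooth_test_mult that \<Phi>)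
  have bp: "gint (\<lambda>x. berezin n (a x * dirac n \<Phi> x)) + gint (\<lambda>x. berezin n (b x * dirac_dag n \<Phi> x)) =
      scal (- 1) * gint (\<lambda>x. berezin n ((right_dirac n a x + right_dirac_dag n b x) * \<Phi> x))"
    if "dec (smooth_on UNIV) UNIV a" "dec (smooth_on UNIV) UNIV b" for a b
  proof -
    have "gint (\<lambda>x. berezin n ((right_dirac n a x + right_dirac_dag n b x) * \<Phi> x)) =
        gint (\<lambda>x. berezin n (right_dirac n a x * \<Phi> x)) + gint (\<lambda>x. berezin n (right_dirac_dag n b x * \<Phi> x))"
      unfolding distrib_right berezin_linear(1) by (intro gint_add ri dec_right_dirac that)
    then show ?thesis unfolding dirac_by_parts[OF that(1) \<Phi>] dirac_by_parts[OF that(2) \<Phi>] by (simp add: scal_hom)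
  qed
  let ?c = "of_real (real ?k * pochhammer (real (Suc ?k)) n * (pi ^ ?m / fact ?m)) :: complex"
  have "vlim (\<lambda>\<epsilon>. gint (\<lambda>x. berezin n (kp n \<epsilon> y x * dirac n \<Phi> x)) + gint (\<lambda>x. berezin n (kd n \<epsilon> y x * dirac_dag n \<Phi> x)))
     (gint (\<lambda>x. berezin n (kp n 0 y x * dirac n \<Phi> x)) + gint (\<lambda>x. berezin n (kd n 0 y x * dirac_dag n \<Phi> x)))"
    by (intro vlim_add v test)
  moreover have "vlim (\<lambda>\<epsilon>. gint (\<lambda>x. berezin n (kp n \<epsilon> y x * dirac n \<Phi> x)) + gint (\<lambda>x. berezin n (kd n \<epsilon> y x * dirac_dag n \<Phi> x)))
     (0 - (scal ?c * berezin n (berezin_top n * \<Phi> y)))"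
    by (rule vlim_cong_pos[OF vlim_diff[OF vlim_const vlim_source[OF n \<Phi>, of y]]])
       (simp only: bp sm right_dirac_kernel(1) n, simp add: scal_hom)
  ultimately have 1: "gint (\<lambda>x. berezin n (kp n 0 y x * dirac n \<Phi> x)) + gint (\<lambda>x. berezin n (kd n 0 y x * dirac_dag n \<Phi> x)) =
     0 - (scal ?c * berezin n (berezin_top n * \<Phi> y))" by (rule vlim_unique)
  have "vlim (\<lambda>\<epsilon>. gint (\<lambda>x. berezin n (kd n \<epsilon> y x * dirac n \<Phi> x)) + gint (\<lambda>x. berezin n (kp n \<epsilon> y x * dirac_dag n \<Phi> x)))
     (gint (\<lambda>x. berezin n (kd n 0 y x * dirac n \<Phi> x)) + gint (\<lambda>x. berezin n (kp n 0 y x * dirac_dag n \<Phi> x)))"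
    by (intro vlim_add v test)
  moreover have "vlim (\<lambda>\<epsilon>. gint (\<lambda>x. berezin n (kd n \<epsilon> y x * dirac n \<Phi> x)) + gint (\<lambda>x. berezin n (kp n \<epsilon> y x * dirac_dag n \<Phi> x))) 0"
    by (rule vlim_cong_pos[OF vlim_const])
       (simp only: bp sm right_dirac_kernel(2) n, simp add: glinearD(3)[OF glinear_berezin] gint_0)
  ultimately have 2: "gint (\<lambda>x. berezin n (kd n 0 y x * dirac n \<Phi> x)) + gint (\<lambda>x. berezin n (kp n 0 y x * dirac_dag n \<Phi> x)) = 0"
    by (rule vlim_unique)
  have P: "gint (\<lambda>x. berezin n (Psi n (x - y) (theta n) * \<Psi> x)) = scal (kernel_const y n) * gint (\<lambda>x. berezin n (kp n 0 y x * \<Psi> x))"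
    "gint (\<lambda>x. berezin n (Psi_dag n (x - y) (theta n) * \<Psi> x)) = scal (kernel_const y n) * gint (\<lambda>x. berezin n (kd n 0 y x * \<Psi> x))"
    if "dec test_fun UNIV \<Psi>" for \<Psi>
    by (simp_all only: Psi_kp[OF n] Psi_dag_kd[OF n] mult.assoc berezin_linear(2) gint_glinear[OF i(1)[OF that] glinear_mult(2)] gint_glinear[OF i(2)[OF that] glinear_mult(2)])
  have "scal (kernel_const y n) * (scal ?c * berezin n (berezin_top n * \<Phi> y)) = scal (of_real pi ^ n) * berezin n (berezin_top n * \<Phi> y)"
    unfolding mult.assoc[symmetric] scal_hom(2)[symmetric] kernel_const_eq[OF n] ..
  \<comment> \<open>The factor \<open>pi ^ n\<close> is exactly the inverse of the normalisation of
    the Berezin integral, and the odd delta function evaluates at the odd coordinates of y.\<close>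
  also have "\<dots> = at_y n (\<Phi> y)"
  proof -
    have "of_real pi ^ n * (1 / of_real pi ^ n) = (1 :: complex)" by simp
    moreover have "fold gpartial [1..<2 * n + 1] (berezin_top n * \<Phi> y) = at_y n (\<Phi> y)"
      by (rule fold_gpartial_berezin_top) (rule s)
    ultimately show ?thesis
      by (simp only: berezin_def mult.assoc[symmetric] scal_hom(2)[symmetric] scal_hom(6) mult_1_left)
  qed
  finally have c: "scal (kernel_const y n) * (scal ?c * berezin n (berezin_top n * \<Phi> y)) = at_y n (\<Phi> y)" .
  show "gint (\<lambda>x. berezin n (Psi n (x - y) (theta n) * dirac n \<Phi> x)) +
      gint (\<lambda>x. berezin n (Psi_dag n (x - y) (theta n) * dirac_dag n \<Phi> x)) = - at_y n (\<Phi> y)"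
    unfolding P[OF test(1)] P[OF test(2)] distrib_left[symmetric] 1 right_diff_distrib c by simp
  show "gint (\<lambda>x. berezin n (Psi_dag n (x - y) (theta n) * dirac n \<Phi> x)) +
      gint (\<lambda>x. berezin n (Psi n (x - y) (theta n) * dirac_dag n \<Phi> x)) = 0"
    unfolding P[OF test(1)] P[OF test(2)] distrib_left[symmetric] 2 by simp
qed

section \<open>Smooth approximations of the Heaviside and delta functions\<close>

definition profile :: "nat \<Rightarrow> real \<Rightarrow> complex" where
  "profile j = (dirderiv 1 ^^ j) (\<lambda>s. complex_of_real (step s))"

lemma smooth_profile: "smooth_on UNIV (profile j)"
  unfolding profile_def by (intro smooth_on_funpow_dirderiv smooth_on_of_real smooth_step open_UNIV)

lemma profile_Suc: "profile (Suc j) = dirderiv 1 (profile j)"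
  by (simp add: profile_def)

text \<open>The derivative \<open>profile 1\<close> of the step is a mollifier; in this form the
  higher profiles are the derivatives that occur in \<open>pullback_delta\<close>.\<close>

lemma profile_Suc': "profile (Suc j) = (dirderiv 1 ^^ j) (profile 1)"
  by (simp add: profile_def funpow_swap1)

lemma profile_off: "s < 0 \<Longrightarrow> profile j s = 0" "s > 1 \<Longrightarrow> profile j s = (if j = 0 then 1 else 0)"
proof -
  have "\<forall>s<0. profile j s = 0"
  proof (induction j)
    case (Suc j)
    show ?case
    proof (intro allI impI)
      fix s :: real assume "s < 0"
      then have "dirderiv 1 (profile j) s = dirderiv 1 (\<lambda>_. 0) s"
        using Suc by (intro dirderiv_cong[of "{..<0}"]) auto
      then show "profile (Suc j) s = 0" by (simp add: profile_Suc dirderiv_eq[OF has_derivative_const])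
    qed
  qed (simp add: profile_def step_0)
  moreover have "\<forall>s>1. profile j s = (if j = 0 then 1 else 0)"
  proof (induction j)
    case (Suc j)
    show ?case
    proof (intro allI impI)
      fix s :: real assume "s > 1"
      then have "dirderiv 1 (profile j) s = dirderiv 1 (\<lambda>_. if j = 0 then 1 else 0) s"
        using Suc by (intro dirderiv_cong[of "{1<..}"]) auto
      then show "profile (Suc j) s = (if Suc j = 0 then 1 else 0)" by (simp add: profile_Suc dirderiv_eq[OF has_derivative_const])
    qed
  qed (simp add: profile_def step_1)
  ultimately show "s < 0 \<Longrightarrow> profile j s = 0" "s > 1 \<Longrightarrow> profile j s = (if j = 0 then 1 else 0)" by blast+
qed

lemma test_profile: "test_fun (profile 1)"
  by (rule test_funI[of _ "{0..1}"]) (auto simp: smooth_profile profile_off not_le)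

lemma integral_profile: "(\<integral>s. profile 1 s \<partial>lborel) = 1"
proof -
  have "(profile 1 has_integral (profile 0 2 - profile 0 (-1))) {-1..2}"
    using smooth_real_has_vector_derivative[OF smooth_profile[of 0]]
    by (intro fundamental_theorem_of_calculus) (auto simp: profile_Suc[of 0, symmetric] intro: has_vector_derivative_at_within)
  then have "integral {-1..2} (profile 1) = 1" by (simp add: profile_off integral_unique)
  moreover have "(\<integral>s. profile 1 s \<partial>lborel) = integral {-1..2} (profile 1)"
    by (rule test_fun_integral_Icc[OF test_profile]) (auto simp: profile_off not_le)
  ultimately show ?thesis by simp
qed

text \<open>For positive \<epsilon> the j-th derivative of t \<mapsto>
  \<open>step (t / \<epsilon>)\<close>. For j > 0 it approximates the (j - 1)-th derivative of the
  delta distribution.\<close>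

definition heavi :: "real \<Rightarrow> nat \<Rightarrow> real \<Rightarrow> complex" where
  "heavi \<epsilon> j t = profile j (t / \<epsilon>) / of_real \<epsilon> ^ j"

lemma smooth_heavi:
  assumes U: "open U" and f: "smooth_on U f"
  shows "smooth_on U (\<lambda>x. heavi \<epsilon> j (f x))"
proof -
  have "smooth_on UNIV (\<lambda>s. profile j ((0 + 1 * s) / \<epsilon>) * inverse (of_real \<epsilon> ^ j))"
    by (rule smooth_on_mult[OF open_UNIV smooth_affine[OF smooth_profile] smooth_on_const])
  then have "smooth_on UNIV (heavi \<epsilon> j)" by (simp add: heavi_def[abs_def] divide_inverse)
  then show ?thesis by (rule smooth_on_compose[OF U open_UNIV UNIV_I _ f])
qed

lemma dirderiv_heavi:
  assumes f: "f differentiable (at x)"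
  shows "dirderiv b (\<lambda>x. heavi \<epsilon> j (f x)) x = heavi \<epsilon> (Suc j) (f x) * of_real (dirderiv b f x)"
proof -
  have "((\<lambda>x. f x / \<epsilon>) has_derivative (\<lambda>v. dirderiv v f x / \<epsilon>)) (at x)"
    by (rule bounded_linear.has_derivative[OF bounded_linear_divide has_derivative_dirderiv[OF f]])
  from has_derivative_compose[OF this smooth_real_has_vector_derivative[OF smooth_profile, unfolded has_vector_derivative_def]]
  have "((\<lambda>x. profile j (f x / \<epsilon>)) has_derivative (\<lambda>v. (dirderiv v f x / \<epsilon>) *\<^sub>R profile (Suc j) (f x / \<epsilon>))) (at x)"
    by (simp only: profile_Suc)
  from bounded_linear.has_derivative[OF bounded_linear_divide this, of "of_real \<epsilon> ^ j"]
  have "((\<lambda>x. heavi \<epsilon> j (f x)) has_derivative (\<lambda>v. (dirderiv v f x / \<epsilon>) *\<^sub>R profile (Suc j) (f x / \<epsilon>) / of_real \<epsilon> ^ j)) (at x)"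
    by (simp only: heavi_def)
  from dirderiv_eq[OF this, of b] show ?thesis by (simp only:) (simp add: heavi_def scaleR_conv_of_real)
qed

lemma heavi_off: "0 < \<epsilon> \<Longrightarrow> t < 0 \<Longrightarrow> heavi \<epsilon> j t = 0" "0 < \<epsilon> \<Longrightarrow> \<epsilon> < t \<Longrightarrow> heavi \<epsilon> j t = (if j = 0 then 1 else 0)"
  by (simp_all add: heavi_def profile_off divide_neg_pos)

section \<open>The distributions of a phase function as limits of functions\<close>

lemma gcoef_one: "gcoef 1 A = (if A = {} then 1 else 0)"
  by (rule fun_cong[OF one_grass.rep_eq, THEN HOL.trans]) simp

lemma gcoef_add: "gcoef (a + b) A = gcoef a A + gcoef b A"
  and gcoef_diff: "gcoef (a - b) A = gcoef a A - gcoef b A"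
  and gcoef_uminus: "gcoef (- a) A = - gcoef a A"
  by (simp_all add: plus_grass.rep_eq minus_grass.rep_eq uminus_grass.rep_eq)

lemma gconst_sum: "gconst (\<Sum>i\<in>I. f i) = (\<Sum>i\<in>I. gconst (f i :: 'a::ring_1))"
  by (induction I rule: infinite_finite_induct) (simp_all add: gconst_0 gconst_add)

text \<open>The signs are those of \<open>sd_mult\<close>. The coefficients of H are scalars, so a
  product with H acts separately on each basis component of K.\<close>

lemma ccoef_scalar_mult:
  fixes K H :: "'m::finite cgrass"
  assumes w: "\<And>A. gcoef H A = cst (w A)"
  shows "ccoef (K * H) C e = (\<Sum>A\<in>Pow C. (-1) ^ inversions A (C - A) * (w (C - A) * ccoef K A e))"
    "ccoef (H * K) C e = (\<Sum>A\<in>Pow C. (-1) ^ inversions A (C - A) * (w A * ccoef K (C - A) e))"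
proof -
  have c: "ccoef a A e = ccoef (gconst (gcoef a A) :: 'm cgrass) {} e" for a :: "'m cgrass" and A
    by (simp add: ccoef_def gcoef_gconst)
  have s: "(-1) ^ k = cst ((-1) ^ k)" for k :: nat by (rule ring_homD(8)[OF ring_hom_cst, symmetric])
  have 1: "(-1) ^ k * a * cst b = cst ((-1) ^ k * b) * a" "(-1) ^ k * cst b * a = cst ((-1) ^ k * b) * a"
    for k :: nat and a :: "('m + 'm) cliff" and b
    by (simp_all only: s cst_mult mult.assoc cst_central[of b a])
  have "ccoef (K * H) C e = ccoef (\<Sum>A\<in>Pow C. scal ((-1) ^ inversions A (C - A) * w (C - A)) * gconst (gcoef K A) :: 'm cgrass) {} e"
    by (subst c) (simp only: gcoef_times w 1 gconst_sum gconst_mult)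
  then show "ccoef (K * H) C e = (\<Sum>A\<in>Pow C. (-1) ^ inversions A (C - A) * (w (C - A) * ccoef K A e))"
    by (simp only: ccoef_sum ccoef_linear c[symmetric] mult.assoc)
  have "ccoef (H * K) C e = ccoef (\<Sum>A\<in>Pow C. scal ((-1) ^ inversions A (C - A) * w A) * gconst (gcoef K (C - A)) :: 'm cgrass) {} e"
    by (subst c) (simp only: gcoef_times w 1 gconst_sum gconst_mult)
  then show "ccoef (H * K) C e = (\<Sum>A\<in>Pow C. (-1) ^ inversions A (C - A) * (w A * ccoef K (C - A) e))"
    by (simp only: ccoef_sum ccoef_linear c[symmetric] mult.assoc)
qed

locale level_set =
  fixes n :: nat and g :: "'m::finite pt \<Rightarrow> real grass"
  assumes phase: "phase_function n g" and compact_sublevel: "compact {x. body (g x) \<le> 0}"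
    and nondegenerate: "\<And>x. body (g x) = 0 \<Longrightarrow> \<exists>i. dirderiv (axis i 1) (\<lambda>x. body (g x)) x \<noteq> 0"
begin

abbreviation "sublevel \<equiv> {x. body (g x) \<le> 0}"
abbreviation "level \<equiv> {x. body (g x) = 0}"

lemma smooth_body: "smooth_on UNIV (\<lambda>x. body (g x))"
  using phase by (simp add: phase_function_def body_def)

lemma smooth_neg_body: "smooth_on UNIV (\<lambda>x. - body (g x))"
  by (intro smooth_on_minus smooth_body open_UNIV)

lemma continuous_body: "continuous_on S (\<lambda>x. body (g x))"
  using smooth_on_continuous[OF smooth_body] continuous_on_subset by blast

lemma closed_level: "closed level"
  by (intro closed_Collect_eq continuous_body continuous_on_const)

lemma smooth_heavi_body: "smooth_on UNIV (\<lambda>x. heavi \<epsilon> j (- body (g x)))"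
  by (intro smooth_heavi smooth_neg_body open_UNIV)

lemma integrable_heavi: "test_fun \<phi> \<Longrightarrow> integrable lborel (\<lambda>x. heavi \<epsilon> j (- body (g x)) * \<phi> x)"
  by (intro test_fun_integrable test_fun_mult smooth_heavi_body)

text \<open>Both approximations are functions of the negative body, so that they vanish where the
  body is positive. For the pullback by the body itself this is possible because the mollifier is
  free: a reflected one is used.\<close>

lemma approx_pullback:
  "approx sublevel (\<lambda>\<epsilon> x. (-1) ^ j * heavi \<epsilon> (Suc j) (- body (g x))) (pullback (delta j) (\<lambda>x. body (g x)))" (is ?A)
  "approx sublevel (\<lambda>\<epsilon> x. heavi \<epsilon> (Suc j) (- body (g x))) (pullback (delta j) (\<lambda>x. - body (g x)))" (is ?B)
proof -
  have nd: "\<exists>b\<in>Basis. dirderiv b (\<lambda>x. body (g x)) x \<noteq> 0" if "body (g x) = 0" for x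
    using nondegenerate[OF that] axis_Basis by blast
  have "dirderiv b (\<lambda>x. - body (g x)) x = - dirderiv b (\<lambda>x. body (g x)) x" for b x
    using has_derivative_minus[OF has_derivative_dirderiv[OF smooth_on_differentiable[OF smooth_body UNIV_I]]]
    by (rule dirderiv_eq)
  then have nd': "\<exists>b\<in>Basis. dirderiv b (\<lambda>x. - body (g x)) x \<noteq> 0" if "- body (g x) = 0" for x
    using nd[of x] that by simp
  \<comment> \<open>The reflected mollifier is written in the affine shape of
    \<open>funpow_dirderiv_affine\<close>; each derivative then yields one factor -1.\<close>
  let ?\<rho> = "\<lambda>s. 1 * profile 1 ((0 + (- 1) * s) / 1)"
  have t: "test_fun ?\<rho>"
  proof (rule test_funI[of _ "{-1..0}"])
    show "smooth_on UNIV ?\<rho>" using smooth_affine[OF smooth_profile, of 1 0 "- 1" 1] by simp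
  qed (auto simp: profile_off not_le)
  have i: "(\<integral>s. ?\<rho> s \<partial>lborel) = 1"
    using lborel_integral_real_affine[of "- 1" "profile 1" 0] integral_profile by simp
  have r: "(dirderiv 1 ^^ j) ?\<rho> s = (-1) ^ j * profile (Suc j) (- s)" for s
    by (subst funpow_dirderiv_affine[OF smooth_profile]) (simp add: profile_Suc'[of j])
  show ?A unfolding approx_def
  proof (intro conjI allI impI)
    fix \<phi> :: "'m pt \<Rightarrow> complex" assume \<phi>: "test_fun \<phi>"
    show "\<forall>\<^sub>F \<epsilon> in at_right 0. integrable lborel (\<lambda>x. (-1) ^ j * heavi \<epsilon> (Suc j) (- body (g x)) * \<phi> x)"
      using integrable_mult_right[OF integrable_heavi[OF \<phi>], of "(-1) ^ j"] by (intro always_eventually) (simp add: mult.assoc)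
    show "((\<lambda>\<epsilon>. \<integral>x. (-1) ^ j * heavi \<epsilon> (Suc j) (- body (g x)) * \<phi> x \<partial>lborel) \<longlongrightarrow> pullback (delta j) (\<lambda>x. body (g x)) \<phi>) (at_right 0)"
      using pullback_delta[OF smooth_body nd \<phi> t i, of j] unfolding r by (simp add: heavi_def)
  qed (simp add: heavi_off)
  show ?B unfolding approx_def
  proof (intro conjI allI impI)
    fix \<phi> :: "'m pt \<Rightarrow> complex" assume \<phi>: "test_fun \<phi>"
    show "\<forall>\<^sub>F \<epsilon> in at_right 0. integrable lborel (\<lambda>x. heavi \<epsilon> (Suc j) (- body (g x)) * \<phi> x)"
      using integrable_heavi[OF \<phi>] by (intro always_eventually) simp
    show "((\<lambda>\<epsilon>. \<integral>x. heavi \<epsilon> (Suc j) (- body (g x)) * \<phi> x \<partial>lborel) \<longlongrightarrow> pullback (delta j) (\<lambda>x. - body (g x)) \<phi>) (at_right 0)"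
      using pullback_delta[OF smooth_neg_body nd' \<phi> test_profile integral_profile, of j]
      by (simp only: heavi_def profile_Suc'[of j])
  qed (simp add: heavi_off)
qed

lemma approx_sublevel_indicator:
  "approx sublevel (\<lambda>\<epsilon> x. heavi \<epsilon> 0 (- body (g x))) (regular (\<lambda>x. if body (g x) < 0 then 1 else 0))"
  unfolding approx_def
proof (intro conjI allI impI)
  fix \<phi> :: "'m pt \<Rightarrow> complex" assume \<phi>: "test_fun \<phi>"
  show "\<forall>\<^sub>F \<epsilon> in at_right 0. integrable lborel (\<lambda>x. heavi \<epsilon> 0 (- body (g x)) * \<phi> x)"
    using integrable_heavi[OF \<phi>] by (intro always_eventually) simp
  have n: "norm (heavi \<epsilon> 0 t) \<le> 1" for \<epsilon> t using step_bounds[of "t / \<epsilon>"] by (simp add: heavi_def profile_def)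
  show "((\<lambda>\<epsilon>. \<integral>x. heavi \<epsilon> 0 (- body (g x)) * \<phi> x \<partial>lborel) \<longlongrightarrow> regular (\<lambda>x. if body (g x) < 0 then 1 else 0) \<phi>) (at_right 0)"
    unfolding regular_def
  proof (rule tendsto_at_right_dominated[where a = 0])
    show "integrable lborel (\<lambda>x. norm (\<phi> x))" using test_fun_integrable[OF \<phi>] by simp
    show "(\<lambda>x. heavi \<epsilon> 0 (- body (g x)) * \<phi> x) \<in> borel_measurable borel" for \<epsilon>
      using borel_measurable_integrable[OF integrable_heavi[OF \<phi>]] by simp
    have "\<phi> \<in> borel_measurable borel" using borel_measurable_integrable[OF test_fun_integrable[OF \<phi>]] by simp
    moreover have "{x. body (g x) < 0} \<in> sets borel"
      by (intro borel_open open_Collect_less continuous_body continuous_on_const)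
    ultimately show "(\<lambda>x. (if body (g x) < 0 then 1 else 0) * \<phi> x) \<in> borel_measurable borel"
      by (intro borel_measurable_times measurable_If) (auto simp: pred_def)
    show "norm (heavi \<epsilon> 0 (- body (g x)) * \<phi> x) \<le> norm (\<phi> x)" for \<epsilon> x
      using mult_right_mono[OF n, of "norm (\<phi> x)"] by (simp add: norm_mult)
    show "((\<lambda>\<epsilon>. heavi \<epsilon> 0 (- body (g x)) * \<phi> x) \<longlongrightarrow> (if body (g x) < 0 then 1 else 0) * \<phi> x) (at_right 0)" for x
    proof (rule tendsto_eventually, cases "body (g x) < 0")
      case True
      have "\<forall>\<^sub>F \<epsilon> in at_right 0. 0 < \<epsilon> \<and> \<epsilon> < - body (g x)"
        using True unfolding eventually_at_right_field by (intro exI[of _ "- body (g x)"]) auto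
      then show "\<forall>\<^sub>F \<epsilon> in at_right 0. heavi \<epsilon> 0 (- body (g x)) * \<phi> x = (if body (g x) < 0 then 1 else 0) * \<phi> x"
        by eventually_elim (simp add: heavi_off True)
    next
      case False
      show "\<forall>\<^sub>F \<epsilon> in at_right 0. heavi \<epsilon> 0 (- body (g x)) * \<phi> x = (if body (g x) < 0 then 1 else 0) * \<phi> x"
        using eventually_right_pos by eventually_elim (use False in \<open>simp add: heavi_def profile_def step_0\<close>)
    qed
  qed
qed (simp add: heavi_off)

text \<open>The components of the \<open>s\<close>-th derivative of the smoothed \<open>H(-g)\<close>.\<close>

definition wt :: "nat \<Rightarrow> real \<Rightarrow> nat set \<Rightarrow> 'm pt \<Rightarrow> complex" where
  "wt s \<epsilon> A x = (\<Sum>j\<le>n. heavi \<epsilon> (s + j) (- body (g x)) * complex_of_real (gcoef ((- nilpart (g x)) ^ j) A / fact j))"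

definition wlim :: "nat \<Rightarrow> nat set \<Rightarrow> 'm pt \<Rightarrow> complex" where
  "wlim s A x = (if s = 0 \<and> A = {} \<and> body (g x) < 0 then 1 else 0)"

lemma smooth_gcoef_nilpart: "smooth_on UNIV (\<lambda>x. gcoef ((- nilpart (g x)) ^ j) A)"
proof (induction j arbitrary: A)
  case 0
  then show ?case by (simp add: gcoef_one smooth_on_const)
next
  case (Suc j)
  have "smooth_on UNIV (\<lambda>x. gcoef (g x) A)" for A using phase by (simp add: phase_function_def)
  then have "smooth_on UNIV (\<lambda>x. gcoef (- nilpart (g x)) A)" for A
    by (cases "A = {}") (simp_all add: nilpart_def gcoef_uminus gcoef_diff gcoef_gconst body_def smooth_on_const smooth_on_minus)
  then show ?case
    unfolding power_Suc gcoef_times by (intro smooth_on_sum smooth_on_mult smooth_on_const Suc open_UNIV)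
qed

text \<open>In the approximants of \<delta>(g) the sign \<open>(-1) ^ j\<close> from the reflected
  derivatives of delta is absorbed by the powers of the negated nilpotent part. For H(-g) the
  summands with j > 0 involve delta derivatives of order j - 1, and the indicator enters only
  through the empty monomial.\<close>

lemma approx_wt:
  "approx sublevel (\<lambda>\<epsilon>. wt 1 \<epsilon> A) (super_delta n g A)"
  "approx sublevel (\<lambda>\<epsilon>. wt 0 \<epsilon> A) (super_heaviside_neg n g A)"
proof -
  have sm: "smooth_on UNIV (\<lambda>x. complex_of_real (gcoef ((- nilpart (g x)) ^ j) A / fact j))" for j
    unfolding divide_inverse by (intro smooth_on_of_real smooth_on_mult smooth_gcoef_nilpart smooth_on_const open_UNIV)
  have p: "gcoef ((- a) ^ j) A = (-1) ^ j * gcoef (a ^ j) A" for a :: "real grass" and j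
    by (cases "even j") (simp_all add: gcoef_uminus)
  have sm': "smooth_on UNIV (\<lambda>x. complex_of_real (gcoef (nilpart (g x) ^ j) A / fact j))" for j
  proof -
    have "smooth_on UNIV (\<lambda>x. (-1) ^ j * complex_of_real (gcoef ((- nilpart (g x)) ^ j) A / fact j))"
      by (intro smooth_on_mult smooth_on_const sm open_UNIV)
    moreover have "(-1) ^ j * complex_of_real ((-1) ^ j * a / fact j) = complex_of_real (a / fact j)" for a
      by (cases "even j") simp_all
    ultimately show ?thesis by (simp only: p)
  qed
  have d: "approx sublevel (\<lambda>\<epsilon> x. \<Sum>j\<in>{..n}. 1 * ((-1) ^ j * heavi \<epsilon> (Suc j) (- body (g x)) * complex_of_real (gcoef (nilpart (g x) ^ j) A / fact j)))
      (\<lambda>\<phi>. \<Sum>j\<in>{..n}. 1 * pullback (delta j) (\<lambda>x. body (g x)) (\<lambda>x. complex_of_real (gcoef (nilpart (g x) ^ j) A / fact j) * \<phi> x))"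
    by (rule approx_sum) (rule approx_smooth_mult[OF approx_pullback(1) sm'])
  have "wt 1 \<epsilon> A = (\<lambda>x. \<Sum>j\<in>{..n}. 1 * ((-1) ^ j * heavi \<epsilon> (Suc j) (- body (g x)) * complex_of_real (gcoef (nilpart (g x) ^ j) A / fact j)))" for \<epsilon>
    by (auto simp: wt_def p fun_eq_iff intro!: sum.cong)
  moreover have "super_delta n g A = (\<lambda>\<phi>. \<Sum>j\<in>{..n}. 1 * pullback (delta j) (\<lambda>x. body (g x)) (\<lambda>x. complex_of_real (gcoef (nilpart (g x) ^ j) A / fact j) * \<phi> x))"
    by (simp only: super_delta_def[abs_def] mult_1_left)
  ultimately show "approx sublevel (\<lambda>\<epsilon>. wt 1 \<epsilon> A) (super_delta n g A)" using d by (simp only:)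
  let ?h = "\<lambda>j x. complex_of_real (gcoef ((- nilpart (g x)) ^ j) A / fact j)"
  have h: "approx sublevel (\<lambda>\<epsilon> x. \<Sum>j\<in>{1..n}. 1 * (heavi \<epsilon> j (- body (g x)) * ?h j x))
      (\<lambda>\<phi>. \<Sum>j\<in>{1..n}. 1 * pullback (delta (j - 1)) (\<lambda>x. - body (g x)) (\<lambda>x. ?h j x * \<phi> x))"
  proof (rule approx_sum)
    fix j assume "j \<in> {1..n}"
    then have "Suc (j - 1) = j" by simp
    with approx_smooth_mult[OF approx_pullback(2)[of "j - 1"] sm[of j]]
    show "approx sublevel (\<lambda>\<epsilon> x. heavi \<epsilon> j (- body (g x)) * ?h j x) (\<lambda>\<phi>. pullback (delta (j - 1)) (\<lambda>x. - body (g x)) (\<lambda>x. ?h j x * \<phi> x))"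
      by (simp only:)
  qed
  from approx_add_cmult[OF h approx_sublevel_indicator, of "if A = {} then 1 else 0"]
  have a: "approx sublevel (\<lambda>\<epsilon> x. (\<Sum>j\<in>{1..n}. 1 * (heavi \<epsilon> j (- body (g x)) * ?h j x)) + (if A = {} then 1 else 0) * heavi \<epsilon> 0 (- body (g x)))
    (\<lambda>\<phi>. (\<Sum>j\<in>{1..n}. 1 * pullback (delta (j - 1)) (\<lambda>x. - body (g x)) (\<lambda>x. ?h j x * \<phi> x)) + (if A = {} then 1 else 0) * regular (\<lambda>x. if body (g x) < 0 then 1 else 0) \<phi>)" .
  have "wt 0 \<epsilon> A = (\<lambda>x. (\<Sum>j\<in>{1..n}. 1 * (heavi \<epsilon> j (- body (g x)) * ?h j x)) + (if A = {} then 1 else 0) * heavi \<epsilon> 0 (- body (g x)))" for \<epsilon>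
  proof
    fix x
    have "{..n} = insert 0 {1..n}" by auto
    then show "wt 0 \<epsilon> A x = (\<Sum>j\<in>{1..n}. 1 * (heavi \<epsilon> j (- body (g x)) * ?h j x)) + (if A = {} then 1 else 0) * heavi \<epsilon> 0 (- body (g x))"
      by (simp add: wt_def gcoef_one)
  qed
  moreover have "super_heaviside_neg n g A = (\<lambda>\<phi>. (\<Sum>j\<in>{1..n}. 1 * pullback (delta (j - 1)) (\<lambda>x. - body (g x)) (\<lambda>x. ?h j x * \<phi> x)) + (if A = {} then 1 else 0) * regular (\<lambda>x. if body (g x) < 0 then 1 else 0) \<phi>)"
    by (rule ext) (simp add: super_heaviside_neg_def)
  ultimately show "approx sublevel (\<lambda>\<epsilon>. wt 0 \<epsilon> A) (super_heaviside_neg n g A)" using a by (simp only:)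
qed

lemma wt_eq_wlim:
  assumes "0 < \<epsilon>" "\<epsilon> < \<bar>body (g x)\<bar>"
  shows "wt s \<epsilon> A x = wlim s A x"
proof (cases "body (g x) < 0")
  case True
  then have "heavi \<epsilon> k (- body (g x)) = (if k = 0 then 1 else 0)" for k
    using assms by (intro heavi_off) auto
  then have "wt s \<epsilon> A x = (\<Sum>j\<le>n. if j = 0 then (if s = 0 then complex_of_real (gcoef 1 A) else 0) else 0)"
    unfolding wt_def by (intro sum.cong) auto
  then show ?thesis using True by (simp add: wlim_def gcoef_one)
next
  case False
  then show ?thesis using assms by (simp add: wt_def wlim_def heavi_off)
qed

lemma wt_off: "0 < \<epsilon> \<Longrightarrow> x \<notin> sublevel \<Longrightarrow> wt s \<epsilon> A x = 0"
  by (simp add: wt_def heavi_off)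

text \<open>On a compact support away from the level set the body is bounded away from 0, and for
  small \<epsilon> the approximants coincide with their limit there.\<close>

lemma represents_wlim:
  assumes a: "approx sublevel (\<lambda>\<epsilon>. wt s \<epsilon> A) v"
  shows "represents (- level) (wlim s A) v"
  unfolding represents_def
proof (intro conjI allI impI)
  let ?N = "{x. body (g x) < 0}" and ?P = "{x. 0 < body (g x)}"
  have o: "open ?N" "open ?P" by (intro open_Collect_less continuous_body continuous_on_const)+
  have "smooth_on ?N (wlim s A)"
    by (rule smooth_on_cong[OF o(1) _ smooth_on_const[of _ "if s = 0 \<and> A = {} then 1 else 0"]]) (simp add: wlim_def)
  moreover have "smooth_on ?P (wlim s A)"
    by (rule smooth_on_cong[OF o(2) _ smooth_on_const[of _ 0]]) (simp add: wlim_def)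
  ultimately have "smooth_on (?N \<union> ?P) (wlim s A)" by (rule smooth_on_Un)
  moreover have "?N \<union> ?P = - level" by auto
  ultimately show "smooth_on (- level) (wlim s A)" by simp
  fix \<phi> :: "'m pt \<Rightarrow> complex" assume \<phi>: "test_fun \<phi> \<and> fsupp \<phi> \<subseteq> - level"
  have "\<exists>d>0. \<forall>x\<in>fsupp \<phi>. d \<le> \<bar>body (g x)\<bar>"
  proof (cases "fsupp \<phi> = {}")
    case True
    then show ?thesis by (auto intro: exI[of _ 1])
  next
    case False
    have "continuous_on (fsupp \<phi>) (\<lambda>x. \<bar>body (g x)\<bar>)" by (intro continuous_on_rabs continuous_body)
    then obtain x where "x \<in> fsupp \<phi>" "\<forall>z\<in>fsupp \<phi>. \<bar>body (g x)\<bar> \<le> \<bar>body (g z)\<bar>"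
      using continuous_attains_inf[of "fsupp \<phi>" "\<lambda>x. \<bar>body (g x)\<bar>"] \<phi> False unfolding test_fun_def by blast
    then show ?thesis using \<phi> by (intro exI[of _ "\<bar>body (g x)\<bar>"]) auto
  qed
  then obtain d where d: "d > 0" "\<And>x. x \<in> fsupp \<phi> \<Longrightarrow> d \<le> \<bar>body (g x)\<bar>" by blast
  have "\<forall>\<^sub>F \<epsilon> in at_right 0. \<epsilon> < d" using d(1) unfolding eventually_at_right_field by blast
  with eventually_right_pos have "\<forall>\<^sub>F \<epsilon> in at_right 0. (\<integral>x. wt s \<epsilon> A x * \<phi> x \<partial>lborel) = (\<integral>x. wlim s A x * \<phi> x \<partial>lborel)"
  proof eventually_elim
    case (elim \<epsilon>)
    have "wt s \<epsilon> A x * \<phi> x = wlim s A x * \<phi> x" for x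
      using wt_eq_wlim[OF elim(1), of x s A] d(2)[of x] elim(2) fsupp_eq_0[of x \<phi>] by (cases "x \<in> fsupp \<phi>") auto
    then show ?case by (simp only:)
  qed
  then have "((\<lambda>\<epsilon>. \<integral>x. wt s \<epsilon> A x * \<phi> x \<partial>lborel) \<longlongrightarrow> regular (wlim s A) \<phi>) (at_right 0)"
    unfolding regular_def by (rule tendsto_eventually)
  then show "v \<phi> = regular (wlim s A) \<phi>"
    using \<phi> by (intro tendsto_unique[OF trivial_limit_at_right_real approxD(3)[OF a]]) auto
qed

definition smoothed :: "nat \<Rightarrow> real \<Rightarrow> 'm pt \<Rightarrow> 'm cgrass" where
  "smoothed s \<epsilon> x = taylor n (\<lambda>j. heavi \<epsilon> (s + j) (- body (g x))) (emb (gmap complex_of_real (- nilpart (g x))))"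

lemma gcoef_smoothed: "gcoef (smoothed s \<epsilon> x) A = cst (wt s \<epsilon> A x)"
proof -
  have "gcoef (emb (gmap complex_of_real (- nilpart (g x))) ^ j :: 'm cgrass) A = cst (complex_of_real (gcoef ((- nilpart (g x)) ^ j) A))" for j
    by (simp only: emb_power[symmetric] gmap_power[OF ring_hom_of_real, symmetric] gcoef_gmap cst_0 of_real_0)
  then show ?thesis
    unfolding smoothed_def taylor_def wt_def
    by (simp add: gcoef_sum ring_homD(7)[OF ring_hom_cst] cst_mult[symmetric])
qed

text \<open>Near y the body stays above half its absolute value at y, so for small \<epsilon> the
  approximants are equal to their limit on a ball around the singularity of K. This is the
  hypothesis of \<open>approx_dist_mult\<close>, applied to each component.\<close>

lemma approx_sd_mult:
  assumes y: "body (g y) \<noteq> 0" and v: "\<And>A. approx sublevel (\<lambda>\<epsilon>. wt s \<epsilon> A) (v A)"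
    and K: "dec (smooth_on (- {y})) (- {y}) K" "\<And>\<phi>. test_fun \<phi> \<Longrightarrow> dec (integrable lborel) UNIV (\<lambda>x. K x * scal (\<phi> x))"
  shows "approx sublevel (\<lambda>\<epsilon> x. ccoef (K x * smoothed s \<epsilon> x) C e) (sd_mult (\<lambda>A. regular (\<lambda>x. ccoef (K x) A e)) v C)"
    "approx sublevel (\<lambda>\<epsilon> x. ccoef (smoothed s \<epsilon> x * K x) C e) (sd_mult v (\<lambda>A. regular (\<lambda>x. ccoef (K x) A e)) C)"
proof -
  have sm: "smooth_on (- {y}) (\<lambda>x. ccoef (K x) A e)" for A
    by (rule dec_ccoef[OF lin_closed_smooth K(1)]) (simp add: open_Compl)
  have i: "integrable lborel (\<lambda>x. ccoef (K x) A e * \<phi> x)" if "test_fun \<phi>" for A \<phi>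
    using dec_ccoef[OF lin_closed_integrable K(2)[OF that], of A e]
    by (simp only: scal_central ccoef_linear mult.commute)
  obtain r where r: "r > 0" "\<And>x. x \<in> ball y r \<Longrightarrow> \<bar>body (g y)\<bar> / 2 < \<bar>body (g x)\<bar>"
  proof -
    have "continuous_on UNIV (\<lambda>x. \<bar>body (g x)\<bar>)" by (intro continuous_on_rabs continuous_body)
    then have "open {x. \<bar>body (g y)\<bar> / 2 < \<bar>body (g x)\<bar>}" by (intro open_Collect_less continuous_on_const)
    moreover have "y \<in> {x. \<bar>body (g y)\<bar> / 2 < \<bar>body (g x)\<bar>}" using y by simp
    ultimately show ?thesis using that unfolding open_contains_ball by blast
  qed
  have near: "\<forall>\<^sub>F \<epsilon> in at_right 0. \<forall>x\<in>ball y r. wt s \<epsilon> A x = wlim s A x" for A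
  proof -
    have "\<forall>\<^sub>F \<epsilon> in at_right 0. \<epsilon> < \<bar>body (g y)\<bar> / 2" using y unfolding eventually_at_right_field by (intro exI[of _ "\<bar>body (g y)\<bar> / 2"]) auto
    with eventually_right_pos show ?thesis
    proof eventually_elim
      case (elim \<epsilon>)
      show ?case
      proof
        fix x assume "x \<in> ball y r"
        then have "\<epsilon> < \<bar>body (g x)\<bar>" using r(2)[of x] elim(2) by linarith
        then show "wt s \<epsilon> A x = wlim s A x" by (rule wt_eq_wlim[OF elim(1)])
      qed
    qed
  qed
  have yl: "y \<notin> level" using y by simp
  note m = approx_dist_mult[OF v closed_level represents_wlim[OF v] yl r(1) near sm i]
  show "approx sublevel (\<lambda>\<epsilon> x. ccoef (K x * smoothed s \<epsilon> x) C e) (sd_mult (\<lambda>A. regular (\<lambda>x. ccoef (K x) A e)) v C)"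
    unfolding ccoef_scalar_mult(1)[OF gcoef_smoothed] sd_mult_def[abs_def]
    by (rule approx_sum) (rule m(2))
  show "approx sublevel (\<lambda>\<epsilon> x. ccoef (smoothed s \<epsilon> x * K x) C e) (sd_mult v (\<lambda>A. regular (\<lambda>x. ccoef (K x) A e)) C)"
    unfolding ccoef_scalar_mult(2)[OF gcoef_smoothed] sd_mult_def[abs_def]
    by (rule approx_sum) (rule m(1))
qed

end

section \<open>Supports in the Grassmann variables\<close>

definition gsupp :: "nat set \<Rightarrow> 'c::zero grass \<Rightarrow> bool" where
  "gsupp S a \<longleftrightarrow> (\<forall>A. gcoef a A \<noteq> 0 \<longrightarrow> A \<subseteq> S)"

lemma gsuppD: "gsupp S a \<Longrightarrow> gcoef a A \<noteq> 0 \<Longrightarrow> A \<subseteq> S"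
  by (simp add: gsupp_def)

lemma gsupp_mono: "gsupp S a \<Longrightarrow> S \<subseteq> T \<Longrightarrow> gsupp T a"
  by (auto simp: gsupp_def)

lemma gsupp_add: "gsupp S a \<Longrightarrow> gsupp S b \<Longrightarrow> gsupp S (a + b)"
  and gsupp_diff: "gsupp S a \<Longrightarrow> gsupp S b \<Longrightarrow> gsupp S (a - b)"
  and gsupp_uminus: "gsupp S a \<Longrightarrow> gsupp S (- a)"
  and gsupp_gconst: "gsupp S (gconst c)" and gsupp_0: "gsupp S 0" and gsupp_1: "gsupp S 1"
  for a b :: "'a::ring_1 grass"
  unfolding gsupp_def
  by (auto simp: gcoef_add gcoef_diff gcoef_uminus gcoef_gconst gcoef_one zero_grass.rep_eq) (metis add.right_neutral diff_zero subsetD)+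

lemma gsupp_mult:
  fixes a b :: "'a::ring_1 grass"
  assumes "gsupp S a" "gsupp S b" shows "gsupp S (a * b)"
  unfolding gsupp_def
proof (intro allI impI)
  fix C assume "gcoef (a * b) C \<noteq> 0"
  then obtain A where A: "A \<in> Pow C" "(-1) ^ inversions A (C - A) * gcoef a A * gcoef b (C - A) \<noteq> 0"
    unfolding gcoef_times by (rule sum.not_neutral_contains_not_neutral)
  then have "gcoef a A \<noteq> 0" "gcoef b (C - A) \<noteq> 0" by auto
  then have "A \<subseteq> S" "C - A \<subseteq> S" using assms by (auto simp: gsupp_def)
  then show "C \<subseteq> S" by blast
qed

lemma gsupp_sum: "(\<And>i. i \<in> I \<Longrightarrow> gsupp S (f i)) \<Longrightarrow> gsupp S (\<Sum>i\<in>I. f i :: 'a::ring_1 grass)"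
  by (induction I rule: infinite_finite_induct) (auto intro: gsupp_add gsupp_0)

lemma gsupp_power: "gsupp S a \<Longrightarrow> gsupp S (a ^ k :: 'a::ring_1 grass)"
  by (induction k) (auto intro: gsupp_mult gsupp_1)

lemma gsupp_gmono: "A \<subseteq> S \<Longrightarrow> gsupp S (gmono A :: 'a::ring_1 grass)"
proof -
  assume "A \<subseteq> S"
  moreover have "B = A" if "gcoef (gmono A :: 'a grass) B \<noteq> 0" for B
    using that gcoef_gmono[of B A] gcoef_infinite[of B "gmono A :: 'a grass"] by (cases "finite B") (auto split: if_splits)
  ultimately show ?thesis by (auto simp: gsupp_def)
qed

lemma gsupp_gmap: "h 0 = 0 \<Longrightarrow> gsupp S a \<Longrightarrow> gsupp S (gmap h a)"
proof -
  assume h: "h 0 = 0" and a: "gsupp S a"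
  have "gcoef a A \<noteq> 0" if "gcoef (gmap h a) A \<noteq> 0" for A
    using that h by (auto simp: gcoef_gmap)
  then show "gsupp S (gmap h a)" using a by (auto simp: gsupp_def)
qed

lemma gsupp_gpartial: "gsupp S a \<Longrightarrow> gsupp S (gpartial j a :: 'a::ring_1 grass)"
proof -
  assume a: "gsupp S a"
  have "gcoef a (insert j A) \<noteq> 0" if "gcoef (gpartial j a) A \<noteq> 0" for A
    using that by (auto simp: gcoef_gpartial split: if_splits)
  then show "gsupp S (gpartial j a)" using a by (auto simp: gsupp_def)
qed

lemma gsupp_taylor: "gsupp S M \<Longrightarrow> gsupp S (taylor n c M)"
  unfolding taylor_def by (intro gsupp_sum gsupp_mult gsupp_gconst gsupp_power)

lemma gsupp_pd:
  assumes U: "open U" "x \<in> U" and F: "dec (smooth_on U) U F" "\<And>z. z \<in> U \<Longrightarrow> gsupp S (F z)"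
  shows "gsupp S (pd i F x)"
  unfolding gsupp_def
proof (intro allI impI, rule ccontr)
  fix A assume A: "gcoef (pd i F x) A \<noteq> 0" "\<not> A \<subseteq> S"
  have "ccoef (F z) A e = 0" if "z \<in> U" for z e
  proof -
    have "gcoef (F z) A = 0" using F(2)[OF that] A(2) by (auto simp: gsupp_def)
    then show ?thesis using ccoef_linear(3)[of A e] by (simp add: ccoef_def zero_grass.rep_eq)
  qed
  then have "dirderiv (axis i 1) (\<lambda>x. ccoef (F x) A e) x = dirderiv (axis i 1) (\<lambda>_. 0) x" for e
    by (intro dirderiv_cong[OF U]) simp
  then have "ccoef (pd i F x) A e = 0" for e
    by (simp add: ccoef_pd[OF U F(1)] dirderiv_eq[OF has_derivative_const])
  then have "gcoef (pd i F x) A = 0" using gcoef_ccoef_superset[of "{}" "pd i F x" A] by simp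
  then show False using A by simp
qed

lemma gsupp_dirac:
  assumes U: "open U" "x \<in> U" and F: "dec (smooth_on U) U F" "\<And>z. z \<in> U \<Longrightarrow> gsupp S (F z)"
  shows "gsupp S (dirac n F x)" "gsupp S (dirac_dag n F x)"
proof -
  have v: "gsupp S (ff l)" "gsupp S (ff_dag l)" "gsupp S (fs j)" "gsupp S (fs_dag j)" for l j
    by (simp_all only: ff_def ff_dag_def fs_def fs_dag_def gsupp_gconst)
  show "gsupp S (dirac n F x)" "gsupp S (dirac_dag n F x)"
    unfolding dirac_def dirac_dag_def pd_z_def pd_zc_def pd_zs_def pd_zsc_def
    by (intro gsupp_add gsupp_diff gsupp_sum gsupp_mult gsupp_gconst gsupp_gpartial gsupp_pd[OF U F] F(2)[OF U(2)] v; assumption)+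
qed

lemma dec_dirac:
  assumes "open U" "dec (smooth_on U) U F"
  shows "dec (smooth_on U) U (dirac n F)" "dec (smooth_on U) U (dirac_dag n F)"
  unfolding dirac_def[abs_def] dirac_dag_def[abs_def]
  by (intro dec_add dec_diff dec_sum dec_glinear[OF _ glinear_mult(2)] dec_glinear[OF _ glinear_pd_zs(1)] dec_glinear[OF _ glinear_pd_zs(2)] dec_pd_z assms)+

lemma dirac_cong_0:
  assumes "open U" "x \<in> U" "\<And>z. z \<in> U \<Longrightarrow> F z = 0"
  shows "dirac n F x = 0" "dirac_dag n F x = 0"
proof -
  have p: "pd i F x = 0" for i
    by (subst pd_cong[OF assms(1,2), of F "\<lambda>_. 0"]) (simp_all add: assms(3) pd_0)
  show "dirac n F x = 0" "dirac_dag n F x = 0"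
    by (simp_all add: dirac_def dirac_dag_def pd_z_def pd_zc_def pd_zs_def pd_zsc_def p assms(2,3) gpartial_linear(4))
qed

lemma dec_smooth_super:
  assumes G: "smooth_super n \<Omega> G"
  shows "dec (smooth_on \<Omega>) \<Omega> G" "x \<in> \<Omega> \<Longrightarrow> gsupp {1..2 * n} (G x)"
proof -
  have s: "gsupp {1..2 * n} (G x)" if "x \<in> \<Omega>" for x
    using conjunct1[OF G[unfolded smooth_super_def]] that unfolding gsupp_def by blast
  then show "x \<in> \<Omega> \<Longrightarrow> gsupp {1..2 * n} (G x)" .
  have d: "dec (smooth_on \<Omega>) \<Omega> (\<lambda>x. gconst (gcoef (G x) A) * gmono A)" for A
  proof -
    obtain N :: nat and f c where f: "\<forall>k<N. smooth_on \<Omega> (f k) \<and> c k \<in> cliff_alg n"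
      "\<forall>x\<in>\<Omega>. gcoef (G x) A = (\<Sum>k<N. cst (f k x) * c k)"
      using spec[OF conjunct2[OF G[unfolded smooth_super_def]], of A] by (elim exE conjE)
    have "dec (smooth_on \<Omega>) \<Omega> (\<lambda>x. (\<Sum>k<N. scal (f k x) * gconst (c k)) * gmono A)"
    proof (rule dec_glinear[OF _ glinear_mult(1)], rule dec_sum)
      fix k assume "k \<in> {..<N}"
      then have "smooth_on \<Omega> (f k)" using f(1) by simp
      then show "dec (smooth_on \<Omega>) \<Omega> (\<lambda>x. scal (f k x) * gconst (c k))" by (rule dec.base) (rule HOL.refl)
    qed
    then show ?thesis
      by (rule dec_cong) (simp only: bspec[OF f(2)] gconst_sum gconst_mult)
  qed
  have "dec (smooth_on \<Omega>) \<Omega> (\<lambda>x. \<Sum>A\<in>Pow {1..2 * n}. gconst (gcoef (G x) A) * gmono A)" by (intro dec_sum d)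
  then show "dec (smooth_on \<Omega>) \<Omega> G"
    by (rule dec_cong) (rule grass_expand, rule gsuppD[OF s], auto)
qed

text \<open>F may vanish off P although the scalar functions in its decomposition do not.
  Multiplication by a cutoff that is 1 on P makes them test functions and leaves F
  unchanged.\<close>

lemma dec_test_cutoff:
  assumes P: "compact P" "P \<subseteq> \<Omega>" "open \<Omega>" and F: "dec (smooth_on \<Omega>) \<Omega> F" "\<And>x. x \<notin> P \<Longrightarrow> F x = 0"
  shows "dec test_fun UNIV F"
proof -
  obtain \<eta> :: "'a \<Rightarrow> complex" and W where \<eta>: "test_fun \<eta>" "fsupp \<eta> \<subseteq> \<Omega>" "P \<subseteq> W" "\<forall>x\<in>W. \<eta> x = 1"
    using smooth_urysohn[OF P(1,3,2)] by metis
  have z: "\<eta> x = 0" if "x \<notin> \<Omega>" for x using \<eta>(2) that fsupp_eq_0[of x \<eta>] by blast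
  from F(1) have "dec test_fun UNIV (\<lambda>x. scal (\<eta> x) * F x)"
  proof (induction rule: dec.induct)
    case (base f F v)
    show ?case
    proof (rule dec.base[of test_fun "\<lambda>x. f x * \<eta> x"])
      show "test_fun (\<lambda>x. f x * \<eta> x)" by (rule test_fun_mult_smooth[OF \<eta>(1) P(3) \<eta>(2) base(1)])
      show "scal (\<eta> x) * F x = scal (f x * \<eta> x) * v" for x
        by (cases "x \<in> \<Omega>") (simp_all add: base(2) z scal_hom mult.assoc scal_left_commute[of "scal (f x)" "\<eta> x"])
    qed
  next
    case (zero F)
    have "scal (\<eta> x) * F x = 0" for x by (cases "x \<in> \<Omega>") (simp_all add: zero z scal_hom)
    then show ?case by (intro dec.zero)
  next
    case (plus F G H)
    have "scal (\<eta> x) * H x = scal (\<eta> x) * F x + scal (\<eta> x) * G x" for x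
      by (cases "x \<in> \<Omega>") (simp_all add: plus.hyps(3) z scal_hom distrib_left)
    then show ?case by (rule dec.plus[OF plus.IH])
  qed
  then show ?thesis
  proof (rule dec_cong)
    show "F x = scal (\<eta> x) * F x" for x
      using \<eta>(3,4) F(2)[of x] by (cases "x \<in> P") (auto simp: scal_hom)
  qed
qed

section \<open>The kernel matrix\<close>

definition admissible :: "nat \<Rightarrow> 'm::finite pt \<Rightarrow> ('m pt \<Rightarrow> 'm cgrass) \<Rightarrow> bool" where
  "admissible n y K \<longleftrightarrow> dec (smooth_on (- {y})) (- {y}) K \<and>
     (\<forall>\<Psi>. dec test_fun UNIV \<Psi> \<longrightarrow> dec (integrable lborel) UNIV (\<lambda>x. K x * \<Psi> x)) \<and>
     (\<forall>x. gsupp {1..4 * n} (K x)) \<and>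
     (\<exists>B. finite B \<and> B \<subseteq> cliff_basis \<and> (\<forall>x A e. e \<notin> B \<longrightarrow> ccoef (K x) A e = 0))"

lemma admissible_scal: "admissible n y K \<Longrightarrow> admissible n y (\<lambda>x. scal c * K x)"
  unfolding admissible_def mult.assoc
  by (auto intro: dec_glinear[OF _ glinear_mult(2)] gsupp_mult gsupp_gconst simp: ccoef_linear)

text \<open>Smoothness off y is clear from the formula; integrability against test functions is the
  case \<epsilon> = 0 of the radial estimates. The same decomposition confines the values to
  finitely many basis vectors.\<close>

lemma admissible_kp:
  fixes y :: "'m::finite pt"
  assumes n: "n < CARD('m)"
  shows "admissible n y (kp n 0 y)" "admissible n y (kd n 0 y)"
proof -
  have id: "glinear (\<lambda>a :: 'm cgrass. a)" by (simp add: glinear_def)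
  have o: "open (- {y})" by (simp add: open_Compl)
  have T: "dec (smooth_on (- {y})) (- {y}) (\<lambda>x. taylor n (\<lambda>j. kc (CARD('m) - n) 0 j y x) (nil_norm n))"
    by (rule dec_taylor_kc[OF o]) simp
  have d: "dec (smooth_on (- {y})) (- {y}) (kp n 0 y)" "dec (smooth_on (- {y})) (- {y}) (kd n 0 y)"
    unfolding kp_def[abs_def] kd_def[abs_def] by (rule dec_smooth_mult[OF o dec_ZZ(1) T], rule dec_smooth_mult[OF o dec_ZZ(2) T])
  have i: "dec (integrable lborel) UNIV (\<lambda>x. kp n 0 y x * \<Psi> x)" "dec (integrable lborel) UNIV (\<lambda>x. kd n 0 y x * \<Psi> x)"
    if "dec test_fun UNIV \<Psi>" for \<Psi>
    using gcont_radial[OF that id dec_radial_kernel(1)[OF n]] gcont_radial[OF that id dec_radial_kernel(2)[OF n]]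
    by (simp_all add: gcont_def)
  have e: "gsupp {1..4 * n} (et n j :: 'm cgrass)" if "j \<in> {1..2 * n}" for j
    unfolding et_def theta_def using that
    by (intro gsupp_gmap gsupp_diff gsupp_gmono) (auto simp: cst_0)
  have zs: "gsupp {1..4 * n} (emb (zs (theta n) j) :: 'm cgrass)" "gsupp {1..4 * n} (emb (zs_conj (theta n) j) :: 'm cgrass)" if "j \<in> {1..n}" for j
    unfolding emb_zs emb_zs_conj using that by (intro gsupp_add gsupp_diff gsupp_mult gsupp_gconst e; force)+
  have v: "gsupp S (ff l)" "gsupp S (ff_dag l)" "gsupp S (fs j)" "gsupp S (fs_dag j)" for l j S
    by (simp_all only: ff_def ff_dag_def fs_def fs_dag_def gsupp_gconst)
  have N: "gsupp {1..4 * n} (nil_norm n :: 'm cgrass)"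
    unfolding nil_norm_def et_pair_def by (intro gsupp_uminus gsupp_sum gsupp_mult e) auto
  have s: "gsupp {1..4 * n} (kp n 0 y x)" "gsupp {1..4 * n} (kd n 0 y x)" for x
    unfolding kp_def kd_def ZZ_def ZZ_dag_def
    by (intro gsupp_mult gsupp_add gsupp_sum gsupp_gconst gsupp_taylor N v zs; assumption)+
  have B: "\<exists>B. finite B \<and> B \<subseteq> cliff_basis \<and> (\<forall>x A e. e \<notin> B \<longrightarrow> ccoef (K 0 y x) A e = 0)"
    if d: "dec (radial y) ({0..} \<times> UNIV) (\<lambda>p. K (fst p) y (snd p))" and s: "\<And>x. gsupp {1..4 * n} (K 0 y x)" for K :: "real \<Rightarrow> 'm pt \<Rightarrow> 'm pt \<Rightarrow> 'm cgrass"
  proof -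
    have "\<forall>A. \<exists>B. finite B \<and> B \<subseteq> cliff_basis \<and> (\<forall>p\<in>{0..} \<times> UNIV. \<forall>e. e \<notin> B \<longrightarrow> ccoef (K (fst p) y (snd p)) A e = 0)"
      using dec_finite[OF d] by blast
    then obtain B where B: "\<And>A. finite (B A)" "\<And>A. B A \<subseteq> cliff_basis"
      "\<And>A. \<forall>p\<in>{0..} \<times> UNIV. \<forall>e. e \<notin> B A \<longrightarrow> ccoef (K (fst p) y (snd p)) A e = 0" by metis
    let ?B = "\<Union>A\<in>Pow {1..4 * n}. B A"
    have "ccoef (K 0 y x) A e = 0" if "e \<notin> ?B" for x A e
    proof (cases "A \<subseteq> {1..4 * n}")
      case True
      then show ?thesis using B(3)[of A] that by (auto dest!: bspec[of _ _ "(0, x)"])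
    next
      case False
      then have "gcoef (K 0 y x) A = 0" using s[of x] by (auto simp: gsupp_def)
      then show ?thesis using ccoef_linear(3)[of A e] by (simp add: ccoef_def zero_grass.rep_eq)
    qed
    moreover have "finite ?B" "?B \<subseteq> cliff_basis" using B(1,2) by auto
    ultimately show ?thesis by blast
  qed
  show "admissible n y (kp n 0 y)" "admissible n y (kd n 0 y)"
    unfolding admissible_def using d i s B[of "kp n", OF dec_radial_kernel(1)[OF n] s(1)] B[of "kd n", OF dec_radial_kernel(2)[OF n] s(2)] by simp_all
qed

lemma kernel_nth: "kernel n y x $ i $ k = (if i = k then Psi n (x - y) (theta n) else Psi_dag n (x - y) (theta n))"
  by (simp add: kernel_def circ_def theta_def[abs_def] Let_def)

lemma admissible_kernel:
  fixes y :: "'m::finite pt"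
  assumes n: "n < CARD('m)"
  shows "admissible n y (\<lambda>x. kernel n y x $ i $ k)"
  by (cases "i = k") (simp_all add: kernel_nth Psi_kp[OF n] Psi_dag_kd[OF n] admissible_scal admissible_kp[OF n])

definition dirac_entry :: "nat \<Rightarrow> 2 \<Rightarrow> 2 \<Rightarrow> ('m::finite pt \<Rightarrow> 'm cgrass) \<Rightarrow> 'm pt \<Rightarrow> 'm cgrass" where
  "dirac_entry n k l = (if k = l then dirac n else dirac_dag n)"

text \<open>For l = i the sum over k pairs equal positions of the kernel and of the Dirac matrix,
  which reproduces the point value; for l \<noteq> i it pairs opposite ones, which cancel.\<close>

lemma kernel_dirac_matrix:
  fixes \<Phi> :: "'m::finite pt \<Rightarrow> 'm cgrass"
  assumes "n < CARD('m)" "dec test_fun UNIV \<Phi>" "\<And>x. gsupp {1..2 * n} (\<Phi> x)"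
  shows "(\<Sum>k\<in>UNIV. gint (\<lambda>x. berezin n (kernel n y x $ i $ k * dirac_entry n k l \<Phi> x))) = (if l = i then - at_y n (\<Phi> y) else 0)"
proof -
  note d = kernel_dirac[OF assms(1,2) gsuppD[OF assms(3)], where y = y]
  have "i = 1 \<or> i = 2" "l = 1 \<or> l = 2" by (rule exhaust_2)+
  then show ?thesis
    using d by (elim disjE) (simp_all add: UNIV_2 kernel_nth dirac_entry_def add.commute)
qed

section \<open>The Cauchy-Pompeiu formula\<close>

context level_set
begin

definition phase_emb :: "'m pt \<Rightarrow> 'm cgrass" where
  "phase_emb x = emb (gmap complex_of_real (g x))"

definition phase_nil :: "'m pt \<Rightarrow> 'm cgrass" where
  "phase_nil x = emb (gmap complex_of_real (- nilpart (g x)))"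

lemma phase_nil_eq: "phase_nil x = scal (complex_of_real (body (g x))) - phase_emb x"
  unfolding phase_nil_def phase_emb_def nilpart_def
  by (simp only: minus_diff_eq gmap_hom[OF ring_hom_of_real] gmap_hom[OF ring_hom_cst])

lemma gsupp_phase: "gsupp {1..2 * n} (phase_emb x)" "gsupp {1..2 * n} (phase_nil x)"
proof -
  have "gsupp {1..2 * n} (g x)" using phase by (auto simp: phase_function_def gsupp_def)
  then show "gsupp {1..2 * n} (phase_emb x)" unfolding phase_emb_def by (intro gsupp_gmap) (simp_all add: cst_0)
  then show "gsupp {1..2 * n} (phase_nil x)" unfolding phase_nil_eq by (intro gsupp_diff gsupp_gconst)
qed

lemma dec_phase: "dec (smooth_on UNIV) UNIV phase_emb" "dec (smooth_on UNIV) UNIV phase_nil"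
proof -
  have sm: "smooth_on UNIV (\<lambda>x. complex_of_real (gcoef (g x) A))" for A
    using phase by (intro smooth_on_of_real open_UNIV) (simp add: phase_function_def)
  have "dec (smooth_on UNIV) UNIV (\<lambda>x. \<Sum>A\<in>Pow {1..2 * n}. scal (complex_of_real (gcoef (g x) A)) * gmono A)"
    by (intro dec_sum dec_scal sm)
  then show 1: "dec (smooth_on UNIV) UNIV phase_emb"
  proof (rule dec_cong)
    fix x
    have c: "gcoef (phase_emb x) A = cst (complex_of_real (gcoef (g x) A))" for A
      by (simp add: phase_emb_def gcoef_gmap cst_0)
    have "phase_emb x = (\<Sum>A\<in>Pow {1..2 * n}. gconst (gcoef (phase_emb x) A) * gmono A)"
      by (rule grass_expand) (rule gsuppD[OF gsupp_phase(1)], auto)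
    then show "phase_emb x = (\<Sum>A\<in>Pow {1..2 * n}. scal (complex_of_real (gcoef (g x) A)) * gmono A)"
      by (simp only: c)
  qed
  have "dec (smooth_on UNIV) UNIV (\<lambda>x. scal (complex_of_real (body (g x))) * 1 :: 'm cgrass)"
    by (intro dec_scal smooth_on_of_real smooth_body open_UNIV)
  then have "dec (smooth_on UNIV) UNIV (\<lambda>x. scal (complex_of_real (body (g x))) :: 'm cgrass)" by simp
  from dec_diff[OF this 1] show "dec (smooth_on UNIV) UNIV phase_nil" by (simp only: phase_nil_eq[abs_def])
qed

lemma gcoef_nilpart: "gcoef (- nilpart (g x)) A \<noteq> 0 \<Longrightarrow> A \<subseteq> {1..2 * n} \<and> 2 \<le> card A" "gcoef (- nilpart (g x)) A \<noteq> 0 \<Longrightarrow> even (card A)"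
proof -
  assume "gcoef (- nilpart (g x)) A \<noteq> 0"
  then have A: "A \<noteq> {}" "gcoef (g x) A \<noteq> 0"
    by (auto simp: nilpart_def gcoef_uminus gcoef_diff gcoef_gconst body_def split: if_splits)
  then have B: "A \<subseteq> {1..2 * n}" "even (card A)" using phase by (auto simp: phase_function_def)
  moreover have "finite A" using B finite_subset by blast
  then have "card A \<noteq> 0" using A by simp
  ultimately show "A \<subseteq> {1..2 * n} \<and> 2 \<le> card A" "even (card A)" by (auto elim!: evenE)
qed

lemma gflip_nilpart: "gflip (gmap complex_of_real (- nilpart (g x))) = gmap complex_of_real (- nilpart (g x))"
proof (rule grass_eqI)
  fix A
  show "gcoef (gflip (gmap complex_of_real (- nilpart (g x)))) A = gcoef (gmap complex_of_real (- nilpart (g x))) A"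
    using gcoef_nilpart(2)[of x A] by (cases "gcoef (- nilpart (g x)) A = 0") (simp_all add: gcoef_gmap)
qed

lemma phase_nil_commute: "phase_nil x * b = b * phase_nil x"
  unfolding phase_nil_def by (rule emb_even_central[OF gflip_nilpart])

lemma gflip_phase_nil: "gflip (phase_nil x) = phase_nil x"
  unfolding phase_nil_def by (simp only: gmap_hom(9)[OF ring_hom_cst, symmetric] gflip_nilpart)

lemma phase_nil_power: "phase_nil x ^ Suc n = 0"
proof -
  have "(- nilpart (g x)) ^ Suc n = 0"
    by (rule nilpotent_degree[of _ "{1..2 * n}" 2]) (use gcoef_nilpart(1) in auto)
  then show ?thesis
    unfolding phase_nil_def
    by (simp only: gmap_power[OF ring_hom_of_real, symmetric] gmap_power[OF ring_hom_cst, symmetric] gmap_hom(5)[OF ring_hom_of_real] gmap_hom(5)[OF ring_hom_cst])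
qed

lemma smoothed_eq: "smoothed s \<epsilon> x = taylor n (\<lambda>j. heavi \<epsilon> (s + j) (- body (g x))) (phase_nil x)"
  by (simp add: smoothed_def phase_nil_def)

lemma smoothed_commute: "smoothed s \<epsilon> x * b = b * smoothed s \<epsilon> x"
  unfolding smoothed_eq by (rule taylor_commute[OF phase_nil_commute])

lemma gflip_smoothed: "gflip (smoothed s \<epsilon> x) = smoothed s \<epsilon> x"
  by (simp add: smoothed_eq taylor_def gflip_sum gflip_mult gflip_linear gflip_power gflip_phase_nil)

lemma gsupp_smoothed: "gsupp {1..2 * n} (smoothed s \<epsilon> x)"
  unfolding smoothed_eq by (intro gsupp_taylor gsupp_phase)

lemma dec_smoothed: "dec (smooth_on UNIV) UNIV (smoothed s \<epsilon>)"
  unfolding smoothed_eq[abs_def] by (rule dec_taylor[OF open_UNIV dec_phase(2) smooth_heavi_body])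

lemma smoothed_off: "\<epsilon> > 0 \<Longrightarrow> x \<notin> sublevel \<Longrightarrow> smoothed s \<epsilon> x = 0"
  by (rule grass_eqI) (simp add: gcoef_smoothed wt_off cst_0 zero_grass.rep_eq)

lemma smoothed_at:
  assumes "0 < \<epsilon>" "\<epsilon> < \<bar>body (g x)\<bar>"
  shows "smoothed 0 \<epsilon> x = (if body (g x) < 0 then 1 else 0)"
  by (rule grass_eqI) (simp add: gcoef_smoothed wt_eq_wlim[OF assms] wlim_def cst_0 cst_1 gcoef_one zero_grass.rep_eq)

text \<open>The two contributions in \<open>pd_taylor\<close>, from the body and from the nilpotent
  part of -g, add up to the derivative of -g itself.\<close>

lemma pd_smoothed: "pd i (smoothed 0 \<epsilon>) x = - (smoothed 1 \<epsilon> x * pd i phase_emb x)"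
proof -
  let ?d = "dirderiv (axis i 1) (\<lambda>x. body (g x)) x"
  have df: "(\<lambda>x. body (g x)) differentiable (at x)" "(\<lambda>x. - body (g x)) differentiable (at x)"
    by (rule smooth_on_differentiable[OF smooth_body UNIV_I], rule smooth_on_differentiable[OF smooth_neg_body UNIV_I])
  have m: "dirderiv (axis i 1) (\<lambda>x. - body (g x)) x = - ?d"
    by (rule dirderiv_eq[OF has_derivative_minus[OF has_derivative_dirderiv[OF df(1)]]])
  have r: "dirderiv (axis i 1) (\<lambda>x. complex_of_real (body (g x))) x = complex_of_real ?d"
    by (rule dirderiv_eq[OF has_derivative_of_real[OF has_derivative_dirderiv[OF df(1)]]])
  have "pd i (smoothed 0 \<epsilon>) x = taylor n (\<lambda>j. heavi \<epsilon> (Suc j) (- body (g x))) (phase_nil x) * (scal (complex_of_real (- ?d)) + pd i phase_nil x)"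
    unfolding smoothed_eq[abs_def] add_0
  proof (rule pd_taylor[OF open_UNIV UNIV_I smooth_heavi_body _ dec_phase(2) phase_nil_commute phase_nil_power])
    show "dirderiv (axis i 1) (\<lambda>x. heavi \<epsilon> j (- body (g x))) x = heavi \<epsilon> (Suc j) (- body (g x)) * complex_of_real (- ?d)" for j
      unfolding dirderiv_heavi[OF df(2)] m ..
  qed
  also have "scal (complex_of_real (- ?d)) + pd i phase_nil x = - pd i phase_emb x"
  proof -
    have "pd i phase_emb x + pd i phase_nil x = pd i (\<lambda>x. phase_emb x + phase_nil x) x"
      by (rule pd_add[OF open_UNIV UNIV_I dec_phase, symmetric])
    also have "(\<lambda>x. phase_emb x + phase_nil x) = (\<lambda>x. scal (complex_of_real (body (g x))) * 1)"
      by (simp add: phase_nil_eq)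
    also have "pd i \<dots> x = scal (complex_of_real ?d)"
      by (subst pd_scal[OF open_UNIV UNIV_I]) (simp_all add: r smooth_on_of_real smooth_body)
    finally show ?thesis by (simp add: scal_hom algebra_simps)
  qed
  finally show ?thesis by (simp add: smoothed_eq[abs_def])
qed

lemma gpartial_smoothed: "gpartial j (smoothed 0 \<epsilon> x) = - (smoothed 1 \<epsilon> x * gpartial j (phase_emb x))"
proof -
  have 1: "gpartial j (1 :: 'm cgrass) = 0" using gpartial_linear(5)[of j 1] by (simp add: gconst_1)
  have p: "gpartial j (phase_nil x * b) = phase_nil x * gpartial j b + gpartial j (phase_nil x) * b" for b
    by (simp only: gpartial_mult gflip_phase_nil add.commute)
  have "gpartial j (smoothed 0 \<epsilon> x) = taylor n (\<lambda>j. heavi \<epsilon> (Suc j) (- body (g x))) (phase_nil x) * gpartial j (phase_nil x)"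
    unfolding smoothed_eq add_0 by (rule derivation_taylor[OF gpartial_linear(1,7) 1 p phase_nil_commute phase_nil_power])
  also have "gpartial j (phase_nil x) = - gpartial j (phase_emb x)"
    by (simp add: phase_nil_eq gpartial_linear)
  finally show ?thesis by (simp add: smoothed_eq)
qed

text \<open>The smoothed functions are even with scalar coefficients, hence central and invariant
  under the flip. So the Leibniz rule for even and odd derivatives takes the same form, and the
  Clifford vectors pass through.\<close>

lemma dirac_smoothed:
  assumes U: "open U" "x \<in> U" and G: "dec (smooth_on U) U G"
  shows "dirac n (\<lambda>x. smoothed 0 \<epsilon> x * G x) x = smoothed 0 \<epsilon> x * dirac n G x - smoothed 1 \<epsilon> x * (dirac n phase_emb x * G x)"
    "dirac_dag n (\<lambda>x. smoothed 0 \<epsilon> x * G x) x = smoothed 0 \<epsilon> x * dirac_dag n G x - smoothed 1 \<epsilon> x * (dirac_dag n phase_emb x * G x)"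
proof -
  let ?h = "smoothed 0 \<epsilon> x" and ?D = "smoothed 1 \<epsilon> x"
  have dU: "dec (smooth_on U) U (smoothed 0 \<epsilon>)"
    by (rule dec_mono[OF dec_smoothed]) (auto intro: smooth_on_subset)
  have pz: "pd_z l (smoothed 0 \<epsilon>) x = - (?D * pd_z l phase_emb x)" "pd_zc l (smoothed 0 \<epsilon>) x = - (?D * pd_zc l phase_emb x)" for l
    unfolding pd_z_def pd_zc_def pd_smoothed
    by (simp_all only: right_diff_distrib distrib_left scal_left_commute[of ?D] mult_minus_right) (simp_all add: algebra_simps)
  have z: "pd_z l (\<lambda>x. smoothed 0 \<epsilon> x * G x) x = ?h * pd_z l G x - ?D * (pd_z l phase_emb x * G x)"
    "pd_zc l (\<lambda>x. smoothed 0 \<epsilon> x * G x) x = ?h * pd_zc l G x - ?D * (pd_zc l phase_emb x * G x)" for l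
    unfolding pd_z_mult[OF U dU G] pz by (simp_all add: mult.assoc)
  have gp: "gpartial j (?h * G x) = ?h * gpartial j (G x) - ?D * (gpartial j (phase_emb x) * G x)" for j
    unfolding gpartial_mult gflip_smoothed gpartial_smoothed by (simp add: mult.assoc)
  have s: "pd_zs j (?h * G x) = ?h * pd_zs j (G x) - ?D * (pd_zs j (phase_emb x) * G x)"
    "pd_zsc j (?h * G x) = ?h * pd_zsc j (G x) - ?D * (pd_zsc j (phase_emb x) * G x)" for j
    unfolding pd_zs_def pd_zsc_def gp
    by (simp_all only: right_diff_distrib left_diff_distrib distrib_left distrib_right scal_left_commute[of ?D] scal_left_commute[of ?h] mult.assoc)
       (simp_all add: algebra_simps)
  have k: "v * (?h * c - ?D * (a * b)) = ?h * (v * c) - ?D * ((v * a) * b)" for v a b c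
  proof -
    have "v * (?h * c) = ?h * (v * c)" "v * (?D * (a * b)) = ?D * (v * (a * b))"
      by (simp_all only: mult.assoc[symmetric] smoothed_commute[of _ _ _ v])
    then show ?thesis by (simp only: right_diff_distrib mult.assoc)
  qed
  have S: "(\<Sum>i\<in>I. ?h * p i - ?D * (q i * b)) = ?h * (\<Sum>i\<in>I. p i) - ?D * ((\<Sum>i\<in>I. q i) * b)" for I :: "'k set" and p q b
    by (simp only: sum_subtractf sum_distrib_left sum_distrib_right)
  show "dirac n (\<lambda>x. smoothed 0 \<epsilon> x * G x) x = ?h * dirac n G x - ?D * (dirac n phase_emb x * G x)"
    unfolding dirac_def z s k S by (simp add: distrib_left distrib_right algebra_simps)
  show "dirac_dag n (\<lambda>x. smoothed 0 \<epsilon> x * G x) x = ?h * dirac_dag n G x - ?D * (dirac_dag n phase_emb x * G x)"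
    unfolding dirac_dag_def z s k S by (simp add: right_diff_distrib left_diff_distrib algebra_simps)
qed

text \<open>Because the smoothed functions are central, the same integrals approximate both orders
  of the product, the kernel to the left of \<delta>(g) and to the right of H(-g).\<close>

lemma super_int_smoothed:
  assumes y: "body (g y) \<noteq> 0" and \<Omega>: "open \<Omega>" "sublevel \<subseteq> \<Omega>" and K: "admissible n y K"
    and v: "\<And>A. approx sublevel (\<lambda>\<epsilon>. wt s \<epsilon> A) (v A)"
    and F: "dec (smooth_on \<Omega>) \<Omega> F" "\<And>x. x \<in> \<Omega> \<Longrightarrow> gsupp {1..4 * n} (F x)"
  shows "vlim (\<lambda>\<epsilon>. gint (\<lambda>x. berezin n (K x * smoothed s \<epsilon> x * F x)))
      (super_int n (\<lambda>A b. sd_mult (\<lambda>A. regular (\<lambda>x. ccoef (K x) A b)) v A) F)"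
    "vlim (\<lambda>\<epsilon>. gint (\<lambda>x. berezin n (K x * smoothed s \<epsilon> x * F x)))
      (super_int n (\<lambda>A b. sd_mult v (\<lambda>A. regular (\<lambda>x. ccoef (K x) A b)) A) F)"
proof -
  have K1: "dec (smooth_on (- {y})) (- {y}) K" using K by (simp add: admissible_def)
  have K2: "dec (integrable lborel) UNIV (\<lambda>x. K x * scal (\<phi> x))" if "test_fun \<phi>" for \<phi>
  proof -
    have "dec test_fun UNIV (\<lambda>x. scal (\<phi> x) * 1 :: 'm cgrass)" by (rule dec.base[of test_fun \<phi>], rule that, rule HOL.refl)
    then show ?thesis using K by (simp add: admissible_def)
  qed
  obtain B where B: "finite B" "B \<subseteq> cliff_basis" "\<And>x A e. e \<notin> B \<Longrightarrow> ccoef (K x) A e = 0"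
    using K unfolding admissible_def by blast
  note a = approx_sd_mult[OF y v K1 K2]
  have W: "K x * smoothed s \<epsilon> x = 0" if "\<epsilon> > 0" "x \<notin> sublevel" for \<epsilon> x
    using smoothed_off[OF that] by simp
  have BW: "ccoef (K x * smoothed s \<epsilon> x) A e = 0" if "e \<notin> B" for \<epsilon> x A e
    unfolding ccoef_scalar_mult(1)[OF gcoef_smoothed] by (simp add: B(3)[OF that])
  have "gsupp {1..4 * n} (K x * smoothed s \<epsilon> x)" for \<epsilon> x
    using K gsupp_mono[OF gsupp_smoothed[of s \<epsilon> x], of "{1..4 * n}"] by (intro gsupp_mult) (auto simp: admissible_def)
  note l = super_int_limit[OF compact_sublevel \<Omega>(2,1) _ W B(1,2) BW gsuppD[OF this] F(1) gsuppD[OF F(2)]]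
  show "vlim (\<lambda>\<epsilon>. gint (\<lambda>x. berezin n (K x * smoothed s \<epsilon> x * F x)))
      (super_int n (\<lambda>A b. sd_mult (\<lambda>A. regular (\<lambda>x. ccoef (K x) A b)) v A) F)"
    by (rule l) (auto intro: a(1))
  show "vlim (\<lambda>\<epsilon>. gint (\<lambda>x. berezin n (K x * smoothed s \<epsilon> x * F x)))
      (super_int n (\<lambda>A b. sd_mult v (\<lambda>A. regular (\<lambda>x. ccoef (K x) A b)) A) F)"
    by (rule l) (use a(2) in \<open>simp_all add: smoothed_commute[of s]\<close>)
qed

text \<open>The Leibniz rule under the integral: the summand with \<delta>(g) is what is missing
  from h D G to the derivative of h G. Cutting off with h also turns all integrands into test
  functions times the kernel.\<close>

lemma entry_by_parts:
  assumes \<Omega>: "open \<Omega>" "sublevel \<subseteq> \<Omega>" and K: "admissible n y K" and \<epsilon>: "\<epsilon> > 0"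
    and G: "\<And>l. dec (smooth_on \<Omega>) \<Omega> (G l)"
  shows "gint (\<lambda>x. berezin n (K x * smoothed 1 \<epsilon> x * (\<Sum>l\<in>UNIV. dirac_entry n k l phase_emb x * G l x))) -
      gint (\<lambda>x. berezin n (K x * smoothed 0 \<epsilon> x * (\<Sum>l\<in>UNIV. dirac_entry n k l (G l) x))) =
      - (\<Sum>l\<in>UNIV. gint (\<lambda>x. berezin n (K x * dirac_entry n k l (\<lambda>x. smoothed 0 \<epsilon> x * G l x) x)))"
proof -
  have sm: "dec (smooth_on \<Omega>) \<Omega> (smoothed s \<epsilon>)" for s
    by (rule dec_mono[OF dec_smoothed]) (auto intro: smooth_on_subset)
  have t: "dec test_fun UNIV (\<lambda>x. smoothed s \<epsilon> x * F x)" if "dec (smooth_on \<Omega>) \<Omega> F" for s F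
    by (rule dec_test_cutoff[OF compact_sublevel \<Omega>(2,1) dec_smooth_mult[OF \<Omega>(1) sm that]])
       (simp add: smoothed_off[OF \<epsilon>])
  have i: "dec (integrable lborel) UNIV (\<lambda>x. berezin n (K x * \<Psi> x))" if "dec test_fun UNIV \<Psi>" for \<Psi>
    using K that by (intro dec_glinear[OF _ glinear_berezin]) (simp add: admissible_def)
  have e\<Omega>: "dec (smooth_on \<Omega>) \<Omega> phase_emb"
    by (rule dec_mono[OF dec_phase(1)]) (auto intro: smooth_on_subset)
  have de: "dec (smooth_on \<Omega>) \<Omega> (dirac_entry n k l F)" if "dec (smooth_on \<Omega>) \<Omega> F" for l F
    using dec_dirac[OF \<Omega>(1) that] by (simp add: dirac_entry_def)
  have t1: "dec test_fun UNIV (\<lambda>x. smoothed 1 \<epsilon> x * (\<Sum>l\<in>UNIV. dirac_entry n k l phase_emb x * G l x))"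
    by (intro t dec_sum dec_smooth_mult \<Omega>(1) de e\<Omega> G)
  have t0: "dec test_fun UNIV (\<lambda>x. smoothed 0 \<epsilon> x * (\<Sum>l\<in>UNIV. dirac_entry n k l (G l) x))"
    by (intro t dec_sum de G)
  have td: "dec test_fun UNIV (dirac_entry n k l (\<lambda>x. smoothed 0 \<epsilon> x * G l x))" for l
    using dec_dirac_test[OF t[OF G, of 0 l]] by (simp add: dirac_entry_def)
  have e: "dirac_entry n k l (\<lambda>x. smoothed 0 \<epsilon> x * G l x) x =
      smoothed 0 \<epsilon> x * dirac_entry n k l (G l) x - smoothed 1 \<epsilon> x * (dirac_entry n k l phase_emb x * G l x)" for l x
  proof (cases "x \<in> \<Omega>")
    case True
    then show ?thesis using dirac_smoothed[OF \<Omega>(1) True G] by (simp add: dirac_entry_def)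
  next
    case False
    \<comment> \<open>Off \<Omega> nothing is known about G, but the smoothed functions vanish in a
      whole neighbourhood, so both sides are zero.\<close>
    have o: "open (- sublevel)" using compact_imp_closed[OF compact_sublevel] by (simp add: open_Compl)
    have x: "x \<in> - sublevel" using False \<Omega>(2) by blast
    have z: "smoothed s \<epsilon> x' = 0" if "x' \<in> - sublevel" for s x' using that by (intro smoothed_off[OF \<epsilon>]) simp
    have "dirac n (\<lambda>x. smoothed 0 \<epsilon> x * G l x) x = 0" "dirac_dag n (\<lambda>x. smoothed 0 \<epsilon> x * G l x) x = 0"
      by (rule dirac_cong_0[OF o x]; simp only: z mult_zero_left)+
    then show ?thesis by (simp add: z[OF x] dirac_entry_def)
  qed
  have p: "berezin n (K x * (smoothed 0 \<epsilon> x * (\<Sum>l\<in>UNIV. dirac_entry n k l (G l) x))) =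
      berezin n (K x * (smoothed 1 \<epsilon> x * (\<Sum>l\<in>UNIV. dirac_entry n k l phase_emb x * G l x))) +
      (\<Sum>l\<in>UNIV. berezin n (K x * dirac_entry n k l (\<lambda>x. smoothed 0 \<epsilon> x * G l x) x))" for x
    unfolding e by (simp add: glinear_sum[OF glinear_berezin, symmetric] berezin_linear(1)[symmetric] sum_distrib_left[symmetric]
        distrib_left[symmetric] sum_subtractf)
  show ?thesis
    unfolding mult.assoc p
    by (subst gint_add[OF i[OF t1] dec_sum]) (simp_all only: i[OF td] gint_sum[OF i[OF td]] diff_add_cancel, simp)
qed

end

theorem theorem5:
  fixes n :: nat
    and \<Omega> :: "(real ^ ('m::finite + 'm)) set"
    and G1 G2 :: "real ^ ('m + 'm) \<Rightarrow> ('m + 'm) cliff grass"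
    and g :: "real ^ ('m + 'm) \<Rightarrow> real grass"
    and y :: "real ^ ('m + 'm)"
  assumes "n < CARD('m)"
    and "open \<Omega>"
    and "smooth_super n \<Omega> G1"
    and "smooth_super n \<Omega> G2"
    and "phase_function n g"
    and "compact {x. body (g x) \<le> 0}"
    and "{x. body (g x) \<le> 0} \<subseteq> \<Omega>"
    and "\<And>x. body (g x) = 0 \<Longrightarrow> \<exists>i. dirderiv (axis i 1) (\<lambda>x. body (g x)) x \<noteq> 0"
    and "body (g y) \<noteq> 0"
  shows "super_int_mat n (kernel_times n y (super_delta n g))
           (\<lambda>x. dirac_mat_of n g x ** circ (G1 x) (G2 x)) -
         super_int_mat n (times_kernel n (super_heaviside_neg n g) y)
           (dirac_mat n (\<lambda>x. circ (G1 x) (G2 x))) =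
         (if body (g y) < 0 then circ (at_y n (G1 y)) (at_y n (G2 y)) else 0)"
proof -
  interpret level_set n g by unfold_locales (use assms in auto)
  note n = assms(1) and \<Omega> = assms(2,7) and y = assms(9)
  define G where "G l j = (if l = j then G1 else G2)" for l j :: 2
  have G: "dec (smooth_on \<Omega>) \<Omega> (G l j)" and Gs: "x \<in> \<Omega> \<Longrightarrow> gsupp {1..2 * n} (G l j x)" for l j x
    using dec_smooth_super[OF assms(3)] dec_smooth_super[OF assms(4)] by (simp_all add: G_def)
  have cG: "circ (G1 x) (G2 x) $ l $ j = G l j x" for x l j by (simp add: circ_def G_def)
  have X: "(dirac_mat_of n g x ** circ (G1 x) (G2 x)) $ k $ j = (\<Sum>l\<in>UNIV. dirac_entry n k l phase_emb x * G l j x)" for x k j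
    by (simp add: matrix_matrix_mult_def cG dirac_mat_of_def dirac_entry_def circ_def phase_emb_def[abs_def] cong: sum.cong)
      (intro sum.cong HOL.refl; simp add: G_def)
  have Y: "dirac_mat n (\<lambda>x. circ (G1 x) (G2 x)) x $ k $ j = (\<Sum>l\<in>UNIV. dirac_entry n k l (G l j) x)" for x k j
    unfolding dirac_mat_def vec_lambda_beta cG by (intro sum.cong HOL.refl) (simp add: circ_def dirac_entry_def)
  have e\<Omega>: "dec (smooth_on \<Omega>) \<Omega> phase_emb"
    by (rule dec_mono[OF dec_phase(1)]) (auto intro: smooth_on_subset)
  have de: "dec (smooth_on \<Omega>) \<Omega> (dirac_entry n k l F)" if "dec (smooth_on \<Omega>) \<Omega> F" for k l F
    using dec_dirac[OF \<Omega>(1) that] by (simp add: dirac_entry_def)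
  have ds: "gsupp {1..2 * n} (dirac_entry n k l F x)" if "x \<in> \<Omega>" "dec (smooth_on \<Omega>) \<Omega> F" "\<And>z. z \<in> \<Omega> \<Longrightarrow> gsupp {1..2 * n} (F z)" for k l F x
    using gsupp_dirac[OF \<Omega>(1) that] by (simp add: dirac_entry_def)
  have s4: "gsupp {1..4 * n} a" if "gsupp {1..2 * n} a" for a :: "'m cgrass"
    using that by (rule gsupp_mono) auto
  show ?thesis
  proof (simp only: vec_eq_iff, intro allI)
    fix i j :: 2
    let ?K = "\<lambda>k x. kernel n y x $ i $ k"
    let ?X = "\<lambda>k x. \<Sum>l\<in>UNIV. dirac_entry n k l phase_emb x * G l j x"
    let ?Y = "\<lambda>k x. \<Sum>l\<in>UNIV. dirac_entry n k l (G l j) x"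
    let ?L = "(\<Sum>k\<in>UNIV. super_int n (kernel_times n y (super_delta n g) $ i $ k) (?X k)) -
        (\<Sum>k\<in>UNIV. super_int n (times_kernel n (super_heaviside_neg n g) y $ i $ k) (?Y k))"
    have X': "dec (smooth_on \<Omega>) \<Omega> (?X k)" "x \<in> \<Omega> \<Longrightarrow> gsupp {1..4 * n} (?X k x)" for k x
      by (intro dec_sum dec_smooth_mult \<Omega>(1) de e\<Omega> G, intro s4 gsupp_sum gsupp_mult ds e\<Omega> Gs gsupp_phase)
    have Y': "dec (smooth_on \<Omega>) \<Omega> (?Y k)" "x \<in> \<Omega> \<Longrightarrow> gsupp {1..4 * n} (?Y k x)" for k x
      by (intro dec_sum de G, intro s4 gsupp_sum ds G Gs)
    have l1: "vlim (\<lambda>\<epsilon>. gint (\<lambda>x. berezin n (?K k x * smoothed 1 \<epsilon> x * ?X k x))) (super_int n (kernel_times n y (super_delta n g) $ i $ k) (?X k))" for k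
      unfolding kernel_times_def vec_lambda_beta kernel_comp_def[abs_def]
      by (rule super_int_smoothed(1)[OF y \<Omega> admissible_kernel[OF n] approx_wt(1) X'])
    have l0: "vlim (\<lambda>\<epsilon>. gint (\<lambda>x. berezin n (?K k x * smoothed 0 \<epsilon> x * ?Y k x))) (super_int n (times_kernel n (super_heaviside_neg n g) y $ i $ k) (?Y k))" for k
      unfolding times_kernel_def vec_lambda_beta kernel_comp_def[abs_def]
      by (rule super_int_smoothed(2)[OF y \<Omega> admissible_kernel[OF n] approx_wt(2) Y'])
    have "vlim (\<lambda>\<epsilon>. (\<Sum>k\<in>UNIV. gint (\<lambda>x. berezin n (?K k x * smoothed 1 \<epsilon> x * ?X k x))) -
        (\<Sum>k\<in>UNIV. gint (\<lambda>x. berezin n (?K k x * smoothed 0 \<epsilon> x * ?Y k x)))) ?L"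
      by (intro vlim_diff vlim_sum l1 l0)
    moreover have "vlim (\<lambda>\<epsilon>. (\<Sum>k\<in>UNIV. gint (\<lambda>x. berezin n (?K k x * smoothed 1 \<epsilon> x * ?X k x))) -
        (\<Sum>k\<in>UNIV. gint (\<lambda>x. berezin n (?K k x * smoothed 0 \<epsilon> x * ?Y k x))))
        (if body (g y) < 0 then at_y n (G i j y) else 0)"
    \<comment> \<open>As soon as \<epsilon> < |body (g y)|, the smoothed Heaviside function at y is
      exactly 0 or 1, so the expression is constant for small \<epsilon>.\<close>
    proof (rule vlim_cong[OF vlim_const])
      have "\<forall>\<^sub>F \<epsilon> in at_right 0. \<epsilon> < \<bar>body (g y)\<bar>"
        using y unfolding eventually_at_right_field by (intro exI[of _ "\<bar>body (g y)\<bar>"]) auto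
      with eventually_right_pos
      show "\<forall>\<^sub>F \<epsilon> in at_right 0. (if body (g y) < 0 then at_y n (G i j y) else 0) =
        (\<Sum>k\<in>UNIV. gint (\<lambda>x. berezin n (?K k x * smoothed 1 \<epsilon> x * ?X k x))) -
        (\<Sum>k\<in>UNIV. gint (\<lambda>x. berezin n (?K k x * smoothed 0 \<epsilon> x * ?Y k x)))"
      proof eventually_elim
        case (elim \<epsilon>)
        let ?\<Phi> = "\<lambda>l x. smoothed 0 \<epsilon> x * G l j x"
        have sm: "dec (smooth_on \<Omega>) \<Omega> (smoothed 0 \<epsilon>)"
          by (rule dec_mono[OF dec_smoothed]) (auto intro: smooth_on_subset)
        have \<Phi>: "dec test_fun UNIV (?\<Phi> l)" for l
          by (rule dec_test_cutoff[OF compact_sublevel \<Omega>(2,1) dec_smooth_mult[OF \<Omega>(1) sm G]])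
             (simp add: smoothed_off[OF elim(1)])
        have \<Phi>s: "gsupp {1..2 * n} (?\<Phi> l x)" for l x
        proof (cases "x \<in> \<Omega>")
          case True
          then show ?thesis by (intro gsupp_mult gsupp_smoothed Gs)
        next
          case False
          then have "smoothed 0 \<epsilon> x = 0" using \<Omega>(2) by (intro smoothed_off[OF elim(1)]) auto
          then show ?thesis by (simp add: gsupp_0)
        qed
        have a0: "at_y n 0 = (0 :: 'm cgrass)" by (simp add: at_y_def zero_grass.rep_eq gconst_0)
        have "(\<Sum>k\<in>UNIV. gint (\<lambda>x. berezin n (?K k x * smoothed 1 \<epsilon> x * ?X k x))) -
            (\<Sum>k\<in>UNIV. gint (\<lambda>x. berezin n (?K k x * smoothed 0 \<epsilon> x * ?Y k x))) =
            (\<Sum>k\<in>UNIV. - (\<Sum>l\<in>UNIV. gint (\<lambda>x. berezin n (?K k x * dirac_entry n k l (?\<Phi> l) x))))"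
          unfolding sum_subtractf[symmetric]
          by (intro sum.cong HOL.refl entry_by_parts[OF \<Omega> admissible_kernel[OF n] elim(1) G])
        \<comment> \<open>For fixed l all terms involve the same function, so summing over k first
          brings \<open>kernel_dirac_matrix\<close> to bear; only l = i survives and gives the entry
          in row i.\<close>
        also have "\<dots> = - (\<Sum>l\<in>UNIV. \<Sum>k\<in>UNIV. gint (\<lambda>x. berezin n (?K k x * dirac_entry n k l (?\<Phi> l) x)))"
          unfolding sum_negf by (subst sum.swap) (rule HOL.refl)
        also have "\<dots> = - (\<Sum>l\<in>UNIV. if l = i then - at_y n (?\<Phi> l y) else 0)"
          unfolding kernel_dirac_matrix[OF n \<Phi> \<Phi>s] ..
        also have "\<dots> = at_y n (?\<Phi> i y)" by simp
        also have "\<dots> = (if body (g y) < 0 then at_y n (G i j y) else 0)"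
          unfolding smoothed_at[OF elim] by (simp add: a0)
        finally show ?case by (rule HOL.sym)
      qed
    qed
    ultimately have L: "?L = (if body (g y) < 0 then at_y n (G i j y) else 0)" by (rule vlim_unique)
    have "(super_int_mat n (kernel_times n y (super_delta n g)) (\<lambda>x. dirac_mat_of n g x ** circ (G1 x) (G2 x)) -
         super_int_mat n (times_kernel n (super_heaviside_neg n g) y) (dirac_mat n (\<lambda>x. circ (G1 x) (G2 x)))) $ i $ j = ?L"
      unfolding super_int_mat_def vector_minus_component vec_lambda_beta X Y ..
    also have "\<dots> = (if body (g y) < 0 then circ (at_y n (G1 y)) (at_y n (G2 y)) else 0) $ i $ j"
      unfolding L by (simp add: circ_def G_def)
    finally show "(super_int_mat n (kernel_times n y (super_delta n g)) (\<lambda>x. dirac_mat_of n g x ** circ (G1 x) (G2 x)) -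
         super_int_mat n (times_kernel n (super_heaviside_neg n g) y) (dirac_mat n (\<lambda>x. circ (G1 x) (G2 x)))) $ i $ j =
         (if body (g y) < 0 then circ (at_y n (G1 y)) (at_y n (G2 y)) else 0) $ i $ j" .
  qed
qed

end
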